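(* The algebra $\mathrm{FTL}_{d,n}$ is isomorphic to the centralizer $\operatorname{End}_{U_q(\mathfrak{gl}_2^{d})}(V^{\otimes n})$, where $V$ is the vector representation of dimension $2d$ of $U_q(\mathfrak{gl}_2^d)=U_q(\mathfrak{gl}_2\oplus\cdots\oplus\mathfrak{gl}_2)$ ($d$ summands).
   Context: $q$ is an indeterminate, $\Bbbk=\mathbb{C}(q)$, $d\ge1$, $n\ge1$. $U_q(\mathfrak{gl}_2^d)\cong U_q(\mathfrak{gl}_2)^{\boxtimes d}$ (tensor product algebra with componentwise comultiplication) and $V=V_1\oplus\cdots\oplus V_d$, where $V_b$ is the 2-dimensional vector representation of the $b$-th tensor factor $U_q(\mathfrak{gl}_2)$, the other factors acting through their counits. The framed braid group $\mathcal{FB}_{d,n}$ has generators $s_1,\dots,s_{n-1},t_1,\dots,t_n$ and relations $s_is_j=s_js_i$ if $|i-j|>1$, $s_is_js_i=s_js_is_j$ if $|i-j|=1$, $t_i^d=1$, $t_it_j=t_jt_i$, $s_it_j=t_{s_i(j)}s_i$, where $s_i$ acts on indices as the transposition $(i,i+1)$. The Yokonuma–Hecke algebra $\mathrm{YH}_{d,n}$ is the quotient of $\Bbbk\mathcal{FB}_{d,n}$ by the relations $s_i^2=(q-q^{-1})E_is_i+1$ ($1\le i\le n-1$), where $E_i=\frac1d\sum_{a=1}^dt_i^at_{i+1}^{-a}$. The framization of the Temperley–Lieb algebra $\mathrm{FTL}_{d,n}$ is the quotient of $\mathrm{YH}_{d,n}$ by the relation (imposed when $n>2$) $$E_1E_2\bigl(1-q^{-1}s_1-q^{-1}s_2+q^{-2}s_1s_2+q^{-2}s_2s_1-q^{-3}s_1s_2s_1\bigr)=0.$$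 *)

theory Defs
  imports
    "HOL-Computational_Algebra.Polynomial"
    "HOL-Computational_Algebra.Fraction_Field"
    "HOL-Combinatorics.Transposition"
    "HOL-Algebra.QuotRing"
    "HOL-Algebra.Module"
    "Jordan_Normal_Form.Matrix"
begin

section \<open>The ground field\<close>

type_synonym Cq = "complex poly fract"

definition q :: Cq where
  "q = Fract [:0, 1:] 1"


section \<open>Algebras\<close>

text \<open>
  An associative unital algebra is a \<^typ>\<open>('k, 'a) module\<close> record whose ring part is not
  required to be commutative; the scalars are the elements of the type \<^typ>\<open>'k\<close>.
  (The library's locale \<^locale>\<open>algebra\<close> is for commutative algebras only.)
\<close>

definition algebra_iso :: "('k, 'a) module \<Rightarrow> ('k, 'b) module \<Rightarrow> ('a \<Rightarrow> 'b) set" where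
  "algebra_iso A B =
     {h \<in> ring_iso A B. \<forall>c. \<forall>x\<in>carrier A. h (c \<odot>\<^bsub>A\<^esub> x) = c \<odot>\<^bsub>B\<^esub> h x}"

definition is_algebra_iso :: "('k, 'a) module \<Rightarrow> ('k, 'b) module \<Rightarrow> bool" (infix "\<cong>\<^bold>a" 50) where
  "A \<cong>\<^bold>a B \<longleftrightarrow> algebra_iso A B \<noteq> {}"

text \<open>
  The monoid algebra of \<open>M\<close>: finitely supported functions on the carrier, with convolution.
  It is the group algebra if \<open>M\<close> is a group, and the free algebra if \<open>M\<close> is a free monoid.
\<close>

definition single :: "'m \<Rightarrow> 'm \<Rightarrow> 'k::zero_neq_one" where
  "single x = (\<lambda>y. if y = x then 1 else 0)"

definition monoid_alg :: "('m, 'e) monoid_scheme \<Rightarrow> ('k::field, 'm \<Rightarrow> 'k) module" where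
  "monoid_alg M = \<lparr>
     carrier = {f. finite {x. f x \<noteq> 0} \<and> {x. f x \<noteq> 0} \<subseteq> carrier M},
     mult = (\<lambda>f g z. \<Sum>(x, y) \<in> {(x, y). f x \<noteq> 0 \<and> g y \<noteq> 0 \<and> x \<otimes>\<^bsub>M\<^esub> y = z}. f x * g y),
     one = single \<one>\<^bsub>M\<^esub>,
     zero = (\<lambda>x. 0),
     add = (\<lambda>f g x. f x + g x),
     smult = (\<lambda>c f x. c * f x)\<rparr>"

definition free_monoid :: "'x set \<Rightarrow> 'x list monoid" where
  "free_monoid X = \<lparr>carrier = lists X, mult = (@), one = []\<rparr>"

abbreviation free_alg :: "'x set \<Rightarrow> ('k::field, 'x list \<Rightarrow> 'k) module" where
  "free_alg X \<equiv> monoid_alg (free_monoid X)"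

text \<open>The quotient of \<open>A\<close> by the two-sided ideal generated by \<open>S\<close>: the library's quotient ring,
  with scalars acting on cosets through representatives (in the style of \<^const>\<open>rcoset_mult\<close>).\<close>

definition quot_alg :: "('k, 'a) module \<Rightarrow> 'a set \<Rightarrow> ('k, 'a set) module" where
  "quot_alg A S = (let I = Idl\<^bsub>A\<^esub> S in
     ring.extend (A Quot I) (module.fields (\<lambda>c X. \<Union>x\<in>X. I +>\<^bsub>A\<^esub> (c \<odot>\<^bsub>A\<^esub> x))))"

text \<open>The multiplicative extension to words, and the linear extension to the free algebra, of an
  assignment \<open>\<rho>\<close> of elements of an algebra to the free generators.\<close>

definition word_lift :: "('k, 'a) module \<Rightarrow> ('x \<Rightarrow> 'a) \<Rightarrow> 'x list \<Rightarrow> 'a" where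
  "word_lift A \<rho> w = foldr (\<lambda>x a. \<rho> x \<otimes>\<^bsub>A\<^esub> a) w \<one>\<^bsub>A\<^esub>"

definition free_lift :: "('k::field, 'a) module \<Rightarrow> ('x \<Rightarrow> 'a) \<Rightarrow> ('x list \<Rightarrow> 'k) \<Rightarrow> 'a" where
  "free_lift A \<rho> f = (\<Oplus>\<^bsub>A\<^esub>w\<in>{w. f w \<noteq> 0}. f w \<odot>\<^bsub>A\<^esub> word_lift A \<rho> w)"


section \<open>Groups given by generators and relations\<close>

text \<open>A letter \<open>(x, True)\<close> stands for the generator \<open>x\<close> and \<open>(x, False)\<close> for its inverse.
  A relation is a pair of words that are to become equal.\<close>

type_synonym 'x gword = "('x \<times> bool) list"

inductive pres_eq :: "'x set \<Rightarrow> ('x gword \<times> 'x gword) set \<Rightarrow> 'x gword \<Rightarrow> 'x gword \<Rightarrow> bool"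
  for X R where
  refl: "u \<in> lists (X \<times> UNIV) \<Longrightarrow> pres_eq X R u u"
| sym: "pres_eq X R u v \<Longrightarrow> pres_eq X R v u"
| trans: "pres_eq X R u v \<Longrightarrow> pres_eq X R v w \<Longrightarrow> pres_eq X R u w"
| cancel: "x \<in> X \<Longrightarrow> u \<in> lists (X \<times> UNIV) \<Longrightarrow> v \<in> lists (X \<times> UNIV) \<Longrightarrow>
    pres_eq X R (u @ [(x, e), (x, \<not> e)] @ v) (u @ v)"
| rel: "(r, r') \<in> R \<Longrightarrow> u \<in> lists (X \<times> UNIV) \<Longrightarrow> v \<in> lists (X \<times> UNIV) \<Longrightarrow>
    pres_eq X R (u @ r @ v) (u @ r' @ v)"

definition pres_class :: "'x set \<Rightarrow> ('x gword \<times> 'x gword) set \<Rightarrow> 'x gword \<Rightarrow> 'x gword set" where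
  "pres_class X R u = {v. pres_eq X R u v}"

definition pres_group :: "'x set \<Rightarrow> ('x gword \<times> 'x gword) set \<Rightarrow> 'x gword set monoid" where
  "pres_group X R = \<lparr>
     carrier = pres_class X R ` lists (X \<times> UNIV),
     mult = (\<lambda>A B. \<Union>u\<in>A. \<Union>v\<in>B. pres_class X R (u @ v)),
     one = pres_class X R []\<rparr>"


section \<open>The framed braid group\<close>

datatype fb_gen = Sgen nat | Tgen nat

definition fb_gens :: "nat \<Rightarrow> fb_gen set" where
  "fb_gens n = Sgen ` {1..<n} \<union> Tgen ` {1..n}"

abbreviation (input) s_word :: "nat \<Rightarrow> fb_gen gword" where
  "s_word i \<equiv> [(Sgen i, True)]"

abbreviation (input) t_word :: "nat \<Rightarrow> fb_gen gword" where
  "t_word j \<equiv> [(Tgen j, True)]"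

definition fb_rels :: "nat \<Rightarrow> nat \<Rightarrow> (fb_gen gword \<times> fb_gen gword) set" where
  "fb_rels d n =
     {(s_word i @ s_word j, s_word j @ s_word i) | i j.
        i \<in> {1..<n} \<and> j \<in> {1..<n} \<and> \<bar>int i - int j\<bar> > 1}
   \<union> {(s_word i @ s_word j @ s_word i, s_word j @ s_word i @ s_word j) | i j.
        i \<in> {1..<n} \<and> j \<in> {1..<n} \<and> \<bar>int i - int j\<bar> = 1}
   \<union> {(replicate d (Tgen j, True), []) | j. j \<in> {1..n}}
   \<union> {(t_word i @ t_word j, t_word j @ t_word i) | i j. i \<in> {1..n} \<and> j \<in> {1..n}}
   \<union> {(s_word i @ t_word j, t_word (Transposition.transpose i (i + 1) j) @ s_word i) | i j.
        i \<in> {1..<n} \<and> j \<in> {1..n}}"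

abbreviation framed_braid_group :: "nat \<Rightarrow> nat \<Rightarrow> fb_gen gword set monoid" where
  "framed_braid_group d n \<equiv> pres_group (fb_gens n) (fb_rels d n)"

definition fb_s :: "nat \<Rightarrow> nat \<Rightarrow> nat \<Rightarrow> fb_gen gword set" where
  "fb_s d n i = pres_class (fb_gens n) (fb_rels d n) (s_word i)"

definition fb_t :: "nat \<Rightarrow> nat \<Rightarrow> nat \<Rightarrow> fb_gen gword set" where
  "fb_t d n j = pres_class (fb_gens n) (fb_rels d n) (t_word j)"


section \<open>The Yokonuma--Hecke algebra and the framization of the Temperley--Lieb algebra\<close>

type_synonym fb_elt = "fb_gen gword set \<Rightarrow> Cq"

abbreviation fb_alg :: "nat \<Rightarrow> nat \<Rightarrow> (Cq, fb_elt) module" where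
  "fb_alg d n \<equiv> monoid_alg (framed_braid_group d n)"

definition yh_E :: "nat \<Rightarrow> nat \<Rightarrow> nat \<Rightarrow> fb_elt" where
  "yh_E d n i = (1 / of_nat d) \<odot>\<^bsub>fb_alg d n\<^esub>
     (\<Oplus>\<^bsub>fb_alg d n\<^esub>a\<in>{1..d}.
        single (fb_t d n i [^]\<^bsub>framed_braid_group d n\<^esub> a
                \<otimes>\<^bsub>framed_braid_group d n\<^esub>
                fb_t d n (i + 1) [^]\<^bsub>framed_braid_group d n\<^esub> (- int a)))"

definition yh_rels :: "nat \<Rightarrow> nat \<Rightarrow> fb_elt set" where
  "yh_rels d n = (let A = fb_alg d n; s = (\<lambda>i. single (fb_s d n i)) in
     {s i [^]\<^bsub>A\<^esub> (2::nat) \<ominus>\<^bsub>A\<^esub>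
        ((q - inverse q) \<odot>\<^bsub>A\<^esub> (yh_E d n i \<otimes>\<^bsub>A\<^esub> s i) \<oplus>\<^bsub>A\<^esub> \<one>\<^bsub>A\<^esub>) | i. i \<in> {1..<n}})"

definition YH :: "nat \<Rightarrow> nat \<Rightarrow> (Cq, fb_elt set) module" where
  "YH d n = quot_alg (fb_alg d n) (yh_rels d n)"

definition yh_proj :: "nat \<Rightarrow> nat \<Rightarrow> fb_elt \<Rightarrow> fb_elt set" where
  "yh_proj d n x = Idl\<^bsub>fb_alg d n\<^esub> (yh_rels d n) +>\<^bsub>fb_alg d n\<^esub> x"

definition ftl_rel :: "nat \<Rightarrow> nat \<Rightarrow> fb_elt set" where
  "ftl_rel d n = (let A = YH d n; p = yh_proj d n;
       s = (\<lambda>i. p (single (fb_s d n i))); E = (\<lambda>i. p (yh_E d n i)) in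
     E 1 \<otimes>\<^bsub>A\<^esub> E 2 \<otimes>\<^bsub>A\<^esub>
       (\<one>\<^bsub>A\<^esub> \<ominus>\<^bsub>A\<^esub> inverse q \<odot>\<^bsub>A\<^esub> s 1 \<ominus>\<^bsub>A\<^esub> inverse q \<odot>\<^bsub>A\<^esub> s 2
        \<oplus>\<^bsub>A\<^esub> inverse (q ^ 2) \<odot>\<^bsub>A\<^esub> (s 1 \<otimes>\<^bsub>A\<^esub> s 2)
        \<oplus>\<^bsub>A\<^esub> inverse (q ^ 2) \<odot>\<^bsub>A\<^esub> (s 2 \<otimes>\<^bsub>A\<^esub> s 1)
        \<ominus>\<^bsub>A\<^esub> inverse (q ^ 3) \<odot>\<^bsub>A\<^esub> (s 1 \<otimes>\<^bsub>A\<^esub> s 2 \<otimes>\<^bsub>A\<^esub> s 1)))"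

definition FTL :: "nat \<Rightarrow> nat \<Rightarrow> (Cq, fb_elt set set) module" where
  "FTL d n = quot_alg (YH d n) (if n > 2 then {ftl_rel d n} else {})"


section \<open>The quantum group of the direct sum of \<open>d\<close> copies of \<open>gl\<^sub>2\<close>\<close>

text \<open>\<open>GL i\<close> and \<open>GLinv i\<close> (for \<open>i = 1, 2\<close>) are the Cartan generators and their inverses;
  \<open>K = L\<^sub>1 L\<^sub>2\<^sup>-\<^sup>1\<close>.\<close>

datatype gl2_gen = GE | GF | GL nat | GLinv nat

definition gl2_gens :: "gl2_gen set" where
  "gl2_gens = {GE, GF} \<union> GL ` {1, 2} \<union> GLinv ` {1, 2}"

text \<open>The generator \<open>(b, g)\<close> is the generator \<open>g\<close> of the \<open>b\<close>-th tensor factor.\<close>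

type_synonym uq_gen = "nat \<times> gl2_gen"

definition uq_gens :: "nat \<Rightarrow> uq_gen set" where
  "uq_gens d = {1..d} \<times> gl2_gens"

abbreviation uq_free :: "nat \<Rightarrow> (Cq, uq_gen list \<Rightarrow> Cq) module" where
  "uq_free d \<equiv> free_alg (uq_gens d)"

text \<open>The defining relations of \<open>U\<^sub>q(gl\<^sub>2)\<close>, written in the \<open>b\<close>-th tensor factor.\<close>

definition gl2_rels :: "nat \<Rightarrow> nat \<Rightarrow> (uq_gen list \<Rightarrow> Cq) set" where
  "gl2_rels d b = (let A = uq_free d; w = (\<lambda>gs. single (map (Pair b) gs)) in
     {w [GL i, GLinv i] \<ominus>\<^bsub>A\<^esub> \<one>\<^bsub>A\<^esub> | i. i \<in> {1, 2}}
   \<union> {w [GLinv i, GL i] \<ominus>\<^bsub>A\<^esub> \<one>\<^bsub>A\<^esub> | i. i \<in> {1, 2}}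
   \<union> {w [GL 1, GL 2] \<ominus>\<^bsub>A\<^esub> w [GL 2, GL 1]}
   \<union> {w [GL 1, GE] \<ominus>\<^bsub>A\<^esub> q \<odot>\<^bsub>A\<^esub> w [GE, GL 1],
      w [GL 2, GE] \<ominus>\<^bsub>A\<^esub> inverse q \<odot>\<^bsub>A\<^esub> w [GE, GL 2],
      w [GL 1, GF] \<ominus>\<^bsub>A\<^esub> inverse q \<odot>\<^bsub>A\<^esub> w [GF, GL 1],
      w [GL 2, GF] \<ominus>\<^bsub>A\<^esub> q \<odot>\<^bsub>A\<^esub> w [GF, GL 2]}
   \<union> {(w [GE, GF] \<ominus>\<^bsub>A\<^esub> w [GF, GE]) \<ominus>\<^bsub>A\<^esub>
        (1 / (q - inverse q)) \<odot>\<^bsub>A\<^esub> (w [GL 1, GLinv 2] \<ominus>\<^bsub>A\<^esub> w [GLinv 1, GL 2])})"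

text \<open>The tensor product of \<open>d\<close> algebras given by generators and relations: the union of the
  presentations, together with the commutation of generators of distinct tensor factors.\<close>

definition uq_rels :: "nat \<Rightarrow> (uq_gen list \<Rightarrow> Cq) set" where
  "uq_rels d =
     (\<Union>b\<in>{1..d}. gl2_rels d b)
   \<union> {single [(b, g), (c, h)] \<ominus>\<^bsub>uq_free d\<^esub> single [(c, h), (b, g)] | b c g h.
        b \<in> {1..d} \<and> c \<in> {1..d} \<and> b \<noteq> c \<and> g \<in> gl2_gens \<and> h \<in> gl2_gens}"

definition Uq :: "nat \<Rightarrow> (Cq, (uq_gen list \<Rightarrow> Cq) set) module" where
  "Uq d = quot_alg (uq_free d) (uq_rels d)"

text \<open>The Hopf structure on generators, componentwise in the tensor factors:
  \<open>\<Delta>(E) = E \<otimes> 1 + K \<otimes> E\<close>, \<open>\<Delta>(F) = F \<otimes> K\<^sup>-\<^sup>1 + 1 \<otimes> F\<close>, \<open>\<Delta>(L) = L \<otimes> L\<close>.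
  A list of pairs of words \<open>(u, v)\<close> stands for the sum of the tensors \<open>u \<otimes> v\<close>.\<close>

fun uq_comult :: "uq_gen \<Rightarrow> (uq_gen list \<times> uq_gen list) list" where
  "uq_comult (b, GE) = [([(b, GE)], []), ([(b, GL 1), (b, GLinv 2)], [(b, GE)])]"
| "uq_comult (b, GF) = [([(b, GF)], [(b, GLinv 1), (b, GL 2)]), ([], [(b, GF)])]"
| "uq_comult (b, GL i) = [([(b, GL i)], [(b, GL i)])]"
| "uq_comult (b, GLinv i) = [([(b, GLinv i)], [(b, GLinv i)])]"

fun gl2_counit :: "gl2_gen \<Rightarrow> Cq" where
  "gl2_counit GE = 0"
| "gl2_counit GF = 0"
| "gl2_counit (GL i) = 1"
| "gl2_counit (GLinv i) = 1"


section \<open>The representations of the quantum group\<close>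

abbreviation mat_alg :: "nat \<Rightarrow> (Cq, Cq mat) module" where
  "mat_alg N \<equiv> module_mat TYPE(Cq) N N"

text \<open>The vector representation of \<open>U\<^sub>q(gl\<^sub>2)\<close>, with matrix indices starting from \<open>0\<close>.\<close>

fun gl2_vect :: "gl2_gen \<Rightarrow> Cq mat" where
  "gl2_vect GE = mat 2 2 (\<lambda>(i, j). if i = 0 \<and> j = 1 then 1 else 0)"
| "gl2_vect GF = mat 2 2 (\<lambda>(i, j). if i = 1 \<and> j = 0 then 1 else 0)"
| "gl2_vect (GL k) = mat 2 2 (\<lambda>(i, j). if i = j then if i + 1 = k then q else 1 else 0)"
| "gl2_vect (GLinv k) = mat 2 2 (\<lambda>(i, j). if i = j then if i + 1 = k then inverse q else 1 else 0)"

text \<open>\<open>V = V\<^sub>1 \<oplus> \<dots> \<oplus> V\<^sub>d\<close>, where the \<open>b\<close>-th tensor factor acts on \<open>V\<^sub>b\<close> by the vector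
  representation and on the other summands through the counit.\<close>

definition uq_vect :: "nat \<Rightarrow> uq_gen \<Rightarrow> Cq mat" where
  "uq_vect d = (\<lambda>(b, g). diag_block_mat
     (map (\<lambda>c. if c = b then gl2_vect g else gl2_counit g \<cdot>\<^sub>m 1\<^sub>m 2) [1..<d + 1]))"

text \<open>Matrix of the tensor product of two linear maps; the basis vector \<open>e\<^sub>i \<otimes> e\<^sub>j\<close> has index
  \<open>i * n + j\<close>, where \<open>n\<close> is the dimension of the second tensor factor.\<close>

definition kron :: "'a::semiring_1 mat \<Rightarrow> 'a mat \<Rightarrow> 'a mat" where
  "kron A B = mat (dim_row A * dim_row B) (dim_col A * dim_col B)
     (\<lambda>(i, j). A $$ (i div dim_row B, j div dim_col B) * B $$ (i mod dim_row B, j mod dim_col B))"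

text \<open>Action of the generators on \<open>V\<^sup>\<otimes>\<^sup>n\<close>: trivial representation for \<open>n = 0\<close>, and
  \<open>V\<^sup>\<otimes>\<^sup>n\<^sup>+\<^sup>1 = V \<otimes> V\<^sup>\<otimes>\<^sup>n\<close> with the action given by the comultiplication.\<close>

primrec uq_tensor :: "nat \<Rightarrow> nat \<Rightarrow> uq_gen \<Rightarrow> Cq mat" where
  "uq_tensor d 0 = (\<lambda>(b, g). gl2_counit g \<cdot>\<^sub>m 1\<^sub>m 1)"
| "uq_tensor d (Suc n) = (\<lambda>x.
     foldr (+)
       (map (\<lambda>(u, v). kron (word_lift (mat_alg (2 * d)) (uq_vect d) u)
                            (word_lift (mat_alg ((2 * d) ^ n)) (uq_tensor d n) v))
         (uq_comult x))
       (0\<^sub>m ((2 * d) ^ Suc n) ((2 * d) ^ Suc n)))"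

text \<open>The action of an element of the quantum group, which is a coset in the free algebra: all
  elements of the coset act on \<open>V\<^sup>\<otimes>\<^sup>n\<close> by the same matrix.\<close>

definition uq_rep :: "nat \<Rightarrow> nat \<Rightarrow> (uq_gen list \<Rightarrow> Cq) set \<Rightarrow> Cq mat" where
  "uq_rep d n u = the_elem (free_lift (mat_alg ((2 * d) ^ n)) (uq_tensor d n) ` u)"

definition uq_centralizer :: "nat \<Rightarrow> nat \<Rightarrow> (Cq, Cq mat) module" where
  "uq_centralizer d n = (mat_alg ((2 * d) ^ n))
     \<lparr>carrier := {A \<in> carrier_mat ((2 * d) ^ n) ((2 * d) ^ n).
        \<forall>u\<in>carrier (Uq d). A * uq_rep d n u = uq_rep d n u * A}\<rparr>"

end

theory Submission
  imports Defs "HOL-Library.Function_Algebras" "Jordan_Normal_Form.Determinant"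
begin

text \<open>
  On \<open>V\<^sup>\<otimes>\<^sup>n\<close> the generator \<open>s\<^sub>i\<close> acts by Jimbo's R-matrix on neighbouring vectors of one colour and by the
  flip on vectors of distinct colours, and \<open>t\<^sub>j\<close> acts by a root of unity that depends on the \<open>j\<close>-th
  colour; this commutes with the quantum group and kills the relations.

  A linear functional on the group algebra that vanishes on the relations is a sum of parts that are
  isotypic for the \<open>t\<^sub>j\<close>. An isotypic part is a function of braid words with coloured strands that
  satisfies a quadratic relation at crossings of one colour and a cubic relation for three strands of
  one colour. By induction on the number of one-coloured crossings it vanishes if it does so at the
  reduced words of the permutations without one-coloured decreasing patterns of length three. Hence
  FTL is spanned by elements indexed by pairs of a colouring \<open>\<chi>\<close> and such a permutation \<open>p\<close>.

  At \<open>q = 1\<close> these elements become place permutations of words of colouring \<open>\<chi>\<close>. Let \<open>x\<close> be the word of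
  colouring \<open>\<chi>\<close> whose bits mark the excedances of \<open>p\<close> within the colours. Then \<open>p\<close> is colexicographically
  last among the permutations carrying \<open>x\<close> to \<open>x \<circ> p\<close>, so the elements are independent; and an operator
  commuting with the classical raising operators and preserving weights vanishes once its entries at
  all these pairs do, because a nonzero one has a nonzero entry at a pair of words satisfying ballot
  conditions, and such a pair is of this form. Scaling by powers of \<open>q - 1\<close> carries both facts over to
  \<open>\<complex>(q)\<close>, where they say that the spanning elements are mapped to a basis of the centralizer.
\<close>

section \<open>Coloured permutations and functionals on braid words\<close>

text \<open>Spanning is proved dually. In the quotient a word is a coset, and rewriting it would
  drag all lower terms along; a functional that kills the relations merely takes values at words,
  and its lower terms disappear by induction. Surjectivity comes from a square linear system: the
  pairs \<open>(\<chi>, p)\<close> index the spanning elements and also the matrix entries that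
  determine an operator of the centralizer. The obstacle at generic \<open>q\<close> is to find
  highest weight vectors at explicit words. It is met at \<open>q = 1\<close>, over the complex
  numbers, by the positivity of a hermitian form. An operator is read there as a tensor whose
  factors belong alternately to the row word and to the column word. This order is chosen so that
  the ballot conditions describe the excedances of 321-free permutations: in such a permutation the
  excedances increase and so do the remaining places, which is what makes equal letters keep their
  order.\<close>

abbreviation adj :: "nat \<Rightarrow> nat \<Rightarrow> nat" where
  "adj i \<equiv> Transposition.transpose i (Suc i)"

primrec wperm :: "nat list \<Rightarrow> nat \<Rightarrow> nat" where
  "wperm [] = id"
| "wperm (i # w) = adj i \<circ> wperm w"

lemma wperm_append: "wperm (u @ v) = wperm u \<circ> wperm v"
  by (induction u) (auto simp: comp_assoc)

definition wletters :: "nat \<Rightarrow> nat list \<Rightarrow> bool" where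
  "wletters n w \<longleftrightarrow> (\<forall>i\<in>set w. Suc i < n)"

lemma wletters_simps [simp]:
  "wletters n []" "wletters n (i # w) \<longleftrightarrow> Suc i < n \<and> wletters n w"
  "wletters n (u @ v) \<longleftrightarrow> wletters n u \<and> wletters n v"
  by (auto simp: wletters_def)

lemma wletters_mono: "wletters m w \<Longrightarrow> m \<le> n \<Longrightarrow> wletters n w"
  by (auto simp: wletters_def)

lemma adj_permutes: "Suc i < n \<Longrightarrow> adj i permutes {..<n}"
  by (rule permutes_swap_id) auto

lemma wperm_permutes: "wletters n w \<Longrightarrow> wperm w permutes {..<n}"
proof (induction w)
  case Nil show "wperm [] permutes {..<n}" by (simp add: permutes_id)
next
  case (Cons i w)
  then show "wperm (i # w) permutes {..<n}" using permutes_compose[OF _ adj_permutes] by simp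
qed

text \<open>The letter \<open>i\<close> exchanges the places \<open>i\<close> and
  \<open>Suc i\<close>, so the rest of the word sees the colouring
  \<open>\<chi> \<circ> adj i\<close>. Accordingly \<open>\<chi> \<circ> wperm u\<close> is the
  colouring seen after a prefix \<open>u\<close>.\<close>

fun mono_len :: "(nat \<Rightarrow> 'c) \<Rightarrow> nat list \<Rightarrow> nat" where
  "mono_len \<chi> [] = 0"
| "mono_len \<chi> (i # w) = (if \<chi> i = \<chi> (Suc i) then 1 else 0) + mono_len (\<chi> \<circ> adj i) w"

lemma mono_len_append: "mono_len \<chi> (u @ v) = mono_len \<chi> u + mono_len (\<chi> \<circ> wperm u) v"
  by (induction u arbitrary: \<chi>) (auto simp: comp_assoc)

section \<open>Canonical words of permutations\<close>

definition run :: "nat \<Rightarrow> nat \<Rightarrow> nat list" where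
  "run m j = rev [j..<m]"

lemma run_refl [simp]: "run m m = []"
  by (simp add: run_def)

lemma run_Suc_left: "j \<le> m \<Longrightarrow> run (Suc m) j = m # run m j"
  by (simp add: run_def)

lemma run_snoc: "j < m \<Longrightarrow> run m j = run m (Suc j) @ [j]"
  by (simp add: run_def upt_rec)

lemma run_split: "j \<le> k \<Longrightarrow> k \<le> m \<Longrightarrow> run m j = run m k @ run k j"
  unfolding run_def by (metis le_add_diff_inverse rev_append upt_add_eq_append)

lemma set_run: "set (run m j) = {j..<m}"
  by (simp add: run_def)

lemma wletters_run: "m < n \<Longrightarrow> wletters n (run m j)"
  by (auto simp: wletters_def set_run)

abbreviation cyc :: "nat \<Rightarrow> nat \<Rightarrow> nat \<Rightarrow> nat" where
  "cyc m j \<equiv> wperm (run m j)"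

lemma cyc_apply:
  assumes "j \<le> m"
  shows "cyc m j r = (if r = j then m else if j < r \<and> r \<le> m then r - 1 else r)"
  using assms
proof (induction "m - j" arbitrary: j r)
  case 0
  then show ?case by auto
next
  case (Suc k)
  then have jm: "j < m" by simp
  have "cyc m j r = cyc m (Suc j) (adj j r)"
    by (simp add: run_snoc[OF jm] wperm_append)
  also have "\<dots> = (if adj j r = Suc j then m else if Suc j < adj j r \<and> adj j r \<le> m then adj j r - 1 else adj j r)"
    using Suc.hyps(1)[of "Suc j" "adj j r"] Suc.hyps(2) jm by simp
  also have "\<dots> = (if r = j then m else if j < r \<and> r \<le> m then r - 1 else r)"
    using jm by (auto simp: Transposition.transpose_def)
  finally show ?case .
qed

text \<open>Coset decomposition along the chain of symmetric groups: \<open>p\<close> sends some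
  \<open>j\<close> to the last point \<open>m\<close>, and \<open>p = h \<circ> cyc m j\<close> with
  \<open>h\<close> fixing \<open>m\<close>. The result is a concatenation of descending runs. It is
  always unfolded through \<open>can_comp_cyc\<close>, in terms of \<open>h\<close> and
  \<open>j\<close>.\<close>

fun can :: "nat \<Rightarrow> (nat \<Rightarrow> nat) \<Rightarrow> nat list" where
  "can 0 p = []"
| "can (Suc m) p = can m (p \<circ> wperm (rev (run m (inv_into UNIV p m)))) @ run m (inv_into UNIV p m)"

declare can.simps(2) [simp del]

lemma wperm_rev: "wperm w \<circ> wperm (rev w) = id"
proof (induction w rule: rev_induct)
  case Nil
  then show ?case by simp
next
  case (snoc i w)
  then show ?case by (simp add: wperm_append fun_eq_iff)
qed

lemma wperm_rev': "wperm (rev w) \<circ> wperm w = id"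
  using wperm_rev[of "rev w"] by simp

lemma can_comp_cyc:
  assumes "h permutes {..<m}" "j \<le> m"
  shows "can (Suc m) (h \<circ> cyc m j) = can m h @ run m j"
proof -
  have cp: "cyc m j permutes {..<Suc m}"
    by (rule wperm_permutes) (simp add: wletters_run)
  have hp: "h permutes {..<Suc m}" using assms(1) by (rule permutes_subset) auto
  have "(h \<circ> cyc m j) permutes {..<Suc m}" using permutes_compose[OF cp hp] .
  moreover have "(h \<circ> cyc m j) j = m"
    using assms by (simp add: cyc_apply permutes_def)
  ultimately have "inv_into UNIV (h \<circ> cyc m j) m = j" by (metis permutes_inverses(2))
  then show ?thesis by (simp add: can.simps comp_assoc wperm_rev)
qed

lemma permutes_Suc_decompose:
  assumes "p permutes {..<Suc m}"
  obtains h j where "h permutes {..<m}" "j \<le> m" "p = h \<circ> cyc m j"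
proof -
  define j where "j = inv_into UNIV p m"
  have pj: "p j = m" using assms by (simp add: j_def permutes_inverses)
  have jm: "j \<le> m" using assms permutes_in_image[OF assms, of j] pj by auto
  define h where "h = p \<circ> wperm (rev (run m j))"
  have hc: "p = h \<circ> cyc m j" by (simp add: h_def comp_assoc wperm_rev')
  have rp: "wperm (rev (run m j)) permutes {..<Suc m}"
    by (rule wperm_permutes) (use wletters_run[of m "Suc m" j] in \<open>auto simp: wletters_def\<close>)
  have hp: "h permutes {..<Suc m}" unfolding h_def by (rule permutes_compose[OF rp assms])
  have "h m = m"
  proof -
    have "h (cyc m j j) = p j" using hc by (metis comp_apply)
    then show ?thesis using jm pj by (simp add: cyc_apply)
  qed
  have "h permutes {..<m}"
    by (rule permutes_superset[OF hp]) (use \<open>h m = m\<close> less_Suc_eq in auto)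
  then show ?thesis using that jm hc by blast
qed

lemma wperm_can: "p permutes {..<m} \<Longrightarrow> wperm (can m p) = p \<and> wletters m (can m p)"
proof (induction m arbitrary: p)
  case 0
  then show ?case by simp
next
  case (Suc m)
  from Suc.prems obtain h j where h: "h permutes {..<m}" "j \<le> m" "p = h \<circ> cyc m j"
    by (rule permutes_Suc_decompose)
  show "wperm (can (Suc m) p) = p \<and> wletters (Suc m) (can (Suc m) p)" using Suc.IH[OF h(1)] h wletters_mono[of m _ "Suc m"]
    by (simp add: can_comp_cyc wperm_append wletters_run)
qed

text \<open>Colours sit at the left end of a word: the strand at place \<open>a\<close> on the right
  is at place \<open>p a\<close> on the left, so its colour is \<open>\<chi> (p a)\<close>.\<close>

definition mono_321_free :: "nat \<Rightarrow> (nat \<Rightarrow> 'c) \<Rightarrow> (nat \<Rightarrow> nat) \<Rightarrow> bool" where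
  "mono_321_free m \<chi> p \<longleftrightarrow> \<not> (\<exists>a b c. a < b \<and> b < c \<and> c < m \<and> p b < p a \<and> p c < p b
     \<and> \<chi> (p a) = \<chi> (p b) \<and> \<chi> (p b) = \<chi> (p c))"

text \<open>The leading parts, with respect to the number of one-coloured crossings, of the functionals
  vanishing on the relations of the coloured algebra.\<close>

locale graded_functional =
  fixes n :: nat and \<chi> :: "nat \<Rightarrow> 'c" and \<psi> :: "nat list \<Rightarrow> 'k::zero"
  assumes far: "Suc i < j \<Longrightarrow> Suc j < n \<Longrightarrow> \<psi> (u @ i # j # v) = \<psi> (u @ j # i # v)"
    and braid: "Suc (Suc i) < n \<Longrightarrow> \<psi> (u @ i # Suc i # i # v) = \<psi> (u @ Suc i # i # Suc i # v)"
    and sq_diff: "Suc i < n \<Longrightarrow> \<chi> (wperm u i) \<noteq> \<chi> (wperm u (Suc i)) \<Longrightarrow> \<psi> (u @ i # i # v) = \<psi> (u @ v)"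
    and sq_mono: "Suc i < n \<Longrightarrow> \<chi> (wperm u i) = \<chi> (wperm u (Suc i)) \<Longrightarrow> \<psi> (u @ i # i # v) = 0"
    and braid_mono: "Suc (Suc i) < n \<Longrightarrow> \<chi> (wperm u i) = \<chi> (wperm u (Suc i)) \<Longrightarrow>
       \<chi> (wperm u (Suc i)) = \<chi> (wperm u (Suc (Suc i))) \<Longrightarrow> \<psi> (u @ i # Suc i # i # v) = 0"
begin

text \<open>Only continuations on the right are compared. The relations refer to the colours behind
  a prefix; a suffix leaves these alone, whereas a new prefix would change them.\<close>

definition eqv :: "nat list \<Rightarrow> nat list \<Rightarrow> bool" where
  "eqv w w' \<longleftrightarrow> (\<forall>v. \<psi> (w @ v) = \<psi> (w' @ v))"

definition dead :: "nat list \<Rightarrow> bool" where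
  "dead w \<longleftrightarrow> (\<forall>v. \<psi> (w @ v) = 0)"

lemma eqv_refl [simp]: "eqv w w" by (simp add: eqv_def)
lemma eqv_sym: "eqv w w' \<Longrightarrow> eqv w' w" by (simp add: eqv_def)
lemma eqv_trans [trans]: "eqv u v \<Longrightarrow> eqv v w \<Longrightarrow> eqv u w" by (simp add: eqv_def)
lemma eqv_append: "eqv w w' \<Longrightarrow> eqv (w @ v) (w' @ v)" by (simp add: eqv_def)
lemma dead_append: "dead w \<Longrightarrow> dead (w @ v)" by (simp add: dead_def)
lemma eqv_dead: "eqv w w' \<Longrightarrow> dead w' \<Longrightarrow> dead w" by (simp add: dead_def eqv_def)

lemma eqv_far:
  assumes "\<And>l. l \<in> set w \<Longrightarrow> Suc i < l \<or> Suc l < i" "wletters n w" "Suc i < n"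
  shows "eqv (u @ i # w) (u @ w @ [i])"
  using assms
proof (induction w arbitrary: u)
  case Nil
  then show ?case by simp
next
  case (Cons l w)
  have "eqv (u @ i # l # w) (u @ l # i # w)"
    using Cons.prems far[of i l u] far[of l i u] by (fastforce simp: eqv_def)
  also have "eqv \<dots> (u @ (l # w) @ [i])"
    using Cons.IH[of "u @ [l]"] Cons.prems by simp
  finally show ?case .
qed

text \<open>A letter passes from right to left through a descending run that contains it and its
  lower neighbour, and comes out lowered by one: far commutations up to the block
  \<open>Suc k, k\<close>, one braid relation, then far commutations again.\<close>

lemma eqv_run_high:
  assumes "j \<le> k" "Suc k < m" "m < n"
  shows "eqv (u @ run m j @ [Suc k]) (u @ k # run m j)"
proof -
  have r: "run m j = run m (Suc (Suc k)) @ Suc k # k # run k j"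
    using run_split[of j "Suc (Suc k)" m] assms by (simp add: run_Suc_left)
  have "eqv (u @ run m j @ [Suc k]) (u @ run m (Suc (Suc k)) @ Suc k # k # Suc k # run k j)"
    using eqv_sym[OF eqv_far[of "run k j" "Suc k" "u @ run m (Suc (Suc k)) @ [Suc k, k]"]] assms
    by (auto simp: r set_run wletters_run)
  also have "eqv \<dots> (u @ run m (Suc (Suc k)) @ k # Suc k # k # run k j)"
    using braid[of k "u @ run m (Suc (Suc k))"] assms by (auto simp: eqv_def)
  also have "eqv \<dots> (u @ k # run m (Suc (Suc k)) @ Suc k # k # run k j)"
  proof -
    have "eqv (u @ k # run m (Suc (Suc k))) (u @ run m (Suc (Suc k)) @ [k])"
      by (rule eqv_far) (use assms in \<open>auto simp: set_run wletters_run\<close>)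
    from eqv_append[OF eqv_sym[OF this], of "Suc k # k # run k j"] show ?thesis by simp
  qed
  finally show ?thesis by (simp add: r)
qed

lemma eqv_run_low:
  assumes "Suc i < j" "m < n" "j \<le> m"
  shows "eqv (u @ run m j @ [i]) (u @ i # run m j)"
  by (rule eqv_sym, rule eqv_far) (use assms in \<open>auto simp: set_run wletters_run\<close>)

text \<open>Appending a letter to a canonical word gives a canonical word up to a square. With
  \<open>j\<close> the end of the last run, the letter lengthens the run, or meets its own copy at
  the end of it, or passes the run and is treated by induction. The square is the only source of
  dead words here.\<close>

lemma can_snoc:
  assumes "p permutes {..<m}" "m \<le> n" "Suc i < m"
  shows "dead (can m p @ [i]) \<or> eqv (can m p @ [i]) (can m (p \<circ> adj i))"
  using assms
proof (induction m arbitrary: p i)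
  case 0
  then show ?case by simp
next
  case (Suc m)
  from Suc.prems(1) obtain h j where h: "h permutes {..<m}" "j \<le> m" "p = h \<circ> cyc m j"
    by (rule permutes_Suc_decompose)
  have c: "can (Suc m) p = can m h @ run m j" using h can_comp_cyc by blast
  have wh: "wperm (can m h) = h" using wperm_can h(1) by blast
  consider "Suc i = j" | "i = j" | "j < i" | "Suc i < j" by linarith
  then show "dead (can (Suc m) p @ [i]) \<or> eqv (can (Suc m) p @ [i]) (can (Suc m) (p \<circ> adj i))"
  proof cases
    case 1
    then have r: "run m i = run m j @ [i]" using run_snoc[of i m] h by simp
    have "p \<circ> adj i = h \<circ> cyc m i" by (simp add: r wperm_append h(3) comp_assoc)
    then have "can (Suc m) (p \<circ> adj i) = can m h @ run m i" using can_comp_cyc[of h m i] h 1 by simp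
    then show ?thesis using c r by simp
  next
    case 2
    then have jm: "j < m" using Suc.prems by simp
    then have r: "run m j = run m (Suc j) @ [j]" by (rule run_snoc)
    have "p \<circ> adj i = h \<circ> cyc m (Suc j)" by (simp add: r wperm_append h(3) comp_assoc 2)
    then have "can (Suc m) (p \<circ> adj i) = can m h @ run m (Suc j)" using can_comp_cyc[of h m "Suc j"] h jm by simp
    moreover have "dead ((can m h @ run m (Suc j)) @ [j, j]) \<or> eqv ((can m h @ run m (Suc j)) @ [j, j]) (can m h @ run m (Suc j))"
      using sq_diff[of j "can m h @ run m (Suc j)"] sq_mono[of j "can m h @ run m (Suc j)"] Suc.prems 2
      unfolding dead_def eqv_def append_assoc append_Cons append_Nil by (metis less_le_trans)
    ultimately show ?thesis using c r 2 by simp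
  next
    case 3
    then obtain k where k: "i = Suc k" "j \<le> k" by (cases i) auto
    have e: "eqv (can (Suc m) p @ [i]) (can m h @ k # run m j)"
      using eqv_run_high[of j k m "can m h"] Suc.prems k c by simp
    have "cyc m j \<circ> adj i = adj k \<circ> cyc m j"
      using k Suc.prems h(2) by (auto simp: fun_eq_iff cyc_apply Transposition.transpose_def)
    then have "p \<circ> adj i = (h \<circ> adj k) \<circ> cyc m j" by (simp add: h(3) comp_assoc)
    moreover have "(h \<circ> adj k) permutes {..<m}"
      by (rule permutes_compose[OF adj_permutes h(1)]) (use k Suc.prems in simp)
    ultimately have "can (Suc m) (p \<circ> adj i) = can m (h \<circ> adj k) @ run m j" using can_comp_cyc h by metis
    moreover have "dead (can m h @ [k]) \<or> eqv (can m h @ [k]) (can m (h \<circ> adj k))"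
      by (rule Suc.IH[OF h(1)]) (use k Suc.prems in auto)
    ultimately show ?thesis using e dead_append[of "can m h @ [k]" "run m j"] eqv_append[of "can m h @ [k]" _ "run m j"]
      by (auto intro: eqv_dead eqv_trans)
  next
    case 4
    have e: "eqv (can (Suc m) p @ [i]) (can m h @ i # run m j)"
      using eqv_run_low[of i j m "can m h"] Suc.prems 4 h c by simp
    have "cyc m j \<circ> adj i = adj i \<circ> cyc m j"
      using 4 Suc.prems h(2) by (auto simp: fun_eq_iff cyc_apply Transposition.transpose_def)
    then have "p \<circ> adj i = (h \<circ> adj i) \<circ> cyc m j" by (simp add: h(3) comp_assoc)
    moreover have "(h \<circ> adj i) permutes {..<m}"
      by (rule permutes_compose[OF adj_permutes h(1)]) (use 4 h in simp)
    ultimately have "can (Suc m) (p \<circ> adj i) = can m (h \<circ> adj i) @ run m j" using can_comp_cyc h by metis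
    moreover have "dead (can m h @ [i]) \<or> eqv (can m h @ [i]) (can m (h \<circ> adj i))"
      by (rule Suc.IH[OF h(1)]) (use 4 h Suc.prems in auto)
    ultimately show ?thesis using e dead_append[of "can m h @ [i]" "run m j"] eqv_append[of "can m h @ [i]" _ "run m j"]
      by (auto intro: eqv_dead eqv_trans)
  qed
qed

lemma can_id: "can m id = []"
proof (induction m)
  case (Suc m)
  show "can (Suc m) id = []" using can_comp_cyc[OF permutes_id, of m m] Suc by (simp)
qed simp

lemma normal_form:
  assumes "wletters m w" "m \<le> n"
  shows "dead w \<or> eqv w (can m (wperm w))"
  using assms
proof (induction w rule: rev_induct)
  case Nil
  show "dead [] \<or> eqv [] (can m (wperm []))" by (simp add: can_id)
next
  case (snoc i w)
  then consider "dead w" | "eqv w (can m (wperm w))" by auto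
  then show "dead (w @ [i]) \<or> eqv (w @ [i]) (can m (wperm (w @ [i])))"
  proof cases
    case 1
    then show ?thesis using dead_append by blast
  next
    case 2
    then have e: "eqv (w @ [i]) (can m (wperm w) @ [i])" by (rule eqv_append)
    have "dead (can m (wperm w) @ [i]) \<or> eqv (can m (wperm w) @ [i]) (can m (wperm w \<circ> adj i))"
      by (rule can_snoc) (use snoc.prems wperm_permutes in auto)
    then show ?thesis using e by (auto simp: wperm_append intro: eqv_dead eqv_trans)
  qed
qed

text \<open>The exchange condition for canonical words. Far commutations and braid relations suffice
  for it, so the value is preserved and the alternative of a dead word does not arise.\<close>

lemma can_exchange:
  assumes "p permutes {..<m}" "m \<le> n" "Suc i < m" "p (Suc i) < p i"
  shows "\<exists>w. eqv (can m p) (w @ [i]) \<and> wperm (w @ [i]) = p \<and> wletters m w"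
  using assms
proof (induction m arbitrary: p i)
  case 0
  then show ?case by simp
next
  case (Suc m)
  from Suc.prems(1) obtain h j where h: "h permutes {..<m}" "j \<le> m" "p = h \<circ> cyc m j"
    by (rule permutes_Suc_decompose)
  have c: "can (Suc m) p = can m h @ run m j" using h can_comp_cyc by blast
  have wh: "wperm (can m h) = h" "wletters m (can m h)" using wperm_can h(1) by blast+
  have fb_rep: "h m = m" using h(1) by (simp add: permutes_def)
  have hlt: "h x < m \<longleftrightarrow> x < m" for x using permutes_in_image[OF h(1), of x] by simp
  consider "Suc i = j" | "i = j" | "j < i" | "Suc i < j" by linarith
  then show "\<exists>w. eqv (can (Suc m) p) (w @ [i]) \<and> wperm (w @ [i]) = p \<and> wletters (Suc m) w"
  proof cases
    \<comment> \<open>The place \<open>Suc i\<close> carries the largest value \<open>m\<close>, so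
      \<open>i\<close> is not a descent.\<close>
    case 1
    then have "p i = h i" "p (Suc i) = m" "i < m" using h by (auto simp: cyc_apply fb_rep)
    then show ?thesis using Suc.prems(4) hlt[of i] by simp
  next
    case 2
    then have jm: "j < m" using Suc.prems by simp
    then have r: "run m j = run m (Suc j) @ [j]" by (rule run_snoc)
    have "eqv (can (Suc m) p) ((can m h @ run m (Suc j)) @ [i])" using c r 2 by simp
    moreover have "wperm ((can m h @ run m (Suc j)) @ [i]) = p"
      using wh h r 2 by (simp add: wperm_append comp_assoc)
    moreover have "wletters (Suc m) (can m h @ run m (Suc j))"
      using wh wletters_mono[of m _ "Suc m"] by (simp add: wletters_run)
    ultimately show ?thesis by blast
  next
    case 3
    then obtain k where k: "i = Suc k" "j \<le> k" by (cases i) auto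
    have "h (Suc k) < h k" using Suc.prems(3,4) h k by (simp add: cyc_apply)
    then obtain w where w: "eqv (can m h) (w @ [k])" "wperm (w @ [k]) = h" "wletters m w"
      using Suc.IH[OF h(1), of k] Suc.prems k by auto
    have "eqv (can (Suc m) p) (w @ k # run m j)" using eqv_append[OF w(1), of "run m j"] c by simp
    also have "eqv \<dots> ((w @ run m j) @ [i])"
      using eqv_sym[OF eqv_run_high[of j k m w]] k Suc.prems by simp
    finally have e: "eqv (can (Suc m) p) ((w @ run m j) @ [i])" .
    have cc: "cyc m j \<circ> adj i = adj k \<circ> cyc m j"
      using k Suc.prems h(2) by (auto simp: fun_eq_iff cyc_apply Transposition.transpose_def)
    have "wperm ((w @ run m j) @ [i]) = p"
      using w(2) cc h(3) by (simp add: wperm_append comp_assoc[symmetric])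
    moreover have "wletters (Suc m) (w @ run m j)"
      using w wletters_mono[of m _ "Suc m"] by (simp add: wletters_run)
    ultimately show ?thesis using e by blast
  next
    case 4
    have "h (Suc i) < h i" using Suc.prems(3,4) h 4 by (simp add: cyc_apply)
    then obtain w where w: "eqv (can m h) (w @ [i])" "wperm (w @ [i]) = h" "wletters m w"
      using Suc.IH[OF h(1), of i] Suc.prems 4 h by auto
    have "eqv (can (Suc m) p) (w @ i # run m j)" using eqv_append[OF w(1), of "run m j"] c by simp
    also have "eqv \<dots> ((w @ run m j) @ [i])"
      using eqv_sym[OF eqv_run_low[of i j m w]] 4 h Suc.prems by simp
    finally have e: "eqv (can (Suc m) p) ((w @ run m j) @ [i])" .
    have cc: "cyc m j \<circ> adj i = adj i \<circ> cyc m j"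
      using 4 Suc.prems h(2) by (auto simp: fun_eq_iff cyc_apply Transposition.transpose_def)
    have "wperm ((w @ run m j) @ [i]) = p"
      using w(2) cc h(3) by (simp add: wperm_append comp_assoc[symmetric])
    moreover have "wletters (Suc m) (w @ run m j)"
      using w wletters_mono[of m _ "Suc m"] by (simp add: wletters_run)
    ultimately show ?thesis using e by blast
  qed
qed

text \<open>The strand \<open>m\<close> moves left across the strands at \<open>a < b\<close>, which have its colour and are
  already crossed. Strands of other colours between \<open>a\<close> and \<open>b\<close> are moved out of the way.\<close>

lemma dead_append_run:
  assumes "wletters m g" "m < n" "j \<le> a" "a < b" "b < m" "wperm g b < wperm g a"
    and "\<chi> (wperm g a) = \<chi> m" "\<chi> (wperm g b) = \<chi> m"
  shows "dead (g @ run m j)"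
  using assms
proof (induction "b - a" arbitrary: g a b rule: less_induct)
  case less
  have gp: "wperm g permutes {..<m}" using less.prems(1) by (rule wperm_permutes)
  then have gm: "wperm g m = m" by (simp add: permutes_def)
  show ?case
  proof (cases "b = Suc a")
    \<comment> \<open>Two neighbouring strands that are already crossed: after the exchange the word
      ends in \<open>a\<close>, which commutes with the upper part of the run and then stands in
      front of \<open>Suc a, a\<close>. This is a braid word on three strands of one colour.\<close>
    case True
    have "dead g \<or> eqv g (can m (wperm g))" using normal_form less.prems by simp
    moreover have "dead (g @ run m j)" if e: "eqv g (can m (wperm g))"
    proof -
      obtain w where w: "eqv (can m (wperm g)) (w @ [a])" "wperm (w @ [a]) = wperm g" "wletters m w"
        using can_exchange[OF gp, of a] less.prems True by auto
      have r: "run m j = run m (Suc (Suc a)) @ Suc a # a # run a j"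
        using run_split[of j "Suc (Suc a)" m] less.prems True by (simp add: run_Suc_left)
      have "eqv (g @ run m j) (w @ a # run m j)"
        using eqv_append[OF eqv_trans[OF e w(1)], of "run m j"] by simp
      also have "eqv \<dots> (w @ run m (Suc (Suc a)) @ a # Suc a # a # run a j)"
        using eqv_append[OF eqv_far[of "run m (Suc (Suc a))" a w], of "Suc a # a # run a j"] less.prems True
        by (simp add: r set_run wletters_run)
      finally have e2: "eqv (g @ run m j) \<dots>" .
      have wg: "wperm w = wperm g \<circ> adj a"
        using w(2) by (simp add: wperm_append fun_eq_iff) (metis transpose_involutory)
      have "dead (w @ run m (Suc (Suc a)) @ a # Suc a # a # run a j)"
        unfolding dead_def
      proof
        fix v
        have "Suc (Suc a) \<le> m" using less.prems True by simp
        then show "\<psi> ((w @ run m (Suc (Suc a)) @ a # Suc a # a # run a j) @ v) = 0"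
          using braid_mono[of a "w @ run m (Suc (Suc a))" "run a j @ v"] less.prems True
          by (simp add: wperm_append cyc_apply wg gm)
      qed
      then show ?thesis using e2 eqv_dead by blast
    qed
    ultimately show ?thesis using dead_append by blast
  next
    case False
    then obtain c where c: "b = Suc c" "a < c" using less.prems(4) by (cases b) auto
    show ?thesis
    proof (cases "\<chi> (wperm g c) = \<chi> m")
      case True
      \<comment> \<open>The strand at \<open>c\<close>, the left neighbour of \<open>b\<close>, has
        the colour as well. It is crossed with the strand at \<open>a\<close> or with the one at
        \<open>b\<close>, and the gap shrinks either way.\<close>
      have "wperm g c < wperm g a \<or> wperm g b < wperm g c" using less.prems(6) by linarith
      then show ?thesis
      proof
        assume "wperm g c < wperm g a"
        show ?thesis by (rule less.hyps[of c a g]) (use \<open>wperm g c < wperm g a\<close> less.prems c True in auto)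
      next
        assume "wperm g b < wperm g c"
        show ?thesis by (rule less.hyps[of b c g]) (use \<open>wperm g b < wperm g c\<close> less.prems c True in auto)
      qed
    next
      case False
      \<comment> \<open>The strands at \<open>c\<close> and \<open>b\<close> have distinct colours,
        so the square of their crossing may be inserted. One copy brings the strand from
        \<open>b\<close> to \<open>c\<close>, nearer to \<open>a\<close>; the other travels through
        the run and ends up on the right, where it cannot revive a dead word.\<close>
      have "eqv g (g @ [c, c])"
        using sq_diff[of c g] less.prems c False by (auto simp: eqv_def)
      from eqv_append[OF this, of "run m j"]
      have "eqv (g @ run m j) ((g @ [c]) @ c # run m j)" by simp
      also have "eqv \<dots> ((g @ [c]) @ run m j @ [Suc c])"
        by (rule eqv_sym, rule eqv_run_high) (use less.prems c in auto)
      finally have e: "eqv (g @ run m j) (((g @ [c]) @ run m j) @ [Suc c])" by simp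
      have "dead ((g @ [c]) @ run m j)"
        by (rule less.hyps[of c a "g @ [c]"])
          (use less.prems c in \<open>auto simp: wperm_append Transposition.transpose_def\<close>)
      then show ?thesis using e eqv_dead dead_append by blast
    qed
  qed
qed

text \<open>The largest value \<open>m\<close> can only come first in a decreasing pattern. If it
  does, the last run crosses two strands that are already crossed; otherwise the pattern lies in
  \<open>h\<close>, whose canonical word is a prefix.\<close>

lemma dead_can:
  assumes "p permutes {..<m}" "m \<le> n" "\<not> mono_321_free m \<chi> p"
  shows "dead (can m p)"
  using assms
proof (induction m arbitrary: p)
  case 0
  then show ?case by (simp add: mono_321_free_def)
next
  case (Suc m)
  from Suc.prems(1) obtain h j where h: "h permutes {..<m}" "j \<le> m" "p = h \<circ> cyc m j"
    by (rule permutes_Suc_decompose)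
  have c: "can (Suc m) p = can m h @ run m j" using h can_comp_cyc by blast
  have wh: "wperm (can m h) = h" "wletters m (can m h)" using wperm_can h(1) by blast+
  have fb_rep: "h m = m" using h(1) by (simp add: permutes_def)
  have hlt: "h x < m \<longleftrightarrow> x < m" for x using permutes_in_image[OF h(1), of x] by simp
  obtain x y z where xyz: "x < y" "y < z" "z < Suc m" "p y < p x" "p z < p y"
     "\<chi> (p x) = \<chi> (p y)" "\<chi> (p y) = \<chi> (p z)"
    using Suc.prems(3) unfolding mono_321_free_def by blast
  define f where "f r = cyc m j r" for r
  have pf: "p r = h (f r)" for r by (simp add: f_def h(3))
  have fj: "f j = m" and f1: "r \<noteq> j \<Longrightarrow> r \<le> m \<Longrightarrow> f r = (if j < r then r - 1 else r)" for r
    using h(2) by (auto simp: f_def cyc_apply)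
  have pj: "p j = m" by (simp add: pf fj fb_rep)
  have plt: "p r \<le> m" if "r \<le> m" for r
    using permutes_in_image[OF Suc.prems(1), of r] that by simp
  have ny: "y \<noteq> j" "z \<noteq> j" using xyz pj plt[of x] plt[of y] by auto
  show ?case
  proof (cases "x = j")
    case True
    \<comment> \<open>Places to the right of \<open>j\<close> move down by one when the last run is
      removed.\<close>
    have "dead (can m h @ run m j)"
      by (rule dead_append_run[of m "can m h" j "y - 1" "z - 1"])
        (use xyz ny True pj fb_rep pf f1[of y] f1[of z] wh Suc.prems h in auto)
    then show ?thesis using c by simp
  next
    case False
    have "f x < f y" "f y < f z" "f z < m" using f1[of x] f1[of y] f1[of z] xyz ny False h(2) by auto
    then have "\<not> mono_321_free m \<chi> h" using xyz unfolding mono_321_free_def pf by blast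
    then have "dead (can m h)" using Suc.IH[OF h(1)] Suc.prems by simp
    then show ?thesis using c dead_append by simp
  qed
qed

lemma graded_vanishes:
  assumes "\<And>p. p permutes {..<n} \<Longrightarrow> mono_321_free n \<chi> p \<Longrightarrow> \<psi> (can n p) = 0"
    and "wletters n w"
  shows "\<psi> w = 0"
proof -
  have p: "wperm w permutes {..<n}" using assms(2) by (rule wperm_permutes)
  have "dead w \<or> eqv w (can n (wperm w))" using normal_form assms(2) by simp
  moreover have "\<psi> (can n (wperm w)) = 0"
    using assms(1)[OF p] dead_can[OF p] unfolding dead_def by (metis append_Nil2 order_refl)
  ultimately show ?thesis unfolding dead_def eqv_def by (metis append_Nil2)
qed

end

section \<open>The filtration by one-coloured crossings\<close>

lemma mono_len_far: "Suc i < j \<Longrightarrow> mono_len \<chi> (u @ i # j # v) = mono_len \<chi> (u @ j # i # v)"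
proof -
  assume a: "Suc i < j"
  have "adj i \<circ> adj j = adj j \<circ> adj i" using a by (auto simp: fun_eq_iff Transposition.transpose_def)
  then show ?thesis using a by (auto simp: mono_len_append comp_assoc Transposition.transpose_def)
qed

lemma mono_len_braid: "mono_len \<chi> (u @ i # Suc i # i # v) = mono_len \<chi> (u @ Suc i # i # Suc i # v)"
proof -
  have "adj i \<circ> (adj (Suc i) \<circ> adj i) = adj (Suc i) \<circ> (adj i \<circ> adj (Suc i))"
    by (auto simp: fun_eq_iff Transposition.transpose_def)
  then show ?thesis by (auto simp: mono_len_append comp_assoc Transposition.transpose_def)
qed

text \<open>The quadratic and cubic relations are homogeneous up to words with fewer one-coloured
  crossings. Once \<open>\<phi>\<close> is known to vanish on those, its restriction to the words
  with the current number of crossings satisfies the graded relations.\<close>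

theorem functional_vanishes:
  fixes \<phi> :: "nat list \<Rightarrow> 'k::field"
  assumes far: "\<And>u v i j. Suc i < j \<Longrightarrow> Suc j < n \<Longrightarrow> wletters n u \<Longrightarrow> wletters n v \<Longrightarrow> \<phi> (u @ i # j # v) = \<phi> (u @ j # i # v)"
    and braid: "\<And>u v i. Suc (Suc i) < n \<Longrightarrow> wletters n u \<Longrightarrow> wletters n v \<Longrightarrow> \<phi> (u @ i # Suc i # i # v) = \<phi> (u @ Suc i # i # Suc i # v)"
    and sq: "\<And>u v i. Suc i < n \<Longrightarrow> wletters n u \<Longrightarrow> wletters n v \<Longrightarrow> \<phi> (u @ i # i # v) = \<phi> (u @ v) +
       (if \<chi> (wperm u i) = \<chi> (wperm u (Suc i)) then c * \<phi> (u @ i # v) else 0)"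
    and cubic: "\<And>u v i. Suc (Suc i) < n \<Longrightarrow> wletters n u \<Longrightarrow> wletters n v \<Longrightarrow>
       \<chi> (wperm u i) = \<chi> (wperm u (Suc i)) \<Longrightarrow> \<chi> (wperm u (Suc i)) = \<chi> (wperm u (Suc (Suc i))) \<Longrightarrow>
       \<phi> (u @ i # Suc i # i # v) = c0 * \<phi> (u @ v) + c1 * \<phi> (u @ i # v) + c2 * \<phi> (u @ Suc i # v)
         + c3 * \<phi> (u @ i # Suc i # v) + c4 * \<phi> (u @ Suc i # i # v)"
    and van: "\<And>p. p permutes {..<n} \<Longrightarrow> mono_321_free n \<chi> p \<Longrightarrow> \<phi> (can n p) = 0"
    and w: "wletters n w"
  shows "\<phi> w = 0"
  using w
proof (induction "mono_len \<chi> w" arbitrary: w rule: less_induct)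
  case (less w)
  define k where "k = mono_len \<chi> w"
  have low: "\<phi> w' = 0" if "mono_len \<chi> w' < k" "wletters n w'" for w'
    using less.hyps that k_def by blast
  \<comment> \<open>The extension by zero to letters out of range makes the locale assumptions true
    for all words \<open>u\<close> and \<open>v\<close>.\<close>
  define \<psi> where "\<psi> w = (if wletters n w \<and> mono_len \<chi> w = k then \<phi> w else 0)" for w
  have sqlen: "mono_len \<chi> (u @ i # i # v) = mono_len \<chi> (u @ v) + (if \<chi> (wperm u i) = \<chi> (wperm u (Suc i)) then 2 else 0)" for u i v
    by (auto simp: mono_len_append comp_assoc)
  interpret graded_functional n \<chi> \<psi>
  proof
    fix i j u v
    assume "Suc i < j" "Suc j < n"
    then show "\<psi> (u @ i # j # v) = \<psi> (u @ j # i # v)"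
      using far[of i j u v] mono_len_far[of i j \<chi> u v] by (auto simp: \<psi>_def)
  next
    fix i u v
    assume "Suc (Suc i) < n"
    then show "\<psi> (u @ i # Suc i # i # v) = \<psi> (u @ Suc i # i # Suc i # v)"
      using braid[of i u v] mono_len_braid[of \<chi> u i v] by (auto simp: \<psi>_def)
  next
    fix i u v
    assume "Suc i < n" "\<chi> (wperm u i) \<noteq> \<chi> (wperm u (Suc i))"
    then show "\<psi> (u @ i # i # v) = \<psi> (u @ v)"
      by (auto simp: \<psi>_def sqlen sq)
  next
    fix i u v
    assume a: "Suc i < n" "\<chi> (wperm u i) = \<chi> (wperm u (Suc i))"
    have th: "\<chi> \<circ> wperm u \<circ> adj i = \<chi> \<circ> wperm u"
      using a by (auto simp: fun_eq_iff Transposition.transpose_def)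
    show "\<psi> (u @ i # i # v) = 0"
    proof (cases "wletters n u \<and> wletters n v \<and> mono_len \<chi> (u @ i # i # v) = k")
      case True
      then have "mono_len \<chi> (u @ v) < k" "mono_len \<chi> (u @ i # v) < k"
        using a th by (auto simp: mono_len_append)
      then show ?thesis using True a sq[of i u v] low by (simp add: \<psi>_def)
    next
      case False
      then show ?thesis using a by (auto simp: \<psi>_def)
    qed
  next
    fix i u v
    assume a: "Suc (Suc i) < n" "\<chi> (wperm u i) = \<chi> (wperm u (Suc i))" "\<chi> (wperm u (Suc i)) = \<chi> (wperm u (Suc (Suc i)))"
    let ?\<theta> = "\<chi> \<circ> wperm u"
    have th: "?\<theta> \<circ> adj i = ?\<theta>" "?\<theta> \<circ> adj (Suc i) = ?\<theta>"
      using a by (auto simp: fun_eq_iff Transposition.transpose_def)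
    have th': "\<chi> \<circ> (wperm u \<circ> adj i) = ?\<theta>" "\<chi> \<circ> (wperm u \<circ> adj (Suc i)) = ?\<theta>"
      using th by (simp_all add: comp_assoc)
    show "\<psi> (u @ i # Suc i # i # v) = 0"
    proof (cases "wletters n u \<and> wletters n v \<and> mono_len \<chi> (u @ i # Suc i # i # v) = k")
      case True
      have "mono_len \<chi> (u @ v) < k" "mono_len \<chi> (u @ i # v) < k" "mono_len \<chi> (u @ Suc i # v) < k"
         "mono_len \<chi> (u @ i # Suc i # v) < k" "mono_len \<chi> (u @ Suc i # i # v) < k"
        using True a by (auto simp: mono_len_append th th')
      then show ?thesis using True a cubic[of i u v] low by (simp add: \<psi>_def)
    next
      case False
      then show ?thesis using a by (auto simp: \<psi>_def)
    qed
  qed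
  have "\<psi> w = 0"
    by (rule graded_vanishes) (use van less.prems in \<open>auto simp: \<psi>_def\<close>)
  then show ?case using less.prems by (simp add: \<psi>_def k_def)
qed

section \<open>Excedance words and the commutant at q = 1\<close>

text \<open>Summing over the insertions and over the deletions of a point gives the raising and
  lowering operators of sl_2 on functions of subsets, adjoint to each other. Their commutator is a
  multiple of the identity in each size, so if \<open>v\<close> is killed by one of them, the
  squared norm of its image under the other is \<open>N - 2 * k\<close> times that of
  \<open>v\<close>. For \<open>N < 2 * k\<close> this forces \<open>v = 0\<close>.\<close>

lemma boolean_lattice_injective:
  fixes v :: "nat set \<Rightarrow> complex"
  assumes supp: "\<And>B. B \<subseteq> {..<N} \<Longrightarrow> card B \<noteq> k \<Longrightarrow> v B = 0"
    and killed: "\<And>B. B \<subseteq> {..<N} \<Longrightarrow> (\<Sum>z\<in>{..<N} - B. v (insert z B)) = 0"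
    and k: "N < 2 * k" and B: "B \<subseteq> {..<N}"
  shows "v B = 0"
proof -
  let ?P = "Pow {..<N}"
  let ?S = "\<Sum>B\<in>?P. (cmod (v B))\<^sup>2"
  let ?X = "\<Sum>(C, z, y)\<in>(SIGMA C:?P. {(z, y). z \<in> C \<and> y \<in> C \<and> z \<noteq> y}). v (C - {z}) * cnj (v (C - {y}))"
  let ?Y = "\<Sum>(D, z, y)\<in>(SIGMA D:?P. {(z, y). z \<in> {..<N} - D \<and> y \<in> {..<N} - D \<and> z \<noteq> y}). v (insert z D) * cnj (v (insert y D))"
  have fin: "finite C" if "C \<subseteq> {..<N}" for C using that finite_subset by blast
  have finp: "finite {(z, y). z \<in> C \<and> y \<in> C \<and> z \<noteq> y}" if "finite C" for C :: "nat set"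
    by (rule finite_subset[of _ "C \<times> C"]) (use that in auto)
  \<comment> \<open>The mixed terms of the two norms agree: \<open>(C, z, y)\<close> corresponds to
    \<open>C\<close> without both points, with the roles of \<open>z\<close> and \<open>y\<close>
    exchanged.\<close>
  have XY: "?X = ?Y"
    by (rule sum.reindex_bij_witness[where i = "\<lambda>(D, z, y). (insert z (insert y D), y, z)" and j = "\<lambda>(C, z, y). (C - {z, y}, y, z)"])
      (auto simp: insert_absorb intro!: arg_cong2[where f = "(*)"] arg_cong[where f = v] arg_cong[where f = cnj])
  have sqsum: "(\<Sum>z\<in>C. f z) * cnj (\<Sum>z\<in>C. f z) =
      (\<Sum>z\<in>C. of_real ((cmod (f z))\<^sup>2)) + (\<Sum>(z, y)\<in>{(z, y). z \<in> C \<and> y \<in> C \<and> z \<noteq> y}. f z * cnj (f y))"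
    if "finite C" for C :: "nat set" and f :: "nat \<Rightarrow> complex"
  proof -
    have "(\<Sum>z\<in>C. f z) * cnj (\<Sum>z\<in>C. f z) = (\<Sum>(z, y)\<in>C \<times> C. f z * cnj (f y))"
      by (simp add: cnj_sum sum_product sum.cartesian_product)
    also have "C \<times> C = (\<lambda>z. (z, z)) ` C \<union> {(z, y). z \<in> C \<and> y \<in> C \<and> z \<noteq> y}" by auto
    also have "(\<Sum>(z, y)\<in>\<dots>. f z * cnj (f y)) = (\<Sum>(z, y)\<in>(\<lambda>z. (z, z)) ` C. f z * cnj (f y)) + (\<Sum>(z, y)\<in>{(z, y). z \<in> C \<and> y \<in> C \<and> z \<noteq> y}. f z * cnj (f y))"
      by (rule sum.union_disjoint) (use that finp in auto)
    also have "(\<Sum>(z, y)\<in>(\<lambda>z. (z, z)) ` C. f z * cnj (f y)) = (\<Sum>z\<in>C. of_real ((cmod (f z))\<^sup>2))"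
      by (subst sum.reindex) (auto simp: inj_on_def complex_norm_square simp del: of_real_power)
    finally show ?thesis .
  qed
  have down: "(\<Sum>C\<in>?P. (\<Sum>z\<in>C. v (C - {z})) * cnj (\<Sum>z\<in>C. v (C - {z}))) = of_real (\<Sum>B\<in>?P. (real N - real (card B)) * (cmod (v B))\<^sup>2) + ?X"
  proof -
    have "(\<Sum>C\<in>?P. \<Sum>z\<in>C. (cmod (v (C - {z})))\<^sup>2) = (\<Sum>(C, z)\<in>(SIGMA C:?P. C). (cmod (v (C - {z})))\<^sup>2)"
      by (rule sum.Sigma) (auto intro: fin)
    also have "\<dots> = (\<Sum>(B, z)\<in>(SIGMA B:?P. {..<N} - B). (cmod (v B))\<^sup>2)"
      by (rule sum.reindex_bij_witness[where i = "\<lambda>(B, z). (insert z B, z)" and j = "\<lambda>(C, z). (C - {z}, z)"])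
        (auto simp: insert_absorb)
    also have "\<dots> = (\<Sum>B\<in>?P. \<Sum>z\<in>{..<N} - B. (cmod (v B))\<^sup>2)"
      by (rule sum.Sigma[symmetric]) auto
    also have "\<dots> = (\<Sum>B\<in>?P. (real N - real (card B)) * (cmod (v B))\<^sup>2)"
    proof (rule sum.cong[OF HOL.refl])
      fix B assume "B \<in> ?P"
      then have "card ({..<N} - B) = N - card B" "card B \<le> N"
        using card_Diff_subset[of B "{..<N}"] fin card_mono[of "{..<N}" B] by auto
      then show "(\<Sum>z\<in>{..<N} - B. (cmod (v B))\<^sup>2) = (real N - real (card B)) * (cmod (v B))\<^sup>2"
        by (simp add: of_nat_diff)
    qed
    finally have e: "(\<Sum>C\<in>?P. \<Sum>z\<in>C. (cmod (v (C - {z})))\<^sup>2) = \<dots>" .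
    have "(\<Sum>C\<in>?P. (\<Sum>z\<in>C. v (C - {z})) * cnj (\<Sum>z\<in>C. v (C - {z}))) = (\<Sum>C\<in>?P. \<Sum>z\<in>C. of_real ((cmod (v (C - {z})))\<^sup>2)) +
       (\<Sum>C\<in>?P. \<Sum>(z, y)\<in>{(z, y). z \<in> C \<and> y \<in> C \<and> z \<noteq> y}. v (C - {z}) * cnj (v (C - {y})))"
      unfolding sum.distrib[symmetric] by (rule sum.cong[OF HOL.refl], rule sqsum) (auto intro: fin)
    also have "(\<Sum>C\<in>?P. \<Sum>(z, y)\<in>{(z, y). z \<in> C \<and> y \<in> C \<and> z \<noteq> y}. v (C - {z}) * cnj (v (C - {y}))) = ?X"
      by (subst sum.Sigma) (auto intro!: finp[unfolded case_prod_unfold] fin simp: case_prod_unfold)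
    also have "(\<Sum>C\<in>?P. \<Sum>z\<in>C. complex_of_real ((cmod (v (C - {z})))\<^sup>2)) = of_real (\<Sum>C\<in>?P. \<Sum>z\<in>C. (cmod (v (C - {z})))\<^sup>2)"
      by simp
    finally show ?thesis by (simp only: e)
  qed
  have up: "0 = of_real (\<Sum>B\<in>?P. real (card B) * (cmod (v B))\<^sup>2) + ?Y"
  proof -
    have "(\<Sum>D\<in>?P. \<Sum>z\<in>{..<N} - D. (cmod (v (insert z D)))\<^sup>2) = (\<Sum>(D, z)\<in>(SIGMA D:?P. {..<N} - D). (cmod (v (insert z D)))\<^sup>2)"
      by (rule sum.Sigma) auto
    also have "\<dots> = (\<Sum>(B, z)\<in>(SIGMA B:?P. B). (cmod (v B))\<^sup>2)"
      by (rule sum.reindex_bij_witness[where i = "\<lambda>(B, z). (B - {z}, z)" and j = "\<lambda>(C, z). (insert z C, z)"])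
        (auto simp: insert_absorb)
    also have "\<dots> = (\<Sum>B\<in>?P. \<Sum>z\<in>B. (cmod (v B))\<^sup>2)"
      by (rule sum.Sigma[symmetric]) (auto intro: fin)
    also have "\<dots> = (\<Sum>B\<in>?P. real (card B) * (cmod (v B))\<^sup>2)" by simp
    finally have e: "(\<Sum>D\<in>?P. \<Sum>z\<in>{..<N} - D. (cmod (v (insert z D)))\<^sup>2) = \<dots>" .
    have "0 = (\<Sum>D\<in>?P. (\<Sum>z\<in>{..<N} - D. v (insert z D)) * cnj (\<Sum>z\<in>{..<N} - D. v (insert z D)))"
      using killed by (simp add: sum.neutral)
    also have "\<dots> = (\<Sum>D\<in>?P. \<Sum>z\<in>{..<N} - D. of_real ((cmod (v (insert z D)))\<^sup>2)) +
       (\<Sum>D\<in>?P. \<Sum>(z, y)\<in>{(z, y). z \<in> {..<N} - D \<and> y \<in> {..<N} - D \<and> z \<noteq> y}. v (insert z D) * cnj (v (insert y D)))"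
      unfolding sum.distrib[symmetric] by (rule sum.cong[OF HOL.refl], rule sqsum) auto
    also have "(\<Sum>D\<in>?P. \<Sum>(z, y)\<in>{(z, y). z \<in> {..<N} - D \<and> y \<in> {..<N} - D \<and> z \<noteq> y}. v (insert z D) * cnj (v (insert y D))) = ?Y"
      by (subst sum.Sigma) (use finp[of "{..<N} - _", unfolded case_prod_unfold] in \<open>auto simp: case_prod_unfold\<close>)
    also have "(\<Sum>D\<in>?P. \<Sum>z\<in>{..<N} - D. complex_of_real ((cmod (v (insert z D)))\<^sup>2)) = of_real (\<Sum>D\<in>?P. \<Sum>z\<in>{..<N} - D. (cmod (v (insert z D)))\<^sup>2)"
      by simp
    finally show ?thesis by (simp only: e)
  qed
  have *: "(\<Sum>B\<in>?P. real (card B) * (cmod (v B))\<^sup>2) = real k * ?S"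
    "(\<Sum>B\<in>?P. (real N - real (card B)) * (cmod (v B))\<^sup>2) = (real N - real k) * ?S"
  proof -
    have e: "f (card B) * (cmod (v B))\<^sup>2 = f k * (cmod (v B))\<^sup>2" if "B \<in> ?P" for B and f :: "nat \<Rightarrow> real"
      using supp[of B] that by (cases "card B = k") auto
    show "(\<Sum>B\<in>?P. real (card B) * (cmod (v B))\<^sup>2) = real k * ?S"
      "(\<Sum>B\<in>?P. (real N - real (card B)) * (cmod (v B))\<^sup>2) = (real N - real k) * ?S"
      unfolding sum_distrib_left
      using e[of _ real] e[of _ "\<lambda>m. real N - real m"] by (auto intro!: sum.cong)
  qed
  have neg: "b = - a" if "0 = a + b" for a b :: complex
    using that by (simp add: eq_neg_iff_add_eq_0 add.commute)
  have Y: "?Y = - of_real (real k * ?S)" by (rule neg[OF up[unfolded *(1)]])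
  have alg: "of_real ((a - b) * s) + - of_real (b * s) = complex_of_real ((a - 2 * b) * s)" for a b s
    by (simp add: algebra_simps)
  have 1: "(\<Sum>C\<in>?P. (\<Sum>z\<in>C. v (C - {z})) * cnj (\<Sum>z\<in>C. v (C - {z}))) = of_real ((real N - 2 * real k) * ?S)"
    by (simp only: down XY *(2) Y alg)
  have 2: "(\<Sum>C\<in>?P. (\<Sum>z\<in>C. v (C - {z})) * cnj (\<Sum>z\<in>C. v (C - {z}))) = of_real (\<Sum>C\<in>?P. (cmod (\<Sum>z\<in>C. v (C - {z})))\<^sup>2)"
    by (simp only: complex_norm_square[symmetric] of_real_sum)
  have "(real N - 2 * real k) * ?S = (\<Sum>C\<in>?P. (cmod (\<Sum>z\<in>C. v (C - {z})))\<^sup>2)"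
    using HOL.trans[OF 1[symmetric] 2] by (simp only: of_real_eq_iff)
  also have "\<dots> \<ge> 0" by (simp add: sum_nonneg)
  finally have "(real N - 2 * real k) * ?S \<ge> 0" .
  moreover have "?S \<ge> 0" by (simp add: sum_nonneg)
  moreover have "real N - 2 * real k < 0" using k by linarith
  ultimately have "?S = 0" by (smt (verit) mult_neg_pos)
  then show ?thesis using B by (subst (asm) sum_nonneg_eq_0_iff) auto
qed

text \<open>Highest weight vectors are detected at ballot sets. The last point is split off, which
  reduces to one point less. The ballot condition at the full length only says that the size
  \<open>k\<close> is at most half the number of points; when this fails, the whole vector is zero
  by \<open>boolean_lattice_injective\<close>.\<close>

lemma ballot_support:
  fixes v :: "nat set \<Rightarrow> complex"
  assumes supp: "\<And>B. B \<subseteq> {..<N} \<Longrightarrow> card B \<noteq> k \<Longrightarrow> v B = 0"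
    and killed: "\<And>B. B \<subseteq> {..<N} \<Longrightarrow> (\<Sum>z\<in>{..<N} - B. v (insert z B)) = 0"
    and ballot: "\<And>B. B \<subseteq> {..<N} \<Longrightarrow> (\<And>m. m \<le> N \<Longrightarrow> 2 * card (B \<inter> {..<m}) \<le> m) \<Longrightarrow> v B = 0"
    and B: "B \<subseteq> {..<N}"
  shows "v B = 0"
  using assms
proof (induction N arbitrary: v k B)
  case 0
  then show ?case by simp
next
  case (Suc N)
  show ?case
  proof (cases "Suc N < 2 * k")
    case True
    then show ?thesis using boolean_lattice_injective[of "Suc N" k v B] Suc.prems by blast
  next
    case False
    \<comment> \<open>Insertion sums at sets that contain the last point \<open>N\<close> involve
      only such sets, so the values there form a vector of the same kind, of size
      \<open>k - 1\<close>. When they are zero, the term inserting \<open>N\<close> drops out of the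
      sums at the other sets.\<close>
    have top: "v (insert N B) = 0" if B: "B \<subseteq> {..<N}" for B
    proof (cases k)
      case 0
      have "finite B" using B finite_subset by blast
      then show ?thesis using Suc.prems(1)[of "insert N B"] B 0 by (cases "N \<in> B") (auto simp: subset_insertI2 lessThan_Suc)
    next
      case (Suc k')
      define w where "w B = v (insert N B)" for B
      have fB: "finite B" if "B \<subseteq> {..<N}" for B using that finite_subset by blast
      have "w B = 0"
      proof (rule Suc.IH[of k' w])
        show "w B = 0" if "B \<subseteq> {..<N}" "card B \<noteq> k'" for B
        proof -
          have "N \<notin> B" using that by auto
          moreover have "insert N B \<subseteq> {..<Suc N}" using that by auto
          ultimately show ?thesis unfolding w_def using Suc.prems(1)[of "insert N B"] that Suc fB by auto
        qed
        show "(\<Sum>z\<in>{..<N} - B. w (insert z B)) = 0" if "B \<subseteq> {..<N}" for B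
        proof -
          have "{..<Suc N} - insert N B = {..<N} - B" by auto
          moreover have "insert N B \<subseteq> {..<Suc N}" using that by auto
          ultimately show ?thesis using Suc.prems(2)[of "insert N B"]
            by (simp add: w_def insert_commute)
        qed
        show "w B = 0" if B: "B \<subseteq> {..<N}" and b: "\<And>m. m \<le> N \<Longrightarrow> 2 * card (B \<inter> {..<m}) \<le> m" for B
        proof (cases "card B = k'")
          case True
          have nB: "N \<notin> B" using B by auto
          have "2 * card (insert N B \<inter> {..<m}) \<le> m" if "m \<le> Suc N" for m
          proof (cases "m = Suc N")
            case True
            have "insert N B \<inter> {..<m} = insert N B" using B True by auto
            then show ?thesis using nB fB[OF B] \<open>card B = k'\<close> False Suc True by simp
          next
            case False
            then have "insert N B \<inter> {..<m} = B \<inter> {..<m}" using that by auto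
            then show ?thesis using b[of m] that False by simp
          qed
          moreover have "insert N B \<subseteq> {..<Suc N}" using B by auto
          ultimately show ?thesis unfolding w_def using Suc.prems(3)[of "insert N B"] by blast
        next
          case False
          have nB: "N \<notin> B" using B by auto
          moreover have "insert N B \<subseteq> {..<Suc N}" using B by auto
          ultimately show ?thesis unfolding w_def using Suc.prems(1)[of "insert N B"] B False Suc fB by auto
        qed
      qed (rule B)
      then show ?thesis by (simp add: w_def)
    qed
    have bot: "v B = 0" if B: "B \<subseteq> {..<N}" for B
    proof (rule Suc.IH[of k v])
      show "v B = 0" if "B \<subseteq> {..<N}" "card B \<noteq> k" for B using Suc.prems(1)[of B] that by (simp add: lessThan_Suc subset_insertI2)
      show "(\<Sum>z\<in>{..<N} - B. v (insert z B)) = 0" if "B \<subseteq> {..<N}" for B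
      proof -
        have "{..<Suc N} - B = insert N ({..<N} - B)" "N \<notin> {..<N} - B" using that by auto
        moreover have "B \<subseteq> {..<Suc N}" using that by auto
        ultimately show ?thesis using Suc.prems(2)[of B] that top[of B] by simp
      qed
      show "v B = 0" if B: "B \<subseteq> {..<N}" and b: "\<And>m. m \<le> N \<Longrightarrow> 2 * card (B \<inter> {..<m}) \<le> m" for B
      proof (cases "card B = k")
        case True
        have "2 * card (B \<inter> {..<m}) \<le> m" if "m \<le> Suc N" for m
        proof (cases "m = Suc N")
          case True
          then have "B \<inter> {..<m} = B" using B by auto
          then show ?thesis using \<open>card B = k\<close> False True by simp
        next
          case False
          then show ?thesis using b[of m] that by simp
        qed
        moreover have "B \<subseteq> {..<Suc N}" using B by auto
        ultimately show ?thesis using Suc.prems(3)[of B] by blast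
      next
        case False
        then show ?thesis using Suc.prems(1)[of B] B by (simp add: lessThan_Suc subset_insertI2)
      qed
    qed (rule B)
    show ?thesis
    proof (cases "N \<in> B")
      case True
      then have "B = insert N (B - {N})" "B - {N} \<subseteq> {..<N}" using Suc.prems(4) by auto
      then show ?thesis using top by metis
    next
      case False
      then show ?thesis using bot Suc.prems(4) by (metis lessThan_Suc subset_insert)
    qed
  qed
qed

section \<open>Ranks within colours, excedances and ballot conditions\<close>

definition rank :: "(nat \<Rightarrow> 'c) \<Rightarrow> nat \<Rightarrow> nat" where
  "rank \<chi> i = card {i'. i' < i \<and> \<chi> i' = \<chi> i}"

lemma rank_less:
  assumes "\<chi> i = \<chi> j" "i < j"
  shows "rank \<chi> i < rank \<chi> j"
  unfolding rank_def by (rule psubset_card_mono) (use assms in auto)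

lemma rank_less_iff: "\<chi> i = \<chi> j \<Longrightarrow> rank \<chi> i < rank \<chi> j \<longleftrightarrow> i < j"
  by (metis rank_less linorder_neqE_nat order_less_asym order_less_irrefl)

lemma rank_bij: "bij_betw (rank \<chi>) {i. i < n \<and> \<chi> i = c} {..<card {i. i < n \<and> \<chi> i = c}}"
proof -
  let ?X = "{i. i < n \<and> \<chi> i = c}"
  have inj: "inj_on (rank \<chi>) ?X"
  proof (rule inj_onI)
    fix i j assume "i \<in> ?X" "j \<in> ?X" "rank \<chi> i = rank \<chi> j"
    then show "i = j" using rank_less[of \<chi> i j] rank_less[of \<chi> j i] by (cases i j rule: linorder_cases) auto
  qed
  have "rank \<chi> ` ?X \<subseteq> {..<card ?X}"
  proof
    fix r assume "r \<in> rank \<chi> ` ?X"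
    then obtain i where i: "i < n" "\<chi> i = c" "r = rank \<chi> i" by auto
    have "rank \<chi> i < card ?X" unfolding rank_def by (rule psubset_card_mono) (use i in auto)
    then show "r \<in> {..<card ?X}" using i by simp
  qed
  then have "rank \<chi> ` ?X = {..<card ?X}" by (intro card_subset_eq) (auto simp: card_image[OF inj])
  then show ?thesis using inj by (simp add: bij_betw_def)
qed

text \<open>The marks of a permutation: the strands ending at a higher rank within their colour than they start.\<close>

definition exc_word :: "nat \<Rightarrow> (nat \<Rightarrow> nat) \<Rightarrow> (nat \<Rightarrow> nat) \<Rightarrow> nat \<Rightarrow> nat" where
  "exc_word n \<chi> p i = (if i < n then
     2 * \<chi> i + (if rank (\<chi> \<circ> p) (inv_into UNIV p i) < rank \<chi> i then 1 else 0) else 0)"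

definition class_increasing :: "nat \<Rightarrow> (nat \<Rightarrow> 'a) \<Rightarrow> (nat \<Rightarrow> nat) \<Rightarrow> bool" where
  "class_increasing n x p \<longleftrightarrow> (\<forall>i j. i < j \<longrightarrow> j < n \<longrightarrow> x (p i) = x (p j) \<longrightarrow> p i < p j)"

text \<open>In a 321-free permutation the excedances are increasing and so are the other places;
  here this is applied within each colour. If two marked strands crossed, counting would yield a
  third one to their right with a still lower value. If two unmarked strands crossed, it would yield
  one to their left with a still higher value.\<close>

lemma exc_word_class_increasing:
  assumes p: "p permutes {..<n}" and free: "mono_321_free n \<chi> p"
  shows "class_increasing n (exc_word n \<chi> p) p"
  unfolding class_increasing_def
proof (intro allI impI)
  fix i j
  assume ij: "i < j" "j < n" and e: "exc_word n \<chi> p (p i) = exc_word n \<chi> p (p j)"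
  have inv: "inv_into UNIV p (p a) = a" for a using p by (simp add: permutes_inverses)
  have inj: "p a = p b \<longleftrightarrow> a = b" for a b using permutes_inj[OF p] by (simp add: inj_eq)
  have lt: "p a < n \<longleftrightarrow> a < n" for a using permutes_in_image[OF p, of a] by simp
  let ?bit = "\<lambda>a. rank (\<chi> \<circ> p) a < rank \<chi> (p a)"
  have "2 * \<chi> (p i) + (if ?bit i then 1 else 0) = 2 * \<chi> (p j) + (if ?bit j then 1 else 0)"
    using e ij by (simp add: exc_word_def inv lt)
  then have c: "\<chi> (p i) = \<chi> (p j)" and b: "?bit i = ?bit j"
    by (auto split: if_splits) presburger+
  show "p i < p j"
  proof (rule ccontr)
    assume "\<not> p i < p j"
    then have gt: "p j < p i" using inj[of i j] ij by simp
    show False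
    proof (cases "?bit j")
      case True
      have "\<exists>k. j < k \<and> p k < p j \<and> \<chi> (p k) = \<chi> (p j)"
      proof (rule ccontr)
        assume none: "\<not> ?thesis"
        \<comment> \<open>All values of the colour below \<open>p j\<close> would be taken before
          \<open>j\<close>, against the mark.\<close>
        have "rank \<chi> (p j) \<le> rank (\<chi> \<circ> p) j" unfolding rank_def
        proof (rule card_inj_on_le[of "inv_into UNIV p"])
          show "inj_on (inv_into UNIV p) {i'. i' < p j \<and> \<chi> i' = \<chi> (p j)}"
            by (metis p permutes_inj permutes_inv inj_on_subset subset_UNIV)
          show "inv_into UNIV p ` {i'. i' < p j \<and> \<chi> i' = \<chi> (p j)} \<subseteq> {i'. i' < j \<and> (\<chi> \<circ> p) i' = (\<chi> \<circ> p) j}"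
          proof (clarify, intro conjI)
            fix i' assume i': "i' < p j" "\<chi> i' = \<chi> (p j)"
            define k where "k = inv_into UNIV p i'"
            have pk: "p k = i'" using p by (simp add: k_def permutes_inverses)
            show "inv_into UNIV p i' < j" using none i' pk inj[of j k] unfolding k_def[symmetric] by (metis less_irrefl linorder_neqE_nat)
            show "(\<chi> \<circ> p) (inv_into UNIV p i') = (\<chi> \<circ> p) j" using i' pk unfolding k_def[symmetric] by simp
          qed
        qed simp
        then show False using True by simp
      qed
      then obtain k where "j < k" "p k < p j" "\<chi> (p k) = \<chi> (p j)" by blast
      moreover have "k < n" using \<open>p k < p j\<close> lt[of k] lt[of j] ij by simp
      ultimately have "i < j \<and> j < k \<and> k < n \<and> p j < p i \<and> p k < p j \<and> \<chi> (p i) = \<chi> (p j) \<and> \<chi> (p j) = \<chi> (p k)"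
        using ij gt c by auto
      then show False using free unfolding mono_321_free_def by blast
    next
      case False
      then have nb: "rank \<chi> (p i) \<le> rank (\<chi> \<circ> p) i" using b by simp
      have "\<exists>k. k < i \<and> p i < p k \<and> \<chi> (p k) = \<chi> (p i)"
      proof (rule ccontr)
        assume none: "\<not> ?thesis"
        \<comment> \<open>The earlier places of the colour would all be mapped below
          \<open>p i\<close>, but the value \<open>p j\<close> below \<open>p i\<close> is missed by
          them. The inequality is therefore strict and makes \<open>i\<close> an excedance.\<close>
        have "rank (\<chi> \<circ> p) i < rank \<chi> (p i)"
        proof -
          have "card {i'. i' < i \<and> (\<chi> \<circ> p) i' = (\<chi> \<circ> p) i} = card (p ` {i'. i' < i \<and> (\<chi> \<circ> p) i' = (\<chi> \<circ> p) i})"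
            by (rule card_image[symmetric]) (metis p permutes_inj inj_on_subset subset_UNIV)
          also have "\<dots> < card {i'. i' < p i \<and> \<chi> i' = \<chi> (p i)}"
          proof (rule psubset_card_mono)
            show "p ` {i'. i' < i \<and> (\<chi> \<circ> p) i' = (\<chi> \<circ> p) i} \<subset> {i'. i' < p i \<and> \<chi> i' = \<chi> (p i)}"
            proof
              show "p ` {i'. i' < i \<and> (\<chi> \<circ> p) i' = (\<chi> \<circ> p) i} \<subseteq> {i'. i' < p i \<and> \<chi> i' = \<chi> (p i)}"
              proof (clarify, intro conjI)
                fix k assume "k < i" "(\<chi> \<circ> p) k = (\<chi> \<circ> p) i"
                then show "p k < p i" "\<chi> (p k) = \<chi> (p i)" using none inj[of k i] by (auto simp: neq_iff)
              qed
              have "p j \<in> {i'. i' < p i \<and> \<chi> i' = \<chi> (p i)}" using gt c by simp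
              moreover have "p j \<notin> p ` {i'. i' < i \<and> (\<chi> \<circ> p) i' = (\<chi> \<circ> p) i}" using inj ij by auto
              ultimately show "p ` {i'. i' < i \<and> (\<chi> \<circ> p) i' = (\<chi> \<circ> p) i} \<noteq> {i'. i' < p i \<and> \<chi> i' = \<chi> (p i)}" by blast
            qed
          qed simp
          finally show ?thesis by (simp add: rank_def)
        qed
        then show False using nb by simp
      qed
      then obtain k where "k < i" "p i < p k" "\<chi> (p k) = \<chi> (p i)" by blast
      then have "k < i \<and> i < j \<and> j < n \<and> p i < p k \<and> p j < p i \<and> \<chi> (p k) = \<chi> (p i) \<and> \<chi> (p i) = \<chi> (p j)"
        using ij gt c by auto
      then show False using free unfolding mono_321_free_def by blast
    qed
  qed
qed

text \<open>Among the letters of colour \<open>c\<close>, the first \<open>r + 1\<close> in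
  \<open>x\<close> have at most as many marks as the first \<open>r\<close> in \<open>y\<close>. If
  the bits of \<open>x\<close> and the complemented bits of \<open>y\<close> are interleaved,
  starting with \<open>x\<close>, this is the ballot condition for the initial segments of odd
  length.\<close>

definition ballot :: "nat \<Rightarrow> nat \<Rightarrow> (nat \<Rightarrow> nat) \<Rightarrow> (nat \<Rightarrow> nat) \<Rightarrow> bool" where
  "ballot n c x y \<longleftrightarrow> (\<forall>i<n. x i div 2 = c \<longrightarrow>
     card {i'. i' \<le> i \<and> x i' = 2 * c + 1} \<le>
     card {j. j < n \<and> y j = 2 * c + 1 \<and> rank (\<lambda>j. y j div 2) j < rank (\<lambda>i. x i div 2) i})"

lemma strict_mono_bij_exists:
  fixes S T :: "nat set"
  assumes "finite S" "finite T" "card S = card T"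
  shows "\<exists>h. bij_betw h S T \<and> strict_mono_on S h"
proof -
  obtain f where f: "bij_betw f {0..<card S} S" "strict_mono_on {0..<card S} f"
    using ex_bij_betw_strict_mono_card[OF assms(1)] by (metis atLeast0LessThan)
  obtain g where g: "bij_betw g {0..<card T} T" "strict_mono_on {0..<card T} g"
    using ex_bij_betw_strict_mono_card[OF assms(2)] by (metis atLeast0LessThan)
  define f' where "f' = inv_into {0..<card S} f"
  have f': "bij_betw f' S {0..<card S}" unfolding f'_def using f(1) by (rule bij_betw_inv_into)
  have ff': "f (f' s) = s" if "s \<in> S" for s using f(1) that bij_betw_inv_into_right f'_def by fastforce
  have "strict_mono_on S (g \<circ> f')"
  proof (rule strict_mono_onI)
    fix r s assume rs: "r \<in> S" "s \<in> S" "r < s"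
    have i: "f' r \<in> {0..<card S}" "f' s \<in> {0..<card S}" using f' rs by (auto simp: bij_betw_def)
    have "f' r < f' s"
      using ff'[OF rs(1)] ff'[OF rs(2)] rs(3) strict_mono_onD[OF f(2) i(2) i(1)]
      by (cases "f' r" "f' s" rule: linorder_cases) auto
    then show "(g \<circ> f') r < (g \<circ> f') s"
      using strict_mono_onD[OF g(2)] i assms(3) by simp
  qed
  moreover have "bij_betw (g \<circ> f') S T" using bij_betw_trans[OF f'] g(1) assms(3) by metis
  ultimately show ?thesis by blast
qed

text \<open>Standardisation: for each letter, the order-preserving bijection from its places in
  \<open>y\<close> to its places in \<open>x\<close>.\<close>

lemma class_increasing_exists:
  assumes "\<And>l. card {i. i < n \<and> x i = l} = card {j. j < n \<and> y j = l}"
  shows "\<exists>p. p permutes {..<n} \<and> class_increasing n x p \<and> (\<forall>j<n. y j = x (p j))"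
proof -
  have "\<exists>h. bij_betw h {j. j < n \<and> y j = l} {i. i < n \<and> x i = l} \<and> strict_mono_on {j. j < n \<and> y j = l} h" for l
    by (rule strict_mono_bij_exists) (use assms in auto)
  then have "\<forall>l. \<exists>h. bij_betw h {j. j < n \<and> y j = l} {i. i < n \<and> x i = l} \<and> strict_mono_on {j. j < n \<and> y j = l} h"
    by blast
  from choice[OF this] obtain H where H: "\<And>l. bij_betw (H l) {j. j < n \<and> y j = l} {i. i < n \<and> x i = l}"
    "\<And>l. strict_mono_on {j. j < n \<and> y j = l} (H l)" by blast
  define p where "p j = (if j < n then H (y j) j else j)" for j
  have px: "p j < n \<and> x (p j) = y j" if "j < n" for j
    using H(1)[of "y j"] that by (auto simp: p_def bij_betw_def)
  have "inj_on p {..<n}"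
  proof (rule inj_onI)
    fix i j assume a: "i \<in> {..<n}" "j \<in> {..<n}" "p i = p j"
    then have "y i = y j" using px by (metis lessThan_iff)
    then show "i = j" using a H(1)[of "y j"] by (auto simp: p_def bij_betw_def inj_on_def)
  qed
  moreover have "p ` {..<n} \<subseteq> {..<n}" using px by auto
  ultimately have "bij_betw p {..<n} {..<n}" by (simp add: bij_betw_def endo_inj_surj)
  then have "p permutes {..<n}" by (rule bij_imp_permutes) (simp add: p_def)
  moreover have "class_increasing n x p"
    unfolding class_increasing_def
  proof (intro allI impI)
    fix i j assume a: "i < j" "j < n" "x (p i) = x (p j)"
    then have e: "y i = y j" using px by (metis order_less_trans)
    show "p i < p j" using strict_mono_onD[OF H(2)[of "y j"], of i j] a e by (simp add: p_def)
  qed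
  ultimately show ?thesis using px by metis
qed

text \<open>Converse of \<open>exc_word_class_increasing\<close>. Since \<open>p\<close> keeps the
  order of equal letters, the copies of a letter before \<open>p j\<close> in \<open>x\<close>
  correspond to those before \<open>j\<close> in \<open>y\<close>. This turns the ballot inequality
  at \<open>p j\<close> into a comparison of the ranks of \<open>j\<close> and
  \<open>p j\<close>.\<close>

lemma ballot_exc_word:
  assumes p: "p permutes {..<n}" and inc: "class_increasing n x p" and y: "\<And>j. j < n \<Longrightarrow> y j = x (p j)"
    and b: "\<And>i. i < n \<Longrightarrow> ballot n (x i div 2) x y" and x0: "\<And>i. i \<ge> n \<Longrightarrow> x i = 0"
  defines "\<chi> \<equiv> \<lambda>i. x i div 2"
  shows "exc_word n \<chi> p = x" "mono_321_free n \<chi> p"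
proof -
  have inj: "p a = p b \<longleftrightarrow> a = b" for a b using permutes_inj[OF p] by (simp add: inj_eq)
  have lt: "p a < n \<longleftrightarrow> a < n" for a using permutes_in_image[OF p, of a] by simp
  have mono: "p i < p j \<longleftrightarrow> i < j" if "i < n" "j < n" "x (p i) = x (p j)" for i j
    using inc that inj unfolding class_increasing_def by (metis linorder_neqE_nat order_less_asym order_less_irrefl)
  have rk: "rank (\<lambda>j. y j div 2) j = rank (\<chi> \<circ> p) j" if "j < n" for j
    using that by (auto simp: rank_def \<chi>_def y intro!: arg_cong[where f = card])
  have below: "card {i'. i' < p j \<and> x i' = x (p j)} = card {j'. j' < j \<and> y j' = y j}" if "j < n" for j
  proof -
    have "{i'. i' < p j \<and> x i' = x (p j)} = p ` {j'. j' < j \<and> y j' = y j}"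
    proof safe
      fix i' assume i': "i' < p j" "x i' = x (p j)"
      define k where "k = inv_into UNIV p i'"
      have pk: "p k = i'" using p by (simp add: k_def permutes_inverses)
      then have "k < n" using i' lt[of k] lt[of j] that by simp
      then have "k < j" using mono[of k j] that pk i' by simp
      then show "i' \<in> p ` {j'. j' < j \<and> y j' = y j}" using pk i' that y by auto
    next
      fix j' assume j': "j' < j" "y j' = y j"
      then show e: "x (p j') = x (p j)" using y that by simp
      show "p j' < p j" using mono[of j' j] j' that e by simp
    qed
    then show ?thesis by (simp add: card_image inj inj_on_def)
  qed
  have bit: "x (p j) = 2 * \<chi> (p j) + (if rank (\<chi> \<circ> p) j < rank \<chi> (p j) then 1 else 0)" if j: "j < n" for j
  proof -
    define c where "c = \<chi> (p j)"
    have yc: "y j div 2 = c" using y[OF j] by (simp add: c_def \<chi>_def)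
    have B: "card {i'. i' \<le> p j \<and> x i' = 2 * c + 1} \<le>
       card {k. k < n \<and> y k = 2 * c + 1 \<and> rank (\<lambda>j. y j div 2) k < rank \<chi> (p j)}" (is "_ \<le> card ?K")
      using b[of "p j"] j lt unfolding ballot_def by (simp add: c_def \<chi>_def)
    have "x (p j) = 2 * c + 1 \<or> x (p j) = 2 * c" unfolding c_def \<chi>_def by presburger
    then consider "x (p j) = 2 * c + 1" | "x (p j) = 2 * c" by blast
    then show ?thesis
    proof cases
      case 1
      have "rank (\<chi> \<circ> p) j < rank \<chi> (p j)"
      proof (rule ccontr)
        assume "\<not> ?thesis"
        then have le: "rank \<chi> (p j) \<le> rank (\<lambda>j. y j div 2) j" using rk j by simp
        \<comment> \<open>Without an excedance the marks of \<open>y\<close> in the ballot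
          inequality all lie before \<open>j\<close>. By \<open>below\<close> they are at most as
          many as the marks of \<open>x\<close> strictly before \<open>p j\<close>, which is one too
          few.\<close>
        have "?K \<subseteq> {j'. j' < j \<and> y j' = y j}"
        proof clarify
          fix k assume k: "k < n" "y k = 2 * c + 1" "rank (\<lambda>j. y j div 2) k < rank \<chi> (p j)"
          have "rank (\<lambda>j. y j div 2) k < rank (\<lambda>j. y j div 2) j" using k le by simp
          then have "k < j" by (subst (asm) rank_less_iff) (use k yc in auto)
          then show "k < j \<and> y k = y j" using k 1 y j by simp
        qed
        then have "card ?K \<le> card {i'. i' < p j \<and> x i' = x (p j)}" unfolding below[OF j] by (intro card_mono) auto
        also have "\<dots> < card {i'. i' \<le> p j \<and> x i' = 2 * c + 1}"
          by (rule psubset_card_mono) (use 1 in auto)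
        finally show False using B by simp
      qed
      then show ?thesis using 1 c_def by simp
    next
      case 2
      have "rank \<chi> (p j) \<le> rank (\<chi> \<circ> p) j"
      proof (rule ccontr)
        assume "\<not> ?thesis"
        then have gt: "rank (\<lambda>j. y j div 2) j < rank \<chi> (p j)" using rk j by simp
        \<comment> \<open>\<open>?M\<close> has at most \<open>rank \<chi> (p j)\<close> elements.
          It contains the marked places of the ballot inequality and, disjoint from them, the
          unmarked places up to and including \<open>j\<close>; this is one too many.\<close>
        let ?M = "{k. k < n \<and> y k div 2 = c \<and> rank (\<lambda>j. y j div 2) k < rank \<chi> (p j)}"
        let ?J = "{k. k \<le> j \<and> y k = y j}"
        have "card ?M \<le> card {..<rank \<chi> (p j)}"
        proof (rule card_inj_on_le[of "rank (\<lambda>j. y j div 2)"])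
          show "inj_on (rank (\<lambda>j. y j div 2)) ?M"
            by (rule inj_on_subset[OF bij_betw_imp_inj_on[OF rank_bij[of "\<lambda>j. y j div 2" n c]]]) auto
        qed auto
        moreover have "?K \<union> ?J \<subseteq> ?M"
        proof -
          have "k \<in> ?M" if "k \<le> j" "y k = y j" for k
            using that j yc gt rank_less[of "\<lambda>j. y j div 2" k j] by (cases "k = j") auto
          then show ?thesis by auto
        qed
        then have "card (?K \<union> ?J) \<le> card ?M" by (intro card_mono) auto
        moreover have "card (?K \<union> ?J) = card ?K + card ?J"
          by (rule card_Un_disjoint) (use y[OF j] 2 in auto)
        moreover have "card ?J = Suc (card {k. k < j \<and> y k = y j})"
        proof -
          have "?J = insert j {k. k < j \<and> y k = y j}" by auto
          then show ?thesis by simp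
        qed
        \<comment> \<open>The marked letters may be counted up to \<open>p j\<close> inclusively, as
          in \<open>ballot\<close>, because \<open>x (p j)\<close> itself is unmarked.\<close>
        moreover have "rank \<chi> (p j) = card {i'. i' < p j \<and> x i' = x (p j)} + card {i'. i' \<le> p j \<and> x i' = 2 * c + 1}"
        proof -
          have "{i'. i' < p j \<and> \<chi> i' = \<chi> (p j)} = {i'. i' < p j \<and> x i' = x (p j)} \<union> {i'. i' \<le> p j \<and> x i' = 2 * c + 1}"
          proof (intro Set.set_eqI iffI)
            fix i' assume "i' \<in> {i'. i' < p j \<and> \<chi> i' = \<chi> (p j)}"
            then have "i' < p j" "x i' div 2 = c" using c_def by (auto simp: \<chi>_def)
            moreover have "x i' = 2 * c \<or> x i' = 2 * c + 1" using \<open>x i' div 2 = c\<close> by presburger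
            ultimately show "i' \<in> {i'. i' < p j \<and> x i' = x (p j)} \<union> {i'. i' \<le> p j \<and> x i' = 2 * c + 1}"
              using 2 by auto
          next
            fix i' assume a: "i' \<in> {i'. i' < p j \<and> x i' = x (p j)} \<union> {i'. i' \<le> p j \<and> x i' = 2 * c + 1}"
            then have "i' \<noteq> p j" using 2 by auto
            then show "i' \<in> {i'. i' < p j \<and> \<chi> i' = \<chi> (p j)}" using a c_def by (auto simp: \<chi>_def)
          qed
          moreover have "card ({i'. i' < p j \<and> x i' = x (p j)} \<union> {i'. i' \<le> p j \<and> x i' = 2 * c + 1}) =
             card {i'. i' < p j \<and> x i' = x (p j)} + card {i'. i' \<le> p j \<and> x i' = 2 * c + 1}"
            by (rule card_Un_disjoint) (use 2 in auto)
          ultimately show ?thesis unfolding rank_def by simp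
        qed
        moreover have "\<lbrakk>M \<le> card {..<r}; U \<le> M; U = K + J; J = Suc J'; r = I + L; L \<le> K; I = J'\<rbrakk> \<Longrightarrow> False"
          for M U K J J' I L r :: nat by simp
        ultimately show False using B below[OF j] by blast
      qed
      then show ?thesis using 2 c_def by simp
    qed
  qed
  show "exc_word n \<chi> p = x"
  proof
    fix i
    show "exc_word n \<chi> p i = x i"
    proof (cases "i < n")
      case True
      define j where "j = inv_into UNIV p i"
      have "p j = i" using p by (simp add: j_def permutes_inverses)
      then show ?thesis using bit[of j] True lt[of j] by (simp add: exc_word_def j_def[symmetric])
    qed (simp add: exc_word_def x0)
  qed
  show "mono_321_free n \<chi> p"
    unfolding mono_321_free_def
  proof (intro notI, elim exE conjE)
    fix a b c
    assume abc: "a < b" "b < c" "c < n" "p b < p a" "p c < p b" and e: "\<chi> (p a) = \<chi> (p b)" "\<chi> (p b) = \<chi> (p c)"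
    \<comment> \<open>A colour has two letters, so two of the three strands carry the same
      one.\<close>
    have "x (p a) = x (p b) \<or> x (p b) = x (p c) \<or> x (p a) = x (p c)"
    proof -
      have "x k = 2 * \<chi> k \<or> x k = 2 * \<chi> k + 1" for k unfolding \<chi>_def by presburger
      from this[of "p a"] this[of "p b"] this[of "p c"] show ?thesis using e by linarith
    qed
    moreover have "p i < p j" if "i < j" "j < n" "x (p i) = x (p j)" for i j
      using inc that unfolding class_increasing_def by blast
    note this[of a b] this[of b c] this[of a c]
    ultimately show False using abc by auto
  qed
qed

lemma card_rank:
  "card {i. i < n \<and> \<chi> i = c \<and> P (rank \<chi> i)} = card {r. r < card {i. i < n \<and> \<chi> i = c} \<and> P r}"
proof (rule bij_betw_same_card)
  let ?X = "{i. i < n \<and> \<chi> i = c}"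
  have b: "bij_betw (rank \<chi>) ?X {..<card ?X}" by (rule rank_bij)
  show "bij_betw (rank \<chi>) {i. i < n \<and> \<chi> i = c \<and> P (rank \<chi> i)} {r. r < card ?X \<and> P r}"
  proof (rule bij_betw_imageI)
    show "inj_on (rank \<chi>) {i. i < n \<and> \<chi> i = c \<and> P (rank \<chi> i)}"
      by (rule inj_on_subset[OF bij_betw_imp_inj_on[OF b]]) auto
    have "rank \<chi> ` ?X = {..<card ?X}" using b by (rule bij_betw_imp_surj_on)
    then show "rank \<chi> ` {i. i < n \<and> \<chi> i = c \<and> P (rank \<chi> i)} = {r. r < card ?X \<and> P r}"
      by (auto simp: set_eq_iff image_iff) metis+
  qed
qed

lemma sum_rank:
  "(\<Sum>r\<in>{r. r < card {i. i < n \<and> \<chi> i = c} \<and> P r}. f r) = (\<Sum>i\<in>{i. i < n \<and> \<chi> i = c \<and> P (rank \<chi> i)}. f (rank \<chi> i))"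
proof (rule sum.reindex_bij_betw[symmetric])
  let ?X = "{i. i < n \<and> \<chi> i = c}"
  have b: "bij_betw (rank \<chi>) ?X {..<card ?X}" by (rule rank_bij)
  show "bij_betw (rank \<chi>) {i. i < n \<and> \<chi> i = c \<and> P (rank \<chi> i)} {r. r < card ?X \<and> P r}"
  proof (rule bij_betw_imageI)
    show "inj_on (rank \<chi>) {i. i < n \<and> \<chi> i = c \<and> P (rank \<chi> i)}"
      by (rule inj_on_subset[OF bij_betw_imp_inj_on[OF b]]) auto
    have "rank \<chi> ` ?X = {..<card ?X}" using b by (rule bij_betw_imp_surj_on)
    then show "rank \<chi> ` {i. i < n \<and> \<chi> i = c \<and> P (rank \<chi> i)} = {r. r < card ?X \<and> P r}"
      by (auto simp: set_eq_iff image_iff) metis+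
  qed
qed

lemma card_even_odd:
  "card (B \<inter> {..<2 * m}) = card {r. r < m \<and> 2 * r \<in> B} + card {r. r < m \<and> Suc (2 * r) \<in> B}"
proof (induction m)
  case (Suc m)
  have "B \<inter> {..<2 * Suc m} = (B \<inter> {..<2 * m}) \<union> (B \<inter> {2 * m}) \<union> (B \<inter> {Suc (2 * m)})" by auto
  moreover have "card \<dots> = card (B \<inter> {..<2 * m}) + card (B \<inter> {2 * m}) + card (B \<inter> {Suc (2 * m)})"
    by (subst card_Un_disjoint, simp, simp, force, subst card_Un_disjoint, auto)
  moreover have "{r. r < Suc m \<and> Q r} = (if Q m then insert m {r. r < m \<and> Q r} else {r. r < m \<and> Q r})" for Q
    using less_Suc_eq by auto
  then have "card {r. r < Suc m \<and> Q r} = card {r. r < m \<and> Q r} + (if Q m then 1 else 0)" for Q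
    by simp
  ultimately show ?case using Suc by simp
qed simp

text \<open>The letter \<open>2 * c + b\<close> stands for the basis vector \<open>b\<close> of the summand of colour \<open>c\<close>, where
  colours count from \<open>0\<close>. Words are padded with zeros, so that they are determined by their letters.\<close>

definition words :: "nat \<Rightarrow> nat \<Rightarrow> (nat \<Rightarrow> nat) set" where
  "words n d = {x. (\<forall>i<n. x i < 2 * d) \<and> (\<forall>i\<ge>n. x i = 0)}"

definition colourings :: "nat \<Rightarrow> nat \<Rightarrow> (nat \<Rightarrow> nat) set" where
  "colourings n d = {\<chi>. (\<forall>i<n. \<chi> i < d) \<and> (\<forall>i\<ge>n. \<chi> i = 0)}"

lemma ballot_cong:
  assumes "\<And>i. x' i div 2 = x i div 2" "\<And>i. y' i div 2 = y i div 2"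
    and "\<And>i. x i div 2 = c \<Longrightarrow> x' i = x i" "\<And>i. y i div 2 = c \<Longrightarrow> y' i = y i"
    and "ballot n c x y"
  shows "ballot n c x' y'"
proof -
  have "x' i = 2 * c + 1 \<longleftrightarrow> x i = 2 * c + 1" for i using assms(1,3)[of i] by fastforce
  moreover have "y' i = 2 * c + 1 \<longleftrightarrow> y i = 2 * c + 1" for i using assms(2,4)[of i] by fastforce
  ultimately show ?thesis using assms(5) unfolding ballot_def assms(1,2) by simp
qed

section \<open>Operators commuting with the raising operators at q = 1\<close>

text \<open>\<open>weight\<close> is the trace of commuting with the Cartan generators.
  \<open>comm\<close> is the entry at \<open>(x, y)\<close> of the commutation with the raising
  operator of colour \<open>c\<close>, which acts on coordinates by turning one letter
  \<open>2 * c\<close> of the argument into \<open>2 * c + 1\<close>.\<close>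

locale classical_commutant =
  fixes n d :: nat and A :: "(nat \<Rightarrow> nat) \<Rightarrow> (nat \<Rightarrow> nat) \<Rightarrow> complex"
  assumes weight: "x \<in> words n d \<Longrightarrow> y \<in> words n d \<Longrightarrow> A x y \<noteq> 0 \<Longrightarrow>
      card {i. i < n \<and> x i = l} = card {j. j < n \<and> y j = l}"
    and comm: "c < d \<Longrightarrow> x \<in> words n d \<Longrightarrow> y \<in> words n d \<Longrightarrow>
      (\<Sum>i\<in>{i. i < n \<and> x i = 2 * c}. A (x(i := 2 * c + 1)) y) =
      (\<Sum>j\<in>{j. j < n \<and> y j = 2 * c + 1}. A x (y(j := 2 * c)))"
begin

text \<open>With the colours of all places and the letters of other colours fixed, \<open>A\<close>
  is an endomorphism of a tensor power of the two-dimensional space, hence a tensor with twice as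
  many factors once this space is identified with its dual. The identification complements the bits
  of \<open>y\<close> and introduces signs. Commutation then says that the tensor is killed by the
  raising operator, and preservation of weights that exactly half of the bits are set, so
  \<open>ballot_support\<close> applies.\<close>

lemma ballot_colour:
  assumes xy: "x \<in> words n d" "y \<in> words n d" "A x y \<noteq> 0" and c: "c < d"
  shows "\<exists>x' y'. x' \<in> words n d \<and> y' \<in> words n d \<and> A x' y' \<noteq> 0 \<and> ballot n c x' y' \<and>
    (\<forall>i. x' i div 2 = x i div 2 \<and> y' i div 2 = y i div 2) \<and>
    (\<forall>i. x i div 2 \<noteq> c \<longrightarrow> x' i = x i) \<and> (\<forall>i. y i div 2 \<noteq> c \<longrightarrow> y' i = y i)"
proof -
  define \<chi> where "\<chi> = (\<lambda>i. x i div 2)"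
  define \<psi> where "\<psi> = (\<lambda>i. y i div 2)"
  define \<mu> where "\<mu> = card {i. i < n \<and> \<chi> i = c}"
  have two: "card {i. i < n \<and> z i div 2 = c} = card {i. i < n \<and> z i = 2 * c} + card {i. i < n \<and> z i = 2 * c + 1}" for z :: "nat \<Rightarrow> nat"
  proof -
    have "{i. i < n \<and> z i div 2 = c} = {i. i < n \<and> z i = 2 * c} \<union> {i. i < n \<and> z i = 2 * c + 1}"
      by (auto; presburger)
    then show ?thesis by (simp add: card_Un_disjoint disjoint_iff)
  qed
  have \<mu>': "\<mu> = card {i. i < n \<and> \<psi> i = c}"
    unfolding \<mu>_def \<chi>_def \<psi>_def two using weight[OF xy] by simp
  \<comment> \<open>The even point \<open>2 * r\<close> carries the bit of the letter of rank
    \<open>r\<close> in \<open>x\<close>, the odd point after it the complemented bit of the letter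
    of rank \<open>r\<close> in \<open>y\<close>.\<close>
  define X where "X B i = (if i < n \<and> \<chi> i = c then 2 * c + (if 2 * rank \<chi> i \<in> B then 1 else 0) else x i)" for B i
  define Y where "Y B i = (if i < n \<and> \<psi> i = c then 2 * c + (if Suc (2 * rank \<psi> i) \<in> B then 0 else 1) else y i)" for B i
  have XW: "X B \<in> words n d" and YW: "Y B \<in> words n d" for B
    using xy c by (auto simp: words_def X_def Y_def)
  have Xd: "X B i div 2 = \<chi> i" and Yd: "Y B i div 2 = \<psi> i" for B i
    by (auto simp: X_def Y_def \<chi>_def \<psi>_def)
  have X1: "i < n \<and> X B i = 2 * c + 1 \<longleftrightarrow> i < n \<and> \<chi> i = c \<and> 2 * rank \<chi> i \<in> B" for B i
    by (auto simp: X_def \<chi>_def)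
  have X0: "i < n \<and> X B i = 2 * c \<longleftrightarrow> i < n \<and> \<chi> i = c \<and> 2 * rank \<chi> i \<notin> B" for B i
    by (auto simp: X_def \<chi>_def)
  have Y1: "i < n \<and> Y B i = 2 * c + 1 \<longleftrightarrow> i < n \<and> \<psi> i = c \<and> Suc (2 * rank \<psi> i) \<notin> B" for B i
    by (auto simp: Y_def \<psi>_def)
  define odds where "odds B = {r. r < \<mu> \<and> Suc (2 * r) \<in> B}" for B
  \<comment> \<open>The sign turns the difference of the two sides of \<open>comm\<close> into one
    sum over insertions: it changes when an odd point is inserted and stays when an even one
    is.\<close>
  define v where "v B = (- 1) ^ card (odds B) * A (X B) (Y B)" for B
  have inj: "rank \<chi> i = rank \<chi> j \<longleftrightarrow> i = j" if "i < n" "j < n" "\<chi> i = c" "\<chi> j = c" for i j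
    using rank_bij[of \<chi> n c] that by (auto simp: bij_betw_def dest: inj_onD)
  have inj': "rank \<psi> i = rank \<psi> j \<longleftrightarrow> i = j" if "i < n" "j < n" "\<psi> i = c" "\<psi> j = c" for i j
    using rank_bij[of \<psi> n c] that by (auto simp: bij_betw_def dest: inj_onD)
  have "\<exists>B. B \<subseteq> {..<2 * \<mu>} \<and> (\<forall>m\<le>2 * \<mu>. 2 * card (B \<inter> {..<m}) \<le> m) \<and> v B \<noteq> 0"
  proof (rule ccontr)
    assume none: "\<not> ?thesis"
    define B0 where "B0 = {2 * rank \<chi> i | i. i < n \<and> x i = 2 * c + 1} \<union> {Suc (2 * rank \<psi> j) | j. j < n \<and> y j = 2 * c}"
    have e: "2 * rank \<chi> i \<in> B0 \<longleftrightarrow> x i = 2 * c + 1" if "i < n" "\<chi> i = c" for i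
    proof -
      have "2 * rank \<chi> i \<in> B0 \<longleftrightarrow> (\<exists>k. k < n \<and> x k = 2 * c + 1 \<and> rank \<chi> i = rank \<chi> k)"
        by (auto simp: B0_def) presburger
      also have "\<dots> \<longleftrightarrow> (\<exists>k. k < n \<and> x k = 2 * c + 1 \<and> i = k)"
      proof -
        have "(k < n \<and> x k = 2 * c + 1 \<and> rank \<chi> i = rank \<chi> k) \<longleftrightarrow> (k < n \<and> x k = 2 * c + 1 \<and> i = k)" for k
          using inj[of i k] that unfolding \<chi>_def by (cases "x k div 2 = c") auto
        then show ?thesis by simp
      qed
      finally show ?thesis using that by auto
    qed
    have e': "Suc (2 * rank \<psi> i) \<in> B0 \<longleftrightarrow> y i = 2 * c" if "i < n" "\<psi> i = c" for i
    proof -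
      have "Suc (2 * rank \<psi> i) \<in> B0 \<longleftrightarrow> (\<exists>k. k < n \<and> y k = 2 * c \<and> rank \<psi> i = rank \<psi> k)"
        by (auto simp: B0_def) presburger
      also have "\<dots> \<longleftrightarrow> (\<exists>k. k < n \<and> y k = 2 * c \<and> i = k)"
      proof -
        have "(k < n \<and> y k = 2 * c \<and> rank \<psi> i = rank \<psi> k) \<longleftrightarrow> (k < n \<and> y k = 2 * c \<and> i = k)" for k
          using inj'[of i k] that unfolding \<psi>_def by (cases "y k div 2 = c") auto
        then show ?thesis by simp
      qed
      finally show ?thesis using that by auto
    qed
    have dx: "x i = 2 * c \<or> x i = 2 * c + 1" if "\<chi> i = c" for i using that unfolding \<chi>_def by presburger
    have dy: "y i = 2 * c \<or> y i = 2 * c + 1" if "\<psi> i = c" for i using that unfolding \<psi>_def by presburger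
    have "X B0 = x"
    proof
      fix i show "X B0 i = x i" using e[of i] dx[of i] by (cases "i < n \<and> \<chi> i = c") (auto simp: X_def)
    qed
    moreover have "Y B0 = y"
    proof
      fix i show "Y B0 i = y i" using e'[of i] dy[of i] by (cases "i < n \<and> \<psi> i = c") (auto simp: Y_def)
    qed
    ultimately have "v B0 \<noteq> 0" using xy by (simp add: v_def)
    moreover have "v B0 = 0"
    proof (rule ballot_support[of "2 * \<mu>" \<mu> v])
      show "v B = 0" if B: "B \<subseteq> {..<2 * \<mu>}" and k: "card B \<noteq> \<mu>" for B
      proof (rule ccontr)
        assume "v B \<noteq> 0"
        then have "A (X B) (Y B) \<noteq> 0" by (simp add: v_def)
        then have "card {i. i < n \<and> X B i = 2 * c + 1} = card {i. i < n \<and> Y B i = 2 * c + 1}"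
          using weight XW YW by blast
        then have "card {r. r < \<mu> \<and> 2 * r \<in> B} = card {r. r < \<mu> \<and> Suc (2 * r) \<notin> B}"
          unfolding X1 Y1 using card_rank[of n \<chi> c "\<lambda>r. 2 * r \<in> B"] card_rank[of n \<psi> c "\<lambda>r. Suc (2 * r) \<notin> B"]
          by (simp add: \<mu>_def[symmetric] \<mu>'[symmetric])
        moreover have "card {r. r < \<mu> \<and> Suc (2 * r) \<notin> B} + card {r. r < \<mu> \<and> Suc (2 * r) \<in> B} = \<mu>"
        proof -
          have "{r. r < \<mu> \<and> Suc (2 * r) \<notin> B} \<union> {r. r < \<mu> \<and> Suc (2 * r) \<in> B} = {..<\<mu>}" by auto
          then show ?thesis using card_Un_disjoint[of "{r. r < \<mu> \<and> Suc (2 * r) \<notin> B}" "{r. r < \<mu> \<and> Suc (2 * r) \<in> B}"]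
            by (simp add: disjoint_iff)
        qed
        moreover have "card B = card {r. r < \<mu> \<and> 2 * r \<in> B} + card {r. r < \<mu> \<and> Suc (2 * r) \<in> B}"
          using card_even_odd[of B \<mu>] B by (simp add: Int_absorb2)
        ultimately show False using k by simp
      qed
      show "(\<Sum>z\<in>{..<2 * \<mu>} - B. v (insert z B)) = 0" if B: "B \<subseteq> {..<2 * \<mu>}" for B
      proof -
        let ?s = "(- 1) ^ card (odds B) :: complex"
        have set: "{..<2 * \<mu>} - B = (\<lambda>r. 2 * r) ` {r. r < \<mu> \<and> 2 * r \<notin> B} \<union> (\<lambda>r. Suc (2 * r)) ` {r. r < \<mu> \<and> Suc (2 * r) \<notin> B}"
        proof (intro Set.set_eqI iffI)
          fix z assume z: "z \<in> {..<2 * \<mu>} - B"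
          show "z \<in> (\<lambda>r. 2 * r) ` {r. r < \<mu> \<and> 2 * r \<notin> B} \<union> (\<lambda>r. Suc (2 * r)) ` {r. r < \<mu> \<and> Suc (2 * r) \<notin> B}"
          proof (cases "even z")
            case True
            then obtain r where "z = 2 * r" by (rule evenE)
            then show ?thesis using z by auto
          next
            case False
            then obtain r where "z = 2 * r + 1" by (rule oddE)
            then show ?thesis using z by auto
          qed
        qed auto
        have "(\<Sum>z\<in>{..<2 * \<mu>} - B. v (insert z B)) =
           (\<Sum>z\<in>(\<lambda>r. 2 * r) ` {r. r < \<mu> \<and> 2 * r \<notin> B}. v (insert z B)) + (\<Sum>z\<in>(\<lambda>r. Suc (2 * r)) ` {r. r < \<mu> \<and> Suc (2 * r) \<notin> B}. v (insert z B))"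
          unfolding set by (rule sum.union_disjoint) (auto, presburger)
        also have "(\<Sum>z\<in>(\<lambda>r. 2 * r) ` {r. r < \<mu> \<and> 2 * r \<notin> B}. v (insert z B)) = (\<Sum>r\<in>{r. r < \<mu> \<and> 2 * r \<notin> B}. v (insert (2 * r) B))"
          by (subst sum.reindex) (auto simp: inj_on_def)
        also have "\<dots> = (\<Sum>i\<in>{i. i < n \<and> \<chi> i = c \<and> 2 * rank \<chi> i \<notin> B}. v (insert (2 * rank \<chi> i) B))"
          unfolding \<mu>_def by (rule sum_rank)
        also have "\<dots> = (\<Sum>i\<in>{i. i < n \<and> X B i = 2 * c}. ?s * A ((X B)(i := 2 * c + 1)) (Y B))"
        proof (rule sum.cong)
          fix i assume "i \<in> {i. i < n \<and> X B i = 2 * c}"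
          then have i: "i < n" "\<chi> i = c" using X0 by auto
          have "X (insert (2 * rank \<chi> i) B) = (X B)(i := 2 * c + 1)"
          proof
            fix k show "X (insert (2 * rank \<chi> i) B) k = ((X B)(i := 2 * c + 1)) k"
              using i inj[of k i] by (cases "k = i") (auto simp: X_def)
          qed
          moreover have "Y (insert (2 * rank \<chi> i) B) = Y B" unfolding Y_def by (auto simp: fun_eq_iff; presburger)
          moreover have "odds (insert (2 * rank \<chi> i) B) = odds B" unfolding odds_def by (auto; presburger)
          ultimately show "v (insert (2 * rank \<chi> i) B) = ?s * A ((X B)(i := 2 * c + 1)) (Y B)"
            by (simp add: v_def)
        qed (use X0 in blast)
        also have "(\<Sum>z\<in>(\<lambda>r. Suc (2 * r)) ` {r. r < \<mu> \<and> Suc (2 * r) \<notin> B}. v (insert z B)) = (\<Sum>r\<in>{r. r < \<mu> \<and> Suc (2 * r) \<notin> B}. v (insert (Suc (2 * r)) B))"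
          by (subst sum.reindex) (auto simp: inj_on_def)
        also have "\<dots> = (\<Sum>i\<in>{i. i < n \<and> \<psi> i = c \<and> Suc (2 * rank \<psi> i) \<notin> B}. v (insert (Suc (2 * rank \<psi> i)) B))"
          unfolding \<mu>' by (rule sum_rank)
        also have "\<dots> = (\<Sum>j\<in>{j. j < n \<and> Y B j = 2 * c + 1}. - ?s * A (X B) ((Y B)(j := 2 * c)))"
        proof (rule sum.cong)
          fix i assume "i \<in> {j. j < n \<and> Y B j = 2 * c + 1}"
          then have i: "i < n" "\<psi> i = c" "Suc (2 * rank \<psi> i) \<notin> B" using Y1 by auto
          have "Y (insert (Suc (2 * rank \<psi> i)) B) = (Y B)(i := 2 * c)"
          proof
            fix k show "Y (insert (Suc (2 * rank \<psi> i)) B) k = ((Y B)(i := 2 * c)) k"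
              using i inj'[of k i] by (cases "k = i") (auto simp: Y_def)
          qed
          moreover have "X (insert (Suc (2 * rank \<psi> i)) B) = X B" unfolding X_def by (auto simp: fun_eq_iff; presburger)
          moreover have "card (odds (insert (Suc (2 * rank \<psi> i)) B)) = Suc (card (odds B))"
          proof -
            have "rank \<psi> i < \<mu>" using rank_bij[of \<psi> n c] i \<mu>' by (auto simp: bij_betw_def)
            then have "odds (insert (Suc (2 * rank \<psi> i)) B) = insert (rank \<psi> i) (odds B)" unfolding odds_def by auto
            moreover have "rank \<psi> i \<notin> odds B" "finite (odds B)" using i by (auto simp: odds_def)
            ultimately show ?thesis by simp
          qed
          ultimately show "v (insert (Suc (2 * rank \<psi> i)) B) = - ?s * A (X B) ((Y B)(i := 2 * c))"
            by (simp add: v_def)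
        qed (use Y1 in blast)
        also have "(\<Sum>i\<in>{i. i < n \<and> X B i = 2 * c}. ?s * A ((X B)(i := 2 * c + 1)) (Y B)) + \<dots> =
           ?s * ((\<Sum>i\<in>{i. i < n \<and> X B i = 2 * c}. A ((X B)(i := 2 * c + 1)) (Y B)) - (\<Sum>j\<in>{j. j < n \<and> Y B j = 2 * c + 1}. A (X B) ((Y B)(j := 2 * c))))"
          by (simp add: sum_distrib_left right_diff_distrib sum_negf)
        also have "\<dots> = 0" using comm[OF c XW YW] by simp
        finally show ?thesis .
      qed
      show "v B = 0" if "B \<subseteq> {..<2 * \<mu>}" "\<And>m. m \<le> 2 * \<mu> \<Longrightarrow> 2 * card (B \<inter> {..<m}) \<le> m" for B
        using none that by blast
      have lt: "rank \<chi> i < \<mu>" if "i < n" "x i = 2 * c + 1" for i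
        using rank_bij[of \<chi> n c] that by (auto simp: bij_betw_def \<mu>_def \<chi>_def)
      have lt': "rank \<psi> i < \<mu>" if "i < n" "y i = 2 * c" for i
        using rank_bij[of \<psi> n c] that by (auto simp: bij_betw_def \<mu>' \<psi>_def)
      show "B0 \<subseteq> {..<2 * \<mu>}" using lt lt' by (fastforce simp: B0_def)
    qed
    ultimately show False by simp
  qed
  then obtain B where B: "B \<subseteq> {..<2 * \<mu>}" "\<And>m. m \<le> 2 * \<mu> \<Longrightarrow> 2 * card (B \<inter> {..<m}) \<le> m" "v B \<noteq> 0" by blast
  have "ballot n c (X B) (Y B)"
    unfolding ballot_def Xd Yd
  proof (intro allI impI)
    fix i assume i: "i < n" "\<chi> i = c"
    let ?r = "rank \<chi> i"
    have r: "?r < \<mu>" using rank_bij[of \<chi> n c] i by (auto simp: bij_betw_def \<mu>_def)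
    have "{i'. i' \<le> i \<and> X B i' = 2 * c + 1} = {i'. i' < n \<and> \<chi> i' = c \<and> rank \<chi> i' \<le> ?r \<and> 2 * rank \<chi> i' \<in> B}"
    proof (intro Set.set_eqI iffI)
      fix k assume k: "k \<in> {i'. i' \<le> i \<and> X B i' = 2 * c + 1}"
      then have "k < n \<and> X B k = 2 * c + 1" using i by auto
      then have "k < n" "\<chi> k = c" "2 * rank \<chi> k \<in> B" using X1 by blast+
      moreover have "rank \<chi> k \<le> ?r" using rank_less[of \<chi> k i] k calculation i by (cases "k = i") auto
      ultimately show "k \<in> {i'. i' < n \<and> \<chi> i' = c \<and> rank \<chi> i' \<le> ?r \<and> 2 * rank \<chi> i' \<in> B}" by simp
    next
      fix k assume k: "k \<in> {i'. i' < n \<and> \<chi> i' = c \<and> rank \<chi> i' \<le> ?r \<and> 2 * rank \<chi> i' \<in> B}"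
      then have "X B k = 2 * c + 1" using X1 by blast
      moreover have "k \<le> i" using rank_less[of \<chi> i k] k i by force
      ultimately show "k \<in> {i'. i' \<le> i \<and> X B i' = 2 * c + 1}" by simp
    qed
    moreover have "{s. s < \<mu> \<and> s \<le> ?r \<and> 2 * s \<in> B} = {s. s < Suc ?r \<and> 2 * s \<in> B}" using r by auto
    ultimately have l: "card {i'. i' \<le> i \<and> X B i' = 2 * c + 1} = card {s. s < Suc ?r \<and> 2 * s \<in> B}"
      using card_rank[of n \<chi> c "\<lambda>s. s \<le> ?r \<and> 2 * s \<in> B"] by (simp only: \<mu>_def)
    have "{j. j < n \<and> Y B j = 2 * c + 1 \<and> rank \<psi> j < ?r} = {j. j < n \<and> \<psi> j = c \<and> Suc (2 * rank \<psi> j) \<notin> B \<and> rank \<psi> j < ?r}"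
      using Y1 by blast
    moreover have "{s. s < \<mu> \<and> Suc (2 * s) \<notin> B \<and> s < ?r} = {s. s < ?r \<and> Suc (2 * s) \<notin> B}" using r by auto
    ultimately have rr: "card {j. j < n \<and> Y B j = 2 * c + 1 \<and> rank \<psi> j < ?r} = card {s. s < ?r \<and> Suc (2 * s) \<notin> B}"
      using card_rank[of n \<psi> c "\<lambda>s. Suc (2 * s) \<notin> B \<and> s < ?r"] by (simp only: \<mu>')
    have "{s. s < ?r \<and> Suc (2 * s) \<notin> B} \<union> {s. s < ?r \<and> Suc (2 * s) \<in> B} = {..<?r}" by auto
    then have s: "card {s. s < ?r \<and> Suc (2 * s) \<notin> B} + card {s. s < ?r \<and> Suc (2 * s) \<in> B} = ?r"
      using card_Un_disjoint[of "{s. s < ?r \<and> Suc (2 * s) \<notin> B}" "{s. s < ?r \<and> Suc (2 * s) \<in> B}"]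
      by (simp add: disjoint_iff)
    \<comment> \<open>The initial segment of length \<open>2 * ?r + 1\<close> contains the even
      points up to rank \<open>?r\<close> and the odd points below it, which is the asymmetry in
      \<open>ballot\<close>.\<close>
    have "card {s. s < Suc ?r \<and> 2 * s \<in> B} + card {s. s < ?r \<and> Suc (2 * s) \<in> B} = card (B \<inter> {..<Suc (2 * ?r)})"
    proof -
      have "card (B \<inter> {..<Suc (2 * ?r)}) = card ((B \<inter> {..<Suc (2 * ?r)}) \<inter> {..<2 * Suc ?r})"
        by (rule arg_cong[where f = card]) auto
      also have "\<dots> = card {s. s < Suc ?r \<and> 2 * s \<in> B \<inter> {..<Suc (2 * ?r)}} + card {s. s < Suc ?r \<and> Suc (2 * s) \<in> B \<inter> {..<Suc (2 * ?r)}}"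
        by (rule card_even_odd)
      also have "{s. s < Suc ?r \<and> 2 * s \<in> B \<inter> {..<Suc (2 * ?r)}} = {s. s < Suc ?r \<and> 2 * s \<in> B}" by auto
      also have "{s. s < Suc ?r \<and> Suc (2 * s) \<in> B \<inter> {..<Suc (2 * ?r)}} = {s. s < ?r \<and> Suc (2 * s) \<in> B}" by auto
      finally show ?thesis by simp
    qed
    moreover have "2 * card (B \<inter> {..<Suc (2 * ?r)}) \<le> Suc (2 * ?r)" using B(2)[of "Suc (2 * ?r)"] r by simp
    ultimately show "card {i'. i' \<le> i \<and> X B i' = 2 * c + 1} \<le> card {j. j < n \<and> Y B j = 2 * c + 1 \<and> rank \<psi> j < rank \<chi> i}"
      unfolding l rr using s by linarith
  qed
  moreover have "A (X B) (Y B) \<noteq> 0" using B(3) by (simp add: v_def)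
  moreover have "\<forall>i. X B i div 2 = x i div 2 \<and> Y B i div 2 = y i div 2"
    using Xd Yd by (simp add: \<chi>_def \<psi>_def)
  moreover have "\<forall>i. x i div 2 \<noteq> c \<longrightarrow> X B i = x i" "\<forall>i. y i div 2 \<noteq> c \<longrightarrow> Y B i = y i"
    by (auto simp: X_def Y_def \<chi>_def \<psi>_def)
  ultimately show ?thesis using XW YW by blast
qed

text \<open>The colours can be treated one after another: adjusting one of them changes neither the
  ranks nor the letters of the others.\<close>

lemma ballot_all_colours:
  assumes xy: "x \<in> words n d" "y \<in> words n d" "A x y \<noteq> 0" and "c \<le> d"
  shows "\<exists>x y. x \<in> words n d \<and> y \<in> words n d \<and> A x y \<noteq> 0 \<and> (\<forall>c'<c. ballot n c' x y)"
  using \<open>c \<le> d\<close>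
proof (induction c)
  case 0
  then show ?case using xy by blast
next
  case (Suc c)
  then obtain x y where 1: "x \<in> words n d" "y \<in> words n d" "A x y \<noteq> 0" "\<forall>c'<c. ballot n c' x y" by auto
  obtain x' y' where 2: "x' \<in> words n d" "y' \<in> words n d" "A x' y' \<noteq> 0" "ballot n c x' y'"
    "\<forall>i. x' i div 2 = x i div 2 \<and> y' i div 2 = y i div 2"
    "\<forall>i. x i div 2 \<noteq> c \<longrightarrow> x' i = x i" "\<forall>i. y i div 2 \<noteq> c \<longrightarrow> y' i = y i"
    using ballot_colour[OF 1(1-3), of c] Suc.prems by auto
  have "ballot n c' x' y'" if "c' < Suc c" for c'
  proof (cases "c' = c")
    case False
    then show ?thesis using that 1(4) 2 by (intro ballot_cong[of x' x y' y c' n]) auto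
  qed (use 2 in simp)
  then show ?case using 2 by blast
qed

text \<open>A nonzero entry yields one at a pair of words that is ballot for all colours. Equality
  of weights provides the class-increasing permutation between the two words, and the ballot
  conditions recognise the pair as an excedance word and its rearrangement.\<close>

theorem determined_by_exc_words:
  assumes van: "\<And>\<chi> p. \<chi> \<in> colourings n d \<Longrightarrow> p permutes {..<n} \<Longrightarrow> mono_321_free n \<chi> p \<Longrightarrow>
      A (exc_word n \<chi> p) (exc_word n \<chi> p \<circ> p) = 0"
    and xy: "x \<in> words n d" "y \<in> words n d"
  shows "A x y = 0"
proof (rule ccontr)
  assume "A x y \<noteq> 0"
  then obtain x y where 1: "x \<in> words n d" "y \<in> words n d" "A x y \<noteq> 0" "\<forall>c<d. ballot n c x y"
    using ballot_all_colours[OF xy, of d] by auto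
  have "card {i. i < n \<and> x i = l} = card {j. j < n \<and> y j = l}" for l using weight[OF 1(1-3)] by simp
  then obtain p where p: "p permutes {..<n}" "class_increasing n x p" "\<forall>j<n. y j = x (p j)"
    using class_increasing_exists[of n x y] by auto
  let ?\<chi> = "\<lambda>i. x i div 2"
  have x0: "x i = 0" "y i = 0" if "n \<le> i" for i using 1(1,2) that by (auto simp: words_def)
  have xd: "x i div 2 < d" if "i < n" for i using 1(1) that by (auto simp: words_def less_mult_imp_div_less mult.commute)
  have e: "exc_word n ?\<chi> p = x" "mono_321_free n ?\<chi> p"
    using ballot_exc_word[OF p(1,2), of y] p(3) 1(4) x0 xd by auto
  have "y = x \<circ> p"
  proof
    fix j show "y j = (x \<circ> p) j"
      using p(3) x0 p(1) by (cases "j < n") (auto simp: permutes_def)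
  qed
  moreover have "?\<chi> \<in> colourings n d" using xd x0 by (auto simp: colourings_def)
  ultimately show False using van[of ?\<chi> p] p(1) e 1(3) by simp
qed

end

section \<open>Algebras, quotients and monoid algebras\<close>

text \<open>Scalars act through the multiples of the unit, as in \<open>smult_conv_mult\<close>;
  hence two-sided ideals are stable under scalars and quotients are again of this kind.\<close>

locale kalgebra = ring A for A :: "('k::field, 'a) module" (structure) +
  assumes smult_closed [simp, intro]: "x \<in> carrier A \<Longrightarrow> c \<odot> x \<in> carrier A"
    and smult_add: "x \<in> carrier A \<Longrightarrow> y \<in> carrier A \<Longrightarrow> c \<odot> (x \<oplus> y) = c \<odot> x \<oplus> c \<odot> y"
    and smult_mult_left: "x \<in> carrier A \<Longrightarrow> y \<in> carrier A \<Longrightarrow> (c \<odot> x) \<otimes> y = c \<odot> (x \<otimes> y)"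
begin

lemma smult_conv_mult: "x \<in> carrier A \<Longrightarrow> c \<odot> x = (c \<odot> \<one>) \<otimes> x"
  by (simp add: smult_mult_left)

end

section \<open>Homomorphisms and quotients of algebras\<close>

definition alg_hom :: "('k, 'a) module \<Rightarrow> ('k, 'b) module \<Rightarrow> ('a \<Rightarrow> 'b) set" where
  "alg_hom A B = {h \<in> Ring.ring_hom A B. \<forall>c. \<forall>x\<in>carrier A. h (c \<odot>\<^bsub>A\<^esub> x) = c \<odot>\<^bsub>B\<^esub> h x}"

lemma alg_homD:
  assumes "h \<in> alg_hom A B"
  shows "h \<in> Ring.ring_hom A B" "\<And>c x. x \<in> carrier A \<Longrightarrow> h (c \<odot>\<^bsub>A\<^esub> x) = c \<odot>\<^bsub>B\<^esub> h x"
    "\<And>x. x \<in> carrier A \<Longrightarrow> h x \<in> carrier B"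
    "\<And>x y. x \<in> carrier A \<Longrightarrow> y \<in> carrier A \<Longrightarrow> h (x \<otimes>\<^bsub>A\<^esub> y) = h x \<otimes>\<^bsub>B\<^esub> h y"
    "\<And>x y. x \<in> carrier A \<Longrightarrow> y \<in> carrier A \<Longrightarrow> h (x \<oplus>\<^bsub>A\<^esub> y) = h x \<oplus>\<^bsub>B\<^esub> h y"
    "h \<one>\<^bsub>A\<^esub> = \<one>\<^bsub>B\<^esub>"
  using assms by (auto simp: alg_hom_def Ring.ring_hom_def)

lemma alg_hom_minus:
  assumes "h \<in> alg_hom A B" "ring A" "ring B" "x \<in> carrier A" "y \<in> carrier A"
  shows "h (x \<ominus>\<^bsub>A\<^esub> y) = h x \<ominus>\<^bsub>B\<^esub> h y" "h \<zero>\<^bsub>A\<^esub> = \<zero>\<^bsub>B\<^esub>"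
proof -
  interpret ring_hom_ring A B h
    using ring_hom_ringI2[OF assms(2,3) alg_homD(1)[OF assms(1)]] .
  show "h (x \<ominus>\<^bsub>A\<^esub> y) = h x \<ominus>\<^bsub>B\<^esub> h y" "h \<zero>\<^bsub>A\<^esub> = \<zero>\<^bsub>B\<^esub>"
    using assms(4,5) by (simp_all add: a_minus_def)
qed

locale algebra_quotient = kalgebra A for A :: "('k::field, 'a) module" (structure) +
  fixes S :: "'a set"
  assumes gens: "S \<subseteq> carrier A"
begin

abbreviation "Q \<equiv> quot_alg A S"
abbreviation "I \<equiv> Idl S"

sublocale id: ideal I A by (rule genideal_ideal[OF gens])

lemma Q_simps:
  "carrier Q = a_rcosets I" "mult Q = rcoset_mult A I" "one Q = I +> \<one>" "zero Q = I" "add Q = set_add A"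
  "smult Q c X = (\<Union>x\<in>X. I +> (c \<odot> x))"
  by (simp_all add: quot_alg_def Let_def FactRing_def ring.defs module.defs)

lemma ring_Q: "ring Q"
proof -
  interpret R: ring "A Quot I" by (rule id.quotient_is_ring)
  have eq: "carrier Q = carrier (A Quot I)" "mult Q = mult (A Quot I)" "one Q = one (A Quot I)"
    "zero Q = zero (A Quot I)" "add Q = add (A Quot I)"
    by (simp_all add: Q_simps FactRing_def)
  show ?thesis
  proof (rule ringI)
    show "abelian_group Q"
    proof (rule abelian_groupI, unfold eq)
      fix x assume x: "x \<in> carrier (A Quot I)"
      show "\<zero>\<^bsub>A Quot I\<^esub> \<oplus>\<^bsub>A Quot I\<^esub> x = x" using x by (rule R.l_zero)
      show "\<exists>y\<in>carrier (A Quot I). y \<oplus>\<^bsub>A Quot I\<^esub> x = \<zero>\<^bsub>A Quot I\<^esub>"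
        using x R.l_neg R.a_inv_closed by blast
      fix y assume y: "y \<in> carrier (A Quot I)"
      show "x \<oplus>\<^bsub>A Quot I\<^esub> y \<in> carrier (A Quot I)" using x y by (rule R.a_closed)
      show "x \<oplus>\<^bsub>A Quot I\<^esub> y = y \<oplus>\<^bsub>A Quot I\<^esub> x" using x y by (rule R.a_comm)
      fix z assume z: "z \<in> carrier (A Quot I)"
      show "x \<oplus>\<^bsub>A Quot I\<^esub> y \<oplus>\<^bsub>A Quot I\<^esub> z = x \<oplus>\<^bsub>A Quot I\<^esub> (y \<oplus>\<^bsub>A Quot I\<^esub> z)"
        using x y z by (rule R.a_assoc)
    qed (rule R.zero_closed)
    show "Group.monoid Q"
      by (rule monoidI, unfold eq) (simp_all add: R.m_assoc)
  qed (unfold eq, simp_all add: R.l_distr R.r_distr)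
qed

lemma proj_ring_hom: "(\<lambda>x. I +> x) \<in> Ring.ring_hom A Q"
  using id.rcos_ring_hom by (simp add: Ring.ring_hom_def Q_simps FactRing_def)

lemma carrier_Q: "carrier Q = (\<lambda>x. I +> x) ` carrier A"
  by (auto simp: Q_simps A_RCOSETS_def')

lemma proj_eq_iff: "x \<in> carrier A \<Longrightarrow> y \<in> carrier A \<Longrightarrow> I +> x = I +> y \<longleftrightarrow> x \<ominus> y \<in> I"
  using quotient_eq_iff_same_a_r_cos[OF id.ideal_axioms] by simp

lemma proj_zero_iff: "x \<in> carrier A \<Longrightarrow> I +> x = \<zero>\<^bsub>Q\<^esub> \<longleftrightarrow> x \<in> I"
  using a_rcos_zero[OF id.ideal_axioms] id.rcos_const_imp_mem by (auto simp: Q_simps)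

text \<open>The union over representatives collapses to one coset, because scaling is multiplication
  by a multiple of the unit and ideals absorb it.\<close>

lemma proj_smult:
  assumes "x \<in> carrier A"
  shows "c \<odot>\<^bsub>Q\<^esub> (I +> x) = I +> (c \<odot> x)"
proof -
  have "I +> (c \<odot> x') = I +> (c \<odot> x)" if "x' \<in> I +> x" for x'
  proof -
    have x': "x' \<in> carrier A" using that id.a_rcosets_carrier assms carrier_Q Q_simps by blast
    have "x' \<ominus> x \<in> I" using that id.a_rcos_module_minus[OF ring_axioms assms x'] by simp
    then have "(c \<odot> \<one>) \<otimes> (x' \<ominus> x) \<in> I" by (simp add: id.I_l_closed)
    also have "(c \<odot> \<one>) \<otimes> (x' \<ominus> x) = c \<odot> x' \<ominus> c \<odot> x"
      using x' assms by (simp add: smult_conv_mult[of x'] smult_conv_mult[of x] a_minus_def r_distr r_minus)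
    finally show ?thesis using proj_eq_iff x' assms by simp
  qed
  moreover have "x \<in> I +> x" using assms by (rule id.a_rcos_self)
  ultimately show ?thesis unfolding Q_simps by blast
qed

lemma proj_alg_hom: "(\<lambda>x. I +> x) \<in> alg_hom A Q"
  using proj_ring_hom proj_smult by (auto simp: alg_hom_def)

lemma kalgebra_Q: "kalgebra Q"
proof -
  interpret Q: ring Q by (rule ring_Q)
  note h = alg_homD[OF proj_alg_hom]
  show ?thesis
  proof
    show "c \<odot>\<^bsub>Q\<^esub> x \<in> carrier Q" if "x \<in> carrier Q" for c x
      using that h(3) by (auto simp: carrier_Q proj_smult)
    show "c \<odot>\<^bsub>Q\<^esub> (x \<oplus>\<^bsub>Q\<^esub> y) = c \<odot>\<^bsub>Q\<^esub> x \<oplus>\<^bsub>Q\<^esub> c \<odot>\<^bsub>Q\<^esub> y" if "x \<in> carrier Q" "y \<in> carrier Q" for c x y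
      using that unfolding carrier_Q by (auto simp: proj_smult h(5)[symmetric] smult_add)
    show "c \<odot>\<^bsub>Q\<^esub> x \<otimes>\<^bsub>Q\<^esub> y = c \<odot>\<^bsub>Q\<^esub> (x \<otimes>\<^bsub>Q\<^esub> y)" if "x \<in> carrier Q" "y \<in> carrier Q" for c x y
      using that unfolding carrier_Q by (auto simp: proj_smult h(4)[symmetric] smult_mult_left)
  qed
qed

lemma hom_vanishes:
  assumes "h \<in> alg_hom A B" "ring B" "\<And>s. s \<in> S \<Longrightarrow> h s = \<zero>\<^bsub>B\<^esub>" "x \<in> I"
  shows "h x = \<zero>\<^bsub>B\<^esub>"
proof -
  have rh: "ring_hom_ring A B h"
    using ring_hom_ringI2[OF ring_axioms assms(2) alg_homD(1)[OF assms(1)]] .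
  have "S \<subseteq> a_kernel A B h" using gens assms(3) unfolding a_kernel_def' by blast
  then have "I \<subseteq> a_kernel A B h" by (rule genideal_minimal[OF ring_hom_ring.kernel_is_ideal[OF rh]])
  then show ?thesis using assms(4) unfolding a_kernel_def' by blast
qed

lemma hom_factors:
  assumes h: "h \<in> alg_hom A B" "ring B" "\<And>s. s \<in> S \<Longrightarrow> h s = \<zero>\<^bsub>B\<^esub>"
  shows "\<exists>h'\<in>alg_hom Q B. \<forall>x\<in>carrier A. h' (I +> x) = h x"
proof -
  interpret B: ring B by fact
  define h' where "h' X = h (SOME x. x \<in> carrier A \<and> I +> x = X)" for X
  have h': "h' (I +> x) = h x" if "x \<in> carrier A" for x
  proof -
    define y where "y = (SOME y. y \<in> carrier A \<and> I +> y = I +> x)"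
    have y: "y \<in> carrier A \<and> I +> y = I +> x" unfolding y_def by (rule someI[of _ x]) (use that in simp)
    then have "y \<ominus> x \<in> I" using proj_eq_iff[of y x] that by blast
    then have "h (y \<ominus> x) = \<zero>\<^bsub>B\<^esub>" using hom_vanishes h by blast
    then have "h y \<ominus>\<^bsub>B\<^esub> h x = \<zero>\<^bsub>B\<^esub>"
      using alg_hom_minus(1)[OF h(1) ring_axioms h(2), of y x] y that by simp
    moreover have c: "h x \<in> carrier B" "h y \<in> carrier B" using y that alg_homD(3)[OF h(1)] by blast+
    moreover have "h y = (h y \<ominus>\<^bsub>B\<^esub> h x) \<oplus>\<^bsub>B\<^esub> h x"
      using c by (simp add: B.minus_eq B.a_assoc B.l_neg)
    ultimately have "h y = h x" by simp
    then show ?thesis by (simp add: h'_def y_def)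
  qed
  note p = alg_homD[OF proj_alg_hom] and hh = alg_homD[OF h(1)]
  have "h' \<in> Ring.ring_hom Q B"
  proof (rule ring_hom_memI)
    show "h' x \<in> carrier B" if "x \<in> carrier Q" for x using that hh(3) h' by (auto simp: carrier_Q)
    show "h' (x \<otimes>\<^bsub>Q\<^esub> y) = h' x \<otimes>\<^bsub>B\<^esub> h' y" if "x \<in> carrier Q" "y \<in> carrier Q" for x y
      using that unfolding carrier_Q by (auto simp: p(4)[symmetric] h' hh(4))
    show "h' (x \<oplus>\<^bsub>Q\<^esub> y) = h' x \<oplus>\<^bsub>B\<^esub> h' y" if "x \<in> carrier Q" "y \<in> carrier Q" for x y
      using that unfolding carrier_Q by (auto simp: p(5)[symmetric] h' hh(5))
    show "h' \<one>\<^bsub>Q\<^esub> = \<one>\<^bsub>B\<^esub>" using p(6)[symmetric] h' hh(6) by simp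
  qed
  moreover have "h' (c \<odot>\<^bsub>Q\<^esub> X) = c \<odot>\<^bsub>B\<^esub> h' X" if "X \<in> carrier Q" for c X
    using that unfolding carrier_Q by (auto simp: proj_smult h' hh(2))
  ultimately have "h' \<in> alg_hom Q B" by (simp add: alg_hom_def)
  then show ?thesis using h' by blast
qed

end

text \<open>Identities in a monoid algebra reduce to identities in the monoid, since the functionals
  \<open>lin G\<close> separate its elements.\<close>

definition lin :: "('m \<Rightarrow> 'k::field) \<Rightarrow> ('m \<Rightarrow> 'k) \<Rightarrow> 'k" where
  "lin G a = (\<Sum>z | a z \<noteq> 0. a z * G z)"

lemma lin_superset: "finite S \<Longrightarrow> {z. a z \<noteq> 0} \<subseteq> S \<Longrightarrow> lin G a = (\<Sum>z\<in>S. a z * G z)"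
  unfolding lin_def by (rule sum.mono_neutral_left) auto

lemma lin_add:
  assumes "finite {z. a z \<noteq> 0}" "finite {z. b z \<noteq> 0}"
  shows "lin G (\<lambda>x. a x + b x) = lin G a + lin G b"
proof -
  let ?S = "{z. a z \<noteq> 0} \<union> {z. b z \<noteq> 0}"
  have S: "finite ?S" using assms by simp
  have "lin G (\<lambda>x. a x + b x) = (\<Sum>z\<in>?S. (a z + b z) * G z)" by (rule lin_superset[OF S]) auto
  also have "\<dots> = (\<Sum>z\<in>?S. a z * G z) + (\<Sum>z\<in>?S. b z * G z)" by (simp add: distrib_right sum.distrib)
  also have "(\<Sum>z\<in>?S. a z * G z) = lin G a" by (rule lin_superset[OF S, symmetric]) auto
  also have "(\<Sum>z\<in>?S. b z * G z) = lin G b" by (rule lin_superset[OF S, symmetric]) auto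
  finally show ?thesis .
qed

lemma lin_scale: "lin G (\<lambda>x. c * a x) = c * lin G a"
  by (cases "c = 0") (auto simp: lin_def sum_distrib_left mult.assoc)

lemma lin_single [simp]:
  fixes G :: "'m \<Rightarrow> 'k::field"
  shows "lin G (single x) = G x"
proof -
  have "{z. (single x z :: 'k) \<noteq> 0} = {x}" by (auto simp: single_def)
  then have "lin G (single x) = (\<Sum>z\<in>{x}. single x z * G z)" by (simp only: lin_def)
  then show ?thesis by (simp add: single_def)
qed

lemma lin_zero [simp]: "lin G (\<lambda>x. 0) = 0"
  by (simp add: lin_def)

lemma lin_cong: "(\<And>z. a z \<noteq> 0 \<Longrightarrow> G z = H z) \<Longrightarrow> lin G a = lin H a"
  unfolding lin_def by (rule sum.cong) auto

lemma lin_fun_add: "lin (\<lambda>z. G z + H z) a = lin G a + lin H a"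
  unfolding lin_def sum.distrib[symmetric] by (rule sum.cong) (simp_all add: distrib_left)

lemma lin_fun_scale: "lin (\<lambda>z. c * G z) a = c * lin G a" "lin (\<lambda>z. G z * c) a = lin G a * c"
  unfolding lin_def sum_distrib_left sum_distrib_right by (rule sum.cong; simp)+

lemma lin_fun_sum: "lin (\<lambda>z. \<Sum>k\<in>K. G k z) a = (\<Sum>k\<in>K. lin (G k) a)"
  unfolding lin_def sum_distrib_left by (rule sum.swap)

lemma lin_ext:
  assumes "finite {z. a z \<noteq> 0}" "finite {z. b z \<noteq> 0}" "\<And>G. lin G a = lin G b"
  shows "a = b"
proof
  fix x
  have e: "lin (\<lambda>z. if z = x then 1 else 0) c = c x" if "finite {z. c z \<noteq> 0}" for c :: "'a \<Rightarrow> 'b"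
    using that by (simp add: lin_def if_distrib[of "\<lambda>t. _ * t"] cong: if_cong)
  from assms(3)[of "\<lambda>z. if z = x then 1 else 0"] show "a x = b x"
    unfolding e[OF assms(1)] e[OF assms(2)] .
qed

definition conv :: "('m, 'e) monoid_scheme \<Rightarrow> ('m \<Rightarrow> 'k::field) \<Rightarrow> ('m \<Rightarrow> 'k) \<Rightarrow> 'm \<Rightarrow> 'k" where
  "conv M = (\<lambda>f g z. \<Sum>(x, y) \<in> {(x, y). f x \<noteq> 0 \<and> g y \<noteq> 0 \<and> x \<otimes>\<^bsub>M\<^esub> y = z}. f x * g y)"

lemma monoid_alg_simps [simp]:
  "mult (monoid_alg M) = conv M" "one (monoid_alg M) = single \<one>\<^bsub>M\<^esub>" "zero (monoid_alg M) = (\<lambda>x. 0)"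
  "add (monoid_alg M) = (\<lambda>f g x. f x + g x)" "smult (monoid_alg M) = (\<lambda>c f x. c * f x)"
  unfolding monoid_alg_def conv_def
  by (simp_all only: module.select_convs ring.select_convs monoid.select_convs)

lemma carrier_monoid_alg:
  "a \<in> carrier (monoid_alg M) \<longleftrightarrow> finite {x. a x \<noteq> 0} \<and> {x. a x \<noteq> 0} \<subseteq> carrier M"
  unfolding monoid_alg_def by (simp only: partial_object.select_convs mem_Collect_eq)

lemma conv_support: "{z. conv M a b z \<noteq> 0} \<subseteq> (\<lambda>(x, y). x \<otimes>\<^bsub>M\<^esub> y) ` ({x. a x \<noteq> 0} \<times> {y. b y \<noteq> 0})"
proof
  fix z assume z: "z \<in> {z. conv M a b z \<noteq> 0}"
  show "z \<in> (\<lambda>(x, y). x \<otimes>\<^bsub>M\<^esub> y) ` ({x. a x \<noteq> 0} \<times> {y. b y \<noteq> 0})"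
  proof (rule ccontr)
    assume "\<not> ?thesis"
    then have "{(x, y). a x \<noteq> 0 \<and> b y \<noteq> 0 \<and> x \<otimes>\<^bsub>M\<^esub> y = z} = {}" by blast
    then have "conv M a b z = 0" unfolding conv_def by (simp only: sum.empty)
    then show False using z by simp
  qed
qed

lemma conv_finite:
  "finite {x. a x \<noteq> 0} \<Longrightarrow> finite {x. b x \<noteq> 0} \<Longrightarrow> finite {z. conv M a b z \<noteq> 0}"
  by (rule finite_subset[OF conv_support]) auto

text \<open>A product is tested by applying \<open>lin\<close> twice, so associativity,
  distributivity and the unit laws of the convolution reduce to those of the monoid.\<close>

lemma lin_conv:
  assumes "finite {x. a x \<noteq> 0}" "finite {x. b x \<noteq> 0}"
  shows "lin G (conv M a b) = lin (\<lambda>x. lin (\<lambda>y. G (x \<otimes>\<^bsub>M\<^esub> y)) b) a"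
proof -
  let ?P = "{x. a x \<noteq> 0} \<times> {y. b y \<noteq> 0}"
  let ?m = "\<lambda>(x, y). x \<otimes>\<^bsub>M\<^esub> y"
  have fin: "finite ?P" using assms by simp
  have "lin G (conv M a b) = (\<Sum>z\<in>?m ` ?P. conv M a b z * G z)"
    by (rule lin_superset[OF finite_imageI[OF fin] conv_support])
  also have "\<dots> = (\<Sum>z\<in>?m ` ?P. \<Sum>p\<in>{p \<in> ?P. ?m p = z}. (case p of (x, y) \<Rightarrow> a x * b y * G (x \<otimes>\<^bsub>M\<^esub> y)))"
  proof (rule sum.cong[OF HOL.refl])
    fix z
    have "conv M a b z * G z = (\<Sum>p\<in>{(x, y). a x \<noteq> 0 \<and> b y \<noteq> 0 \<and> x \<otimes>\<^bsub>M\<^esub> y = z}. (case p of (x, y) \<Rightarrow> a x * b y * G z))"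
      unfolding conv_def sum_distrib_right by (rule sum.cong) auto
    also have "\<dots> = (\<Sum>p\<in>{p \<in> ?P. ?m p = z}. (case p of (x, y) \<Rightarrow> a x * b y * G (x \<otimes>\<^bsub>M\<^esub> y)))"
      by (rule sum.cong) auto
    finally show "conv M a b z * G z = \<dots>" .
  qed
  also have "\<dots> = (\<Sum>p\<in>?P. (case p of (x, y) \<Rightarrow> a x * b y * G (x \<otimes>\<^bsub>M\<^esub> y)))"
    by (rule sum.group) (use fin in auto)
  also have "\<dots> = lin (\<lambda>x. lin (\<lambda>y. G (x \<otimes>\<^bsub>M\<^esub> y)) b) a"
    by (simp add: lin_def sum_distrib_left sum.cartesian_product mult.assoc)
  finally show ?thesis .
qed

lemma single_in_carrier [simp]:
  "(single x :: 'm \<Rightarrow> 'k::field) \<in> carrier (monoid_alg M) \<longleftrightarrow> x \<in> carrier M"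
proof -
  have "{z. (single x z :: 'k) \<noteq> 0} = {x}" by (auto simp: single_def)
  then show ?thesis by (simp add: carrier_monoid_alg)
qed

lemma kalgebra_monoid_alg:
  assumes "Group.monoid M"
  shows "kalgebra (monoid_alg M :: ('k::field, 'm \<Rightarrow> 'k) module)"
proof -
  interpret M: Group.monoid M by fact
  let ?A = "monoid_alg M :: ('k, 'm \<Rightarrow> 'k) module"
  have fin: "finite {z. a z \<noteq> 0}" and sub: "a z \<noteq> 0 \<Longrightarrow> z \<in> carrier M" if "a \<in> carrier ?A" for a z
    using that by (auto simp: carrier_monoid_alg)
  have addc: "(\<lambda>x. a x + b x) \<in> carrier ?A" if "a \<in> carrier ?A" "b \<in> carrier ?A" for a b
  proof -
    have "{x. a x + b x \<noteq> 0} \<subseteq> {x. a x \<noteq> 0} \<union> {x. b x \<noteq> 0}" by auto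
    then show ?thesis using that finite_subset[of _ "{x. a x \<noteq> 0} \<union> {x. b x \<noteq> 0}"]
      unfolding carrier_monoid_alg by blast
  qed
  have sc: "(\<lambda>x. c * a x) \<in> carrier ?A" if "a \<in> carrier ?A" for a c
  proof -
    have "{x. c * a x \<noteq> 0} \<subseteq> {x. a x \<noteq> 0}" by auto
    then show ?thesis using that finite_subset unfolding carrier_monoid_alg by blast
  qed
  have cc: "conv M a b \<in> carrier ?A" if "a \<in> carrier ?A" "b \<in> carrier ?A" for a b
    using conv_support[of M a b] conv_finite[of a b M] that M.m_closed unfolding carrier_monoid_alg by fastforce
  have eqI: "a = b" if "a \<in> carrier ?A" "b \<in> carrier ?A" "\<And>G. lin G a = lin G b" for a b
    using lin_ext that fin by blast
  have one: "single \<one>\<^bsub>M\<^esub> \<in> carrier ?A" by simp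
  have ring: "ring ?A"
  proof (rule ringI)
    show "abelian_group ?A"
    proof (rule abelian_groupI)
      fix x assume "x \<in> carrier ?A"
      then have "(\<lambda>z. - 1 * x z) \<in> carrier ?A" by (rule sc)
      then show "\<exists>y\<in>carrier ?A. y \<oplus>\<^bsub>?A\<^esub> x = \<zero>\<^bsub>?A\<^esub>"
        by (intro bexI[of _ "\<lambda>z. - 1 * x z"]) simp_all
    qed (auto simp: addc add.assoc add.commute carrier_monoid_alg[of "\<lambda>x. 0"])
    show "Group.monoid ?A"
    proof (rule monoidI; unfold monoid_alg_simps)
      fix a b c :: "'m \<Rightarrow> 'k" assume abc: "a \<in> carrier ?A" "b \<in> carrier ?A" "c \<in> carrier ?A"
      show "conv M a b \<in> carrier ?A" using cc abc by blast
      show "conv M (conv M a b) c = conv M a (conv M b c)"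
        by (rule eqI) (auto simp: cc abc lin_conv fin conv_finite intro!: lin_cong dest!: sub[OF abc(1)] sub[OF abc(2)] sub[OF abc(3)] simp: M.m_assoc)
      show "conv M (single \<one>\<^bsub>M\<^esub>) a = a"
        by (rule eqI) (auto simp: cc abc lin_conv fin[OF one] fin intro!: lin_cong dest!: sub[OF abc(1)])
      show "conv M a (single \<one>\<^bsub>M\<^esub>) = a"
        by (rule eqI) (auto simp: cc abc lin_conv fin[OF one] fin intro!: lin_cong dest!: sub[OF abc(1)])
    qed (rule one)
    fix a b c :: "'m \<Rightarrow> 'k" assume abc: "a \<in> carrier ?A" "b \<in> carrier ?A" "c \<in> carrier ?A"
    show "(a \<oplus>\<^bsub>?A\<^esub> b) \<otimes>\<^bsub>?A\<^esub> c = a \<otimes>\<^bsub>?A\<^esub> c \<oplus>\<^bsub>?A\<^esub> b \<otimes>\<^bsub>?A\<^esub> c"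
      unfolding monoid_alg_simps
      by (rule eqI) (auto intro!: cc addc abc simp: lin_conv lin_add fin[OF abc(1)] fin[OF abc(2)] fin[OF abc(3)] fin[OF addc] fin[OF cc] abc)
    show "c \<otimes>\<^bsub>?A\<^esub> (a \<oplus>\<^bsub>?A\<^esub> b) = c \<otimes>\<^bsub>?A\<^esub> a \<oplus>\<^bsub>?A\<^esub> c \<otimes>\<^bsub>?A\<^esub> b"
      unfolding monoid_alg_simps
      by (rule eqI) (auto intro!: cc addc abc simp: lin_conv lin_add lin_fun_add fin[OF abc(1)] fin[OF abc(2)] fin[OF abc(3)] fin[OF addc] fin[OF cc] abc)
  qed
  interpret ring ?A by (rule ring)
  show ?thesis
  proof
    fix a b :: "'m \<Rightarrow> 'k" and c assume ab: "a \<in> carrier ?A"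
    show "c \<odot>\<^bsub>?A\<^esub> a \<in> carrier ?A" using sc ab by simp
    assume b: "b \<in> carrier ?A"
    show "c \<odot>\<^bsub>?A\<^esub> (a \<oplus>\<^bsub>?A\<^esub> b) = c \<odot>\<^bsub>?A\<^esub> a \<oplus>\<^bsub>?A\<^esub> c \<odot>\<^bsub>?A\<^esub> b" by (simp add: distrib_left)
    show "c \<odot>\<^bsub>?A\<^esub> a \<otimes>\<^bsub>?A\<^esub> b = c \<odot>\<^bsub>?A\<^esub> (a \<otimes>\<^bsub>?A\<^esub> b)"
      unfolding monoid_alg_simps
      by (rule eqI) (auto intro!: cc sc ab b simp: lin_conv lin_scale fin[OF ab] fin[OF b] fin[OF sc] ab)
  qed
qed

lemma mat_alg_simps [simp]:
  "carrier (module_mat TYPE('k::semiring_1) N N) = carrier_mat N N" "mult (module_mat TYPE('k) N N) = (*)"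
  "one (module_mat TYPE('k) N N) = 1\<^sub>m N" "zero (module_mat TYPE('k) N N) = 0\<^sub>m N N"
  "add (module_mat TYPE('k) N N) = (+)" "smult (module_mat TYPE('k) N N) = (\<cdot>\<^sub>m)"
  by (simp_all add: module_mat_def)

lemma kalgebra_mat: "kalgebra (module_mat TYPE('k::field) N N)"
proof -
  let ?A = "module_mat TYPE('k) N N"
  have ring: "ring ?A"
  proof (rule ringI)
    show "abelian_group ?A"
    proof (rule abelian_groupI)
      fix x assume "x \<in> carrier ?A"
      then show "\<exists>y\<in>carrier ?A. y \<oplus>\<^bsub>?A\<^esub> x = \<zero>\<^bsub>?A\<^esub>"
        by (intro bexI[of _ "- x"]) (auto intro!: uminus_l_inv_mat)
    qed (auto simp: assoc_add_mat comm_add_mat)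
    show "Group.monoid ?A" by (rule monoidI) (auto simp: assoc_mult_mat)
  qed (auto simp: add_mult_distrib_mat mult_add_distrib_mat)
  interpret ring ?A by (rule ring)
  show ?thesis
    by standard (auto simp: add_smult_distrib_left_mat intro: mult_smult_assoc_mat)
qed

lemma mat_alg_minus:
  fixes X Y :: "'k::field mat"
  assumes "X \<in> carrier_mat N N" "Y \<in> carrier_mat N N"
  shows "X \<ominus>\<^bsub>module_mat TYPE('k) N N\<^esub> Y = X - Y"
proof -
  interpret kalgebra "module_mat TYPE('k) N N" by (rule kalgebra_mat)
  have "\<ominus>\<^bsub>module_mat TYPE('k) N N\<^esub> Y = - Y"
    by (rule minus_equality) (use assms in \<open>auto intro!: uminus_l_inv_mat\<close>)
  then show ?thesis using assms by (simp add: a_minus_def minus_add_uminus_mat)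
qed

text \<open>The linear extension of a matrix-valued map, taken entry by entry so that the rules for
  \<open>lin\<close> carry over.\<close>

definition mlin :: "nat \<Rightarrow> ('m \<Rightarrow> 'k::field mat) \<Rightarrow> ('m \<Rightarrow> 'k) \<Rightarrow> 'k mat" where
  "mlin N \<rho> a = mat N N (\<lambda>(i, j). lin (\<lambda>g. \<rho> g $$ (i, j)) a)"

lemma mlin_carrier [simp]: "mlin N \<rho> a \<in> carrier_mat N N" "dim_row (mlin N \<rho> a) = N" "dim_col (mlin N \<rho> a) = N"
  by (simp_all add: mlin_def)

lemma mlin_single: "\<rho> x \<in> carrier_mat N N \<Longrightarrow> mlin N \<rho> (single x) = \<rho> x"
  by (rule eq_matI) (auto simp: mlin_def)

lemma mlin_alg_hom:
  fixes \<rho> :: "'m \<Rightarrow> 'k::field mat"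
  assumes "Group.monoid M" "\<And>g. g \<in> carrier M \<Longrightarrow> \<rho> g \<in> carrier_mat N N"
    "\<And>g h. g \<in> carrier M \<Longrightarrow> h \<in> carrier M \<Longrightarrow> \<rho> (g \<otimes>\<^bsub>M\<^esub> h) = \<rho> g * \<rho> h" "\<rho> \<one>\<^bsub>M\<^esub> = 1\<^sub>m N"
  shows "mlin N \<rho> \<in> alg_hom (monoid_alg M) (module_mat TYPE('k) N N)"
proof -
  let ?A = "monoid_alg M :: ('k, 'm \<Rightarrow> 'k) module"
  have "mlin N \<rho> \<in> Ring.ring_hom ?A (module_mat TYPE('k) N N)"
  proof (rule ring_hom_memI; unfold monoid_alg_simps mat_alg_simps)
    show "mlin N \<rho> (single \<one>\<^bsub>M\<^esub>) = 1\<^sub>m N" using mlin_single[of \<rho> "\<one>\<^bsub>M\<^esub>" N] assms(4) by simp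
    fix a b :: "'m \<Rightarrow> 'k" assume a: "a \<in> carrier ?A"
    show "mlin N \<rho> a \<in> carrier_mat N N" by simp
    assume b: "b \<in> carrier ?A"
    have fa: "finite {z. a z \<noteq> 0}" "\<And>z. a z \<noteq> 0 \<Longrightarrow> z \<in> carrier M"
      and fb: "finite {z. b z \<noteq> 0}" "\<And>z. b z \<noteq> 0 \<Longrightarrow> z \<in> carrier M"
      using a b by (auto simp: carrier_monoid_alg)
    show "mlin N \<rho> (\<lambda>x. a x + b x) = mlin N \<rho> a + mlin N \<rho> b"
      by (rule eq_matI) (simp_all add: mlin_def lin_add fa fb)
    show "mlin N \<rho> (conv M a b) = mlin N \<rho> a * mlin N \<rho> b"
    proof (rule eq_matI)
      fix i j assume ij: "i < dim_row (mlin N \<rho> a * mlin N \<rho> b)" "j < dim_col (mlin N \<rho> a * mlin N \<rho> b)"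
      then have ij': "i < N" "j < N" by simp_all
      have "mlin N \<rho> (conv M a b) $$ (i, j) = lin (\<lambda>x. lin (\<lambda>y. \<rho> (x \<otimes>\<^bsub>M\<^esub> y) $$ (i, j)) b) a"
        using ij' by (simp add: mlin_def lin_conv fa fb)
      also have "\<dots> = lin (\<lambda>x. lin (\<lambda>y. \<Sum>k = 0..<N. \<rho> x $$ (i, k) * \<rho> y $$ (k, j)) b) a"
      proof (rule lin_cong, rule lin_cong)
        fix x y assume "a x \<noteq> 0" "b y \<noteq> 0"
        then have "x \<in> carrier M" "y \<in> carrier M" using fa fb by auto
        then have c: "\<rho> x \<in> carrier_mat N N" "\<rho> y \<in> carrier_mat N N" and e: "\<rho> (x \<otimes>\<^bsub>M\<^esub> y) = \<rho> x * \<rho> y" using assms by auto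
        show "\<rho> (x \<otimes>\<^bsub>M\<^esub> y) $$ (i, j) = (\<Sum>k = 0..<N. \<rho> x $$ (i, k) * \<rho> y $$ (k, j))"
          unfolding e using c ij' by (auto simp: scalar_prod_def)
      qed
      also have "\<dots> = (\<Sum>k = 0..<N. lin (\<lambda>x. \<rho> x $$ (i, k)) a * lin (\<lambda>y. \<rho> y $$ (k, j)) b)"
        by (simp add: lin_fun_sum lin_fun_scale)
      also have "\<dots> = (mlin N \<rho> a * mlin N \<rho> b) $$ (i, j)"
        using ij' by (simp add: mlin_def scalar_prod_def)
      finally show "mlin N \<rho> (conv M a b) $$ (i, j) = (mlin N \<rho> a * mlin N \<rho> b) $$ (i, j)" .
    qed simp_all
  qed
  moreover have "mlin N \<rho> (\<lambda>x. c * a x) = c \<cdot>\<^sub>m mlin N \<rho> a" for c a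
    by (rule eq_matI) (simp_all add: mlin_def lin_scale)
  ultimately show ?thesis by (simp add: alg_hom_def)
qed

lemma mlin_commute:
  fixes \<rho> :: "'a \<Rightarrow> 'k::field mat"
  assumes A: "A \<in> carrier_mat N N"
    and \<rho>: "\<And>g. a g \<noteq> 0 \<Longrightarrow> \<rho> g \<in> carrier_mat N N" "\<And>g. a g \<noteq> 0 \<Longrightarrow> A * \<rho> g = \<rho> g * A"
  shows "A * mlin N \<rho> a = mlin N \<rho> a * A"
proof (rule eq_matI)
  fix i j assume "i < dim_row (mlin N \<rho> a * A)" "j < dim_col (mlin N \<rho> a * A)"
  then have ij: "i < N" "j < N" using A by auto
  have "(A * mlin N \<rho> a) $$ (i, j) = lin (\<lambda>w. \<Sum>k = 0..<N. A $$ (i, k) * \<rho> w $$ (k, j)) a"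
    using ij A by (simp add: mlin_def scalar_prod_def lin_fun_sum lin_fun_scale)
  also have "\<dots> = lin (\<lambda>w. \<Sum>k = 0..<N. \<rho> w $$ (i, k) * A $$ (k, j)) a"
  proof (rule lin_cong)
    fix w assume w: "a w \<noteq> 0"
    have "(A * \<rho> w) $$ (i, j) = (\<rho> w * A) $$ (i, j)" using \<rho>(2)[OF w] by simp
    then show "(\<Sum>k = 0..<N. A $$ (i, k) * \<rho> w $$ (k, j)) = (\<Sum>k = 0..<N. \<rho> w $$ (i, k) * A $$ (k, j))"
      using \<rho>(1)[OF w] A ij by (simp add: scalar_prod_def)
  qed
  also have "\<dots> = (mlin N \<rho> a * A) $$ (i, j)"
    using ij A by (simp add: mlin_def scalar_prod_def lin_fun_sum lin_fun_scale)
  finally show "(A * mlin N \<rho> a) $$ (i, j) = (mlin N \<rho> a * A) $$ (i, j)" .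
qed (use A in auto)

lemma monoid_free_monoid: "Group.monoid (free_monoid X)"
  by (rule monoidI) (auto simp: free_monoid_def)

lemma word_lift_mat_carrier:
  assumes "\<And>x. x \<in> set w \<Longrightarrow> \<rho> x \<in> carrier_mat N N"
  shows "word_lift (module_mat TYPE('k::field) N N) \<rho> w \<in> carrier_mat N N"
  using assms by (induction w) (auto simp: word_lift_def intro: mult_carrier_mat)

lemma word_lift_mat_append:
  assumes "\<And>x. x \<in> set u \<union> set v \<Longrightarrow> \<rho> x \<in> carrier_mat N N"
  shows "word_lift (module_mat TYPE('k::field) N N) \<rho> (u @ v) =
    word_lift (module_mat TYPE('k) N N) \<rho> u * word_lift (module_mat TYPE('k) N N) \<rho> v"
  using assms
proof (induction u)
  case Nil
  then show ?case using left_mult_one_mat[OF word_lift_mat_carrier[of v \<rho> N]] by (simp add: word_lift_def)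
next
  case (Cons x u)
  then show ?case
    using assoc_mult_mat[OF _ word_lift_mat_carrier[of u \<rho> N] word_lift_mat_carrier[of v \<rho> N], of "\<rho> x" N]
    by (simp add: word_lift_def)
qed

text \<open>Connects the finite sum in the matrix ring, through which the quantum group action is
  defined, with \<open>mlin\<close>, through which it is computed.\<close>

lemma free_lift_mat:
  assumes "f \<in> carrier (free_alg X)" "\<And>x. x \<in> X \<Longrightarrow> \<rho> x \<in> carrier_mat N N"
  shows "free_lift (module_mat TYPE('k::field) N N) \<rho> f = mlin N (word_lift (module_mat TYPE('k) N N) \<rho>) f"
proof -
  interpret kalgebra "module_mat TYPE('k) N N" by (rule kalgebra_mat)
  let ?A = "module_mat TYPE('k) N N" and ?w = "word_lift (module_mat TYPE('k) N N) \<rho>"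
  have fin: "finite {w. f w \<noteq> 0}" and sub: "\<And>w. f w \<noteq> 0 \<Longrightarrow> set w \<subseteq> X"
    using assms(1) by (auto simp: carrier_monoid_alg free_monoid_def)
  have wc: "?w w \<in> carrier_mat N N" if "f w \<noteq> 0" for w
    using word_lift_mat_carrier[of w \<rho> N] sub[OF that] assms(2) by blast
  have "(\<Oplus>\<^bsub>?A\<^esub>w\<in>F. f w \<cdot>\<^sub>m ?w w) \<in> carrier_mat N N \<and>
     (\<forall>i<N. \<forall>j<N. (\<Oplus>\<^bsub>?A\<^esub>w\<in>F. f w \<cdot>\<^sub>m ?w w) $$ (i, j) = (\<Sum>w\<in>F. f w * ?w w $$ (i, j)))"
    if "finite F" "F \<subseteq> {w. f w \<noteq> 0}" for F
    using that
  proof (induction F)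
    case empty
    then show ?case using finsum_empty by simp
  next
    case (insert w F)
    have c: "(\<lambda>w. f w \<cdot>\<^sub>m ?w w) \<in> insert w F \<rightarrow> carrier ?A" using insert.prems wc by auto
    have e: "(\<Oplus>\<^bsub>?A\<^esub>w\<in>insert w F. f w \<cdot>\<^sub>m ?w w) = f w \<cdot>\<^sub>m ?w w + (\<Oplus>\<^bsub>?A\<^esub>w\<in>F. f w \<cdot>\<^sub>m ?w w)"
      using finsum_insert[of F w "\<lambda>w. f w \<cdot>\<^sub>m ?w w"] insert.hyps c by auto
    have "?w w \<in> carrier_mat N N" using insert.prems wc by auto
    then show ?case unfolding e using insert by auto
  qed
  from this[OF fin] have "free_lift ?A \<rho> f \<in> carrier_mat N N"
    "\<And>i j. i < N \<Longrightarrow> j < N \<Longrightarrow> free_lift ?A \<rho> f $$ (i, j) = lin (\<lambda>w. ?w w $$ (i, j)) f"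
    by (auto simp: free_lift_def lin_def)
  then show ?thesis by (intro eq_matI) (auto simp: mlin_def)
qed

section \<open>Groups given by presentations\<close>

locale presentation =
  fixes X :: "'x set" and R :: "('x gword \<times> 'x gword) set"
  assumes rels: "R \<subseteq> lists (X \<times> UNIV) \<times> lists (X \<times> UNIV)"
begin

abbreviation "L \<equiv> lists (X \<times> (UNIV :: bool set))"
abbreviation "eqp \<equiv> pres_eq X R"
abbreviation "cls \<equiv> pres_class X R"
abbreviation "G \<equiv> pres_group X R"

lemma eqp_lists: "eqp u v \<Longrightarrow> u \<in> L \<and> v \<in> L"
proof (induction rule: pres_eq.induct)
  case (rel r r' u v)
  then show ?case using rels by auto
qed auto

lemma eqp_append_left: "eqp u v \<Longrightarrow> w \<in> L \<Longrightarrow> eqp (w @ u) (w @ v)"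
proof (induction rule: pres_eq.induct)
  case (refl u)
  then show ?case by (simp add: pres_eq.refl)
next
  case (sym u v)
  then show ?case by (simp add: pres_eq.sym)
next
  case (trans u v w)
  then show ?case by (meson pres_eq.trans)
next
  case (cancel x u v e)
  then show ?case using pres_eq.cancel[of x X "w @ u" v R e] by simp
next
  case (rel r r' u v)
  then show ?case using pres_eq.rel[of r r' R "w @ u" X v] by simp
qed

lemma eqp_append_right: "eqp u v \<Longrightarrow> w \<in> L \<Longrightarrow> eqp (u @ w) (v @ w)"
proof (induction rule: pres_eq.induct)
  case (refl u)
  then show ?case by (simp add: pres_eq.refl)
next
  case (sym u v)
  then show ?case by (simp add: pres_eq.sym)
next
  case (trans u v w)
  then show ?case by (meson pres_eq.trans)
next
  case (cancel x u v e)
  then show ?case using pres_eq.cancel[of x X u "v @ w" R e] by simp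
next
  case (rel r r' u v)
  then show ?case using pres_eq.rel[of r r' R u X "v @ w"] by simp
qed

lemma eqp_append: "eqp u u' \<Longrightarrow> eqp v v' \<Longrightarrow> eqp (u @ v) (u' @ v')"
  using eqp_append_left eqp_append_right eqp_lists pres_eq.trans by meson

lemma cls_eq: "v \<in> L \<Longrightarrow> cls u = cls v \<longleftrightarrow> eqp u v"
proof
  assume v: "v \<in> L" and "cls u = cls v"
  then have "v \<in> cls u" by (simp add: pres_class_def pres_eq.refl)
  then show "eqp u v" by (simp add: pres_class_def)
next
  assume uv: "eqp u v"
  have "eqp u w \<longleftrightarrow> eqp v w" for w using uv pres_eq.trans[OF uv] pres_eq.trans[OF pres_eq.sym[OF uv]] by blast
  then show "cls u = cls v" by (simp add: pres_class_def)
qed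

lemma cls_self: "u \<in> L \<Longrightarrow> u \<in> cls u"
  by (simp add: pres_class_def pres_eq.refl)

lemma cls_mult:
  assumes "u \<in> L" "v \<in> L"
  shows "cls u \<otimes>\<^bsub>G\<^esub> cls v = cls (u @ v)"
proof -
  have "cls (u' @ v') = cls (u @ v)" if "u' \<in> cls u" "v' \<in> cls v" for u' v'
  proof -
    have "eqp u u'" "eqp v v'" using that by (auto simp: pres_class_def)
    then have e: "eqp (u @ v) (u' @ v')" by (rule eqp_append)
    then show ?thesis using cls_eq eqp_lists by blast
  qed
  then show ?thesis using cls_self[OF assms(1)] cls_self[OF assms(2)]
    unfolding pres_group_def monoid.select_convs by blast
qed

lemma carrier_G: "carrier G = cls ` L" by (simp add: pres_group_def)
lemma one_G: "\<one>\<^bsub>G\<^esub> = cls []" by (simp add: pres_group_def)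

definition winv :: "'x gword \<Rightarrow> 'x gword" where
  "winv u = rev (map (\<lambda>(x, e). (x, \<not> e)) u)"

lemma winv_L: "u \<in> L \<Longrightarrow> winv u \<in> L"
  by (auto simp: winv_def in_lists_conv_set)

lemma winv_left: "u \<in> L \<Longrightarrow> eqp (winv u @ u) []"
proof (induction u)
  case Nil
  then show ?case by (simp add: winv_def pres_eq.refl)
next
  case (Cons l u)
  obtain x e where l: "l = (x, e)" by (cases l)
  have "eqp (winv u @ [(x, \<not> e), (x, \<not> \<not> e)] @ u) (winv u @ u)"
    using pres_eq.cancel[of x X "winv u" u R "\<not> e"] Cons.prems l winv_L by auto
  then show ?case using Cons l pres_eq.trans by (fastforce simp: winv_def)
qed

lemma group_G: "Group.group G"
proof (rule groupI)
  fix x assume "x \<in> carrier G"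
  then obtain u where u: "u \<in> L" "x = cls u" by (auto simp: carrier_G)
  have "cls (winv u) \<otimes>\<^bsub>G\<^esub> x = \<one>\<^bsub>G\<^esub>"
    unfolding u(2) cls_mult[OF winv_L[OF u(1)] u(1)] one_G
    by (rule cls_eq[THEN iffD2]) (simp_all add: winv_left u(1))
  moreover have "cls (winv u) \<in> carrier G" unfolding carrier_G using winv_L[OF u(1)] by (rule imageI)
  ultimately show "\<exists>y\<in>carrier G. y \<otimes>\<^bsub>G\<^esub> x = \<one>\<^bsub>G\<^esub>" by (rule bexI)
next
  fix x y assume "x \<in> carrier G" "y \<in> carrier G"
  then obtain u v where uv: "u \<in> L" "x = cls u" "v \<in> L" "y = cls v" by (auto simp: carrier_G)
  then have "u @ v \<in> L" by simp
  then show "x \<otimes>\<^bsub>G\<^esub> y \<in> carrier G" using uv by (simp only: cls_mult carrier_G imageI)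
  fix z assume "z \<in> carrier G"
  then obtain w where w: "w \<in> L" "z = cls w" by (auto simp: carrier_G)
  then have "v @ w \<in> L" using uv by simp
  then show "x \<otimes>\<^bsub>G\<^esub> y \<otimes>\<^bsub>G\<^esub> z = x \<otimes>\<^bsub>G\<^esub> (y \<otimes>\<^bsub>G\<^esub> z)"
    using uv w \<open>u @ v \<in> L\<close> by (simp only: cls_mult append_assoc)
next
  show "\<one>\<^bsub>G\<^esub> \<in> carrier G" unfolding one_G carrier_G by blast
next
  fix x assume "x \<in> carrier G"
  then obtain u where u: "u \<in> L" "x = cls u" by (auto simp: carrier_G)
  have "[] \<in> L" by simp
  then show "\<one>\<^bsub>G\<^esub> \<otimes>\<^bsub>G\<^esub> x = x" unfolding one_G u(2) using u(1) by (simp only: cls_mult append_Nil)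
qed

lemma cls_pow: "u \<in> L \<Longrightarrow> cls u [^]\<^bsub>G\<^esub> (k::nat) = cls (concat (replicate k u))"
proof (induction k)
  case 0
  then show ?case by (simp add: one_G)
next
  case (Suc k)
  have c: "concat (replicate k u) \<in> L" using Suc.prems by (induction k) auto
  have e: "concat (replicate k u) @ u = u @ concat (replicate k u)" by (induction k) auto
  have "cls u [^]\<^bsub>G\<^esub> Suc k = cls (concat (replicate k u)) \<otimes>\<^bsub>G\<^esub> cls u"
    unfolding nat_pow_Suc Suc.IH[OF Suc.prems] ..
  also have "\<dots> = cls (u @ concat (replicate k u))" unfolding cls_mult[OF c Suc.prems] e ..
  finally show ?case by simp
qed

lemma cls_inv:
  assumes u: "u \<in> L"
  shows "m_inv G (cls u) = cls (winv u)"
proof (rule group.inv_equality[OF group_G])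
  show "cls (winv u) \<otimes>\<^bsub>G\<^esub> cls u = \<one>\<^bsub>G\<^esub>"
    unfolding cls_mult[OF winv_L[OF u] u] one_G
    by (rule cls_eq[THEN iffD2]) (simp_all add: winv_left u)
  show "cls u \<in> carrier G" "cls (winv u) \<in> carrier G"
    unfolding carrier_G using u winv_L[OF u] by (simp_all only: imageI)
qed

lemma invariant:
  assumes "\<And>x e u v. x \<in> X \<Longrightarrow> u \<in> L \<Longrightarrow> v \<in> L \<Longrightarrow> f (u @ [(x, e), (x, \<not> e)] @ v) = f (u @ v)"
    and "\<And>r r' u v. (r, r') \<in> R \<Longrightarrow> u \<in> L \<Longrightarrow> v \<in> L \<Longrightarrow> f (u @ r @ v) = f (u @ r' @ v)"
    and "eqp u v"
  shows "f u = f v"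
  using assms(3)
proof (induction rule: pres_eq.induct)
  case (cancel x u v e)
  then show ?case by (rule assms(1))
next
  case (rel r r' u v)
  then show ?case by (rule assms(2))
qed simp_all

end

section \<open>Matrices indexed by words\<close>

declare power_mult_distrib [where a = "numeral w" for w, simp del]
declare power_mult_distrib [where b = "numeral w" for w, simp del]

lemma q_power: "q ^ a = Fract ([:0, 1:] ^ a) 1"
  by (induction a) (simp_all add: q_def One_fract_def)

lemma q_power_eq_iff: "q ^ a = q ^ b \<longleftrightarrow> a = b"
proof
  assume "q ^ a = q ^ b"
  then have "([:0, 1:] :: complex poly) ^ a = [:0, 1:] ^ b" by (simp add: q_power eq_fract)
  then have "degree (([:0, 1:] :: complex poly) ^ a) = degree (([:0, 1:] :: complex poly) ^ b)" by simp
  then show "a = b" by (simp add: degree_power_eq)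
qed simp

lemma q_nonzero [simp]: "q \<noteq> 0"
  by (simp add: q_def Zero_fract_def eq_fract)

lemma q_minus_inverse_nonzero: "q - inverse q \<noteq> 0"
proof
  assume "q - inverse q = 0"
  then have "q * q = 1" by (metis q_nonzero right_inverse eq_iff_diff_eq_0)
  then have "q ^ 2 = q ^ 0" by (simp add: power2_eq_square)
  then show False by (simp only: q_power_eq_iff)
qed

section \<open>Numbering of words, and matrices acting on functions of words\<close>

lemma div_mod_eq:
  fixes a r N :: nat
  assumes "r < N"
  shows "(a * N + r) div N = a" "(a * N + r) mod N = r"
proof -
  show "(a * N + r) div N = a" by (rule div_nat_eqI) (use assms in \<open>simp_all add: mult.commute\<close>)
  show "(a * N + r) mod N = r" using assms by simp
qed

text \<open>The first letter is the leading digit in base \<open>2 * d\<close>, in agreement with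
  \<open>kron\<close> and with the order of factors in \<open>uq_tensor\<close>.\<close>

primrec word_index :: "nat \<Rightarrow> nat \<Rightarrow> (nat \<Rightarrow> nat) \<Rightarrow> nat" where
  "word_index d 0 x = 0"
| "word_index d (Suc n) x = x 0 * (2 * d) ^ n + word_index d n (\<lambda>i. x (Suc i))"

declare word_index.simps(2) [simp del]

lemma words_0: "words 0 d = {\<lambda>_. 0}"
  by (auto simp: words_def)

lemma words_Suc: "words (Suc n) d = (\<lambda>(a, x). case_nat a x) ` ({..<2 * d} \<times> words n d)"
proof (intro Set.set_eqI iffI)
  fix x assume x: "x \<in> words (Suc n) d"
  have "x = case_nat (x 0) (\<lambda>i. x (Suc i))" by (rule ext) (simp split: nat.split)
  moreover have "x 0 < 2 * d" "(\<lambda>i. x (Suc i)) \<in> words n d" using x by (auto simp: words_def)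
  ultimately show "x \<in> (\<lambda>(a, x). case_nat a x) ` ({..<2 * d} \<times> words n d)" by force
next
  fix x assume "x \<in> (\<lambda>(a, x). case_nat a x) ` ({..<2 * d} \<times> words n d)"
  then show "x \<in> words (Suc n) d" by (auto simp: words_def split: nat.split)
qed

lemma case_nat_words: "a < 2 * d \<Longrightarrow> x \<in> words n d \<Longrightarrow> case_nat a x \<in> words (Suc n) d"
  by (force simp: words_Suc)

lemma inj_case_nat: "inj_on (\<lambda>(a, x). case_nat a x :: nat \<Rightarrow> nat) S"
proof (rule inj_onI, clarify)
  fix a x b y assume e: "case_nat a x = (case_nat b y :: nat \<Rightarrow> nat)"
  have "a = b" using fun_cong[OF e, of 0] by simp
  moreover have "x = y" using fun_cong[OF e, of "Suc i" for i] by (intro ext) simp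
  ultimately show "a = b \<and> x = y" by simp
qed

lemma finite_words: "finite (words n d)"
  by (induction n) (simp_all add: words_0 words_Suc)

lemma sum_words_Suc: "(\<Sum>x\<in>words (Suc n) d. f x) = (\<Sum>a<2 * d. \<Sum>x\<in>words n d. f (case_nat a x))"
  unfolding words_Suc
  by (subst sum.reindex[OF inj_case_nat]) (simp add: sum.cartesian_product case_prod_unfold)

lemma word_index_bij: "bij_betw (word_index d n) (words n d) {..<(2 * d) ^ n}"
proof (induction n)
  case 0
  show ?case by (simp add: words_0 bij_betw_def lessThan_Suc)
next
  case (Suc n)
  let ?N = "(2 * d) ^ n"
  have ixc: "word_index d (Suc n) (case_nat a x) = a * ?N + word_index d n x" for a x by (simp add: word_index.simps(2))
  have lt: "word_index d n x < ?N" if "x \<in> words n d" for x using Suc that by (auto simp: bij_betw_def)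
  have "inj_on (word_index d (Suc n)) (words (Suc n) d)"
  proof (rule inj_onI)
    fix x y assume xy: "x \<in> words (Suc n) d" "y \<in> words (Suc n) d" "word_index d (Suc n) x = word_index d (Suc n) y"
    from xy(1) obtain a x' where x: "x = case_nat a x'" "x' \<in> words n d" by (auto simp: words_Suc)
    from xy(2) obtain b y' where y: "y = case_nat b y'" "y' \<in> words n d" by (auto simp: words_Suc)
    have e: "a * ?N + word_index d n x' = b * ?N + word_index d n y'" using xy(3) x y ixc by metis
    have "a = (a * ?N + word_index d n x') div ?N" "b = (b * ?N + word_index d n y') div ?N"
      using div_mod_eq(1)[OF lt[OF x(2)]] div_mod_eq(1)[OF lt[OF y(2)]] by simp_all
    then have "a = b" using e by simp
    then have "word_index d n x' = word_index d n y'" using e by simp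
    then have "x' = y'" using Suc x y by (auto simp: bij_betw_def inj_on_def)
    then show "x = y" using x y \<open>a = b\<close> by simp
  qed
  moreover have "word_index d (Suc n) ` words (Suc n) d = {..<(2 * d) ^ Suc n}"
  proof (rule card_subset_eq)
    show "word_index d (Suc n) ` words (Suc n) d \<subseteq> {..<(2 * d) ^ Suc n}"
    proof (clarsimp)
      fix x assume "x \<in> words (Suc n) d"
      then obtain a x' where x: "x = case_nat a x'" "x' \<in> words n d" "a < 2 * d" by (auto simp: words_Suc)
      have "a * ?N + word_index d n x' < Suc a * ?N" using lt[OF x(2)] by simp
      also have "\<dots> \<le> (2 * d) * ?N" using x(3) by (intro mult_le_mono) auto
      finally show "word_index d (Suc n) x < 2 * d * ?N" unfolding x(1) ixc .
    qed
    have "card (words (Suc n) d) = 2 * d * card (words n d)"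
      unfolding words_Suc by (simp add: card_image[OF inj_case_nat] card_cartesian_product)
    moreover have "card (words n d) = ?N" using bij_betw_same_card[OF Suc] by simp
    moreover have "card (word_index d (Suc n) ` words (Suc n) d) = card (words (Suc n) d)"
      using \<open>inj_on (word_index d (Suc n)) (words (Suc n) d)\<close> by (rule card_image)
    ultimately show "card (word_index d (Suc n) ` words (Suc n) d) = card {..<(2 * d) ^ Suc n}" by simp
  qed simp
  ultimately show ?case by (simp add: bij_betw_def)
qed

lemma word_index_less: "x \<in> words n d \<Longrightarrow> word_index d n x < (2 * d) ^ n"
  using word_index_bij[of d n] by (auto simp: bij_betw_def)

lemma word_index_eq_iff: "x \<in> words n d \<Longrightarrow> y \<in> words n d \<Longrightarrow> word_index d n x = word_index d n y \<longleftrightarrow> x = y"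
  using word_index_bij[of d n] by (auto simp: bij_betw_def inj_on_def)

lemma sum_word_index: "(\<Sum>k<(2 * d) ^ n. f k) = (\<Sum>x\<in>words n d. f (word_index d n x))"
  using sum.reindex_bij_betw[OF word_index_bij[of d n], of f] by simp

lemma word_index_surj: "k < (2 * d) ^ n \<Longrightarrow> \<exists>x\<in>words n d. k = word_index d n x"
  using word_index_bij[of d n] by (auto simp: bij_betw_def image_def set_eq_iff)

text \<open>Vectors are functions on words, and only their values on \<open>words n d\<close> are
  used. Identities of matrices become identities of operators on functions, in which a leading
  letter can be split off by \<open>case_nat\<close>.\<close>

definition mat_act :: "nat \<Rightarrow> nat \<Rightarrow> 'k::field mat \<Rightarrow> ((nat \<Rightarrow> nat) \<Rightarrow> 'k) \<Rightarrow> (nat \<Rightarrow> nat) \<Rightarrow> 'k" where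
  "mat_act d n M v x = (\<Sum>y\<in>words n d. M $$ (word_index d n x, word_index d n y) * v y)"

lemma mat_act_cong: "(\<And>y. y \<in> words n d \<Longrightarrow> v y = w y) \<Longrightarrow> mat_act d n M v x = mat_act d n M w x"
  by (simp add: mat_act_def)


lemma mat_act_mat_mult:
  assumes M: "M \<in> carrier_mat ((2 * d) ^ n) ((2 * d) ^ n)" and M': "M' \<in> carrier_mat ((2 * d) ^ n) ((2 * d) ^ n)"
    and x: "x \<in> words n d"
  shows "mat_act d n (M * M') v x = mat_act d n M (\<lambda>y. mat_act d n M' v y) x"
proof -
  have e: "(M * M') $$ (word_index d n x, word_index d n y) = (\<Sum>z\<in>words n d. M $$ (word_index d n x, word_index d n z) * M' $$ (word_index d n z, word_index d n y))"
    if "y \<in> words n d" for y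
  proof -
    have "(M * M') $$ (word_index d n x, word_index d n y) = (\<Sum>k<(2 * d) ^ n. M $$ (word_index d n x, k) * M' $$ (k, word_index d n y))"
      using M M' word_index_less[OF x] word_index_less[OF that] by (simp add: scalar_prod_def atLeast0LessThan)
    then show ?thesis by (simp add: sum_word_index)
  qed
  have "mat_act d n (M * M') v x = (\<Sum>y\<in>words n d. \<Sum>z\<in>words n d. M $$ (word_index d n x, word_index d n z) * M' $$ (word_index d n z, word_index d n y) * v y)"
    by (simp add: mat_act_def e sum_distrib_right)
  also have "\<dots> = (\<Sum>z\<in>words n d. \<Sum>y\<in>words n d. M $$ (word_index d n x, word_index d n z) * M' $$ (word_index d n z, word_index d n y) * v y)"
    by (rule sum.swap)
  finally show ?thesis by (simp add: mat_act_def sum_distrib_left mult.assoc)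
qed

lemma mat_act_delta:
  assumes "y \<in> words n d"
  shows "mat_act d n M (\<lambda>z. if z = y then 1 else 0) x = M $$ (word_index d n x, word_index d n y)"
  using assms by (simp add: mat_act_def if_distrib[of "\<lambda>t. _ * t"] finite_words cong: if_cong)

lemma mat_act_eqI:
  assumes "M \<in> carrier_mat ((2 * d) ^ n) ((2 * d) ^ n)" "M' \<in> carrier_mat ((2 * d) ^ n) ((2 * d) ^ n)"
    and "\<And>v x. x \<in> words n d \<Longrightarrow> mat_act d n M v x = mat_act d n M' v x"
  shows "M = M'"
proof (rule eq_matI)
  fix i j assume "i < dim_row M'" "j < dim_col M'"
  then have "i < (2 * d) ^ n" "j < (2 * d) ^ n" using assms by auto
  then obtain x y where "x \<in> words n d" "i = word_index d n x" "y \<in> words n d" "j = word_index d n y" using word_index_surj by blast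
  then show "M $$ (i, j) = M' $$ (i, j)" using assms(3)[of x] mat_act_delta[of y n d] by metis
qed (use assms in auto)

lemma mat_act_one: "x \<in> words n d \<Longrightarrow> mat_act d n (1\<^sub>m ((2 * d) ^ n)) v x = v x"
proof -
  assume x: "x \<in> words n d"
  have "mat_act d n (1\<^sub>m ((2 * d) ^ n)) v x = (\<Sum>y\<in>words n d. if y = x then v y else 0)"
    unfolding mat_act_def by (rule sum.cong) (auto simp: word_index_less x word_index_eq_iff)
  then show ?thesis using x by (simp add: finite_words)
qed

lemma mat_act_arith:
  assumes "M \<in> carrier_mat ((2 * d) ^ n) ((2 * d) ^ n)" "M' \<in> carrier_mat ((2 * d) ^ n) ((2 * d) ^ n)" "x \<in> words n d"
  shows "mat_act d n (M + M') v x = mat_act d n M v x + mat_act d n M' v x"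
    "mat_act d n (M - M') v x = mat_act d n M v x - mat_act d n M' v x"
    "mat_act d n (c \<cdot>\<^sub>m M) v x = c * mat_act d n M v x"
    "mat_act d n (0\<^sub>m ((2 * d) ^ n) ((2 * d) ^ n)) v x = 0"
proof -
  have i: "y \<in> words n d \<Longrightarrow> word_index d n y < dim_row M \<and> word_index d n y < dim_col M \<and> word_index d n y < dim_row M' \<and> word_index d n y < dim_col M'" for y
    using word_index_less assms by auto
  show "mat_act d n (M + M') v x = mat_act d n M v x + mat_act d n M' v x"
    unfolding mat_act_def sum.distrib[symmetric] using i assms by (intro sum.cong) (auto simp: distrib_right)
  show "mat_act d n (M - M') v x = mat_act d n M v x - mat_act d n M' v x"
    unfolding mat_act_def sum_subtractf[symmetric] using i assms by (intro sum.cong) (auto simp: left_diff_distrib)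
  show "mat_act d n (c \<cdot>\<^sub>m M) v x = c * mat_act d n M v x"
    unfolding mat_act_def sum_distrib_left using i assms by (intro sum.cong) auto
  show "mat_act d n (0\<^sub>m ((2 * d) ^ n) ((2 * d) ^ n)) v x = 0"
    unfolding mat_act_def by (rule sum.neutral) (use assms(3) word_index_less in auto)
qed

lemma kron_carrier: "A \<in> carrier_mat m m \<Longrightarrow> B \<in> carrier_mat k k \<Longrightarrow> kron A B \<in> carrier_mat (m * k) (m * k)"
  by (auto simp: kron_def)

lemma mat_act_kron:
  assumes A: "A \<in> carrier_mat (2 * d) (2 * d)" and B: "B \<in> carrier_mat ((2 * d) ^ n) ((2 * d) ^ n)" and x: "x \<in> words (Suc n) d"
  shows "mat_act d (Suc n) (kron A B) v x =
    (\<Sum>b<2 * d. A $$ (x 0, b) * mat_act d n B (\<lambda>y. v (case_nat b y)) (\<lambda>i. x (Suc i)))"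
proof -
  from x obtain a x' where x': "x = case_nat a x'" "a < 2 * d" "x' \<in> words n d" by (auto simp: words_Suc)
  have lt: "a * (2 * d) ^ n + word_index d n y < 2 * d * (2 * d) ^ n" if "a < 2 * d" "y \<in> words n d" for a y
    using word_index_less[OF case_nat_words[OF that]] by (simp add: word_index.simps(2))
  have e: "kron A B $$ (word_index d (Suc n) x, word_index d (Suc n) (case_nat b y)) = A $$ (a, b) * B $$ (word_index d n x', word_index d n y)"
    if "b < 2 * d" "y \<in> words n d" for b y
    using lt[OF x'(2,3)] lt[OF that] div_mod_eq[OF word_index_less[OF x'(3)]] div_mod_eq[OF word_index_less[OF that(2)]] A B
    by (simp add: kron_def x'(1) word_index.simps(2))
  have "mat_act d (Suc n) (kron A B) v x =
     (\<Sum>b<2 * d. \<Sum>y\<in>words n d. kron A B $$ (word_index d (Suc n) x, word_index d (Suc n) (case_nat b y)) * v (case_nat b y))"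
    unfolding mat_act_def sum_words_Suc ..
  also have "\<dots> = (\<Sum>b<2 * d. \<Sum>y\<in>words n d. A $$ (a, b) * B $$ (word_index d n x', word_index d n y) * v (case_nat b y))"
    by (intro sum.cong HOL.refl) (simp only: e lessThan_iff)
  finally show ?thesis by (simp add: x'(1) mat_act_def sum_distrib_left mult.assoc)
qed

lemma diag_block_mat_2:
  assumes "\<And>A. A \<in> set As \<Longrightarrow> A \<in> carrier_mat 2 2"
  shows "diag_block_mat As \<in> carrier_mat (2 * length As) (2 * length As) \<and>
    (\<forall>i<2 * length As. \<forall>j<2 * length As. diag_block_mat As $$ (i, j) =
      (if i div 2 = j div 2 then As ! (i div 2) $$ (i mod 2, j mod 2) else (0::'k::field)))"
  using assms
proof (induction As)
  case Nil
  then show ?case by simp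
next
  case (Cons A As)
  let ?B = "diag_block_mat As"
  have A: "A \<in> carrier_mat 2 2" using Cons.prems by simp
  have IH: "?B \<in> carrier_mat (2 * length As) (2 * length As)"
    "\<And>i j. i < 2 * length As \<Longrightarrow> j < 2 * length As \<Longrightarrow> ?B $$ (i, j) = (if i div 2 = j div 2 then As ! (i div 2) $$ (i mod 2, j mod 2) else 0)"
    using Cons by auto
  have D: "diag_block_mat (A # As) = four_block_mat A (0\<^sub>m 2 (2 * length As)) (0\<^sub>m (2 * length As) 2) ?B"
    using A IH(1) by (simp add: Let_def)
  have dims: "dim_row A = 2" "dim_col A = 2" "dim_row ?B = 2 * length As" "dim_col ?B = 2 * length As" using A IH(1) by auto
  have "diag_block_mat (A # As) $$ (i, j) = (if i div 2 = j div 2 then (A # As) ! (i div 2) $$ (i mod 2, j mod 2) else 0)"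
    if ij: "i < 2 * length (A # As)" "j < 2 * length (A # As)" for i j
  proof -
    have e: "diag_block_mat (A # As) $$ (i, j) = (if i < 2 then if j < 2 then A $$ (i, j) else 0 else if j < 2 then 0 else ?B $$ (i - 2, j - 2))"
      unfolding D using ij dims by auto
    show ?thesis
    proof (cases "i < 2")
      case True
      then show ?thesis unfolding e by (cases "j < 2") (auto simp: div_eq_0_iff simp del: diag_block_mat.simps)
    next
      case False
      then obtain i' where i: "i = i' + 2" by (metis le_add_diff_inverse2 not_less)
      show ?thesis
      proof (cases "j < 2")
        case True
        then show ?thesis using e i by (simp add: div_eq_0_iff del: diag_block_mat.simps)
      next
        case False
        then obtain j' where j: "j = j' + 2" by (metis le_add_diff_inverse2 not_less)
        then show ?thesis using e ij IH(2)[of i' j'] i by (simp del: diag_block_mat.simps)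
      qed
    qed
  qed
  moreover have "diag_block_mat (A # As) \<in> carrier_mat (2 * length (A # As)) (2 * length (A # As))"
    unfolding D using four_block_carrier_mat[OF A IH(1)] by simp
  ultimately show ?case by blast
qed

lemma gl2_vect_carrier: "gl2_vect g \<in> carrier_mat 2 2"
  by (cases g) auto

text \<open>The colour \<open>a div 2\<close> counts from 0 and the tensor factors from 1, hence
  \<open>Suc (a div 2) = b\<close>.\<close>

lemma uq_vect_entry:
  assumes "b \<in> {1..d}"
  shows "uq_vect d (b, g) \<in> carrier_mat (2 * d) (2 * d)"
    "a < 2 * d \<Longrightarrow> a' < 2 * d \<Longrightarrow> uq_vect d (b, g) $$ (a, a') = (if a div 2 = a' div 2 then
      (if Suc (a div 2) = b then gl2_vect g $$ (a mod 2, a' mod 2) else if a = a' then gl2_counit g else 0) else 0)"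
proof -
  let ?Ms = "map (\<lambda>c. if c = b then gl2_vect g else gl2_counit g \<cdot>\<^sub>m 1\<^sub>m 2) [1..<d + 1]"
  have D: "diag_block_mat ?Ms \<in> carrier_mat (2 * length ?Ms) (2 * length ?Ms) \<and>
    (\<forall>i<2 * length ?Ms. \<forall>j<2 * length ?Ms. diag_block_mat ?Ms $$ (i, j) =
      (if i div 2 = j div 2 then ?Ms ! (i div 2) $$ (i mod 2, j mod 2) else 0))"
    by (rule diag_block_mat_2) (auto simp: gl2_vect_carrier)
  have len: "length ?Ms = d" by (simp del: upt_Suc)
  show "uq_vect d (b, g) \<in> carrier_mat (2 * d) (2 * d)" using D unfolding len by (simp add: uq_vect_def)
  assume a: "a < 2 * d" "a' < 2 * d"
  then have nth: "?Ms ! (a div 2) = (if Suc (a div 2) = b then gl2_vect g else gl2_counit g \<cdot>\<^sub>m 1\<^sub>m 2)"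
    by (subst nth_map) (auto simp: less_mult_imp_div_less mult.commute simp del: upt_Suc)
  have "uq_vect d (b, g) $$ (a, a') = (if a div 2 = a' div 2 then ?Ms ! (a div 2) $$ (a mod 2, a' mod 2) else 0)"
    using D a unfolding len by (simp add: uq_vect_def)
  also have "\<dots> = (if a div 2 = a' div 2 then
      (if Suc (a div 2) = b then gl2_vect g $$ (a mod 2, a' mod 2) else if a = a' then gl2_counit g else 0) else 0)"
  proof (cases "a div 2 = a' div 2 \<and> Suc (a div 2) \<noteq> b")
    case True
    then have 1: "a div 2 = a' div 2" and 2: "\<not> Suc (a div 2) = b" by auto
    have 3: "a = a' \<longleftrightarrow> a mod 2 = a' mod 2" using 1 by (metis div_mult_mod_eq)
    have 4: "(gl2_counit g \<cdot>\<^sub>m 1\<^sub>m 2) $$ (a mod 2, a' mod 2) = (if a mod 2 = a' mod 2 then gl2_counit g else 0)"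
      by simp
    show ?thesis unfolding nth if_P[OF 1] if_not_P[OF 2] 3 4 ..
  next
    case False
    then show ?thesis unfolding nth by (simp only: if_True if_False simp_thms split: if_split) blast
  qed
  finally show "uq_vect d (b, g) $$ (a, a') = (if a div 2 = a' div 2 then
      (if Suc (a div 2) = b then gl2_vect g $$ (a mod 2, a' mod 2) else if a = a' then gl2_counit g else 0) else 0)" .
qed

section \<open>The action of the quantum group on tensor space\<close>

lemma sum_uq_vect:
  assumes "c < d" "a < 2 * d"
  shows "(\<Sum>b<2 * d. uq_vect d (Suc c, GE) $$ (a, b) * f b) = (if a = 2 * c then f (2 * c + 1) else 0)"
    "(\<Sum>b<2 * d. uq_vect d (Suc c, GF) $$ (a, b) * f b) = (if a = 2 * c + 1 then f (2 * c) else 0)"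
    "k \<in> {1, 2} \<Longrightarrow> (\<Sum>b<2 * d. uq_vect d (Suc c, GL k) $$ (a, b) * f b) = (if Suc a = 2 * c + k then q else 1) * f a"
    "k \<in> {1, 2} \<Longrightarrow> (\<Sum>b<2 * d. uq_vect d (Suc c, GLinv k) $$ (a, b) * f b) = (if Suc a = 2 * c + k then inverse q else 1) * f a"
proof -
  have b: "Suc c \<in> {1..d}" using assms by simp
  have one: "(\<Sum>b<2 * d. (if b = t then s else 0) * f b) = s * f t" if "t < 2 * d" for t s
    using that by (simp add: if_distrib[of "\<lambda>s. s * _"] cong: if_cong)
  have dm: "a = 2 * c \<longleftrightarrow> a div 2 = c \<and> a mod 2 = 0" "a = 2 * c + 1 \<longleftrightarrow> a div 2 = c \<and> a mod 2 = 1" for a :: nat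
    by presburger+
  have eq: "b = a \<longleftrightarrow> a div 2 = b div 2 \<and> a mod 2 = b mod 2" for b
  proof
    assume h: "a div 2 = b div 2 \<and> a mod 2 = b mod 2"
    have "b = 2 * (b div 2) + b mod 2" by (rule mult_div_mod_eq[symmetric])
    also have "\<dots> = 2 * (a div 2) + a mod 2" by (simp only: h)
    also have "\<dots> = a" by (rule mult_div_mod_eq)
    finally show "b = a" .
  qed simp
  have eq': "a = b \<longleftrightarrow> a div 2 = b div 2 \<and> a mod 2 = b mod 2" for b
    using eq[of b] by (simp only: eq_commute[of a b])
  have vE: "gl2_vect GE $$ (x mod 2, y mod 2) = (if x mod 2 = 0 \<and> y mod 2 = 1 then 1 else 0)"
    "gl2_vect GF $$ (x mod 2, y mod 2) = (if x mod 2 = 1 \<and> y mod 2 = 0 then 1 else 0)"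
    "gl2_vect (GL k) $$ (x mod 2, y mod 2) = (if x mod 2 = y mod 2 then if x mod 2 + 1 = k then q else 1 else 0)"
    "gl2_vect (GLinv k) $$ (x mod 2, y mod 2) = (if x mod 2 = y mod 2 then if x mod 2 + 1 = k then inverse q else 1 else 0)"
    for x y :: nat by simp_all
  define \<alpha> i where "\<alpha> = a div 2" "i = a mod 2"
  note ab = this[symmetric]
  have E: "uq_vect d (Suc c, GE) $$ (a, b) = (if b = 2 * c + 1 then (if a = 2 * c then 1 else 0) else 0)" if "b < 2 * d" for b
  proof -
    define \<beta> j where "\<beta> = b div 2" "j = b mod 2"
    note ba = this[symmetric]
    show ?thesis
      using uq_vect_entry(2)[OF b assms(2) that, of GE] unfolding dm vE gl2_counit.simps
      unfolding ab ba
      by (auto split: if_splits)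
  qed
  have F: "uq_vect d (Suc c, GF) $$ (a, b) = (if b = 2 * c then (if a = 2 * c + 1 then 1 else 0) else 0)" if "b < 2 * d" for b
  proof -
    define \<beta> j where "\<beta> = b div 2" "j = b mod 2"
    note ba = this[symmetric]
    show ?thesis
      using uq_vect_entry(2)[OF b assms(2) that, of GF] unfolding dm vE gl2_counit.simps
      unfolding ab ba
      by (auto split: if_splits)
  qed
  show "(\<Sum>b<2 * d. uq_vect d (Suc c, GE) $$ (a, b) * f b) = (if a = 2 * c then f (2 * c + 1) else 0)"
    using one[of "2 * c + 1" "if a = 2 * c then 1 else 0"] assms by (simp add: E)
  show "(\<Sum>b<2 * d. uq_vect d (Suc c, GF) $$ (a, b) * f b) = (if a = 2 * c + 1 then f (2 * c) else 0)"
    using one[of "2 * c" "if a = 2 * c + 1 then 1 else 0"] assms by (simp add: F)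
  have sc: "Suc a = 2 * c + k \<longleftrightarrow> a div 2 = c \<and> a mod 2 + 1 = k" if "k \<in> {1, 2}" for k
  proof -
    have e1: "(Suc a = 2 * c + 1) = (a = 2 * c)" and f1: "(a mod 2 + 1 = 1) = (a mod 2 = 0)" by simp_all
    have e2: "(Suc a = 2 * c + 2) = (a = 2 * c + 1)" and f2: "(a mod 2 + 1 = 2) = (a mod 2 = 1)" by simp_all
    have "(Suc a = 2 * c + 1) = (a div 2 = c \<and> a mod 2 + 1 = 1)" unfolding e1 f1 by (rule dm(1))
    moreover have "(Suc a = 2 * c + 2) = (a div 2 = c \<and> a mod 2 + 1 = 2)" unfolding e2 f2 by (rule dm(2))
    moreover have "k = 1 \<or> k = 2" using that by blast
    ultimately show ?thesis by (elim disjE; hypsubst)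
  qed
  assume k: "k \<in> {1, 2}"
  have L: "uq_vect d (Suc c, GL k) $$ (a, b) = (if b = a then (if Suc a = 2 * c + k then q else 1) else 0)" if "b < 2 * d" for b
  proof -
    define \<beta> j where "\<beta> = b div 2" "j = b mod 2"
    note ba = this[symmetric]
    show ?thesis
      using uq_vect_entry(2)[OF b assms(2) that, of "GL k"] unfolding eq[of b] eq'[of b] vE gl2_counit.simps sc[OF k]
      unfolding ab ba
      by (auto split: if_splits)
  qed
  have L': "uq_vect d (Suc c, GLinv k) $$ (a, b) = (if b = a then (if Suc a = 2 * c + k then inverse q else 1) else 0)" if "b < 2 * d" for b
  proof -
    define \<beta> j where "\<beta> = b div 2" "j = b mod 2"
    note ba = this[symmetric]
    show ?thesis
      using uq_vect_entry(2)[OF b assms(2) that, of "GLinv k"] unfolding eq[of b] eq'[of b] vE gl2_counit.simps sc[OF k]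
      unfolding ab ba
      by (auto split: if_splits)
  qed
  show "(\<Sum>b<2 * d. uq_vect d (Suc c, GL k) $$ (a, b) * f b) = (if Suc a = 2 * c + k then q else 1) * f a"
    using one[of a "if Suc a = 2 * c + k then q else 1"] assms by (simp add: L)
  show "(\<Sum>b<2 * d. uq_vect d (Suc c, GLinv k) $$ (a, b) * f b) = (if Suc a = 2 * c + k then inverse q else 1) * f a"
    using one[of a "if Suc a = 2 * c + k then inverse q else 1"] assms by (simp add: L')
qed


section \<open>The generators of the quantum group as operators on functions of words\<close>

definition kq :: "nat \<Rightarrow> nat \<Rightarrow> Cq" where
  "kq c a = (if a = 2 * c then q else if a = 2 * c + 1 then inverse q else 1)"

text \<open>The iterated comultiplication of \<open>E\<close>: one summand per place, with
  \<open>K\<close> on all earlier places, \<open>kq\<close> being its eigenvalue. The argument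
  \<open>x\<close> is a row index, so the matrix sending the basis vector \<open>2 * c + 1\<close>
  to \<open>2 * c\<close> reads \<open>v\<close> at the word with the letter \<open>2 * c\<close>
  replaced by \<open>2 * c + 1\<close>.\<close>

definition EO :: "nat \<Rightarrow> nat \<Rightarrow> ((nat \<Rightarrow> nat) \<Rightarrow> Cq) \<Rightarrow> (nat \<Rightarrow> nat) \<Rightarrow> Cq" where
  "EO c n v x = (\<Sum>i<n. if x i = 2 * c then (\<Prod>j<i. kq c (x j)) * v (x(i := 2 * c + 1)) else 0)"

text \<open>The iterated comultiplication of \<open>F\<close>, with the inverse of \<open>K\<close>
  on all later places.\<close>

definition FO :: "nat \<Rightarrow> nat \<Rightarrow> ((nat \<Rightarrow> nat) \<Rightarrow> Cq) \<Rightarrow> (nat \<Rightarrow> nat) \<Rightarrow> Cq" where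
  "FO c n v x = (\<Sum>i<n. if x i = 2 * c + 1 then (\<Prod>j\<in>{i<..<n}. inverse (kq c (x j))) * v (x(i := 2 * c)) else 0)"

text \<open>The eigenvalue of the grouplike generator \<open>GL k\<close>. For
  \<open>k = 1, 2\<close> it counts the letters \<open>2 * c + k - 1\<close>, since \<open>k\<close>
  starts from 1 and letters from 0.\<close>

definition LO :: "nat \<Rightarrow> nat \<Rightarrow> nat \<Rightarrow> (nat \<Rightarrow> nat) \<Rightarrow> Cq" where
  "LO c k n x = (\<Prod>j<n. if Suc (x j) = 2 * c + k then q else 1)"

definition KI :: "nat \<Rightarrow> nat \<Rightarrow> (nat \<Rightarrow> nat) \<Rightarrow> Cq" where
  "KI c n x = (\<Prod>j<n. inverse (kq c (x j)))"

lemma kq_nonzero [simp]: "kq c a \<noteq> 0"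
  by (simp add: kq_def)

lemma kq_simps [simp]: "kq c (2 * c) = q" "kq c (Suc (2 * c)) = inverse q"
  by (simp_all add: kq_def)

lemma kq_other: "a \<noteq> 2 * c \<Longrightarrow> a \<noteq> Suc (2 * c) \<Longrightarrow> kq c a = 1"
  by (simp add: kq_def)

lemma kq_other_colour [simp]: "b \<noteq> c \<Longrightarrow> kq c (2 * b) = 1" "b \<noteq> c \<Longrightarrow> kq c (Suc (2 * b)) = 1"
  by (rule kq_other; presburger)+

lemma LO_nonzero [simp]: "LO c k n x \<noteq> 0"
  by (simp add: LO_def)

lemma KI_nonzero [simp]: "KI c n x \<noteq> 0"
  by (simp add: KI_def)

lemma case_nat_upd [simp]:
  "(case_nat a x)(0 := t) = (case_nat t x :: nat \<Rightarrow> nat)" "(case_nat a x)(Suc i := t) = (case_nat a (x(i := t)) :: nat \<Rightarrow> nat)"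
  by (auto simp: fun_eq_iff split: nat.split)

lemma EO_0 [simp]: "EO c 0 v x = 0" by (simp add: EO_def)
lemma FO_0 [simp]: "FO c 0 v x = 0" by (simp add: FO_def)
lemma LO_0 [simp]: "LO c k 0 x = 1" by (simp add: LO_def)
lemma KI_0 [simp]: "KI c 0 x = 1" by (simp add: KI_def)

lemma EO_Suc [simp]:
  "EO c (Suc n) v (case_nat a x) = (if a = 2 * c then v (case_nat (2 * c + 1) x) else 0) + kq c a * EO c n (\<lambda>y. v (case_nat a y)) x"
proof -
  have "EO c (Suc n) v (case_nat a x) = (if a = 2 * c then v (case_nat (2 * c + 1) x) else 0) +
     (\<Sum>i<n. if x i = 2 * c then (\<Prod>j<Suc i. kq c (case_nat a x j)) * v (case_nat a (x(i := 2 * c + 1))) else 0)"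
    unfolding EO_def sum.lessThan_Suc_shift case_nat_upd by simp
  also have "(\<Sum>i<n. if x i = 2 * c then (\<Prod>j<Suc i. kq c (case_nat a x j)) * v (case_nat a (x(i := 2 * c + 1))) else 0) =
     kq c a * EO c n (\<lambda>y. v (case_nat a y)) x"
    unfolding EO_def sum_distrib_left prod.lessThan_Suc_shift nat.case by (rule sum.cong) (simp_all split: if_split)
  finally show ?thesis .
qed

lemma prod_greaterThan_shift: "(\<Prod>j\<in>{Suc i<..<Suc n}. f j) = (\<Prod>j\<in>{i<..<n}. f (Suc j))"
  by (rule prod.reindex_bij_witness[of _ Suc "\<lambda>j. j - 1"]) auto

lemma prod_greaterThan_0: "(\<Prod>j\<in>{0<..<Suc n}. f j) = (\<Prod>j<n. f (Suc j))"
  by (rule prod.reindex_bij_witness[of _ Suc "\<lambda>j. j - 1"]) auto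

lemma FO_Suc [simp]:
  "FO c (Suc n) v (case_nat a x) = (if a = 2 * c + 1 then KI c n x * v (case_nat (2 * c) x) else 0) + FO c n (\<lambda>y. v (case_nat a y)) x"
  unfolding FO_def KI_def sum.lessThan_Suc_shift prod_greaterThan_shift prod_greaterThan_0 case_nat_upd nat.case by simp

lemma LO_Suc [simp]: "LO c k (Suc n) (case_nat a x) = (if Suc a = 2 * c + k then q else 1) * LO c k n x"
  unfolding LO_def prod.lessThan_Suc_shift by simp

lemma KI_Suc [simp]: "KI c (Suc n) (case_nat a x) = inverse (kq c a) * KI c n x"
  unfolding KI_def prod.lessThan_Suc_shift by simp

lemma KI_conv_LO: "KI c n x = inverse (LO c 1 n x) * LO c 2 n x"
  unfolding KI_def LO_def by (simp add: prod_inversef[symmetric] prod.distrib[symmetric] kq_def cong: prod.cong) (auto intro!: prod.cong)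

lemma case_nat_exhaust: obtains a y where "(x :: nat \<Rightarrow> nat) = case_nat a y"
proof
  show "x = case_nat (x 0) (\<lambda>i. x (Suc i))" by (rule ext) (simp split: nat.split)
qed

lemma EO_add: "EO c n (\<lambda>y. v y + w y) x = EO c n v x + EO c n w x"
  unfolding EO_def sum.distrib[symmetric] by (rule sum.cong) (simp_all add: distrib_left)

lemma FO_add: "FO c n (\<lambda>y. v y + w y) x = FO c n v x + FO c n w x"
  unfolding FO_def sum.distrib[symmetric] by (rule sum.cong) (simp_all add: distrib_left)

text \<open>Exchange of \<open>E\<close> with a diagonal operator whose value changes by a fixed
  factor \<open>s\<close> at each letter that \<open>E\<close> touches. The commutation rules with
  the Cartan generators, with \<open>K\<close> of any colour and with the framings are
  instances.\<close>

lemma EO_weight: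
  assumes "\<And>i. i < n \<Longrightarrow> x i = 2 * c \<Longrightarrow> w (x(i := 2 * c + 1)) = s * w x"
  shows "EO c n (\<lambda>y. w y * v y) x = s * w x * EO c n v x"
  unfolding EO_def sum_distrib_left by (rule sum.cong) (use assms in \<open>auto\<close>)

lemma FO_weight:
  assumes "\<And>i. i < n \<Longrightarrow> x i = 2 * c + 1 \<Longrightarrow> w (x(i := 2 * c)) = s * w x"
  shows "FO c n (\<lambda>y. w y * v y) x = s * w x * FO c n v x"
  unfolding FO_def sum_distrib_left by (rule sum.cong) (use assms in \<open>auto\<close>)

lemma EO_scale: "EO c n (\<lambda>y. s * v y) x = s * EO c n v x"
  using EO_weight[of n x c "\<lambda>_. s" 1 v] by simp

lemma FO_scale: "FO c n (\<lambda>y. s * v y) x = s * FO c n v x"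
  using FO_weight[of n x c "\<lambda>_. s" 1 v] by simp

lemma EO_zero [simp]: "EO c n (\<lambda>y. 0) x = 0" by (simp add: EO_def cong: if_cong)
lemma FO_zero [simp]: "FO c n (\<lambda>y. 0) x = 0" by (simp add: FO_def cong: if_cong)

lemma prod_upd:
  fixes f :: "nat \<Rightarrow> 'k::field" and x :: "nat \<Rightarrow> nat"
  assumes "i < n" "f (x i) \<noteq> 0"
  shows "(\<Prod>j<n. f ((x(i := t)) j)) = f t / f (x i) * (\<Prod>j<n. f (x j))"
proof -
  have e: "(\<Prod>j<n. f (z j)) = f (z i) * (\<Prod>j\<in>{..<n} - {i}. f (z j))" for z :: "nat \<Rightarrow> nat"
    using assms by (subst prod.remove[of _ i]) auto
  have "(\<Prod>j\<in>{..<n} - {i}. f ((x(i := t)) j)) = (\<Prod>j\<in>{..<n} - {i}. f (x j))" by (rule prod.cong) auto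
  then show ?thesis using assms e[of x] e[of "x(i := t)"] by simp
qed

lemma LO_upd: "i < n \<Longrightarrow> LO c k n (x(i := t)) =
    (if Suc t = 2 * c + k then q else 1) / (if Suc (x i) = 2 * c + k then q else 1) * LO c k n x"
  unfolding LO_def using prod_upd[of i n "\<lambda>a. if Suc a = 2 * c + k then q else 1" x t] by simp

lemma KI_upd: "i < n \<Longrightarrow> KI c n (x(i := t)) = kq c (x i) / kq c t * KI c n x"
  unfolding KI_def using prod_upd[of i n "\<lambda>a. inverse (kq c a)" x t] by (simp add: field_simps)

lemma E_KI: "EO c n (\<lambda>y. KI c n y * v y) x = q ^ 2 * KI c n x * EO c n v x"
  by (rule EO_weight) (simp add: KI_upd power2_eq_square divide_inverse)

lemma E_KI_other: "b \<noteq> c \<Longrightarrow> EO b n (\<lambda>y. KI c n y * v y) x = KI c n x * EO b n v x"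
  using EO_weight[of n x b "KI c n" 1 v] by (simp add: KI_upd)

lemma F_KI_other: "b \<noteq> c \<Longrightarrow> FO b n (\<lambda>y. KI c n y * v y) x = KI c n x * FO b n v x"
  using FO_weight[of n x b "KI c n" 1 v] by (simp add: KI_upd)

text \<open>Induction through the comultiplication. If the first letter has colour \<open>c\<close>,
  the cross terms collapse (for the letter \<open>2 * c + 1\<close> by \<open>E_KI\<close>), and
  there remains the telescoping of \<open>K \<otimes> K - K^-1 \<otimes> K^-1\<close> into the
  commutators of the first factor and of the rest.\<close>

lemma EF_commutator:
  "(q - inverse q) * (EO c n (FO c n v) x - FO c n (EO c n v) x) = (inverse (KI c n x) - KI c n x) * v x"
proof (induction n arbitrary: v x)
  case 0
  show ?case by simp
next
  case (Suc n)
  obtain a y where x: "x = case_nat a y" by (rule case_nat_exhaust)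
  have IH: "EO c n (FO c n v) y = FO c n (EO c n v) y + (inverse (KI c n y) - KI c n y) / (q - inverse q) * v y" for v
    using Suc.IH[of v y] q_minus_inverse_nonzero by (simp add: field_simps)
  consider "a = 2 * c" | "a = Suc (2 * c)" | "a \<noteq> 2 * c" "a \<noteq> Suc (2 * c)" by blast
  then show "(q - inverse q) * (EO c (Suc n) (FO c (Suc n) v) x - FO c (Suc n) (EO c (Suc n) v) x) =
      (inverse (KI c (Suc n) x) - KI c (Suc n) x) * v x"
  proof cases
    case 1
    have "EO c (Suc n) (FO c (Suc n) v) x - FO c (Suc n) (EO c (Suc n) v) x =
       KI c n y * v x + q * ((inverse (KI c n y) - KI c n y) / (q - inverse q) * v x)"
      by (simp add: x 1 FO_add FO_scale IH, (simp add: algebra_simps)?)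
    then have "(q - inverse q) * (EO c (Suc n) (FO c (Suc n) v) x - FO c (Suc n) (EO c (Suc n) v) x) =
       (q - inverse q) * (KI c n y * v x) + q * ((inverse (KI c n y) - KI c n y) * v x)"
      using q_minus_inverse_nonzero by (simp add: distrib_left)
    then show ?thesis by (simp add: x 1) (simp add: algebra_simps)
  next
    case 2
    have "EO c (Suc n) (FO c (Suc n) v) x - FO c (Suc n) (EO c (Suc n) v) x =
       inverse q * ((inverse (KI c n y) - KI c n y) / (q - inverse q) * v x) - KI c n y * v x"
      by (simp add: x 2 EO_add FO_scale E_KI IH) (simp add: algebra_simps power2_eq_square)
    then have "(q - inverse q) * (EO c (Suc n) (FO c (Suc n) v) x - FO c (Suc n) (EO c (Suc n) v) x) =
       inverse q * ((inverse (KI c n y) - KI c n y) * v x) - (q - inverse q) * (KI c n y * v x)"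
      using q_minus_inverse_nonzero by (simp add: right_diff_distrib)
    then show ?thesis by (simp add: x 2) (simp add: algebra_simps)
  next
    case 3
    then show ?thesis using Suc.IH[of "\<lambda>y. v (case_nat a y)" y] by (simp add: x kq_other)
  qed
qed

lemma colours_commute:
  assumes bc: "b \<noteq> c"
  shows "EO b n (EO c n v) x = EO c n (EO b n v) x" "EO b n (FO c n v) x = FO c n (EO b n v) x"
    "FO b n (FO c n v) x = FO c n (FO b n v) x"
proof -
  have ne: "2 * b \<noteq> 2 * c" "2 * b \<noteq> Suc (2 * c)" "Suc (2 * b) \<noteq> 2 * c" using bc by presburger+
  have "EO b n (EO c n v) x = EO c n (EO b n v) x \<and> EO b n (FO c n v) x = FO c n (EO b n v) x \<and>
     FO b n (FO c n v) x = FO c n (FO b n v) x"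
  proof (induction n arbitrary: v x)
    case 0
    show ?case by simp
  next
    case (Suc n)
    obtain a y where x: "x = case_nat a y" by (rule case_nat_exhaust)
    note simps = EO_add FO_add EO_scale FO_scale E_KI_other[OF bc] E_KI_other[OF bc[symmetric]] F_KI_other[OF bc]
      F_KI_other[OF bc[symmetric]] Suc.IH ne ne[symmetric] bc bc[symmetric]
    consider "a = 2 * b" | "a = Suc (2 * b)" | "a = 2 * c" | "a = Suc (2 * c)"
      | "a \<noteq> 2 * b" "a \<noteq> Suc (2 * b)" "a \<noteq> 2 * c" "a \<noteq> Suc (2 * c)" by blast
    then show "EO b (Suc n) (EO c (Suc n) v) x = EO c (Suc n) (EO b (Suc n) v) x \<and>
      EO b (Suc n) (FO c (Suc n) v) x = FO c (Suc n) (EO b (Suc n) v) x \<and>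
      FO b (Suc n) (FO c (Suc n) v) x = FO c (Suc n) (FO b (Suc n) v) x"
      by cases (simp_all add: x simps kq_other)
  qed
  then show "EO b n (EO c n v) x = EO c n (EO b n v) x" "EO b n (FO c n v) x = FO c n (EO b n v) x"
    "FO b n (FO c n v) x = FO c n (FO b n v) x" by blast+
qed

fun uq_op :: "nat \<Rightarrow> nat \<Rightarrow> gl2_gen \<Rightarrow> ((nat \<Rightarrow> nat) \<Rightarrow> Cq) \<Rightarrow> (nat \<Rightarrow> nat) \<Rightarrow> Cq" where
  "uq_op n c GE v x = EO c n v x"
| "uq_op n c GF v x = FO c n v x"
| "uq_op n c (GL k) v x = LO c k n x * v x"
| "uq_op n c (GLinv k) v x = inverse (LO c k n x) * v x"

lemma sum_mat_mult:
  assumes "A \<in> carrier_mat N N" "B \<in> carrier_mat N N" "a < N"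
  shows "(\<Sum>b<N. (A * B) $$ (a, b) * f b) = (\<Sum>b<N. A $$ (a, b) * (\<Sum>k<N. B $$ (b, k) * f k))"
proof -
  have "(\<Sum>b<N. (A * B) $$ (a, b) * f b) = (\<Sum>b<N. \<Sum>k<N. A $$ (a, k) * B $$ (k, b) * f b)"
    using assms by (intro sum.cong HOL.refl) (simp add: scalar_prod_def atLeast0LessThan sum_distrib_right)
  also have "\<dots> = (\<Sum>k<N. \<Sum>b<N. A $$ (a, k) * B $$ (k, b) * f b)" by (rule sum.swap)
  finally show ?thesis by (simp add: sum_distrib_left mult.assoc)
qed

lemma gl2_gens_cases:
  assumes "g \<in> gl2_gens"
  obtains "g = GE" | "g = GF" | k where "g = GL k" "k \<in> {1, 2}" | k where "g = GLinv k" "k \<in> {1, 2}"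
  using assms by (auto simp: gl2_gens_def)

text \<open>The induction treats all generators at once, because the comultiplication of
  \<open>E\<close> and \<open>F\<close> involves the Cartan generators on the other factors. The
  colour \<open>c\<close> belongs to the tensor factor \<open>Suc c\<close>.\<close>

lemma uq_tensor_act:
  assumes c: "c < d" and g: "g \<in> gl2_gens"
  shows "uq_tensor d n (Suc c, g) \<in> carrier_mat ((2 * d) ^ n) ((2 * d) ^ n) \<and>
    (\<forall>v. \<forall>x\<in>words n d. mat_act d n (uq_tensor d n (Suc c, g)) v x = uq_op n c g v x)"
  using g
proof (induction n arbitrary: g)
  case 0
  then show ?case
    by (cases rule: gl2_gens_cases) (auto simp: mat_act_def words_0)
next
  case (Suc n)
  let ?V = "\<lambda>g. uq_vect d (Suc c, g)" and ?T = "\<lambda>g. uq_tensor d n (Suc c, g)" and ?N = "(2 * d) ^ n"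
  have b: "Suc c \<in> {1..d}" using c by simp
  have V: "?V g \<in> carrier_mat (2 * d) (2 * d)" for g using uq_vect_entry(1)[OF b] .
  have gens: "GE \<in> gl2_gens" "GF \<in> gl2_gens" "GL 1 \<in> gl2_gens" "GL 2 \<in> gl2_gens" "GLinv 1 \<in> gl2_gens" "GLinv 2 \<in> gl2_gens"
    by (auto simp: gl2_gens_def)
  have T: "?T g \<in> carrier_mat ?N ?N" if "g \<in> gl2_gens" for g using Suc.IH[OF that] by blast
  have Ta: "mat_act d n (?T g) v x = uq_op n c g v x" if "g \<in> gl2_gens" "x \<in> words n d" for g v x using Suc.IH[OF that(1)] that(2) by blast
  have one: "?V g * 1\<^sub>m (2 * d) = ?V g" "?T g * 1\<^sub>m ?N = ?T g" if "g \<in> gl2_gens" for g using V[of g] T[OF that] by auto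
  have pow: "(2 * d) ^ Suc n = 2 * d * ?N" by simp
  have kc: "A \<in> carrier_mat (2 * d) (2 * d) \<Longrightarrow> B \<in> carrier_mat ?N ?N \<Longrightarrow> kron A B \<in> carrier_mat ((2 * d) ^ Suc n) ((2 * d) ^ Suc n)" for A B :: "Cq mat"
    unfolding pow by (rule kron_carrier)
  have tens: "uq_tensor d (Suc n) (Suc c, GE) = kron (?V GE) (1\<^sub>m ?N) + kron (?V (GL 1) * ?V (GLinv 2)) (?T GE)"
    "uq_tensor d (Suc n) (Suc c, GF) = kron (?V GF) (?T (GLinv 1) * ?T (GL 2)) + kron (1\<^sub>m (2 * d)) (?T GF)"
    "uq_tensor d (Suc n) (Suc c, GL k) = kron (?V (GL k)) (?T (GL k))"
    "uq_tensor d (Suc n) (Suc c, GLinv k) = kron (?V (GLinv k)) (?T (GLinv k))" if "k \<in> {1, 2}" for k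
  proof -
    have "GL k \<in> gl2_gens" "GLinv k \<in> gl2_gens" using that by (auto simp: gl2_gens_def)
    note o = one[OF this(1)] one[OF this(2)] kc[OF V T[OF this(1)], of "GL k"] kc[OF V T[OF this(2)], of "GLinv k"]
    have z: "M + 0\<^sub>m ((2 * d) ^ Suc n) ((2 * d) ^ Suc n) = M" if "M \<in> carrier_mat ((2 * d) ^ Suc n) ((2 * d) ^ Suc n)" for M :: "Cq mat"
      using that by (rule right_add_zero_mat)
    show "uq_tensor d (Suc n) (Suc c, GE) = kron (?V GE) (1\<^sub>m ?N) + kron (?V (GL 1) * ?V (GLinv 2)) (?T GE)"
      using one gens z[OF kc[OF mult_carrier_mat[OF V V] T[OF gens(1)]]] by (simp add: word_lift_def)
    show "uq_tensor d (Suc n) (Suc c, GF) = kron (?V GF) (?T (GLinv 1) * ?T (GL 2)) + kron (1\<^sub>m (2 * d)) (?T GF)"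
      using one gens z[OF kc[OF one_carrier_mat T[OF gens(2)]]] by (simp add: word_lift_def)
    show "uq_tensor d (Suc n) (Suc c, GL k) = kron (?V (GL k)) (?T (GL k))"
      "uq_tensor d (Suc n) (Suc c, GLinv k) = kron (?V (GLinv k)) (?T (GLinv k))"
      using o z by (simp_all add: word_lift_def)
  qed
  have k1: "(1::nat) \<in> {1, 2}" "(2::nat) \<in> {1, 2}" by simp_all
  have s2: "(\<Sum>b<2 * d. (?V (GL 1) * ?V (GLinv 2)) $$ (a, b) * f b) = kq c a * f a" if a: "a < 2 * d" for a f
  proof -
    have "(\<Sum>b<2 * d. (?V (GL 1) * ?V (GLinv 2)) $$ (a, b) * f b) =
       (\<Sum>b<2 * d. ?V (GL 1) $$ (a, b) * ((if Suc b = 2 * c + 2 then inverse q else 1) * f b))"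
      unfolding sum_mat_mult[OF V V a]
      by (intro sum.cong HOL.refl) (simp only: sum_uq_vect(4)[OF c _ k1(2)] lessThan_iff)
    also have "\<dots> = (if Suc a = 2 * c + 1 then q else 1) * ((if Suc a = 2 * c + 2 then inverse q else 1) * f a)"
      by (rule sum_uq_vect(3)[OF c a k1(1)])
    finally show ?thesis by (simp add: kq_def)
  qed
  have s1: "(\<Sum>b<2 * d. (1\<^sub>m (2 * d)) $$ (a, b) * f b) = f a" if a: "a < 2 * d" for a and f :: "nat \<Rightarrow> Cq"
  proof -
    have "(\<Sum>b<2 * d. (1\<^sub>m (2 * d)) $$ (a, b) * f b) = (\<Sum>b<2 * d. if b = a then f b else 0)"
      by (rule sum.cong) (use a in auto)
    then show ?thesis using a by simp
  qed
  have kk: "mat_act d n (?T (GLinv 1) * ?T (GL 2)) w y = KI c n y * w y" if "y \<in> words n d" for w y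
    unfolding mat_act_mat_mult[OF T[OF gens(5)] T[OF gens(4)] that] Ta[OF gens(5) that] uq_op.simps Ta[OF gens(4) that] KI_conv_LO
    by (simp only: mult.assoc)
  from Suc.prems show "uq_tensor d (Suc n) (Suc c, g) \<in> carrier_mat ((2 * d) ^ Suc n) ((2 * d) ^ Suc n) \<and>
    (\<forall>v. \<forall>x\<in>words (Suc n) d. mat_act d (Suc n) (uq_tensor d (Suc n) (Suc c, g)) v x = uq_op (Suc n) c g v x)"
  proof (cases rule: gl2_gens_cases)
    case 1
    note K = kc[OF V[of GE] one_carrier_mat] kc[OF mult_carrier_mat[OF V[of "GL 1"] V[of "GLinv 2"]] T[OF gens(1)]]
    have "mat_act d (Suc n) (uq_tensor d (Suc n) (Suc c, GE)) v x = EO c (Suc n) v x" if "x \<in> words (Suc n) d" for v x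
    proof -
      from that obtain a y where x: "x = case_nat a y" "a < 2 * d" "y \<in> words n d" by (auto simp: words_Suc)
      show ?thesis
        unfolding tens(1)[OF k1(1)] mat_act_arith(1)[OF K that] mat_act_kron[OF V one_carrier_mat that]
          mat_act_kron[OF mult_carrier_mat[OF V V] T[OF gens(1)] that]
        unfolding x(1) nat.case mat_act_one[OF x(3)] Ta[OF gens(1) x(3)] s2[OF x(2)] sum_uq_vect(1)[OF c x(2)] uq_op.simps EO_Suc ..
    qed
    then show ?thesis unfolding 1 tens(1)[OF k1(1)] using add_carrier_mat[OF K(2)] by simp
  next
    case 2
    note K = kc[OF V[of GF] mult_carrier_mat[OF T[OF gens(5)] T[OF gens(4)]]] kc[OF one_carrier_mat T[OF gens(2)]]
    have "mat_act d (Suc n) (uq_tensor d (Suc n) (Suc c, GF)) v x = FO c (Suc n) v x" if "x \<in> words (Suc n) d" for v x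
    proof -
      from that obtain a y where x: "x = case_nat a y" "a < 2 * d" "y \<in> words n d" by (auto simp: words_Suc)
      show ?thesis
        unfolding tens(2)[OF k1(1)] mat_act_arith(1)[OF K that] mat_act_kron[OF V mult_carrier_mat[OF T[OF gens(5)] T[OF gens(4)]] that]
          mat_act_kron[OF one_carrier_mat T[OF gens(2)] that]
        unfolding x(1) nat.case kk[OF x(3)] Ta[OF gens(2) x(3)] s1[OF x(2)] sum_uq_vect(2)[OF c x(2)] uq_op.simps FO_Suc ..
    qed
    then show ?thesis unfolding 2 tens(2)[OF k1(1)] using add_carrier_mat[OF K(2)] by simp
  next
    case (3 k)
    then have g: "GL k \<in> gl2_gens" by (auto simp: gl2_gens_def)
    have "mat_act d (Suc n) (uq_tensor d (Suc n) (Suc c, GL k)) v x = LO c k (Suc n) x * v x" if "x \<in> words (Suc n) d" for v x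
    proof -
      from that obtain a y where x: "x = case_nat a y" "a < 2 * d" "y \<in> words n d" by (auto simp: words_Suc)
      show ?thesis
        unfolding tens(3)[OF 3(2)] mat_act_kron[OF V T[OF g] that]
        unfolding x(1) nat.case Ta[OF g x(3)] sum_uq_vect(3)[OF c x(2) 3(2)] uq_op.simps LO_Suc by (simp only: mult.assoc)
    qed
    then show ?thesis unfolding 3(1) tens(3)[OF 3(2)] using kc[OF V T[OF g]] by simp
  next
    case (4 k)
    then have g: "GLinv k \<in> gl2_gens" by (auto simp: gl2_gens_def)
    have "mat_act d (Suc n) (uq_tensor d (Suc n) (Suc c, GLinv k)) v x = inverse (LO c k (Suc n) x) * v x" if "x \<in> words (Suc n) d" for v x
    proof -
      from that obtain a y where x: "x = case_nat a y" "a < 2 * d" "y \<in> words n d" by (auto simp: words_Suc)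
      have i: "inverse (if B then q else 1) = (if B then inverse q else 1)" for B by simp
      show ?thesis
        unfolding tens(4)[OF 4(2)] mat_act_kron[OF V T[OF g] that]
        unfolding x(1) nat.case Ta[OF g x(3)] sum_uq_vect(4)[OF c x(2) 4(2)] uq_op.simps LO_Suc inverse_mult_distrib i by (simp only: mult.assoc)
    qed
    then show ?thesis unfolding 4(1) tens(4)[OF 4(2)] using kc[OF V T[OF g]] by simp
  qed
qed

lemma uq_op_eta:
  "uq_op n c GE v = EO c n v" "uq_op n c GF v = FO c n v"
  "uq_op n c (GL k) v = (\<lambda>x. LO c k n x * v x)" "uq_op n c (GLinv k) v = (\<lambda>x. inverse (LO c k n x) * v x)"
  by (simp_all add: fun_eq_iff)

lemma E_LO: "EO c n (\<lambda>y. LO c 1 n y * v y) x = inverse q * LO c 1 n x * EO c n v x"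
  "EO c n (\<lambda>y. LO c 2 n y * v y) x = q * LO c 2 n x * EO c n v x"
  by (rule EO_weight; simp add: LO_upd divide_inverse)+

lemma F_LO: "FO c n (\<lambda>y. LO c 1 n y * v y) x = q * LO c 1 n x * FO c n v x"
  "FO c n (\<lambda>y. LO c 2 n y * v y) x = inverse q * LO c 2 n x * FO c n v x"
  by (rule FO_weight; simp add: LO_upd divide_inverse)+

lemma LO_other_colour:
  assumes "b \<noteq> c" "k \<in> {1, 2}"
  shows "Suc (2 * b) \<noteq> 2 * c + k" "Suc (Suc (2 * b)) \<noteq> 2 * c + k"
proof -
  have "k = 1 \<or> k = 2" using assms(2) by blast
  then show "Suc (2 * b) \<noteq> 2 * c + k" "Suc (Suc (2 * b)) \<noteq> 2 * c + k"
    using assms(1) by (elim disjE; hypsubst; presburger)+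
qed

lemma EF_LO_other:
  assumes "b \<noteq> c" "k \<in> {1, 2}"
  shows "EO b n (\<lambda>y. LO c k n y * v y) x = LO c k n x * EO b n v x"
    "FO b n (\<lambda>y. LO c k n y * v y) x = LO c k n x * FO b n v x"
    "EO b n (\<lambda>y. inverse (LO c k n y) * v y) x = inverse (LO c k n x) * EO b n v x"
    "FO b n (\<lambda>y. inverse (LO c k n y) * v y) x = inverse (LO c k n x) * FO b n v x"
  using EO_weight[of n x b "LO c k n" 1 v] FO_weight[of n x b "LO c k n" 1 v]
    EO_weight[of n x b "\<lambda>y. inverse (LO c k n y)" 1 v] FO_weight[of n x b "\<lambda>y. inverse (LO c k n y)" 1 v]
    LO_other_colour[OF assms]
  by (simp_all add: LO_upd)

lemma uq_op_commute:
  assumes bc: "b \<noteq> c" and g: "g \<in> gl2_gens" and h: "h \<in> gl2_gens"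
  shows "uq_op n b g (uq_op n c h v) x = uq_op n c h (uq_op n b g v) x"
  using g
proof (cases rule: gl2_gens_cases)
  case 1
  show ?thesis using h
    by (cases rule: gl2_gens_cases) (simp_all add: 1 uq_op_eta colours_commute[OF bc] EF_LO_other[OF bc])
next
  case 2
  show ?thesis using h
    by (cases rule: gl2_gens_cases) (simp_all add: 2 uq_op_eta colours_commute[OF bc] colours_commute(2)[OF bc[symmetric], symmetric] EF_LO_other[OF bc])
next
  case (3 k)
  show ?thesis using h
    by (cases rule: gl2_gens_cases) (simp_all add: 3 uq_op_eta EF_LO_other[OF bc[symmetric] 3(2)], (simp_all add: mult.left_commute)?)
next
  case (4 k)
  show ?thesis using h
    by (cases rule: gl2_gens_cases) (simp_all add: 4 uq_op_eta EF_LO_other[OF bc[symmetric] 4(2)], (simp_all add: mult.left_commute)?)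
qed

section \<open>The action is well defined on cosets; the centralizer in terms of generators\<close>

context
  fixes d n :: nat
begin

abbreviation (input) "N \<equiv> (2 * d) ^ n"
abbreviation (input) "W \<equiv> word_lift (mat_alg N) (uq_tensor d n)"

definition uq_act :: "(uq_gen list \<Rightarrow> Cq) \<Rightarrow> Cq mat" where
  "uq_act = mlin N W"

lemma uq_tensor_carrier: "z \<in> uq_gens d \<Longrightarrow> uq_tensor d n z \<in> carrier_mat N N"
proof -
  assume z: "z \<in> uq_gens d"
  then obtain c g where "z = (Suc c, g)" "c < d" "g \<in> gl2_gens"
    by (cases z, cases "fst z") (auto simp: uq_gens_def)
  then show ?thesis using uq_tensor_act by blast
qed

lemma W_carrier: "w \<in> lists (uq_gens d) \<Longrightarrow> W w \<in> carrier_mat N N"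
  by (rule word_lift_mat_carrier) (auto intro: uq_tensor_carrier)

lemma W_act:
  assumes "w \<in> lists (uq_gens d)" "x \<in> words n d"
  shows "mat_act d n (W w) v x = foldr (\<lambda>(b, g). uq_op n (b - 1) g) w v x"
  using assms
proof (induction w arbitrary: x rule: list.induct)
  case Nil
  then show ?case by (simp add: word_lift_def mat_act_one)
next
  case (Cons z w)
  then obtain c g where z: "z = (Suc c, g)" "c < d" "g \<in> gl2_gens"
    by (cases z, cases "fst z") (auto simp: uq_gens_def)
  have w: "w \<in> lists (uq_gens d)" using Cons.prems by simp
  have "mat_act d n (W (z # w)) v x = mat_act d n (uq_tensor d n z * W w) v x" by (simp add: word_lift_def)
  also have "\<dots> = mat_act d n (uq_tensor d n z) (\<lambda>y. mat_act d n (W w) v y) x"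
    by (rule mat_act_mat_mult) (use Cons.prems w uq_tensor_carrier W_carrier in auto)
  also have "\<dots> = mat_act d n (uq_tensor d n z) (foldr (\<lambda>(b, g). uq_op n (b - 1) g) w v) x"
    by (rule mat_act_cong) (rule Cons.IH[OF w])
  also have "\<dots> = uq_op n c g (foldr (\<lambda>(b, g). uq_op n (b - 1) g) w v) x"
    unfolding z(1) using uq_tensor_act[OF z(2,3)] Cons.prems(2) by blast
  finally show ?case by (simp add: z(1))
qed

lemma uq_act_hom: "uq_act \<in> alg_hom (uq_free d) (mat_alg N)"
  unfolding uq_act_def
proof (rule mlin_alg_hom[OF monoid_free_monoid])
  show "W g \<in> carrier_mat N N" if "g \<in> carrier (free_monoid (uq_gens d))" for g
    using that W_carrier by (simp add: free_monoid_def)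
  show "W (g \<otimes>\<^bsub>free_monoid (uq_gens d)\<^esub> h) = W g * W h"
    if "g \<in> carrier (free_monoid (uq_gens d))" "h \<in> carrier (free_monoid (uq_gens d))" for g h
    unfolding free_monoid_def monoid.select_convs
    by (rule word_lift_mat_append) (use that uq_tensor_carrier in \<open>auto simp: free_monoid_def\<close>)
  show "W \<one>\<^bsub>free_monoid (uq_gens d)\<^esub> = 1\<^sub>m N" by (simp add: free_monoid_def word_lift_def)
qed

lemma single_free: "(single w :: uq_gen list \<Rightarrow> Cq) \<in> carrier (uq_free d) \<longleftrightarrow> w \<in> lists (uq_gens d)"
  by (simp add: free_monoid_def)

interpretation F: kalgebra "uq_free d"
  by (rule kalgebra_monoid_alg[OF monoid_free_monoid])
interpretation MA: kalgebra "mat_alg N"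
  by (rule kalgebra_mat)

lemma uq_act_carrier: "uq_act a \<in> carrier_mat N N" by (simp add: uq_act_def)

lemma uq_act_single: "w \<in> lists (uq_gens d) \<Longrightarrow> uq_act (single w) = W w"
  unfolding uq_act_def by (rule mlin_single) (rule W_carrier)

lemma act_single: "w \<in> lists (uq_gens d) \<Longrightarrow> x \<in> words n d \<Longrightarrow>
    mat_act d n (uq_act (single w)) v x = foldr (\<lambda>(b, g). uq_op n (b - 1) g) w v x"
  by (simp add: uq_act_single W_act)

lemma act_minus:
  assumes "a \<in> carrier (uq_free d)" "b \<in> carrier (uq_free d)" "x \<in> words n d"
  shows "mat_act d n (uq_act (a \<ominus>\<^bsub>uq_free d\<^esub> b)) v x = mat_act d n (uq_act a) v x - mat_act d n (uq_act b) v x"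
  using alg_hom_minus(1)[OF uq_act_hom F.ring_axioms MA.ring_axioms assms(1,2)] mat_act_arith(2)[OF uq_act_carrier uq_act_carrier assms(3)]
  by (simp add: mat_alg_minus uq_act_carrier)

lemma act_smult:
  assumes "a \<in> carrier (uq_free d)" "x \<in> words n d"
  shows "mat_act d n (uq_act (s \<odot>\<^bsub>uq_free d\<^esub> a)) v x = s * mat_act d n (uq_act a) v x"
  using alg_homD(2)[OF uq_act_hom assms(1)] mat_act_arith(3)[OF uq_act_carrier uq_act_carrier assms(2)] by simp

lemma act_zeroI:
  assumes "\<And>v x. x \<in> words n d \<Longrightarrow> mat_act d n (uq_act a) v x = 0"
  shows "uq_act a = 0\<^sub>m N N"
  by (rule mat_act_eqI[OF uq_act_carrier zero_carrier_mat]) (simp add: assms mat_act_arith(4)[OF zero_carrier_mat zero_carrier_mat])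

lemma one_free: "\<one>\<^bsub>uq_free d\<^esub> = single []"
  by (simp add: free_monoid_def)

lemma gl2_rels_vanish:
  assumes c: "c < d" and r: "r \<in> gl2_rels d (Suc c)"
  shows "r \<in> carrier (uq_free d)" "uq_act r = 0\<^sub>m N N"
proof -
  let ?w = "\<lambda>gs. single (map (Pair (Suc c)) gs) :: uq_gen list \<Rightarrow> Cq"
  have w: "map (Pair (Suc c)) gs \<in> lists (uq_gens d)" if "set gs \<subseteq> gl2_gens" for gs
    using that c by (auto simp: uq_gens_def)
  have wc: "?w gs \<in> carrier (uq_free d)" if "set gs \<subseteq> gl2_gens" for gs
    using w[OF that] by (simp only: single_free)
  have gens: "GE \<in> gl2_gens" "GF \<in> gl2_gens" "GL 1 \<in> gl2_gens" "GL 2 \<in> gl2_gens" "GLinv 1 \<in> gl2_gens" "GLinv 2 \<in> gl2_gens"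
    by (auto simp: gl2_gens_def)
  have ac: "mat_act d n (uq_act (?w gs)) v x = foldr (uq_op n c) gs v x" if "set gs \<subseteq> gl2_gens" "x \<in> words n d" for gs v x
    using act_single[OF w[OF that(1)] that(2)] by (simp add: foldr_map comp_def)
  have one: "\<one>\<^bsub>uq_free d\<^esub> = ?w []" by (simp only: one_free list.map)
  note sub = act_minus F.minus_closed act_smult F.smult_closed wc ac
  have gi: "GL i \<in> gl2_gens" "GLinv i \<in> gl2_gens" if "i \<in> {1, 2}" for i using that by (auto simp: gl2_gens_def)
  have "r \<in> carrier (uq_free d) \<and> uq_act r = 0\<^sub>m N N"
    using r unfolding gl2_rels_def Let_def
  proof (elim UnE)
    assume "r \<in> {?w [GL i, GLinv i] \<ominus>\<^bsub>uq_free d\<^esub> \<one>\<^bsub>uq_free d\<^esub> |i. i \<in> {1, 2}}"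
    then obtain i where i: "i \<in> {1, 2}" "r = ?w [GL i, GLinv i] \<ominus>\<^bsub>uq_free d\<^esub> ?w []" unfolding one by blast
    have s: "set [GL i, GLinv i] \<subseteq> gl2_gens" "set [] \<subseteq> gl2_gens" using gi[OF i(1)] by auto
    show ?thesis unfolding i(2)
      using F.minus_closed[OF wc[OF s(1)] wc[OF s(2)]] act_minus[OF wc[OF s(1)] wc[OF s(2)]] ac[OF s(1)] ac[OF s(2)]
      by (intro conjI act_zeroI) (simp_all only:, simp)
  next
    assume "r \<in> {?w [GLinv i, GL i] \<ominus>\<^bsub>uq_free d\<^esub> \<one>\<^bsub>uq_free d\<^esub> |i. i \<in> {1, 2}}"
    then obtain i where i: "i \<in> {1, 2}" "r = ?w [GLinv i, GL i] \<ominus>\<^bsub>uq_free d\<^esub> ?w []" unfolding one by blast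
    have s: "set [GLinv i, GL i] \<subseteq> gl2_gens" "set [] \<subseteq> gl2_gens" using gi[OF i(1)] by auto
    show ?thesis unfolding i(2)
      using F.minus_closed[OF wc[OF s(1)] wc[OF s(2)]] act_minus[OF wc[OF s(1)] wc[OF s(2)]] ac[OF s(1)] ac[OF s(2)]
      by (intro conjI act_zeroI) (simp_all only:, simp)
  next
    assume "r \<in> {?w [GL 1, GL 2] \<ominus>\<^bsub>uq_free d\<^esub> ?w [GL 2, GL 1]}"
    then have r: "r = ?w [GL 1, GL 2] \<ominus>\<^bsub>uq_free d\<^esub> ?w [GL 2, GL 1]" by blast
    have s: "set [GL 1, GL 2] \<subseteq> gl2_gens" "set [GL 2, GL 1] \<subseteq> gl2_gens" using gens by auto
    show ?thesis unfolding r
      using F.minus_closed[OF wc[OF s(1)] wc[OF s(2)]] act_minus[OF wc[OF s(1)] wc[OF s(2)]] ac[OF s(1)] ac[OF s(2)]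
      by (intro conjI act_zeroI) (simp_all only:, simp)
  next
    have main: "?w gs \<ominus>\<^bsub>uq_free d\<^esub> s \<odot>\<^bsub>uq_free d\<^esub> ?w hs \<in> carrier (uq_free d) \<and> uq_act (?w gs \<ominus>\<^bsub>uq_free d\<^esub> s \<odot>\<^bsub>uq_free d\<^esub> ?w hs) = 0\<^sub>m N N"
      if g: "set gs \<subseteq> gl2_gens" and h: "set hs \<subseteq> gl2_gens" and e: "\<And>v x. foldr (uq_op n c) gs v x = s * foldr (uq_op n c) hs v x" for gs hs s
    proof (intro conjI act_zeroI)
      show "?w gs \<ominus>\<^bsub>uq_free d\<^esub> s \<odot>\<^bsub>uq_free d\<^esub> ?w hs \<in> carrier (uq_free d)"
        by (rule F.minus_closed[OF wc[OF g] F.smult_closed[OF wc[OF h]]])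
      show "mat_act d n (uq_act (?w gs \<ominus>\<^bsub>uq_free d\<^esub> s \<odot>\<^bsub>uq_free d\<^esub> ?w hs)) v x = 0" if "x \<in> words n d" for v x
        unfolding act_minus[OF wc[OF g] F.smult_closed[OF wc[OF h]] that] act_smult[OF wc[OF h] that] ac[OF g that] ac[OF h that] e by simp
    qed
    assume "r \<in> {?w [GL 1, GE] \<ominus>\<^bsub>uq_free d\<^esub> q \<odot>\<^bsub>uq_free d\<^esub> ?w [GE, GL 1],
      ?w [GL 2, GE] \<ominus>\<^bsub>uq_free d\<^esub> inverse q \<odot>\<^bsub>uq_free d\<^esub> ?w [GE, GL 2],
      ?w [GL 1, GF] \<ominus>\<^bsub>uq_free d\<^esub> inverse q \<odot>\<^bsub>uq_free d\<^esub> ?w [GF, GL 1],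
      ?w [GL 2, GF] \<ominus>\<^bsub>uq_free d\<^esub> q \<odot>\<^bsub>uq_free d\<^esub> ?w [GF, GL 2]}"
    then consider "r = ?w [GL 1, GE] \<ominus>\<^bsub>uq_free d\<^esub> q \<odot>\<^bsub>uq_free d\<^esub> ?w [GE, GL 1]"
      | "r = ?w [GL 2, GE] \<ominus>\<^bsub>uq_free d\<^esub> inverse q \<odot>\<^bsub>uq_free d\<^esub> ?w [GE, GL 2]"
      | "r = ?w [GL 1, GF] \<ominus>\<^bsub>uq_free d\<^esub> inverse q \<odot>\<^bsub>uq_free d\<^esub> ?w [GF, GL 1]"
      | "r = ?w [GL 2, GF] \<ominus>\<^bsub>uq_free d\<^esub> q \<odot>\<^bsub>uq_free d\<^esub> ?w [GF, GL 2]" by blast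
    then show ?thesis
    proof cases
      case 1
      show ?thesis unfolding 1 by (rule main) (use gens in \<open>simp_all add: uq_op_eta E_LO[simplified]\<close>)
    next
      case 2
      show ?thesis unfolding 2 by (rule main) (use gens in \<open>simp_all add: uq_op_eta E_LO[simplified]\<close>)
    next
      case 3
      show ?thesis unfolding 3 by (rule main) (use gens in \<open>simp_all add: uq_op_eta F_LO[simplified]\<close>)
    next
      case 4
      show ?thesis unfolding 4 by (rule main) (use gens in \<open>simp_all add: uq_op_eta F_LO[simplified]\<close>)
    qed
  next
    assume "r \<in> {(?w [GE, GF] \<ominus>\<^bsub>uq_free d\<^esub> ?w [GF, GE]) \<ominus>\<^bsub>uq_free d\<^esub>
        (1 / (q - inverse q)) \<odot>\<^bsub>uq_free d\<^esub> (?w [GL 1, GLinv 2] \<ominus>\<^bsub>uq_free d\<^esub> ?w [GLinv 1, GL 2])}"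
    then have r: "r = (?w [GE, GF] \<ominus>\<^bsub>uq_free d\<^esub> ?w [GF, GE]) \<ominus>\<^bsub>uq_free d\<^esub>
        (1 / (q - inverse q)) \<odot>\<^bsub>uq_free d\<^esub> (?w [GL 1, GLinv 2] \<ominus>\<^bsub>uq_free d\<^esub> ?w [GLinv 1, GL 2])" by blast
    have s: "set [GE, GF] \<subseteq> gl2_gens" "set [GF, GE] \<subseteq> gl2_gens" "set [GL 1, GLinv 2] \<subseteq> gl2_gens" "set [GLinv 1, GL 2] \<subseteq> gl2_gens"
      using gens by auto
    note m = F.minus_closed[OF wc[OF s(1)] wc[OF s(2)]] F.minus_closed[OF wc[OF s(3)] wc[OF s(4)]]
    show ?thesis unfolding r
    proof (intro conjI act_zeroI)
      show "(?w [GE, GF] \<ominus>\<^bsub>uq_free d\<^esub> ?w [GF, GE]) \<ominus>\<^bsub>uq_free d\<^esub>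
        (1 / (q - inverse q)) \<odot>\<^bsub>uq_free d\<^esub> (?w [GL 1, GLinv 2] \<ominus>\<^bsub>uq_free d\<^esub> ?w [GLinv 1, GL 2]) \<in> carrier (uq_free d)"
        by (rule F.minus_closed[OF m(1) F.smult_closed[OF m(2)]])
      fix v x assume x: "x \<in> words n d"
      have "foldr (uq_op n c) [GE, GF] v x - foldr (uq_op n c) [GF, GE] v x - 1 / (q - inverse q) *
         (foldr (uq_op n c) [GL 1, GLinv 2] v x - foldr (uq_op n c) [GLinv 1, GL 2] v x) = 0"
      proof -
        have A: "EO c n (FO c n v) x - FO c n (EO c n v) x = 1 / (q - inverse q) * ((inverse (KI c n x) - KI c n x) * v x)"
          unfolding EF_commutator[symmetric] using q_minus_inverse_nonzero by simp
        have i: "inverse (inverse a * b) - inverse a * b = a * inverse b - inverse a * b" for a b :: Cq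
          by (simp add: mult.commute)
        have B: "(inverse (KI c n x) - KI c n x) * v x = LO c 1 n x * (inverse (LO c 2 n x) * v x) - inverse (LO c 1 n x) * (LO c 2 n x * v x)"
          unfolding KI_conv_LO i by (simp only: left_diff_distrib mult.assoc)
        have f: "foldr (uq_op n c) [GE, GF] v x = EO c n (FO c n v) x" "foldr (uq_op n c) [GF, GE] v x = FO c n (EO c n v) x"
          "foldr (uq_op n c) [GL 1, GLinv 2] v x = LO c 1 n x * (inverse (LO c 2 n x) * v x)"
          "foldr (uq_op n c) [GLinv 1, GL 2] v x = inverse (LO c 1 n x) * (LO c 2 n x * v x)"
          by (simp_all only: foldr.simps comp_apply id_apply uq_op_eta)
        show ?thesis unfolding f A B by (rule diff_self)
      qed
      then show "mat_act d n (uq_act ((?w [GE, GF] \<ominus>\<^bsub>uq_free d\<^esub> ?w [GF, GE]) \<ominus>\<^bsub>uq_free d\<^esub>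
        (1 / (q - inverse q)) \<odot>\<^bsub>uq_free d\<^esub> (?w [GL 1, GLinv 2] \<ominus>\<^bsub>uq_free d\<^esub> ?w [GLinv 1, GL 2]))) v x = 0"
        unfolding act_minus[OF m(1) F.smult_closed[OF m(2)] x] act_smult[OF m(2) x] act_minus[OF wc[OF s(1)] wc[OF s(2)] x]
          act_minus[OF wc[OF s(3)] wc[OF s(4)] x] ac[OF s(1) x] ac[OF s(2) x] ac[OF s(3) x] ac[OF s(4) x] .
    qed
  qed
  then show "r \<in> carrier (uq_free d)" "uq_act r = 0\<^sub>m N N" by blast+
qed

lemma uq_rels_vanish:
  assumes "r \<in> uq_rels d"
  shows "r \<in> carrier (uq_free d) \<and> uq_act r = 0\<^sub>m N N"
  using assms unfolding uq_rels_def
proof (elim UnE)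
  assume "r \<in> (\<Union>b\<in>{1..d}. gl2_rels d b)"
  then obtain b where "b \<in> {1..d}" "r \<in> gl2_rels d b" by blast
  then show ?thesis using gl2_rels_vanish[of "b - 1" r] by (cases b) auto
next
  assume "r \<in> {single [(b, g), (c, h)] \<ominus>\<^bsub>uq_free d\<^esub> single [(c, h), (b, g)] | b c g h.
        b \<in> {1..d} \<and> c \<in> {1..d} \<and> b \<noteq> c \<and> g \<in> gl2_gens \<and> h \<in> gl2_gens}"
  then obtain b c g h where r: "r = single [(b, g), (c, h)] \<ominus>\<^bsub>uq_free d\<^esub> single [(c, h), (b, g)]"
    and bc: "b \<in> {1..d}" "c \<in> {1..d}" "b \<noteq> c" "g \<in> gl2_gens" "h \<in> gl2_gens" by blast
  have l: "[(b, g), (c, h)] \<in> lists (uq_gens d)" "[(c, h), (b, g)] \<in> lists (uq_gens d)" using bc by (auto simp: uq_gens_def)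
  note cc = single_free[THEN iffD2, OF l(1)] single_free[THEN iffD2, OF l(2)]
  have ne: "b - 1 \<noteq> c - 1" using bc by auto
  show ?thesis unfolding r
  proof (intro conjI act_zeroI)
    show "single [(b, g), (c, h)] \<ominus>\<^bsub>uq_free d\<^esub> single [(c, h), (b, g)] \<in> carrier (uq_free d)" by (rule F.minus_closed[OF cc])
    show "mat_act d n (uq_act (single [(b, g), (c, h)] \<ominus>\<^bsub>uq_free d\<^esub> single [(c, h), (b, g)])) v x = 0" if "x \<in> words n d" for v x
      unfolding act_minus[OF cc that] act_single[OF l(1) that] act_single[OF l(2) that]
      using uq_op_commute[OF ne bc(4,5)] by simp
  qed
qed

interpretation Q: algebra_quotient "uq_free d" "uq_rels d"
  by standard (use uq_rels_vanish in blast)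

text \<open>\<open>uq_rep\<close> extracts the only element of a set of matrices, which makes sense
  because a whole coset acts by one matrix. For this the defining relations had to be verified: they
  put the ideal into the kernel of \<open>uq_act\<close>.\<close>

lemma uq_rep_proj:
  assumes x: "x \<in> carrier (uq_free d)"
  shows "uq_rep d n (Q.I +>\<^bsub>uq_free d\<^esub> x) = uq_act x"
proof -
  obtain h' where h': "\<And>x. x \<in> carrier (uq_free d) \<Longrightarrow> h' (Q.I +>\<^bsub>uq_free d\<^esub> x) = uq_act x"
    using Q.hom_factors[OF uq_act_hom MA.ring_axioms] uq_rels_vanish by auto
  have "free_lift (mat_alg N) (uq_tensor d n) y = uq_act x" if y: "y \<in> Q.I +>\<^bsub>uq_free d\<^esub> x" for y
  proof -
    have "Q.I +>\<^bsub>uq_free d\<^esub> x \<subseteq> carrier (uq_free d)" by (rule F.a_r_coset_subset_G) (use x Q.id.a_subset in auto)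
    then have yc: "y \<in> carrier (uq_free d)" using y by blast
    have "Q.I +>\<^bsub>uq_free d\<^esub> x = Q.I +>\<^bsub>uq_free d\<^esub> y" using y x by (rule Q.id.a_repr_independence')
    then have "uq_act y = uq_act x" using h'[OF yc] h'[OF x] by simp
    then show ?thesis using free_lift_mat[OF yc uq_tensor_carrier] unfolding uq_act_def by simp
  qed
  then have "free_lift (mat_alg N) (uq_tensor d n) ` (Q.I +>\<^bsub>uq_free d\<^esub> x) = (\<lambda>_. uq_act x) ` (Q.I +>\<^bsub>uq_free d\<^esub> x)"
    by (intro image_cong HOL.refl)
  also have "\<dots> = {uq_act x}" using Q.id.a_rcos_self[OF x] by (rule image_constant)
  finally show ?thesis unfolding uq_rep_def by (simp only: the_elem_eq)
qed

lemma uq_act_commute: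
  assumes A: "A \<in> carrier_mat N N" and c: "\<And>z. z \<in> uq_gens d \<Longrightarrow> A * uq_tensor d n z = uq_tensor d n z * A"
    and x: "x \<in> carrier (uq_free d)"
  shows "A * uq_act x = uq_act x * A"
proof -
  have w: "A * W w = W w * A" if "w \<in> lists (uq_gens d)" for w
    using that
  proof (induction w rule: list.induct)
    case Nil
    then show ?case using A by (simp add: word_lift_def)
  next
    case (Cons z w)
    have cs: "uq_tensor d n z \<in> carrier_mat N N" "W w \<in> carrier_mat N N" using Cons.prems uq_tensor_carrier W_carrier by auto
    have "A * W (z # w) = A * (uq_tensor d n z * W w)" by (simp add: word_lift_def)
    also have "\<dots> = uq_tensor d n z * A * W w" using assoc_mult_mat[OF A cs] c[of z] Cons.prems by simp
    also have "\<dots> = uq_tensor d n z * W w * A" using assoc_mult_mat[OF cs(1) A cs(2)] assoc_mult_mat[OF cs A] Cons by simp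
    finally show ?case by (simp add: word_lift_def)
  qed
  have sub: "w \<in> lists (uq_gens d)" if "x w \<noteq> 0" for w using x that by (auto simp: carrier_monoid_alg free_monoid_def)
  show ?thesis unfolding uq_act_def by (rule mlin_commute[OF A W_carrier[OF sub] w[OF sub]])
qed

text \<open>A generator is represented by the coset of its one-letter word, which gives one
  inclusion. For the other, commutation passes from the generators to words and to their linear
  combinations.\<close>

theorem carrier_uq_centralizer:
  "carrier (uq_centralizer d n) = {A \<in> carrier_mat N N. \<forall>z\<in>uq_gens d. A * uq_tensor d n z = uq_tensor d n z * A}"
proof (intro Set.set_eqI iffI)
  fix A assume "A \<in> carrier (uq_centralizer d n)"
  then have A: "A \<in> carrier_mat N N" "\<And>u. u \<in> carrier (Uq d) \<Longrightarrow> A * uq_rep d n u = uq_rep d n u * A"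
    by (auto simp: uq_centralizer_def)
  have "A * uq_tensor d n z = uq_tensor d n z * A" if z: "z \<in> uq_gens d" for z
  proof -
    have zl: "[z] \<in> lists (uq_gens d)" using z by simp
    have "uq_act (single [z]) = uq_tensor d n z"
      using uq_act_single[OF zl] uq_tensor_carrier[OF z] by (simp add: word_lift_def)
    moreover have s: "single [z] \<in> carrier (uq_free d)" using zl by (simp only: single_free)
    moreover have "Q.I +>\<^bsub>uq_free d\<^esub> single [z] \<in> carrier (Uq d)" unfolding Uq_def Q.carrier_Q using s by (rule imageI)
    ultimately show ?thesis using A(2) uq_rep_proj[OF s] by metis
  qed
  then show "A \<in> {A \<in> carrier_mat N N. \<forall>z\<in>uq_gens d. A * uq_tensor d n z = uq_tensor d n z * A}" using A(1) by blast
next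
  fix A assume "A \<in> {A \<in> carrier_mat N N. \<forall>z\<in>uq_gens d. A * uq_tensor d n z = uq_tensor d n z * A}"
  then have A: "A \<in> carrier_mat N N" "\<And>z. z \<in> uq_gens d \<Longrightarrow> A * uq_tensor d n z = uq_tensor d n z * A" by auto
  have "A * uq_rep d n u = uq_rep d n u * A" if "u \<in> carrier (Uq d)" for u
  proof -
    from that obtain x where x: "x \<in> carrier (uq_free d)" "u = Q.I +>\<^bsub>uq_free d\<^esub> x" unfolding Uq_def Q.carrier_Q by blast
    show ?thesis unfolding x(2) uq_rep_proj[OF x(1)] using A x(1) by (rule uq_act_commute)
  qed
  then show "A \<in> carrier (uq_centralizer d n)" using A(1) by (auto simp: uq_centralizer_def)
qed

end

section \<open>The action of the framed braid group\<close>

text \<open>A primitive \<open>d\<close>-th root of unity among the constants;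
  \<open>frame_op\<close> uses its power \<open>c\<close> as the eigenvalue of a framing generator
  on the colour \<open>c\<close>.\<close>

definition zeta :: "nat \<Rightarrow> Cq" where
  "zeta d = Fract [:cis (2 * pi / real d):] 1"

lemma zeta_power: "zeta d ^ k = Fract [:cis (2 * pi * real k / real d):] 1"
proof (induction k)
  case (Suc k)
  have "cis (2 * pi / real d) * cis (2 * pi * real k / real d) = cis (2 * pi * real (Suc k) / real d)"
    by (simp add: cis_mult add_divide_distrib distrib_left)
  then show ?case using Suc by (simp add: zeta_def mult.commute[of "cis (2 * pi * real k / real d)"])
qed (simp add: One_fract_def one_pCons)

lemma zeta_power_d: "d \<ge> 1 \<Longrightarrow> zeta d ^ d = 1"
  by (simp add: zeta_power One_fract_def one_pCons)

lemma zeta_nonzero [simp]: "zeta d \<noteq> 0"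
  by (simp add: zeta_def Zero_fract_def eq_fract)

lemma zeta_power_neq_one:
  assumes "0 < k" "k < d"
  shows "zeta d ^ k \<noteq> 1"
proof
  assume "zeta d ^ k = 1"
  then have c: "cis (2 * pi * real k / real d) = 1"
    by (simp add: zeta_power One_fract_def eq_fract one_pCons)
  then have "cos (2 * pi * real k / real d) = 1" by (metis cis.simps(1) one_complex.simps(1))
  then obtain m :: int where "2 * pi * real k / real d = of_int m * 2 * pi"
    using cos_one_2pi_int by blast
  then have "real k = of_int m * real d" using assms by (simp add: field_simps)
  then have "int k = m * int d" by (metis of_int_eq_iff of_int_mult of_int_of_nat_eq)
  then have "int d dvd int k" by simp
  then have "d dvd k" by simp
  then show False using assms by (auto dest: dvd_imp_le)
qed

lemma of_nat_Cq_nonzero: "d \<ge> 1 \<Longrightarrow> (of_nat d :: Cq) \<noteq> 0"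
proof -
  assume d: "d \<ge> 1"
  have "(of_nat d :: Cq) = Fract [:of_nat d:] 1"
    by (induction d) (simp_all add: Zero_fract_def One_fract_def one_pCons)
  then show ?thesis using d by (simp add: Zero_fract_def eq_fract)
qed

text \<open>Orthogonality of the characters of a cyclic group, in the shape in which the summands
  \<open>t_i^a t_{i+1}^{-a}\<close> of \<open>E_i\<close> produce it.\<close>

lemma zeta_sum:
  assumes "a < d" "b < d"
  shows "(\<Sum>k\<in>{1..d}. (zeta d ^ a) ^ k * (inverse (zeta d) ^ b) ^ k) = (if a = b then of_nat d else 0)"
proof -
  let ?w = "zeta d ^ a * inverse (zeta d) ^ b"
  have e: "(zeta d ^ a) ^ k * (inverse (zeta d) ^ b) ^ k = ?w ^ k" for k by (simp add: power_mult_distrib)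
  show ?thesis
  proof (cases "a = b")
    case True
    then have "?w = 1" by (simp add: power_mult_distrib[symmetric])
    then show ?thesis unfolding e using True by simp
  next
    case False
    have d1: "d \<ge> 1" using assms by simp
    have w1: "?w \<noteq> 1"
    proof
      assume "?w = 1"
      then have eq: "zeta d ^ a = zeta d ^ b" by (simp add: power_inverse field_simps)
      show False
      proof (cases "a < b")
        case True
        have "zeta d ^ b = zeta d ^ a * zeta d ^ (b - a)" using True by (simp add: power_add[symmetric])
        then have "zeta d ^ (b - a) = 1" using eq by simp
        then show False using zeta_power_neq_one[of "b - a" d] True assms by simp
      next
        case nlt: False
        have "zeta d ^ a = zeta d ^ b * zeta d ^ (a - b)" using nlt by (simp add: power_add[symmetric])
        then have "zeta d ^ (a - b) = 1" using eq by simp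
        then show False using zeta_power_neq_one[of "a - b" d] nlt False assms by simp
      qed
    qed
    have wd: "?w ^ d = 1"
      using zeta_power_d[OF d1]
      by (simp add: power_mult_distrib power_mult[symmetric] mult.commute[of _ d] power_inverse) (simp add: power_mult)
    have "(\<Sum>k\<in>{1..d}. ?w ^ k) = ?w * (\<Sum>k<d. ?w ^ k)"
      unfolding sum_distrib_left by (rule sum.reindex_bij_witness[of _ Suc "\<lambda>k. k - 1"]) (auto simp: power_eq_if)
    also have "(\<Sum>k<d. ?w ^ k) = 0"
    proof -
      have "(1 - ?w) * (\<Sum>k<d. ?w ^ k) = 1 - ?w ^ d" by (rule one_diff_power_eq[symmetric])
      then show ?thesis using w1 wd by simp
    qed
    finally show ?thesis unfolding e using False by simp
  qed
qed

section \<open>Crossings and framings as operators on functions of words\<close>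

type_synonym wfun = "(nat \<Rightarrow> nat) \<Rightarrow> Cq"

text \<open>\<open>sa\<close> and \<open>sb\<close> are the diagonal and off-diagonal coefficients
  of a crossing, normalised to eigenvalues \<open>q\<close> and \<open>- inverse q\<close> within
  one colour. On two distinct letters of a colour the block has off-diagonal entries 1 and diagonal
  entries \<open>q - inverse q\<close> and 0, the former at the ascending pair.\<close>

definition sa :: "nat \<Rightarrow> nat \<Rightarrow> Cq" where
  "sa l m = (if l = m then q else if l div 2 = m div 2 \<and> l < m then q - inverse q else 0)"

definition sb :: "nat \<Rightarrow> nat \<Rightarrow> Cq" where
  "sb l m = (if l = m then 0 else 1)"

text \<open>Jimbo's R-matrix on letters of the same colour, the flip on letters of distinct colours.\<close>

definition braid_op :: "nat \<Rightarrow> wfun \<Rightarrow> wfun" where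
  "braid_op i v x = sa (x i) (x (Suc i)) * v x + sb (x i) (x (Suc i)) * v (x \<circ> adj i)"

text \<open>The quadratic relation solved for the inverse:
  \<open>s^-1 = s - (q - q^-1) E\<close>.\<close>

definition braid_inv_op :: "nat \<Rightarrow> wfun \<Rightarrow> wfun" where
  "braid_inv_op i v x = braid_op i v x - (if x i div 2 = x (Suc i) div 2 then q - inverse q else 0) * v x"

definition frame_op :: "Cq \<Rightarrow> nat \<Rightarrow> wfun \<Rightarrow> wfun" where
  "frame_op z j v x = z ^ (x j div 2) * v x"

lemma adj_case_nat:
  "case_nat a x \<circ> adj (Suc i) = case_nat a (x \<circ> adj i)"
  "case_nat l (case_nat m y) \<circ> adj 0 = (case_nat m (case_nat l y) :: nat \<Rightarrow> nat)"
  by (auto simp: fun_eq_iff Transposition.transpose_def split: nat.split)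

lemma braid_op_Suc: "braid_op (Suc i) v (case_nat a x) = braid_op i (\<lambda>y. v (case_nat a y)) x"
  by (simp add: braid_op_def adj_case_nat)

lemma braid_op_0: "braid_op 0 v (case_nat l (case_nat m y)) = sa l m * v (case_nat l (case_nat m y)) + sb l m * v (case_nat m (case_nat l y))"
  by (simp add: braid_op_def adj_case_nat)

lemma braid_op_add: "braid_op i (\<lambda>y. v y + w y) x = braid_op i v x + braid_op i w x"
  by (simp add: braid_op_def algebra_simps)

lemma braid_op_scale: "braid_op i (\<lambda>y. s * v y) x = s * braid_op i v x"
  by (simp add: braid_op_def algebra_simps)

lemma braid_op_far: "Suc i < j \<Longrightarrow> braid_op i (braid_op j v) x = braid_op j (braid_op i v) x"
proof (induction i arbitrary: j v x)
  case 0
  then obtain j' where j: "j = Suc (Suc j')" by (metis Suc_less_eq less_imp_Suc_add add_Suc Suc_lessE)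
  obtain l x' where x: "x = case_nat l x'" by (rule case_nat_exhaust)
  obtain m y where x': "x' = case_nat m y" by (rule case_nat_exhaust)
  show "braid_op 0 (braid_op j v) x = braid_op j (braid_op 0 v) x" unfolding x x' j by (simp add: braid_op_Suc braid_op_0 braid_op_add braid_op_scale)
next
  case (Suc i)
  then obtain j' where j: "j = Suc j'" "Suc i < j'" by (cases j) auto
  obtain l x' where x: "x = case_nat l x'" by (rule case_nat_exhaust)
  have e: "(\<lambda>y. braid_op (Suc k) u (case_nat l y)) = braid_op k (\<lambda>y. u (case_nat l y))" for k u by (simp add: fun_eq_iff braid_op_Suc)
  show "braid_op (Suc i) (braid_op j v) x = braid_op j (braid_op (Suc i) v) x"
    unfolding x j(1) braid_op_Suc e by (rule Suc.IH[OF j(2)])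
qed

lemma braid_op_quadratic: "braid_op i (braid_op i v) x = v x + (if x i div 2 = x (Suc i) div 2 then (q - inverse q) * braid_op i v x else 0)"
proof -
  have "x \<circ> adj i \<circ> adj i = x" by (simp add: fun_eq_iff)
  then show ?thesis
    by (cases "x i" "x (Suc i)" rule: linorder_cases) (auto simp: braid_op_def sa_def sb_def algebra_simps)
qed

text \<open>Only the letters at three neighbouring places are involved. The induction strips the
  letters before them, and \<open>0\<close> is a finite check over the relative orders and colours
  of three letters.\<close>

lemma braid_op_braid: "braid_op i (braid_op (Suc i) (braid_op i v)) x = braid_op (Suc i) (braid_op i (braid_op (Suc i) v)) x"
proof (induction i arbitrary: v x)
  case 0
  obtain l x' where x: "x = case_nat l x'" by (rule case_nat_exhaust)
  obtain m x'' where x': "x' = case_nat m x''" by (rule case_nat_exhaust)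
  obtain r y where x'': "x'' = case_nat r y" by (rule case_nat_exhaust)
  define a b c where "a = l div 2" "b = m div 2" "c = r div 2"
  note abc = this[symmetric]
  show "braid_op 0 (braid_op (Suc 0) (braid_op 0 v)) x = braid_op (Suc 0) (braid_op 0 (braid_op (Suc 0) v)) x"
    unfolding x x' x''
    apply (simp add: braid_op_Suc braid_op_0)
    unfolding sa_def sb_def abc
    by (cases l m rule: linorder_cases; cases m r rule: linorder_cases; cases l r rule: linorder_cases; cases "a = b"; cases "b = c"; cases "a = c")
      (use abc in \<open>simp_all add: field_simps\<close>)
next
  case (Suc i)
  obtain l x' where x: "x = case_nat l x'" by (rule case_nat_exhaust)
  have e: "(\<lambda>y. braid_op (Suc k) u (case_nat l y)) = braid_op k (\<lambda>y. u (case_nat l y))" for k u by (simp add: fun_eq_iff braid_op_Suc)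
  show "braid_op (Suc i) (braid_op (Suc (Suc i)) (braid_op (Suc i) v)) x = braid_op (Suc (Suc i)) (braid_op (Suc i) (braid_op (Suc (Suc i)) v)) x"
    unfolding x braid_op_Suc e by (rule Suc.IH)
qed

text \<open>The expression is the \<open>q\<close>-antisymmetrizer on three factors. It vanishes on
  one colour because a colour has only two letters, so that its exterior cube is zero.\<close>

lemma braid_op_cubic:
  assumes "x i div 2 = c" "x (Suc i) div 2 = c" "x (Suc (Suc i)) div 2 = c"
  shows "v x - inverse q * braid_op i v x - inverse q * braid_op (Suc i) v x + inverse (q ^ 2) * braid_op i (braid_op (Suc i) v) x
    + inverse (q ^ 2) * braid_op (Suc i) (braid_op i v) x - inverse (q ^ 3) * braid_op i (braid_op (Suc i) (braid_op i v)) x = 0"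
  using assms
proof (induction i arbitrary: v x)
  case 0
  obtain l x' where x: "x = case_nat l x'" by (rule case_nat_exhaust)
  obtain m x'' where x': "x' = case_nat m x''" by (rule case_nat_exhaust)
  obtain r y where x'': "x'' = case_nat r y" by (rule case_nat_exhaust)
  have two: "a = 2 * c \<or> a = Suc (2 * c)" if "a div 2 = c" for a using that by presburger
  have "l = 2 * c \<or> l = Suc (2 * c)" "m = 2 * c \<or> m = Suc (2 * c)" "r = 2 * c \<or> r = Suc (2 * c)"
    using two[of l] two[of m] two[of r] 0 unfolding x x' x'' by simp_all
  then show "v x - inverse q * braid_op 0 v x - inverse q * braid_op (Suc 0) v x + inverse (q ^ 2) * braid_op 0 (braid_op (Suc 0) v) x
    + inverse (q ^ 2) * braid_op (Suc 0) (braid_op 0 v) x - inverse (q ^ 3) * braid_op 0 (braid_op (Suc 0) (braid_op 0 v)) x = 0"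
    unfolding x x' x''
    by (elim disjE; hypsubst)
      (simp_all add: braid_op_Suc braid_op_0 sa_def sb_def field_simps power2_eq_square power3_eq_cube)
next
  case (Suc i)
  obtain l x' where x: "x = case_nat l x'" by (rule case_nat_exhaust)
  have e: "(\<lambda>y. braid_op (Suc k) u (case_nat l y)) = braid_op k (\<lambda>y. u (case_nat l y))" for k u by (simp add: fun_eq_iff braid_op_Suc)
  show "v x - inverse q * braid_op (Suc i) v x - inverse q * braid_op (Suc (Suc i)) v x + inverse (q ^ 2) * braid_op (Suc i) (braid_op (Suc (Suc i)) v) x
    + inverse (q ^ 2) * braid_op (Suc (Suc i)) (braid_op (Suc i) v) x - inverse (q ^ 3) * braid_op (Suc i) (braid_op (Suc (Suc i)) (braid_op (Suc i) v)) x = 0"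
    unfolding x braid_op_Suc e by (rule Suc.IH) (use Suc.prems in \<open>simp_all add: x\<close>)
qed

lemma braid_inv_op_braid_op: "braid_inv_op i (braid_op i v) x = v x" "braid_op i (braid_inv_op i v) x = v x"
proof -
  show "braid_inv_op i (braid_op i v) x = v x" by (simp add: braid_inv_op_def braid_op_quadratic)
  have "braid_op i (braid_inv_op i v) x = braid_op i (braid_op i v) x - (if x i div 2 = x (Suc i) div 2 then q - inverse q else 0) * braid_op i v x"
    by (cases "x i div 2 = x (Suc i) div 2") (simp_all add: braid_op_def[of i "braid_inv_op i v"] braid_inv_op_def braid_op_def[of i "braid_op i v"] algebra_simps braid_op_def[of i v])
  then show "braid_op i (braid_inv_op i v) x = v x" by (simp add: braid_op_quadratic)
qed

lemma frame_op_frame_op: "frame_op z j (frame_op w k v) x = frame_op w k (frame_op z j v) x"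
  by (simp add: frame_op_def)

lemma frame_op_inverse: "z \<noteq> 0 \<Longrightarrow> frame_op z j (frame_op (inverse z) j v) x = v x" "z \<noteq> 0 \<Longrightarrow> frame_op (inverse z) j (frame_op z j v) x = v x"
  by (simp_all add: frame_op_def mult.assoc[symmetric] power_mult_distrib[symmetric])

text \<open>The diagonal coefficient is nonzero only for letters of one colour, where both framings
  give the same scalar.\<close>

lemma braid_op_frame_op: "braid_op i (frame_op z j v) x = frame_op z (adj i j) (braid_op i v) x"
proof -
  have "sa (x i) (x (Suc i)) * z ^ (x j div 2) = sa (x i) (x (Suc i)) * z ^ (x (adj i j) div 2)"
    by (auto simp: sa_def Transposition.transpose_def)
  then show ?thesis by (simp add: braid_op_def frame_op_def distrib_left) blast
qed

text \<open>Leading letters are split off by the comultiplication until the crossing acts on the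
  first two places; for \<open>F\<close> this uses that \<open>K^-1\<close> on the rest is symmetric
  in the places. The remaining check distinguishes, for each of the two letters, the two letters of
  colour \<open>c\<close> and the letters of other colours.\<close>

lemma uq_op_braid_op:
  assumes "Suc i < n" and g: "g \<in> gl2_gens"
  shows "uq_op n c g (braid_op i v) x = braid_op i (uq_op n c g v) x"
  using assms(1)
proof (induction i arbitrary: n v x)
  case 0
  then obtain n' where n: "n = Suc (Suc n')" by (metis Suc_lessE less_imp_Suc_add add_Suc)
  obtain l x' where x: "x = case_nat l x'" by (rule case_nat_exhaust)
  obtain m y where x': "x' = case_nat m y" by (rule case_nat_exhaust)
  have d1: "2 * c div 2 = c" "Suc (2 * c) div 2 = c" by simp_all
  have other: "a div 2 \<noteq> c" if "a \<noteq> 2 * c" "a \<noteq> Suc (2 * c)" for a using that by presburger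
  consider (a) "l = 2 * c" | (b) "l = Suc (2 * c)" | (o) "l \<noteq> 2 * c" "l \<noteq> Suc (2 * c)" "l div 2 \<noteq> c" using other by blast
  note cl = this
  consider (a) "m = 2 * c" | (b) "m = Suc (2 * c)" | (o) "m \<noteq> 2 * c" "m \<noteq> Suc (2 * c)" "m div 2 \<noteq> c" using other by blast
  note cm = this
  from g show "uq_op n c g (braid_op 0 v) x = braid_op 0 (uq_op n c g v) x"
  proof (cases rule: gl2_gens_cases)
    case 1
    show ?thesis unfolding 1 uq_op_eta n x x'
      by (rule cl; rule cm)
        (simp_all add: braid_op_0 EO_add EO_scale sa_def sb_def d1 kq_other, (simp_all add: field_simps)?)
  next
    case 2
    show ?thesis unfolding 2 uq_op_eta n x x'
      by (rule cl; rule cm)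
        (simp_all add: braid_op_0 FO_add FO_scale sa_def sb_def d1 kq_other, (simp_all add: field_simps)?)
  next
    case (3 k)
    show ?thesis unfolding 3 uq_op_eta n x x' by (simp add: braid_op_0 algebra_simps)
  next
    case (4 k)
    show ?thesis unfolding 4 uq_op_eta n x x' by (simp add: braid_op_0 algebra_simps)
  qed
next
  case (Suc i)
  then obtain n' where n: "n = Suc n'" "Suc i < n'" by (cases n) auto
  obtain l y where x: "x = case_nat l y" by (rule case_nat_exhaust)
  have e: "(\<lambda>y. braid_op (Suc k) u (case_nat a y)) = braid_op k (\<lambda>y. u (case_nat a y))" for k u a by (simp add: fun_eq_iff braid_op_Suc)
  note IH = Suc.IH[OF n(2)]
  from g show "uq_op n c g (braid_op (Suc i) v) x = braid_op (Suc i) (uq_op n c g v) x"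
  proof (cases rule: gl2_gens_cases)
    case 1
    show ?thesis using IH unfolding 1 uq_op_eta n(1) x by (simp add: braid_op_Suc e braid_op_add braid_op_scale) (simp add: braid_op_def)
  next
    case 2
    have K: "braid_op i (\<lambda>y. KI c n' y * w y) y = KI c n' y * braid_op i w y" for w
    proof -
      have "KI c n' (y \<circ> adj i) = KI c n' y"
        unfolding KI_def using prod.permute[OF adj_permutes[OF n(2)], of "\<lambda>j. inverse (kq c (y j))"] by (simp add: comp_def)
      then show ?thesis by (simp add: braid_op_def algebra_simps)
    qed
    show ?thesis using IH unfolding 2 uq_op_eta n(1) x by (simp add: braid_op_Suc e braid_op_add braid_op_scale K) (simp add: braid_op_def)
  next
    case (3 k)
    show ?thesis using IH[of "\<lambda>z. v (case_nat l z)" y] unfolding 3 uq_op_eta n(1) x by (simp add: braid_op_Suc e braid_op_scale mult.assoc)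
  next
    case (4 k)
    show ?thesis using IH[of "\<lambda>z. v (case_nat l z)" y] unfolding 4 uq_op_eta n(1) x by (simp add: braid_op_Suc e braid_op_scale mult.assoc)
  qed
qed

text \<open>\<open>E\<close> and \<open>F\<close> change a letter only within its colour, and a
  framing sees nothing but the colour.\<close>

lemma uq_op_frame_op:
  assumes "g \<in> gl2_gens"
  shows "uq_op n c g (frame_op z j v) x = frame_op z j (uq_op n c g v) x"
proof -
  have c: "(x(i := t)) j div 2 = x j div 2" if "x i div 2 = t div 2" for i t using that by simp
  have E: "EO c n (\<lambda>y. z ^ (y j div 2) * v y) x = 1 * z ^ (x j div 2) * EO c n v x"
    by (rule EO_weight) (simp add: c)
  have F: "FO c n (\<lambda>y. z ^ (y j div 2) * v y) x = 1 * z ^ (x j div 2) * FO c n v x"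
    by (rule FO_weight) (simp add: c)
  have T: "frame_op z j v = (\<lambda>y. z ^ (y j div 2) * v y)" for v by (simp add: frame_op_def fun_eq_iff)
  from assms show ?thesis
    by (cases rule: gl2_gens_cases) (use E F in \<open>simp_all add: uq_op_eta T\<close>)
qed

fun letter_op :: "nat \<Rightarrow> fb_gen \<times> bool \<Rightarrow> wfun \<Rightarrow> wfun" where
  "letter_op d (Sgen i, True) = braid_op (i - 1)"
| "letter_op d (Sgen i, False) = braid_inv_op (i - 1)"
| "letter_op d (Tgen j, True) = frame_op (zeta d) (j - 1)"
| "letter_op d (Tgen j, False) = frame_op (inverse (zeta d)) (j - 1)"

section \<open>Matrices of operators on functions of words\<close>

definition linear_op :: "nat \<Rightarrow> nat \<Rightarrow> (wfun \<Rightarrow> wfun) \<Rightarrow> bool" where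
  "linear_op d n T \<longleftrightarrow> (\<forall>v. \<forall>x\<in>words n d. T v x = (\<Sum>y\<in>words n d. T (\<lambda>z. if z = y then 1 else 0) x * v y))"

definition op_mat :: "nat \<Rightarrow> nat \<Rightarrow> (wfun \<Rightarrow> wfun) \<Rightarrow> Cq mat" where
  "op_mat d n T = mat ((2 * d) ^ n) ((2 * d) ^ n) (\<lambda>(i, j).
     T (\<lambda>z. if z = inv_into (words n d) (word_index d n) j then 1 else 0) (inv_into (words n d) (word_index d n) i))"

lemma op_mat_carrier: "op_mat d n T \<in> carrier_mat ((2 * d) ^ n) ((2 * d) ^ n)"
  by (simp add: op_mat_def)

lemma inv_word_index: "x \<in> words n d \<Longrightarrow> inv_into (words n d) (word_index d n) (word_index d n x) = x"
  using word_index_bij[of d n] by (simp add: bij_betw_def)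

lemma mat_act_op_mat:
  assumes "linear_op d n T" "x \<in> words n d"
  shows "mat_act d n (op_mat d n T) v x = T v x"
proof -
  have "op_mat d n T $$ (word_index d n x, word_index d n y) = T (\<lambda>z. if z = y then 1 else 0) x" if "y \<in> words n d" for y
    using that assms(2) by (simp add: op_mat_def word_index_less inv_word_index)
  then have "mat_act d n (op_mat d n T) v x = (\<Sum>y\<in>words n d. T (\<lambda>z. if z = y then 1 else 0) x * v y)"
    by (simp add: mat_act_def)
  also have "\<dots> = T v x" by (rule assms(1)[unfolded linear_op_def, rule_format, OF assms(2), symmetric])
  finally show ?thesis .
qed

lemma words_adj: "x \<in> words n d \<Longrightarrow> Suc i < n \<Longrightarrow> x \<circ> adj i \<in> words n d"
  by (auto simp: words_def Transposition.transpose_def)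

lemma sum_delta_words: "y \<in> words n d \<Longrightarrow> (\<Sum>z\<in>words n d. (if y = z then 1 else 0) * v z) = (v y :: Cq)"
  by (simp add: finite_words if_distrib[of "\<lambda>t. t * _"] cong: if_cong)

lemma linear_op_scale: "linear_op d n (\<lambda>v x. s x * v x)"
  unfolding linear_op_def by (auto simp: mult.assoc sum_distrib_left[symmetric] sum_delta_words)

lemma linear_op_braid_op: "Suc i < n \<Longrightarrow> linear_op d n (braid_op i)"
  unfolding linear_op_def braid_op_def
  by (auto simp: distrib_right mult.assoc sum.distrib sum_distrib_left[symmetric] sum_delta_words words_adj)

lemma linear_op_braid_inv_op: "Suc i < n \<Longrightarrow> linear_op d n (braid_inv_op i)"
  unfolding linear_op_def braid_inv_op_def
proof (intro allI ballI)
  fix v x assume i: "Suc i < n" and x: "x \<in> words n d"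
  let ?s = "if x i div 2 = x (Suc i) div 2 then q - inverse q else 0" and ?\<delta> = "\<lambda>y z. if z = y then 1 else 0 :: Cq"
  have "(\<Sum>y\<in>words n d. (braid_op i (?\<delta> y) x - ?s * ?\<delta> y x) * v y) = (\<Sum>y\<in>words n d. braid_op i (?\<delta> y) x * v y) - ?s * (\<Sum>y\<in>words n d. ?\<delta> y x * v y)"
    by (simp only: left_diff_distrib sum_subtractf sum_distrib_left mult.assoc)
  also have "(\<Sum>y\<in>words n d. braid_op i (?\<delta> y) x * v y) = braid_op i v x" using linear_op_braid_op[OF i, of d] x unfolding linear_op_def by simp
  also have "(\<Sum>y\<in>words n d. ?\<delta> y x * v y) = v x" using x by (rule sum_delta_words)
  finally show "braid_op i v x - ?s * v x = (\<Sum>y\<in>words n d. (braid_op i (?\<delta> y) x - ?s * ?\<delta> y x) * v y)" by simp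
qed

lemma linear_op_frame_op: "linear_op d n (frame_op z j)"
  using linear_op_scale[of d n "\<lambda>x. z ^ (x j div 2)"] by (simp add: frame_op_def[abs_def])

lemma fb_gens_cases:
  assumes "l \<in> fb_gens n \<times> UNIV"
  obtains i e where "l = (Sgen (Suc i), e)" "Suc i < n" | j e where "l = (Tgen (Suc j), e)" "j < n"
proof -
  obtain g e where l: "l = (g, e)" by (cases l)
  show ?thesis
  proof (cases g)
    case (Sgen i)
    then show ?thesis using that(1)[of "i - 1" e] assms l by (auto simp: fb_gens_def)
  next
    case (Tgen j)
    then show ?thesis using that(2)[of "j - 1" e] assms l by (auto simp: fb_gens_def)
  qed
qed

lemma linear_op_letter_op: "l \<in> fb_gens n \<times> UNIV \<Longrightarrow> linear_op d n (letter_op d l)"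
  by (erule fb_gens_cases; hypsubst; case_tac e) (simp_all add: linear_op_braid_op linear_op_braid_inv_op linear_op_frame_op)

lemma uq_op_letter_op:
  assumes g: "g \<in> gl2_gens" and l: "l \<in> fb_gens n \<times> UNIV"
  shows "uq_op n c g (letter_op d l v) x = letter_op d l (uq_op n c g v) x"
  using l
proof (cases rule: fb_gens_cases)
  case (1 i e)
  show ?thesis
  proof (cases e)
    case True
    then show ?thesis using uq_op_braid_op[OF 1(2) g] 1 by simp
  next
    case False
    have f: "braid_op i (braid_inv_op i v) = v" for v by (rule ext) (rule braid_inv_op_braid_op)
    have "uq_op n c g v = braid_op i (uq_op n c g (braid_inv_op i v))" using uq_op_braid_op[OF 1(2) g, of c "braid_inv_op i v"] f by (simp add: fun_eq_iff)
    then have "braid_inv_op i (uq_op n c g v) x = braid_inv_op i (braid_op i (uq_op n c g (braid_inv_op i v))) x" by simp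
    then show ?thesis using False 1 by (simp add: braid_inv_op_braid_op)
  qed
next
  case (2 j e)
  then show ?thesis using uq_op_frame_op[OF g] by (cases e) simp_all
qed

section \<open>The representation of the framed braid group\<close>

context
  fixes d n :: nat
  assumes d1: "d \<ge> 1"
begin

abbreviation (input) "NN \<equiv> (2 * d) ^ n"

definition word_rep :: "fb_gen gword \<Rightarrow> Cq mat" where
  "word_rep = word_lift (mat_alg NN) (\<lambda>l. op_mat d n (letter_op d l))"

lemma word_rep_carrier [simp]: "word_rep w \<in> carrier_mat NN NN"
  unfolding word_rep_def by (rule word_lift_mat_carrier) (rule op_mat_carrier)

lemma word_rep_append: "word_rep (u @ v) = word_rep u * word_rep v"
  unfolding word_rep_def by (rule word_lift_mat_append) (rule op_mat_carrier)

lemma word_rep_Nil: "word_rep [] = 1\<^sub>m NN"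
  by (simp add: word_rep_def word_lift_def)

lemma word_rep_Cons: "word_rep (l # w) = op_mat d n (letter_op d l) * word_rep w"
  by (simp add: word_rep_def word_lift_def)

lemma word_rep_act:
  assumes "w \<in> lists (fb_gens n \<times> UNIV)" "x \<in> words n d"
  shows "mat_act d n (word_rep w) v x = foldr (letter_op d) w v x"
  using assms
proof (induction w arbitrary: x rule: list.induct)
  case Nil
  then show ?case by (simp add: word_rep_Nil mat_act_one)
next
  case (Cons l w)
  then have l: "l \<in> fb_gens n \<times> UNIV" and w: "w \<in> lists (fb_gens n \<times> UNIV)" by auto
  have "mat_act d n (word_rep (l # w)) v x = mat_act d n (op_mat d n (letter_op d l)) (\<lambda>y. mat_act d n (word_rep w) v y) x"
    unfolding word_rep_Cons by (rule mat_act_mat_mult[OF op_mat_carrier word_rep_carrier Cons.prems(2)])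
  also have "\<dots> = mat_act d n (op_mat d n (letter_op d l)) (foldr (letter_op d) w v) x"
    by (rule mat_act_cong) (rule Cons.IH[OF w])
  also have "\<dots> = letter_op d l (foldr (letter_op d) w v) x" by (rule mat_act_op_mat[OF linear_op_letter_op[OF l] Cons.prems(2)])
  finally show ?case by simp
qed

lemma word_rep_eqI:
  assumes "u \<in> lists (fb_gens n \<times> UNIV)" "v \<in> lists (fb_gens n \<times> UNIV)"
    and "\<And>f x. foldr (letter_op d) u f x = foldr (letter_op d) v f x"
  shows "word_rep u = word_rep v"
  by (rule mat_act_eqI[OF word_rep_carrier word_rep_carrier]) (simp add: word_rep_act assms)

lemma fb_rels_lists: "fb_rels d n \<subseteq> lists (fb_gens n \<times> UNIV) \<times> lists (fb_gens n \<times> UNIV)"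
  unfolding fb_rels_def
  by (auto simp: fb_gens_def Transposition.transpose_def image_iff)

interpretation P: presentation "fb_gens n" "fb_rels d n"
  by standard (rule fb_rels_lists)

lemma letter_op_replicate_T:
  "foldr (letter_op d) (replicate k (Tgen (Suc j), True)) v x = (zeta d ^ (x j div 2)) ^ k * v x"
  "foldr (letter_op d) (replicate k (Tgen (Suc j), False)) v x = (inverse (zeta d) ^ (x j div 2)) ^ k * v x"
  by (induction k) (simp_all add: frame_op_def mult.assoc)

lemma word_rep_rel:
  assumes "(r, r') \<in> fb_rels d n"
  shows "word_rep r = word_rep r'"
proof (rule word_rep_eqI)
  show "r \<in> lists (fb_gens n \<times> UNIV)" "r' \<in> lists (fb_gens n \<times> UNIV)" using fb_rels_lists assms by auto
  fix v x
  from assms show "foldr (letter_op d) r v x = foldr (letter_op d) r' v x"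
    unfolding fb_rels_def
  proof (elim UnE)
    assume "(r, r') \<in> {(s_word i @ s_word j, s_word j @ s_word i) | i j.
        i \<in> {1..<n} \<and> j \<in> {1..<n} \<and> \<bar>int i - int j\<bar> > 1}"
    then obtain i j where r: "r = s_word i @ s_word j" "r' = s_word j @ s_word i" and ij: "i \<in> {1..<n}" "j \<in> {1..<n}" "\<bar>int i - int j\<bar> > 1" by blast
    have "Suc (i - 1) < j - 1 \<or> Suc (j - 1) < i - 1" using ij by auto
    then show ?thesis unfolding r using braid_op_far[of "i - 1" "j - 1" v x] braid_op_far[of "j - 1" "i - 1" v x] by auto
  next
    assume "(r, r') \<in> {(s_word i @ s_word j @ s_word i, s_word j @ s_word i @ s_word j) | i j.
        i \<in> {1..<n} \<and> j \<in> {1..<n} \<and> \<bar>int i - int j\<bar> = 1}"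
    then obtain i j where r: "r = s_word i @ s_word j @ s_word i" "r' = s_word j @ s_word i @ s_word j"
      and ij: "i \<in> {1..<n}" "j \<in> {1..<n}" "\<bar>int i - int j\<bar> = 1" by blast
    have "j - 1 = Suc (i - 1) \<or> i - 1 = Suc (j - 1)" using ij by auto
    then show ?thesis unfolding r using braid_op_braid[of "i - 1" v x] braid_op_braid[of "j - 1" v x] by auto
  next
    assume "(r, r') \<in> {(replicate d (Tgen j, True), []) | j. j \<in> {1..n}}"
    then obtain j where r: "r = replicate d (Tgen j, True)" "r' = []" and j: "j \<in> {1..n}" by blast
    obtain j' where j': "j = Suc j'" using j by (cases j) auto
    have "(zeta d ^ (x j' div 2)) ^ d = 1"
      unfolding power_mult[symmetric] mult.commute[of _ d] power_mult zeta_power_d[OF d1] by simp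
    then show ?thesis unfolding r j' letter_op_replicate_T by simp
  next
    assume "(r, r') \<in> {(t_word i @ t_word j, t_word j @ t_word i) | i j. i \<in> {1..n} \<and> j \<in> {1..n}}"
    then obtain i j where r: "r = t_word i @ t_word j" "r' = t_word j @ t_word i" by blast
    show ?thesis unfolding r by (simp add: frame_op_frame_op)
  next
    assume "(r, r') \<in> {(s_word i @ t_word j, t_word (Transposition.transpose i (i + 1) j) @ s_word i) | i j.
        i \<in> {1..<n} \<and> j \<in> {1..n}}"
    then obtain i j where r: "r = s_word i @ t_word j" "r' = t_word (Transposition.transpose i (i + 1) j) @ s_word i"
      and ij: "i \<in> {1..<n}" "j \<in> {1..n}" by blast
    obtain i' j' where ij': "i = Suc i'" "j = Suc j'" using ij by (cases i; cases j) auto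
    have "Transposition.transpose i (i + 1) j - 1 = adj i' j'"
      by (auto simp: ij' Transposition.transpose_def)
    then show ?thesis unfolding r by (simp add: braid_op_frame_op ij')
  qed
qed

lemma word_rep_cancel: "l \<in> fb_gens n \<Longrightarrow> word_rep [(l, e), (l, \<not> e)] = word_rep []"
proof (rule word_rep_eqI)
  assume l: "l \<in> fb_gens n"
  then show "[(l, e), (l, \<not> e)] \<in> lists (fb_gens n \<times> UNIV)" by simp
  fix v x
  show "foldr (letter_op d) [(l, e), (l, \<not> e)] v x = foldr (letter_op d) [] v x"
    by (cases l; cases e) (simp_all add: braid_inv_op_braid_op frame_op_inverse)
qed simp

lemma word_rep_invariant: "P.eqp u v \<Longrightarrow> word_rep u = word_rep v"
proof (rule P.invariant[of word_rep])
  show "word_rep (u @ [(x, e), (x, \<not> e)] @ v) = word_rep (u @ v)" if "x \<in> fb_gens n" for x e u v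
    using word_rep_cancel[OF that, of e] by (simp only: word_rep_append word_rep_Nil left_mult_one_mat[OF word_rep_carrier])
  show "word_rep (u @ r @ v) = word_rep (u @ r' @ v)" if "(r, r') \<in> fb_rels d n" for r r' u v
    using word_rep_rel[OF that] by (simp only: word_rep_append)
qed

text \<open>By \<open>word_rep_invariant\<close> the matrix does not depend on the chosen
  representative.\<close>

definition class_rep :: "fb_gen gword set \<Rightarrow> Cq mat" where
  "class_rep X = word_rep (SOME u. u \<in> X)"

lemma class_rep_cls: "u \<in> P.L \<Longrightarrow> class_rep (P.cls u) = word_rep u"
proof -
  assume u: "u \<in> P.L"
  have "(SOME v. v \<in> P.cls u) \<in> P.cls u" by (rule someI[of _ u]) (rule P.cls_self[OF u])
  then have "P.eqp u (SOME v. v \<in> P.cls u)" by (simp add: pres_class_def)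
  then show ?thesis unfolding class_rep_def using word_rep_invariant by metis
qed

lemma monoid_FB: "Group.monoid (framed_braid_group d n)"
  using P.group_G by (rule group.is_monoid)

interpretation A: kalgebra "fb_alg d n"
  by (rule kalgebra_monoid_alg[OF monoid_FB])
interpretation MA: kalgebra "mat_alg NN"
  by (rule kalgebra_mat)

definition fb_rep :: "fb_elt \<Rightarrow> Cq mat" where
  "fb_rep = mlin NN class_rep"

lemma fb_rep_carrier [simp]: "fb_rep a \<in> carrier_mat NN NN" by (simp add: fb_rep_def)

lemma fb_rep_hom: "fb_rep \<in> alg_hom (fb_alg d n) (mat_alg NN)"
  unfolding fb_rep_def
proof (rule mlin_alg_hom[OF monoid_FB])
  show "class_rep g \<in> carrier_mat NN NN" for g by (simp add: class_rep_def)
  show "class_rep (g \<otimes>\<^bsub>P.G\<^esub> h) = class_rep g * class_rep h" if gh: "g \<in> carrier P.G" "h \<in> carrier P.G" for g h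
  proof -
    from gh obtain u v where uv: "u \<in> P.L" "g = P.cls u" "v \<in> P.L" "h = P.cls v" by (auto simp: P.carrier_G)
    then have "u @ v \<in> P.L" by simp
    then show ?thesis unfolding uv(2,4) P.cls_mult[OF uv(1,3)] by (simp only: class_rep_cls uv(1,3) word_rep_append)
  qed
  show "class_rep \<one>\<^bsub>P.G\<^esub> = 1\<^sub>m NN" by (simp add: P.one_G class_rep_cls word_rep_Nil)
qed

lemma fb_rep_act: "mat_act d n (fb_rep a) v x = lin (\<lambda>g. mat_act d n (class_rep g) v x) a" if "x \<in> words n d"
  unfolding mat_act_def lin_fun_sum
  by (rule sum.cong) (simp_all add: fb_rep_def mlin_def word_index_less that lin_fun_scale)

lemma class_rep_act: "u \<in> P.L \<Longrightarrow> x \<in> words n d \<Longrightarrow> mat_act d n (class_rep (P.cls u)) v x = foldr (letter_op d) u v x"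
  by (simp add: class_rep_cls word_rep_act)

lemma word_rep_commute:
  assumes "w \<in> P.L" "z \<in> uq_gens d"
  shows "word_rep w * uq_tensor d n z = uq_tensor d n z * word_rep w"
proof -
  obtain c g where z: "z = (Suc c, g)" "c < d" "g \<in> gl2_gens"
    using assms(2) by (cases z, cases "fst z") (auto simp: uq_gens_def)
  have zc: "uq_tensor d n z \<in> carrier_mat NN NN" by (rule uq_tensor_carrier[OF assms(2)])
  have za: "mat_act d n (uq_tensor d n z) v x = uq_op n c g v x" if "x \<in> words n d" for v x
    unfolding z(1) using uq_tensor_act[OF z(2,3)] that by blast
  have f: "foldr (letter_op d) w (uq_op n c g v) x = uq_op n c g (foldr (letter_op d) w v) x" for v x
    using assms(1)
  proof (induction w arbitrary: x rule: list.induct)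
    case Nil
    show ?case by simp
  next
    case (Cons l w)
    then have l: "l \<in> fb_gens n \<times> UNIV" and w: "w \<in> P.L" by auto
    have "foldr (letter_op d) w (uq_op n c g v) = uq_op n c g (foldr (letter_op d) w v)" by (rule ext) (rule Cons.IH[OF w])
    then show ?case using uq_op_letter_op[OF z(3) l, of c d "foldr (letter_op d) w v"] by simp
  qed
  show ?thesis
  proof (rule mat_act_eqI[OF mult_carrier_mat[OF word_rep_carrier zc] mult_carrier_mat[OF zc word_rep_carrier]])
    fix v x assume x: "x \<in> words n d"
    have "mat_act d n (word_rep w * uq_tensor d n z) v x = mat_act d n (word_rep w) (\<lambda>y. mat_act d n (uq_tensor d n z) v y) x"
      by (rule mat_act_mat_mult[OF word_rep_carrier zc x])
    also have "\<dots> = mat_act d n (word_rep w) (uq_op n c g v) x" by (rule mat_act_cong) (rule za)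
    also have "\<dots> = uq_op n c g (foldr (letter_op d) w v) x" by (simp add: word_rep_act[OF assms(1) x] f)
    also have "\<dots> = mat_act d n (uq_tensor d n z) (foldr (letter_op d) w v) x" by (simp add: za[OF x])
    also have "\<dots> = mat_act d n (uq_tensor d n z) (\<lambda>y. mat_act d n (word_rep w) v y) x"
      by (rule mat_act_cong) (simp add: word_rep_act[OF assms(1)])
    also have "\<dots> = mat_act d n (uq_tensor d n z * word_rep w) v x"
      by (rule mat_act_mat_mult[OF zc word_rep_carrier x, symmetric])
    finally show "mat_act d n (word_rep w * uq_tensor d n z) v x = mat_act d n (uq_tensor d n z * word_rep w) v x" .
  qed
qed

lemma fb_rep_centralizer:
  assumes "a \<in> carrier (fb_alg d n)"
  shows "fb_rep a \<in> carrier (uq_centralizer d n)"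
proof -
  have sub: "g \<in> P.cls ` P.L" if "a g \<noteq> 0" for g using assms that by (auto simp: carrier_monoid_alg P.carrier_G)
  have "uq_tensor d n z * fb_rep a = fb_rep a * uq_tensor d n z" if z: "z \<in> uq_gens d" for z
    unfolding fb_rep_def
  proof (rule mlin_commute[OF uq_tensor_carrier[OF z]])
    fix g assume "a g \<noteq> 0"
    then obtain u where u: "u \<in> P.L" "g = P.cls u" using sub by blast
    show "class_rep g \<in> carrier_mat NN NN" "uq_tensor d n z * class_rep g = class_rep g * uq_tensor d n z"
      unfolding u(2) class_rep_cls[OF u(1)] using word_rep_commute[OF u(1) z] by simp_all
  qed
  then show ?thesis unfolding carrier_uq_centralizer by auto
qed

section \<open>Functionals evaluated at the relations of YH and FTL\<close>

lemma fin_supp: "a \<in> carrier (fb_alg d n) \<Longrightarrow> finite {x. a x \<noteq> 0}"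
  by (simp add: carrier_monoid_alg)

lemma fb_minus:
  assumes "a \<in> carrier (fb_alg d n)" "b \<in> carrier (fb_alg d n)"
  shows "a \<ominus>\<^bsub>fb_alg d n\<^esub> b = (\<lambda>x. a x + (- 1) * b x)"
proof -
  have "(- 1) \<odot>\<^bsub>fb_alg d n\<^esub> b \<in> carrier (fb_alg d n)" using assms(2) by (rule A.smult_closed)
  then have c: "(\<lambda>x. (- 1) * b x) \<in> carrier (fb_alg d n)" by (simp only: monoid_alg_simps)
  have "\<ominus>\<^bsub>fb_alg d n\<^esub> b = (\<lambda>x. (- 1) * b x)"
    by (rule A.minus_equality[OF _ assms(2) c]) simp
  then show ?thesis by (simp add: a_minus_def)
qed

text \<open>Evaluates functionals at algebraic expressions, so that the relations are handled
  through their values and never as explicit functions on the group.\<close>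

lemma lin_alg:
  assumes "a \<in> carrier (fb_alg d n)" "b \<in> carrier (fb_alg d n)"
  shows "lin G (a \<ominus>\<^bsub>fb_alg d n\<^esub> b) = lin G a - lin G b" "lin G (a \<oplus>\<^bsub>fb_alg d n\<^esub> b) = lin G a + lin G b"
    "lin G (s \<odot>\<^bsub>fb_alg d n\<^esub> a) = s * lin G a"
    "lin G (a \<otimes>\<^bsub>fb_alg d n\<^esub> b) = lin (\<lambda>x. lin (\<lambda>y. G (x \<otimes>\<^bsub>P.G\<^esub> y)) b) a"
proof -
  have "(- 1) \<odot>\<^bsub>fb_alg d n\<^esub> b \<in> carrier (fb_alg d n)" using assms(2) by (rule A.smult_closed)
  then have c: "(\<lambda>x. (- 1) * b x) \<in> carrier (fb_alg d n)" by (simp only: monoid_alg_simps)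
  show "lin G (a \<ominus>\<^bsub>fb_alg d n\<^esub> b) = lin G a - lin G b"
    unfolding fb_minus[OF assms] lin_add[OF fin_supp[OF assms(1)] fin_supp[OF c]] lin_scale by simp
  show "lin G (a \<oplus>\<^bsub>fb_alg d n\<^esub> b) = lin G a + lin G b"
    using lin_add[OF fin_supp[OF assms(1)] fin_supp[OF assms(2)]] by simp
  show "lin G (s \<odot>\<^bsub>fb_alg d n\<^esub> a) = s * lin G a" by (simp add: lin_scale)
  show "lin G (a \<otimes>\<^bsub>fb_alg d n\<^esub> b) = lin (\<lambda>x. lin (\<lambda>y. G (x \<otimes>\<^bsub>P.G\<^esub> y)) b) a"
    using lin_conv[OF fin_supp[OF assms(1)] fin_supp[OF assms(2)]] by simp
qed

text \<open>The word \<open>t_i^a t_{i+1}^{-a}\<close>, a summand of \<open>E_i\<close>; the index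
  \<open>i\<close> is that of the generators and starts from 1, while places start from 0.\<close>

definition eword :: "nat \<Rightarrow> nat \<Rightarrow> fb_gen gword" where
  "eword i a = replicate a (Tgen i, True) @ replicate a (Tgen (Suc i), False)"

lemma eword_L: "i \<in> {1..<n} \<Longrightarrow> eword i a \<in> P.L"
  by (auto simp: eword_def fb_gens_def in_lists_conv_set)

lemma t_pow_word:
  assumes i: "i \<in> {1..<n}"
  shows "fb_t d n i [^]\<^bsub>P.G\<^esub> a \<otimes>\<^bsub>P.G\<^esub> fb_t d n (i + 1) [^]\<^bsub>P.G\<^esub> (- int a) = P.cls (eword i a)"
proof -
  have t: "t_word i \<in> P.L" "t_word (i + 1) \<in> P.L" using i by (auto simp: fb_gens_def)
  have r: "concat (replicate a (t_word k)) = replicate a (Tgen k, True)" for k by (induction a) simp_all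
  have rl: "replicate a (Tgen i, True) \<in> P.L" "replicate a (Tgen (i + 1), True) \<in> P.L"
    using t by (auto simp: in_lists_conv_set)
  have c: "fb_t d n (i + 1) \<in> carrier P.G" unfolding fb_t_def P.carrier_G using t(2) by (rule imageI)
  have w: "P.winv (replicate a (Tgen (i + 1), True)) = replicate a (Tgen (Suc i), False)"
    by (simp add: P.winv_def)
  have "fb_t d n (i + 1) [^]\<^bsub>P.G\<^esub> (- int a) = m_inv P.G (fb_t d n (i + 1) [^]\<^bsub>P.G\<^esub> a)"
    by (rule group.int_pow_neg_int[OF P.group_G c])
  also have "\<dots> = P.cls (replicate a (Tgen (Suc i), False))"
    unfolding fb_t_def P.cls_pow[OF t(2)] r P.cls_inv[OF rl(2)] w ..
  finally have e: "fb_t d n (i + 1) [^]\<^bsub>P.G\<^esub> (- int a) = P.cls (replicate a (Tgen (Suc i), False))" .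
  have rl3: "replicate a (Tgen (Suc i), False) \<in> P.L" using t by (auto simp: in_lists_conv_set)
  show ?thesis unfolding e unfolding fb_t_def P.cls_pow[OF t(1)] r P.cls_mult[OF rl(1) rl3] eword_def ..
qed

lemma single_cls: "u \<in> P.L \<Longrightarrow> (single (P.cls u) :: fb_elt) \<in> carrier (fb_alg d n)"
  unfolding single_in_carrier P.carrier_G by (rule imageI)

lemma yh_E_sum:
  assumes i: "i \<in> {1..<n}" and "finite F"
  shows "(\<Oplus>\<^bsub>fb_alg d n\<^esub>a\<in>F. single (P.cls (eword i a))) \<in> carrier (fb_alg d n) \<and>
    lin G (\<Oplus>\<^bsub>fb_alg d n\<^esub>a\<in>F. single (P.cls (eword i a))) = (\<Sum>a\<in>F. G (P.cls (eword i a)))"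
  using \<open>finite F\<close>
proof (induction F)
  case empty
  have "lin G \<zero>\<^bsub>fb_alg d n\<^esub> = 0" unfolding monoid_alg_simps by (rule lin_zero)
  then show ?case using A.finsum_empty[of "\<lambda>a. single (P.cls (eword i a))"] A.zero_closed by simp
next
  case (insert a F)
  have c: "(\<lambda>a. single (P.cls (eword i a))) \<in> S \<rightarrow> carrier (fb_alg d n)" for S
    using single_cls[OF eword_L[OF i]] by blast
  have s: "single (P.cls (eword i a)) \<in> carrier (fb_alg d n)" by (rule single_cls[OF eword_L[OF i]])
  have e: "(\<Oplus>\<^bsub>fb_alg d n\<^esub>a\<in>insert a F. single (P.cls (eword i a))) = single (P.cls (eword i a)) \<oplus>\<^bsub>fb_alg d n\<^esub> (\<Oplus>\<^bsub>fb_alg d n\<^esub>a\<in>F. single (P.cls (eword i a)))"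
    by (rule A.finsum_insert[OF insert.hyps c s])
  show ?case unfolding e using lin_alg(2)[OF s conjunct1[OF insert.IH], of G] insert A.a_closed[OF s conjunct1[OF insert.IH]] by simp
qed

lemma yh_E_eq: "i \<in> {1..<n} \<Longrightarrow> yh_E d n i = (1 / of_nat d) \<odot>\<^bsub>fb_alg d n\<^esub> (\<Oplus>\<^bsub>fb_alg d n\<^esub>a\<in>{1..d}. single (P.cls (eword i a)))"
  unfolding yh_E_def by (simp only: t_pow_word)

lemma yh_E_carrier: "i \<in> {1..<n} \<Longrightarrow> yh_E d n i \<in> carrier (fb_alg d n)"
  unfolding yh_E_eq using yh_E_sum[of i "{1..d}"] by (intro A.smult_closed) simp

lemma lin_yh_E: "i \<in> {1..<n} \<Longrightarrow> lin G (yh_E d n i) = (1 / of_nat d) * (\<Sum>a\<in>{1..d}. G (P.cls (eword i a)))"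
proof -
  assume i: "i \<in> {1..<n}"
  note e = yh_E_sum[OF i finite_atLeastAtMost[of 1 d], of G]
  show ?thesis unfolding yh_E_eq[OF i] lin_alg(3)[OF conjunct1[OF e] conjunct1[OF e]] conjunct2[OF e] ..
qed

definition yh_rel :: "nat \<Rightarrow> fb_elt" where
  "yh_rel i = (let A = fb_alg d n; s = (\<lambda>i. single (fb_s d n i)) in
     s i [^]\<^bsub>A\<^esub> (2::nat) \<ominus>\<^bsub>A\<^esub> ((q - inverse q) \<odot>\<^bsub>A\<^esub> (yh_E d n i \<otimes>\<^bsub>A\<^esub> s i) \<oplus>\<^bsub>A\<^esub> \<one>\<^bsub>A\<^esub>))"

lemma yh_rels_eq: "yh_rels d n = yh_rel ` {1..<n}"
  unfolding yh_rels_def yh_rel_def Let_def by blast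

lemma s_word_L: "i \<in> {1..<n} \<Longrightarrow> s_word i \<in> P.L"
  by (auto simp: fb_gens_def)

lemma s_carrier: "i \<in> {1..<n} \<Longrightarrow> (single (fb_s d n i) :: fb_elt) \<in> carrier (fb_alg d n)"
  unfolding fb_s_def using s_word_L by (rule single_cls)

lemma one_fb: "\<one>\<^bsub>fb_alg d n\<^esub> = single (P.cls [])"
  by (simp add: P.one_G)

lemma yh_rel_carrier:
  assumes i: "i \<in> {1..<n}"
  shows "yh_rel i \<in> carrier (fb_alg d n)"
  unfolding yh_rel_def Let_def
  by (intro A.minus_closed A.a_closed A.smult_closed A.m_closed A.nat_pow_closed A.one_closed s_carrier yh_E_carrier i)

lemma lin_yh_rel:
  assumes i: "i \<in> {1..<n}"
  shows "lin H (yh_rel i) = H (P.cls (s_word i @ s_word i)) -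
    ((q - inverse q) * ((1 / of_nat d) * (\<Sum>a\<in>{1..d}. H (P.cls (eword i a @ s_word i)))) + H (P.cls []))"
proof -
  note s = s_carrier[OF i] and E = yh_E_carrier[OF i]
  note Es = A.m_closed[OF E s] and ss = A.nat_pow_closed[OF s, of 2]
  have sq: "single (fb_s d n i) [^]\<^bsub>fb_alg d n\<^esub> (2::nat) = single (fb_s d n i) \<otimes>\<^bsub>fb_alg d n\<^esub> single (fb_s d n i)"
    using A.nat_pow_Suc[of "single (fb_s d n i)" 1] A.nat_pow_Suc[of "single (fb_s d n i)" 0] A.l_one[OF s]
    by (simp add: numeral_2_eq_2)
  have "lin H (yh_rel i) = lin H (single (fb_s d n i) \<otimes>\<^bsub>fb_alg d n\<^esub> single (fb_s d n i)) -
     ((q - inverse q) * lin H (yh_E d n i \<otimes>\<^bsub>fb_alg d n\<^esub> single (fb_s d n i)) + lin H \<one>\<^bsub>fb_alg d n\<^esub>)"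
    unfolding yh_rel_def Let_def lin_alg(1)[OF ss A.a_closed[OF A.smult_closed[OF Es] A.one_closed]]
      lin_alg(2)[OF A.smult_closed[OF Es] A.one_closed] lin_alg(3)[OF Es Es] unfolding sq ..
  also have "lin H (single (fb_s d n i) \<otimes>\<^bsub>fb_alg d n\<^esub> single (fb_s d n i)) = H (P.cls (s_word i @ s_word i))"
    unfolding lin_alg(4)[OF s s] lin_single unfolding fb_s_def P.cls_mult[OF s_word_L[OF i] s_word_L[OF i]] ..
  also have "lin H (yh_E d n i \<otimes>\<^bsub>fb_alg d n\<^esub> single (fb_s d n i)) = (1 / of_nat d) * (\<Sum>a\<in>{1..d}. H (P.cls (eword i a @ s_word i)))"
    unfolding lin_alg(4)[OF E s] lin_single lin_yh_E[OF i] unfolding fb_s_def P.cls_mult[OF eword_L[OF i] s_word_L[OF i]] ..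
  also have "lin H \<one>\<^bsub>fb_alg d n\<^esub> = H (P.cls [])" unfolding one_fb lin_single ..
  finally show ?thesis .
qed

text \<open>The summands act by the powers of one root of unity whose exponent is the difference of
  the two colours; their mean is 1 or 0.\<close>

lemma eword_act:
  assumes "i < n" "Suc i < n" "x \<in> words n d"
  shows "(1 / of_nat d) * (\<Sum>a\<in>{1..d}. foldr (letter_op d) (eword (Suc i) a) v x) = (if x i div 2 = x (Suc i) div 2 then v x else 0)"
proof -
  have lt: "x i div 2 < d" "x (Suc i) div 2 < d" using assms by (auto simp: words_def less_mult_imp_div_less mult.commute)
  have "(\<Sum>a\<in>{1..d}. foldr (letter_op d) (eword (Suc i) a) v x) =
     (\<Sum>a\<in>{1..d}. (zeta d ^ (x i div 2)) ^ a * (inverse (zeta d) ^ (x (Suc i) div 2)) ^ a) * v x"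
    unfolding eword_def foldr_append comp_apply letter_op_replicate_T sum_distrib_right by (simp only: mult.assoc)
  then show ?thesis unfolding zeta_sum[OF lt] using of_nat_Cq_nonzero[OF d1] by simp
qed

lemma fb_rep_yh_rel:
  assumes i: "i \<in> {1..<n}"
  shows "fb_rep (yh_rel i) = 0\<^sub>m NN NN"
proof (rule mat_act_eqI[OF fb_rep_carrier zero_carrier_mat])
  fix v x assume x: "x \<in> words n d"
  obtain k where k: "i = Suc k" "Suc k < n" using i by (cases i) auto
  have l: "s_word i @ s_word i \<in> P.L" "eword i a @ s_word i \<in> P.L" "[] \<in> P.L" for a
    using s_word_L[OF i] eword_L[OF i] by (simp_all del: append_Cons)
  have "(1 / of_nat d) * (\<Sum>a\<in>{1..d}. foldr (letter_op d) (eword i a @ s_word i) v x) = (if x k div 2 = x (Suc k) div 2 then braid_op k v x else 0)"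
    using eword_act[of k x "braid_op k v"] k x by (simp add: foldr_append)
  then show "mat_act d n (fb_rep (yh_rel i)) v x = mat_act d n (0\<^sub>m NN NN) v x"
    unfolding fb_rep_act[OF x] lin_yh_rel[OF i] class_rep_act[OF l(1) x] class_rep_act[OF l(2) x] class_rep_act[OF l(3) x]
      mat_act_arith(4)[OF zero_carrier_mat zero_carrier_mat x]
    by (simp add: k(1) braid_op_quadratic)
qed

text \<open>The FTL relation is stated in \<open>YH\<close>. This is its lift to the group algebra,
  where functionals and \<open>fb_rep\<close> can be evaluated.\<close>

definition ftl_elt :: fb_elt where
  "ftl_elt = (let A = fb_alg d n; s = (\<lambda>i. single (fb_s d n i)); E = yh_E d n in
     E 1 \<otimes>\<^bsub>A\<^esub> E 2 \<otimes>\<^bsub>A\<^esub>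
       (\<one>\<^bsub>A\<^esub> \<ominus>\<^bsub>A\<^esub> inverse q \<odot>\<^bsub>A\<^esub> s 1 \<ominus>\<^bsub>A\<^esub> inverse q \<odot>\<^bsub>A\<^esub> s 2
        \<oplus>\<^bsub>A\<^esub> inverse (q ^ 2) \<odot>\<^bsub>A\<^esub> (s 1 \<otimes>\<^bsub>A\<^esub> s 2)
        \<oplus>\<^bsub>A\<^esub> inverse (q ^ 2) \<odot>\<^bsub>A\<^esub> (s 2 \<otimes>\<^bsub>A\<^esub> s 1)
        \<ominus>\<^bsub>A\<^esub> inverse (q ^ 3) \<odot>\<^bsub>A\<^esub> (s 1 \<otimes>\<^bsub>A\<^esub> s 2 \<otimes>\<^bsub>A\<^esub> s 1)))"

lemma
  assumes n: "n > 2"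
  shows ftl_elt_carrier: "ftl_elt \<in> carrier (fb_alg d n)"
    and lin_ftl_elt: "lin H ftl_elt = (1 / of_nat d) * (\<Sum>a\<in>{1..d}. (1 / of_nat d) * (\<Sum>b\<in>{1..d}.
      (let K = (\<lambda>w. H (P.cls (eword 1 a @ eword 2 b @ w))) in
        K [] - inverse q * K (s_word 1) - inverse q * K (s_word 2) + inverse (q ^ 2) * K (s_word 1 @ s_word 2)
          + inverse (q ^ 2) * K (s_word 2 @ s_word 1) - inverse (q ^ 3) * K (s_word 1 @ s_word 2 @ s_word 1))))"
proof -
  have i: "1 \<in> {1..<n}" "2 \<in> {1..<n}" using n by auto
  note s1 = s_carrier[OF i(1)] and s2 = s_carrier[OF i(2)] and E1 = yh_E_carrier[OF i(1)] and E2 = yh_E_carrier[OF i(2)]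
  note s12 = A.m_closed[OF s1 s2] and s21 = A.m_closed[OF s2 s1]
  note s121 = A.m_closed[OF s12 s1] and E12 = A.m_closed[OF E1 E2]
  note c1 = A.minus_closed[OF A.one_closed A.smult_closed[OF s1, of "inverse q"]]
  note c2 = A.minus_closed[OF c1 A.smult_closed[OF s2, of "inverse q"]]
  note c3 = A.a_closed[OF c2 A.smult_closed[OF s12, of "inverse (q ^ 2)"]]
  note c4 = A.a_closed[OF c3 A.smult_closed[OF s21, of "inverse (q ^ 2)"]]
  note c5 = A.minus_closed[OF c4 A.smult_closed[OF s121, of "inverse (q ^ 3)"]]
  show "ftl_elt \<in> carrier (fb_alg d n)" unfolding ftl_elt_def Let_def by (rule A.m_closed[OF E12 c5])
  note w = s_word_L[OF i(1)] s_word_L[OF i(2)]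
  have l: "s_word 1 @ s_word 2 \<in> P.L" "s_word 2 @ s_word 1 \<in> P.L" "(s_word 1 @ s_word 2) @ s_word 1 \<in> P.L" "[] \<in> P.L"
    using w by simp_all
  have X: "lin F (\<one>\<^bsub>fb_alg d n\<^esub> \<ominus>\<^bsub>fb_alg d n\<^esub> inverse q \<odot>\<^bsub>fb_alg d n\<^esub> single (fb_s d n 1) \<ominus>\<^bsub>fb_alg d n\<^esub> inverse q \<odot>\<^bsub>fb_alg d n\<^esub> single (fb_s d n 2)
        \<oplus>\<^bsub>fb_alg d n\<^esub> inverse (q ^ 2) \<odot>\<^bsub>fb_alg d n\<^esub> (single (fb_s d n 1) \<otimes>\<^bsub>fb_alg d n\<^esub> single (fb_s d n 2))
        \<oplus>\<^bsub>fb_alg d n\<^esub> inverse (q ^ 2) \<odot>\<^bsub>fb_alg d n\<^esub> (single (fb_s d n 2) \<otimes>\<^bsub>fb_alg d n\<^esub> single (fb_s d n 1))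
        \<ominus>\<^bsub>fb_alg d n\<^esub> inverse (q ^ 3) \<odot>\<^bsub>fb_alg d n\<^esub> (single (fb_s d n 1) \<otimes>\<^bsub>fb_alg d n\<^esub> single (fb_s d n 2) \<otimes>\<^bsub>fb_alg d n\<^esub> single (fb_s d n 1)))
     = F (P.cls []) - inverse q * F (P.cls (s_word 1)) - inverse q * F (P.cls (s_word 2)) + inverse (q ^ 2) * F (P.cls (s_word 1 @ s_word 2))
          + inverse (q ^ 2) * F (P.cls (s_word 2 @ s_word 1)) - inverse (q ^ 3) * F (P.cls ((s_word 1 @ s_word 2) @ s_word 1))" for F
    unfolding lin_alg(1)[OF c4 A.smult_closed[OF s121]] lin_alg(2)[OF c3 A.smult_closed[OF s21]] lin_alg(2)[OF c2 A.smult_closed[OF s12]]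
      lin_alg(1)[OF c1 A.smult_closed[OF s2]] lin_alg(1)[OF A.one_closed A.smult_closed[OF s1]]
      lin_alg(3)[OF s1 s1] lin_alg(3)[OF s2 s2] lin_alg(3)[OF s12 s12] lin_alg(3)[OF s21 s21] lin_alg(3)[OF s121 s121]
      lin_alg(4)[OF s12 s1] lin_alg(4)[OF s1 s2] lin_alg(4)[OF s2 s1] lin_single
    unfolding one_fb lin_single fb_s_def P.cls_mult[OF w(1) w(2)] P.cls_mult[OF w(2) w(1)] P.cls_mult[OF l(1) w(1)] ..
  have el: "eword 1 a @ eword 2 b \<in> P.L" for a b using eword_L[OF i(1)] eword_L[OF i(2)] by simp
  show "lin H ftl_elt = (1 / of_nat d) * (\<Sum>a\<in>{1..d}. (1 / of_nat d) * (\<Sum>b\<in>{1..d}.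
      (let K = (\<lambda>w. H (P.cls (eword 1 a @ eword 2 b @ w))) in
        K [] - inverse q * K (s_word 1) - inverse q * K (s_word 2) + inverse (q ^ 2) * K (s_word 1 @ s_word 2)
          + inverse (q ^ 2) * K (s_word 2 @ s_word 1) - inverse (q ^ 3) * K (s_word 1 @ s_word 2 @ s_word 1))))"
    unfolding ftl_elt_def Let_def lin_alg(4)[OF E12 c5] lin_alg(4)[OF E1 E2] X lin_yh_E[OF i(1)] lin_yh_E[OF i(2)]
      P.cls_mult[OF eword_L[OF i(1)] eword_L[OF i(2)]]
      P.cls_mult[OF el w(1)] P.cls_mult[OF el w(2)] P.cls_mult[OF el l(1)] P.cls_mult[OF el l(2)] P.cls_mult[OF el l(3)] P.cls_mult[OF el l(4)]
    unfolding append_assoc ..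
qed

text \<open>The alternating sum \<open>Y\<close> of crossings is collected inside the two averages.
  These project to the words whose first three letters have one colour, and there \<open>Y\<close>
  vanishes by \<open>braid_op_cubic\<close>.\<close>

lemma fb_rep_ftl_elt:
  assumes n: "n > 2"
  shows "fb_rep ftl_elt = 0\<^sub>m NN NN"
proof (rule mat_act_eqI[OF fb_rep_carrier zero_carrier_mat])
  fix v x assume x: "x \<in> words n d"
  have i: "1 \<in> {1..<n}" "2 \<in> {1..<n}" using n by auto
  note w = s_word_L[OF i(1)] s_word_L[OF i(2)]
  have l: "eword 1 a @ eword 2 b @ u \<in> P.L" if "u \<in> P.L" for a b u using that eword_L[OF i(1)] eword_L[OF i(2)] by simp
  have l1: "s_word 1 @ s_word 2 \<in> P.L" "s_word 2 @ s_word 1 \<in> P.L" "s_word 1 @ s_word 2 @ s_word 1 \<in> P.L" "[] \<in> P.L"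
    using w by simp_all
  have l0: "eword 1 a @ eword 2 b \<in> P.L" for a b using l[OF l1(4)] by (simp only: append_Nil2)
  define Y where "Y = (\<lambda>x. v x - inverse q * braid_op 0 v x - inverse q * braid_op 1 v x + inverse (q ^ 2) * braid_op 0 (braid_op 1 v) x
    + inverse (q ^ 2) * braid_op 1 (braid_op 0 v) x - inverse (q ^ 3) * braid_op 0 (braid_op 1 (braid_op 0 v)) x)"
  have ee: "foldr (letter_op d) (eword (Suc k) a) u x = (zeta d ^ (x k div 2)) ^ a * ((inverse (zeta d) ^ (x (Suc k) div 2)) ^ a * u x)" for k a u x
    unfolding eword_def foldr_append comp_apply letter_op_replicate_T ..
  have Yab: "foldr (letter_op d) (eword 1 a @ eword 2 b) v x - inverse q * foldr (letter_op d) (eword 1 a @ eword 2 b @ s_word 1) v x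
      - inverse q * foldr (letter_op d) (eword 1 a @ eword 2 b @ s_word 2) v x + inverse (q ^ 2) * foldr (letter_op d) (eword 1 a @ eword 2 b @ s_word 1 @ s_word 2) v x
      + inverse (q ^ 2) * foldr (letter_op d) (eword 1 a @ eword 2 b @ s_word 2 @ s_word 1) v x
      - inverse (q ^ 3) * foldr (letter_op d) (eword 1 a @ eword 2 b @ s_word 1 @ s_word 2 @ s_word 1) v x = foldr (letter_op d) (eword 1 a) (foldr (letter_op d) (eword 2 b) Y) x" for a b
    unfolding foldr_append comp_apply foldr.simps id_apply letter_op.simps One_nat_def numeral_2_eq_2 ee Y_def
    by (simp add: algebra_simps)
  have "mat_act d n (fb_rep ftl_elt) v x = (1 / of_nat d) * (\<Sum>a\<in>{1..d}. (1 / of_nat d) * (\<Sum>b\<in>{1..d}. foldr (letter_op d) (eword 1 a) (foldr (letter_op d) (eword 2 b) Y) x))"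
    unfolding fb_rep_act[OF x] lin_ftl_elt[OF n] Let_def class_rep_act[OF l[OF l1(1)] x] class_rep_act[OF l[OF l1(2)] x] class_rep_act[OF l[OF l1(3)] x]
      class_rep_act[OF l[OF l1(4)] x] class_rep_act[OF l[OF w(1)] x] class_rep_act[OF l[OF w(2)] x] append_Nil2 class_rep_act[OF l0 x] Yab ..
  also have "\<dots> = (1 / of_nat d) * (\<Sum>a\<in>{1..d}. foldr (letter_op d) (eword (Suc 0) a) (\<lambda>x. (1 / of_nat d) * (\<Sum>b\<in>{1..d}. foldr (letter_op d) (eword (Suc (Suc 0)) b) Y x)) x)"
    unfolding One_nat_def numeral_2_eq_2 ee by (simp only: sum_distrib_left) (simp add: algebra_simps)
  also have "\<dots> = (if x 0 div 2 = x 1 div 2 then (1 / of_nat d) * (\<Sum>b\<in>{1..d}. foldr (letter_op d) (eword (Suc (Suc 0)) b) Y x) else 0)"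
    using eword_act[of 0 x] n x by simp
  also have "\<dots> = (if x 0 div 2 = x 1 div 2 then if x 1 div 2 = x 2 div 2 then Y x else 0 else 0)"
    using eword_act[of 1 x Y] n x by (simp add: numeral_2_eq_2)
  also have "\<dots> = 0"
    using braid_op_cubic[of x 0 "x 0 div 2" v] by (simp add: Y_def numeral_2_eq_2)
  finally show "mat_act d n (fb_rep ftl_elt) v x = mat_act d n (0\<^sub>m NN NN) v x"
    using mat_act_arith(4)[OF zero_carrier_mat zero_carrier_mat x] by simp
qed

end

section \<open>Functionals vanishing on the defining relations\<close>

abbreviation (input) "SL i \<equiv> (Sgen (Suc i), True)"
abbreviation (input) "TL j \<equiv> (Tgen (Suc j), True)"

definition sword :: "nat list \<Rightarrow> fb_gen gword" where
  "sword = map (\<lambda>i. SL i)"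

lemma sword_simps [simp]: "sword [] = []" "sword (i # w) = SL i # sword w" "sword (u @ v) = sword u @ sword v"
  by (simp_all add: sword_def)

lemma SL_gens: "Suc i < n \<Longrightarrow> (Sgen (Suc i), e) \<in> fb_gens n \<times> UNIV"
  and TL_gens: "j < n \<Longrightarrow> (Tgen (Suc j), e) \<in> fb_gens n \<times> UNIV"
  by (auto simp: fb_gens_def)

lemma sword_L: "wletters n us \<Longrightarrow> sword us \<in> lists (fb_gens n \<times> UNIV)"
  by (induction us) (auto simp: fb_gens_def)

text \<open>If \<open>F (Suc d) = F 1\<close>, as for powers of an element whose order divides
  \<open>d\<close>, a sum over \<open>1..d\<close> is unchanged by a shift of its index.\<close>

lemma sum_shift_wrap: "(\<Sum>a\<in>{1..d}. F (Suc a)) + F 1 = (\<Sum>a\<in>{1..d}. F a) + (F (Suc d) :: 'a::comm_monoid_add)"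
proof (induction d)
  case (Suc d)
  have "(\<Sum>a\<in>{1..Suc d}. F (Suc a)) + F 1 = F (Suc (Suc d)) + ((\<Sum>a\<in>{1..d}. F (Suc a)) + F 1)"
    by (simp add: ac_simps)
  also have "\<dots> = (\<Sum>a\<in>{1..Suc d}. F a) + F (Suc (Suc d))" unfolding Suc.IH by (simp add: ac_simps)
  finally show ?case .
qed simp

text \<open>The other orthogonality relation, summing over the characters: only the identity
  survives, which in the range \<open>1..d\<close> is \<open>a = d\<close>.\<close>

lemma zeta_dual_sum:
  assumes "a \<in> {1..d}"
  shows "(\<Sum>c<d. inverse (zeta d ^ c) ^ a) = (if a = d then of_nat d else 0)"
proof (cases "a = d")
  case True
  have "inverse (zeta d ^ c) ^ d = 1" for c
    using zeta_power_d[of d] assms True by (simp add: power_inverse power_mult[symmetric] mult.commute[of c d] power_mult)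
  then show ?thesis using True by simp
next
  case False
  let ?w = "inverse (zeta d ^ a)"
  have e: "inverse (zeta d ^ c) ^ a = ?w ^ c" for c
    by (simp add: power_inverse power_mult[symmetric] mult.commute)
  have w: "?w \<noteq> 1" using zeta_power_neq_one[of a d] assms False by simp
  have wd: "?w ^ d = 1"
    using zeta_power_d[of d] assms by (simp add: power_inverse power_mult[symmetric] mult.commute[of a d] power_mult)
  have "(?w - 1) * (\<Sum>c<d. ?w ^ c) = ?w ^ d - 1" by (rule power_diff_1_eq[symmetric])
  then have "(\<Sum>c<d. ?w ^ c) = 0" using w wd by simp
  then show ?thesis unfolding e using False by simp
qed

context
  fixes d n :: nat
  assumes d1: "d \<ge> 1"
begin

interpretation P: presentation "fb_gens n" "fb_rels d n"
  by standard (rule fb_rels_lists[OF d1])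

lemma rel_eqp: "(r, r') \<in> fb_rels d n \<Longrightarrow> P.eqp r r'"
  using pres_eq.rel[of r r' "fb_rels d n" "[]" "fb_gens n" "[]"] by simp

lemma eqp_far: "Suc i < j \<Longrightarrow> Suc j < n \<Longrightarrow> P.eqp [SL i, SL j] [SL j, SL i]"
  by (rule rel_eqp) (auto simp: fb_rels_def)

lemma eqp_braid: "Suc (Suc i) < n \<Longrightarrow> P.eqp [SL i, SL (Suc i), SL i] [SL (Suc i), SL i, SL (Suc i)]"
  by (rule rel_eqp) (auto simp: fb_rels_def)

lemma eqp_Td: "j < n \<Longrightarrow> P.eqp (replicate d (TL j)) []"
  by (rule rel_eqp) (auto simp: fb_rels_def)

lemma eqp_TT: "j < n \<Longrightarrow> k < n \<Longrightarrow> P.eqp [TL j, TL k] [TL k, TL j]"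
  by (rule rel_eqp) (auto simp: fb_rels_def)

lemma eqp_ST: "Suc i < n \<Longrightarrow> j < n \<Longrightarrow> P.eqp [SL i, TL j] [TL (adj i j), SL i]"
proof (rule rel_eqp)
  assume ij: "Suc i < n" "j < n"
  have t: "Transposition.transpose (Suc i) (Suc i + 1) (Suc j) = Suc (adj i j)"
    by (auto simp: Transposition.transpose_def)
  have "(s_word (Suc i) @ t_word (Suc j), t_word (Transposition.transpose (Suc i) (Suc i + 1) (Suc j)) @ s_word (Suc i)) \<in> fb_rels d n"
    unfolding fb_rels_def by (rule UnI2) (use ij in auto)
  then show "([SL i, TL j], [TL (adj i j), SL i]) \<in> fb_rels d n" unfolding t by simp
qed

lemma cls_cong: "P.eqp a b \<Longrightarrow> u \<in> P.L \<Longrightarrow> v \<in> P.L \<Longrightarrow> P.cls (u @ a @ v) = P.cls (u @ b @ v)"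
proof -
  assume "P.eqp a b" "u \<in> P.L" "v \<in> P.L"
  then have "P.eqp (u @ a @ v) (u @ b @ v)" by (intro P.eqp_append_left P.eqp_append_right)
  then show ?thesis using P.cls_eq P.eqp_lists by blast
qed

lemma T_pow_L: "j < n \<Longrightarrow> replicate a (TL j) \<in> P.L"
  by (auto simp: fb_gens_def in_lists_conv_set)

section \<open>Functionals that kill the relations, and their isotypic parts\<close>

definition fb_rel_elts :: "fb_elt set" where
  "fb_rel_elts = yh_rel d n ` {1..<n} \<union> (if n > 2 then {ftl_elt d n} else {})"

text \<open>The value of \<open>lin\<close> at \<open>r\<close> is that of the linear extension of
  \<open>G\<close> at the product of \<open>u\<close>, \<open>r\<close> and \<open>v\<close>; the
  condition is thus vanishing on the two-sided ideal generated by the relations.\<close>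

definition annihilates :: "(fb_gen gword set \<Rightarrow> Cq) \<Rightarrow> bool" where
  "annihilates G \<longleftrightarrow> (\<forall>u\<in>P.L. \<forall>v\<in>P.L. \<forall>r\<in>fb_rel_elts.
     lin (\<lambda>X. G (P.cls u \<otimes>\<^bsub>P.G\<^esub> X \<otimes>\<^bsub>P.G\<^esub> P.cls v)) r = 0)"

lemma fb_rel_elts_carrier: "r \<in> fb_rel_elts \<Longrightarrow> r \<in> carrier (fb_alg d n)"
  using yh_rel_carrier[OF d1] ftl_elt_carrier[OF d1] by (auto simp: fb_rel_elts_def split: if_splits)

lemma annihilates_shift:
  assumes G: "annihilates G" and z: "z \<in> P.L"
  shows "annihilates (\<lambda>X. G (P.cls z \<otimes>\<^bsub>P.G\<^esub> X))"
  unfolding annihilates_def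
proof (intro ballI)
  fix u v r assume u: "u \<in> P.L" and v: "v \<in> P.L" and r: "r \<in> fb_rel_elts"
  have zu: "z @ u \<in> P.L" using z u by simp
  have "lin (\<lambda>X. G (P.cls z \<otimes>\<^bsub>P.G\<^esub> (P.cls u \<otimes>\<^bsub>P.G\<^esub> X \<otimes>\<^bsub>P.G\<^esub> P.cls v))) r =
      lin (\<lambda>X. G (P.cls (z @ u) \<otimes>\<^bsub>P.G\<^esub> X \<otimes>\<^bsub>P.G\<^esub> P.cls v)) r"
  proof (rule lin_cong)
    fix X assume "r X \<noteq> 0"
    then have "X \<in> carrier P.G" using fb_rel_elts_carrier[OF r] by (auto simp: carrier_monoid_alg)
    then obtain w where w: "w \<in> P.L" "X = P.cls w" by (auto simp: P.carrier_G)
    have l: "u @ w \<in> P.L" "(u @ w) @ v \<in> P.L" "(z @ u) @ w \<in> P.L" using z u v w by simp_all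
    show "G (P.cls z \<otimes>\<^bsub>P.G\<^esub> (P.cls u \<otimes>\<^bsub>P.G\<^esub> X \<otimes>\<^bsub>P.G\<^esub> P.cls v)) = G (P.cls (z @ u) \<otimes>\<^bsub>P.G\<^esub> X \<otimes>\<^bsub>P.G\<^esub> P.cls v)"
      unfolding w(2) P.cls_mult[OF u w(1)] P.cls_mult[OF l(1) v] P.cls_mult[OF z l(2)] P.cls_mult[OF zu w(1)]
        P.cls_mult[OF l(3) v]
      unfolding append_assoc ..
  qed
  also have "\<dots> = 0" using G zu v r unfolding annihilates_def by blast
  finally show "lin (\<lambda>X. G (P.cls z \<otimes>\<^bsub>P.G\<^esub> (P.cls u \<otimes>\<^bsub>P.G\<^esub> X \<otimes>\<^bsub>P.G\<^esub> P.cls v))) r = 0" .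
qed

text \<open>The averaging projection to the functionals for which left multiplication by the framing
  generator at place \<open>j\<close> is the scalar \<open>zeta d ^ c\<close>.\<close>

definition isotypic :: "nat \<Rightarrow> nat \<Rightarrow> (fb_gen gword set \<Rightarrow> Cq) \<Rightarrow> fb_gen gword set \<Rightarrow> Cq" where
  "isotypic j c G X = (1 / of_nat d) * (\<Sum>a\<in>{1..d}. inverse (zeta d ^ c) ^ a * G (P.cls (replicate a (TL j)) \<otimes>\<^bsub>P.G\<^esub> X))"

lemma annihilates_isotypic:
  assumes "annihilates G" "j < n"
  shows "annihilates (isotypic j c G)"
proof -
  have "annihilates (\<lambda>X. G (P.cls (replicate a (TL j)) \<otimes>\<^bsub>P.G\<^esub> X))" for a
    by (rule annihilates_shift[OF assms(1) T_pow_L[OF assms(2)]])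
  then show ?thesis unfolding annihilates_def isotypic_def lin_fun_scale lin_fun_sum by simp
qed

lemma isotypic_word:
  "j < n \<Longrightarrow> w \<in> P.L \<Longrightarrow> isotypic j c G (P.cls w) =
    (1 / of_nat d) * (\<Sum>a\<in>{1..d}. inverse (zeta d ^ c) ^ a * G (P.cls (replicate a (TL j) @ w)))"
  unfolding isotypic_def by (simp only: P.cls_mult T_pow_L)

lemma isotypic_same:
  assumes j: "j < n" and w: "w \<in> P.L"
  shows "isotypic j c G (P.cls (TL j # w)) = zeta d ^ c * isotypic j c G (P.cls w)"
proof -
  let ?z = "inverse (zeta d ^ c)" and ?h = "\<lambda>a. G (P.cls (replicate a (TL j) @ w))"
  have w': "TL j # w \<in> P.L" using w TL_gens[OF j] by simp
  have r: "replicate a (TL j) @ TL j # w = replicate (Suc a) (TL j) @ w" for a by (simp add: replicate_app_Cons_same)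
  have hd: "?h (Suc d) = ?h 1"
    using cls_cong[OF eqp_Td[OF j], of "[]" "TL j # w"] w' r[of d] by simp
  have zd: "?z ^ Suc d = ?z ^ 1"
    using zeta_power_d[OF d1] by (simp add: power_inverse power_mult[symmetric] mult.commute[of c d] power_mult)
  have "?z * (\<Sum>a\<in>{1..d}. ?z ^ a * ?h (Suc a)) = (\<Sum>a\<in>{1..d}. ?z ^ Suc a * ?h (Suc a))"
    by (simp add: sum_distrib_left mult.assoc)
  also have "\<dots> = (\<Sum>a\<in>{1..d}. ?z ^ a * ?h a)"
    using sum_shift_wrap[of "\<lambda>a. ?z ^ a * ?h a" d] unfolding zd hd by (simp only: add_right_cancel)
  finally have "(\<Sum>a\<in>{1..d}. ?z ^ a * ?h (Suc a)) = zeta d ^ c * (\<Sum>a\<in>{1..d}. ?z ^ a * ?h a)"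
    by (simp add: field_simps)
  then show ?thesis unfolding isotypic_word[OF j w] isotypic_word[OF j w'] r by (simp add: mult.left_commute)
qed

lemma T_commute: "j < n \<Longrightarrow> k < n \<Longrightarrow> P.eqp (replicate a (TL j) @ [TL k]) (TL k # replicate a (TL j))"
proof (induction a)
  case 0
  then show ?case using pres_eq.refl[of "[TL k]" "fb_gens n"] TL_gens[of k n] by simp
next
  case (Suc a)
  have "[TL j] \<in> P.L" using TL_gens[OF Suc.prems(1)] by simp
  then have "P.eqp ([TL j] @ (replicate a (TL j) @ [TL k])) ([TL j] @ (TL k # replicate a (TL j)))"
    using Suc by (intro P.eqp_append_left) simp_all
  moreover have "P.eqp ([TL j, TL k] @ replicate a (TL j)) ([TL k, TL j] @ replicate a (TL j))"
    by (rule P.eqp_append_right[OF eqp_TT T_pow_L]) (use Suc in simp_all)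
  ultimately show ?case using pres_eq.trans by fastforce
qed

text \<open>The framing generators commute, so a further projection keeps the eigenvalues that are
  already fixed.\<close>

lemma isotypic_other:
  assumes j: "j < n" "k < n" and w: "w \<in> P.L" and G: "\<And>w. w \<in> P.L \<Longrightarrow> G (P.cls (TL k # w)) = e * G (P.cls w)"
  shows "isotypic j c G (P.cls (TL k # w)) = e * isotypic j c G (P.cls w)"
proof -
  have w': "TL k # w \<in> P.L" using w TL_gens[OF j(2)] by simp
  have "G (P.cls (replicate a (TL j) @ TL k # w)) = e * G (P.cls (replicate a (TL j) @ w))" for a
  proof -
    have l: "replicate a (TL j) @ w \<in> P.L" using T_pow_L[OF j(1)] w by simp
    have "P.cls (replicate a (TL j) @ TL k # w) = P.cls (TL k # replicate a (TL j) @ w)"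
      using cls_cong[OF T_commute[OF j], of "[]" w a] w by simp
    then show ?thesis using G[OF l] by simp
  qed
  then show ?thesis unfolding isotypic_word[OF j(1) w] isotypic_word[OF j(1) w'] by (simp add: sum_distrib_left mult_ac)
qed

lemma isotypic_sum:
  assumes j: "j < n" and w: "w \<in> P.L"
  shows "(\<Sum>c<d. isotypic j c G (P.cls w)) = G (P.cls w)"
proof -
  let ?h = "\<lambda>a. G (P.cls (replicate a (TL j) @ w))"
  have "(\<Sum>c<d. isotypic j c G (P.cls w)) = (1 / of_nat d) * (\<Sum>c<d. \<Sum>a\<in>{1..d}. inverse (zeta d ^ c) ^ a * ?h a)"
    unfolding isotypic_word[OF j w] sum_distrib_left ..
  also have "(\<Sum>c<d. \<Sum>a\<in>{1..d}. inverse (zeta d ^ c) ^ a * ?h a) = (\<Sum>a\<in>{1..d}. (\<Sum>c<d. inverse (zeta d ^ c) ^ a) * ?h a)"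
    unfolding sum_distrib_right by (rule sum.swap)
  also have "\<dots> = (\<Sum>a\<in>{1..d}. if a = d then of_nat d * ?h a else 0)"
    by (rule sum.cong[OF HOL.refl]) (simp only: zeta_dual_sum split: if_split, simp)
  also have "\<dots> = of_nat d * ?h d" using d1 by simp
  also have "?h d = G (P.cls w)" using cls_cong[OF eqp_Td[OF j], of "[]" w] w by simp
  finally show ?thesis using of_nat_Cq_nonzero[OF d1] by simp
qed

primrec isotypics :: "(nat \<Rightarrow> nat) \<Rightarrow> nat \<Rightarrow> (fb_gen gword set \<Rightarrow> Cq) \<Rightarrow> fb_gen gword set \<Rightarrow> Cq" where
  "isotypics \<chi> 0 G = G"
| "isotypics \<chi> (Suc m) G = isotypic m (\<chi> m) (isotypics \<chi> m G)"

lemma annihilates_isotypics: "annihilates G \<Longrightarrow> m \<le> n \<Longrightarrow> annihilates (isotypics \<chi> m G)"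
  by (induction m) (simp_all add: annihilates_isotypic)

lemma isotypics_eigen:
  "m \<le> n \<Longrightarrow> j < m \<Longrightarrow> w \<in> P.L \<Longrightarrow> isotypics \<chi> m G (P.cls (TL j # w)) = zeta d ^ \<chi> j * isotypics \<chi> m G (P.cls w)"
proof (induction m arbitrary: w)
  case (Suc m)
  show ?case
  proof (cases "j = m")
    case True
    then show ?thesis using isotypic_same[of m w] Suc.prems by simp
  next
    case False
    then have "isotypic m (\<chi> m) (isotypics \<chi> m G) (P.cls (TL j # w)) = zeta d ^ \<chi> j * isotypic m (\<chi> m) (isotypics \<chi> m G) (P.cls w)"
      using Suc by (intro isotypic_other) simp_all
    then show ?thesis by simp
  qed
qed simp

lemma isotypics_cong: "(\<And>j. j < m \<Longrightarrow> \<chi> j = \<chi>' j) \<Longrightarrow> isotypics \<chi> m G = isotypics \<chi>' m G"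
  by (induction m) simp_all

text \<open>Fourier inversion one place at a time: a functional projected at the first
  \<open>m\<close> places is the sum, over the colours of the next place, of its further
  projections. The induction descends from \<open>n\<close> to 0, where no projection is
  left.\<close>

lemma isotypics_vanish:
  assumes "\<And>\<chi> w. \<chi> \<in> colourings n d \<Longrightarrow> w \<in> P.L \<Longrightarrow> isotypics \<chi> n G (P.cls w) = 0" "w \<in> P.L"
  shows "G (P.cls w) = 0"
proof -
  have "\<forall>\<chi>\<in>colourings n d. \<forall>w\<in>P.L. isotypics \<chi> m G (P.cls w) = 0" if "m \<le> n" for m
    using that
  proof (induction m rule: inc_induct)
    case base
    then show ?case using assms(1) by blast
  next
    case (step m)
    show ?case
    proof (intro ballI)
      fix \<chi> w assume \<chi>: "\<chi> \<in> colourings n d" and w: "w \<in> P.L"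
      have "isotypics \<chi> m G (P.cls w) = (\<Sum>c<d. isotypic m c (isotypics \<chi> m G) (P.cls w))"
        by (rule isotypic_sum[OF _ w, symmetric]) (use step in simp)
      also have "\<dots> = (\<Sum>c<d. 0)"
      proof (rule sum.cong[OF HOL.refl])
        fix c assume c: "c \<in> {..<d}"
        have "\<chi>(m := c) \<in> colourings n d" using \<chi> c step.hyps by (auto simp: colourings_def)
        then have "isotypics (\<chi>(m := c)) (Suc m) G (P.cls w) = 0" using step.IH w by blast
        moreover have "isotypics (\<chi>(m := c)) m G = isotypics \<chi> m G" by (rule isotypics_cong) simp
        ultimately show "isotypic m c (isotypics \<chi> m G) (P.cls w) = 0" by simp
      qed
      finally show "isotypics \<chi> m G (P.cls w) = 0" by simp
    qed
  qed
  moreover have "(\<lambda>i. 0) \<in> colourings n d" using d1 by (simp add: colourings_def)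
  ultimately have "isotypics (\<lambda>i. 0) 0 G (P.cls w) = 0" using assms(2) by blast
  then show ?thesis by simp
qed

text \<open>The projections are finite combinations of translates, hence commute with a linear
  functional \<open>\<Lambda>\<close> acting on a parameter \<open>Y\<close>. For
  \<open>H X Y = single X Y\<close> this transposes them from functionals to elements: it shows that
  \<open>basis_elt\<close> lies in the group algebra and evaluates functionals at it.\<close>

lemma isotypics_linear:
  assumes C: "\<And>A c F. finite (A :: nat set) \<Longrightarrow> (\<And>a. a \<in> A \<Longrightarrow> F a \<in> C) \<Longrightarrow> (\<lambda>Y. \<Sum>a\<in>A. c a * F a Y) \<in> C"
    and \<Lambda>: "\<And>A c F. finite (A :: nat set) \<Longrightarrow> (\<And>a. a \<in> A \<Longrightarrow> F a \<in> C) \<Longrightarrow> \<Lambda> (\<lambda>Y. \<Sum>a\<in>A. c a * F a Y) = (\<Sum>a\<in>A. c a * \<Lambda> (F a))"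
    and H: "\<And>X. X \<in> carrier P.G \<Longrightarrow> H X \<in> C"
  shows "m \<le> n \<Longrightarrow> X \<in> carrier P.G \<Longrightarrow> (\<lambda>Y. isotypics \<chi> m (\<lambda>X. H X Y) X) \<in> C \<and>
    \<Lambda> (\<lambda>Y. isotypics \<chi> m (\<lambda>X. H X Y) X) = isotypics \<chi> m (\<lambda>X. \<Lambda> (H X)) X"
proof (induction m arbitrary: X)
  case 0
  then show ?case using H by simp
next
  case (Suc m)
  let ?c = "\<lambda>a. (1 / of_nat d) * inverse (zeta d ^ \<chi> m) ^ a" and ?X = "\<lambda>a. P.cls (replicate a (TL m)) \<otimes>\<^bsub>P.G\<^esub> X"
  have Xc: "?X a \<in> carrier P.G" for a
    using group.is_monoid[OF P.group_G] T_pow_L[of m a] Suc.prems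
    by (intro monoid.m_closed) (simp_all add: P.carrier_G)
  have e: "isotypics \<chi> (Suc m) G X = (\<Sum>a\<in>{1..d}. ?c a * isotypics \<chi> m G (?X a))" for G
    by (simp add: isotypic_def sum_distrib_left mult.assoc)
  have c: "(\<lambda>Y. isotypics \<chi> m (\<lambda>X. H X Y) (?X a)) \<in> C" "\<Lambda> (\<lambda>Y. isotypics \<chi> m (\<lambda>X. H X Y) (?X a)) = isotypics \<chi> m (\<lambda>X. \<Lambda> (H X)) (?X a)" for a
    using Suc.IH[OF _ Xc] Suc.prems by simp_all
  show ?case unfolding e using C[of "{1..d}" "\<lambda>a Y. isotypics \<chi> m (\<lambda>X. H X Y) (?X a)" ?c]
      \<Lambda>[of "{1..d}" "\<lambda>a Y. isotypics \<chi> m (\<lambda>X. H X Y) (?X a)" ?c] c by simp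
qed

text \<open>Framings are diagonal, so for a matrix coefficient in row \<open>x\<close> the
  projection to \<open>\<chi>\<close> merely tests whether \<open>x\<close> has the colouring
  \<open>\<chi>\<close>.\<close>

lemma isotypics_act:
  assumes "x \<in> words n d" "\<chi> \<in> colourings n d"
    and G: "\<And>w. w \<in> P.L \<Longrightarrow> G (P.cls w) = foldr (letter_op d) w v x"
  shows "m \<le> n \<Longrightarrow> w \<in> P.L \<Longrightarrow> isotypics \<chi> m G (P.cls w) = (if \<forall>j<m. x j div 2 = \<chi> j then foldr (letter_op d) w v x else 0)"
proof (induction m arbitrary: w)
  case 0
  then show ?case using G by simp
next
  case (Suc m)
  have if_if: "(if A then if B then a else 0 else 0) = (if A \<and> B then a else 0)" for A B and a :: Cq by simp
  let ?ok = "\<forall>j<m. x j div 2 = \<chi> j"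
  have m: "m < n" using Suc.prems by simp
  have lt: "x m div 2 < d" "\<chi> m < d" using assms(1,2) m by (auto simp: words_def colourings_def less_mult_imp_div_less mult.commute)
  have l: "replicate a (TL m) @ w \<in> P.L" for a using T_pow_L[OF m] Suc.prems by simp
  have "isotypics \<chi> m G (P.cls (replicate a (TL m) @ w)) = (if ?ok then (zeta d ^ (x m div 2)) ^ a * foldr (letter_op d) w v x else 0)" for a
  proof -
    have "foldr (letter_op d) (replicate a (TL m) @ w) v x = (zeta d ^ (x m div 2)) ^ a * foldr (letter_op d) w v x"
      unfolding foldr_append comp_apply letter_op_replicate_T[OF d1] ..
    then show ?thesis using Suc.IH[OF _ l, of a] m by (simp only: less_imp_le)
  qed
  then have "isotypics \<chi> (Suc m) G (P.cls w) = (1 / of_nat d) * (\<Sum>a\<in>{1..d}. inverse (zeta d ^ \<chi> m) ^ a * (if ?ok then (zeta d ^ (x m div 2)) ^ a * foldr (letter_op d) w v x else 0))"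
    using isotypic_word[OF m Suc.prems(2)] by simp
  also have "\<dots> = (if ?ok then (1 / of_nat d) * ((\<Sum>a\<in>{1..d}. (zeta d ^ (x m div 2)) ^ a * (inverse (zeta d) ^ \<chi> m) ^ a) * foldr (letter_op d) w v x) else 0)"
  proof (cases ?ok)
    case True
    show ?thesis unfolding if_P[OF True] sum_distrib_right by (simp add: mult_ac power_inverse)
  next
    case False
    show ?thesis unfolding if_not_P[OF False] by simp
  qed
  also have "\<dots> = (if ?ok then if x m div 2 = \<chi> m then foldr (letter_op d) w v x else 0 else 0)"
  proof (cases ?ok)
    case True
    show ?thesis unfolding if_P[OF True] zeta_sum[OF lt] using of_nat_Cq_nonzero[OF d1] by simp
  next
    case False
    show ?thesis unfolding if_not_P[OF False] ..
  qed
  also have "\<dots> = (if ?ok \<and> x m div 2 = \<chi> m then foldr (letter_op d) w v x else 0)"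
    by (rule if_if)
  also have "(?ok \<and> x m div 2 = \<chi> m) = (\<forall>j<Suc m. x j div 2 = \<chi> j)" by (auto simp: less_Suc_eq)
  finally show ?case .
qed

text \<open>In an isotypic functional the elements \<open>t\<^sub>j\<close> become scalars wherever they occur, and
  the idempotents \<open>E\<^sub>i\<close> become indicators of equal colours.\<close>

context
  fixes \<chi> :: "nat \<Rightarrow> nat" and G :: "fb_gen gword set \<Rightarrow> Cq"
  assumes chi: "\<chi> \<in> colourings n d" and ann: "annihilates G"
    and eig: "\<And>j w. j < n \<Longrightarrow> w \<in> P.L \<Longrightarrow> G (P.cls (TL j # w)) = zeta d ^ \<chi> j * G (P.cls w)"
begin

abbreviation (input) "gg w \<equiv> G (P.cls w)"

lemma gg_cong: "P.eqp a b \<Longrightarrow> u \<in> P.L \<Longrightarrow> v \<in> P.L \<Longrightarrow> gg (u @ a @ v) = gg (u @ b @ v)"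
  using cls_cong by simp

lemma wperm_lt: "wletters n us \<Longrightarrow> j < n \<Longrightarrow> wperm us j < n"
  using permutes_in_image[OF wperm_permutes, of n us j] by simp

text \<open>The framing slides along its strand through the crossings, from place \<open>j\<close>
  to place \<open>wperm us j\<close> at the left end, where the eigenvalue is known.\<close>

lemma gg_T:
  "wletters n us \<Longrightarrow> j < n \<Longrightarrow> v \<in> P.L \<Longrightarrow> gg (sword us @ TL j # v) = zeta d ^ \<chi> (wperm us j) * gg (sword us @ v)"
proof (induction us arbitrary: j v rule: rev_induct)
  case Nil
  then show ?case by (simp add: eig)
next
  case (snoc i us)
  then have i: "Suc i < n" and us: "wletters n us" by simp_all
  have j': "adj i j < n" using i snoc.prems by (auto simp: Transposition.transpose_def)
  have v': "SL i # v \<in> P.L" using SL_gens[OF i] snoc.prems by simp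
  have "gg (sword (us @ [i]) @ TL j # v) = gg (sword us @ [SL i, TL j] @ v)" by simp
  also have "\<dots> = gg (sword us @ [TL (adj i j), SL i] @ v)"
    by (rule gg_cong[OF eqp_ST[OF i snoc.prems(2)] sword_L[OF us] snoc.prems(3)])
  also have "\<dots> = zeta d ^ \<chi> (wperm us (adj i j)) * gg (sword us @ SL i # v)"
    using snoc.IH[OF us j' v'] by simp
  finally show ?case by (simp add: wperm_append)
qed

lemma gg_Ti:
  assumes "wletters n us" "j < n" "v \<in> P.L"
  shows "gg (sword us @ (Tgen (Suc j), False) # v) = inverse (zeta d ^ \<chi> (wperm us j)) * gg (sword us @ v)"
proof -
  have "(Tgen (Suc j), False) # v \<in> P.L" using assms TL_gens[of j n] by simp
  from gg_T[OF assms(1,2) this]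
  have "gg (sword us @ [TL j, (Tgen (Suc j), False)] @ v) = zeta d ^ \<chi> (wperm us j) * gg (sword us @ (Tgen (Suc j), False) # v)" by simp
  moreover have "P.eqp [TL j, (Tgen (Suc j), False)] []"
    using pres_eq.cancel[of "Tgen (Suc j)" "fb_gens n" "[]" "[]" "fb_rels d n" True] TL_gens[OF assms(2), of True] by simp
  from gg_cong[OF this sword_L[OF assms(1)] assms(3)]
  have "gg (sword us @ [TL j, (Tgen (Suc j), False)] @ v) = gg (sword us @ v)" by simp
  ultimately have h: "zeta d ^ \<chi> (wperm us j) * gg (sword us @ (Tgen (Suc j), False) # v) = gg (sword us @ v)" by simp
  show ?thesis unfolding h[symmetric] by (simp add: mult.assoc[symmetric])
qed

lemma gg_E1:
  assumes us: "wletters n us" and i: "Suc i < n" and v: "v \<in> P.L"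
  shows "gg (sword us @ eword (Suc i) a @ v) =
    (zeta d ^ \<chi> (wperm us i)) ^ a * (inverse (zeta d) ^ \<chi> (wperm us (Suc i))) ^ a * gg (sword us @ v)"
proof -
  have L: "replicate b (Tgen (Suc j), e) @ v \<in> P.L" if "j < n" "v \<in> P.L" for b j e v
    using that by (auto simp: fb_gens_def in_lists_conv_set)
  have T: "gg (sword us @ replicate b (TL j) @ v) = (zeta d ^ \<chi> (wperm us j)) ^ b * gg (sword us @ v)" if "j < n" "v \<in> P.L" for b j v
  proof (induction b)
    case (Suc b)
    then show ?case using gg_T[OF us that(1) L[OF that, of b True]] by (simp add: mult.assoc)
  qed simp
  have Ti: "gg (sword us @ replicate b (Tgen (Suc j), False) @ v) = (inverse (zeta d) ^ \<chi> (wperm us j)) ^ b * gg (sword us @ v)" if "j < n" "v \<in> P.L" for b j v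
  proof (induction b)
    case (Suc b)
    then show ?case using gg_Ti[OF us that(1) L[OF that, of b False]] by (simp add: mult.assoc power_inverse)
  qed simp
  have i': "i < n" using i by simp
  have "gg (sword us @ eword (Suc i) a @ v) = gg (sword us @ replicate a (TL i) @ (replicate a (Tgen (Suc (Suc i)), False) @ v))"
    by (simp add: eword_def[OF d1])
  also have "\<dots> = (zeta d ^ \<chi> (wperm us i)) ^ a * gg (sword us @ replicate a (Tgen (Suc (Suc i)), False) @ v)"
    by (rule T[OF i' L[OF i v]])
  also have "\<dots> = (zeta d ^ \<chi> (wperm us i)) ^ a * ((inverse (zeta d) ^ \<chi> (wperm us (Suc i))) ^ a * gg (sword us @ v))"
    unfolding Ti[OF i v] ..
  finally show ?thesis by (simp only: mult.assoc)
qed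

lemma gg_E:
  assumes us: "wletters n us" and i: "Suc i < n" and v: "v \<in> P.L"
  shows "(1 / of_nat d) * (\<Sum>a\<in>{1..d}. gg (sword us @ eword (Suc i) a @ v)) =
    (if \<chi> (wperm us i) = \<chi> (wperm us (Suc i)) then gg (sword us @ v) else 0)"
proof -
  have lt: "\<chi> (wperm us i) < d" "\<chi> (wperm us (Suc i)) < d"
    using chi wperm_lt[OF us] i by (auto simp: colourings_def)
  show ?thesis unfolding gg_E1[OF us i v] sum_distrib_right[symmetric] zeta_sum[OF lt]
    using of_nat_Cq_nonzero[OF d1] by simp
qed

lemma gg_lin:
  assumes "u \<in> P.L" "v \<in> P.L" "w \<in> P.L"
  shows "G (P.cls u \<otimes>\<^bsub>P.G\<^esub> P.cls w \<otimes>\<^bsub>P.G\<^esub> P.cls v) = gg (u @ w @ v)"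
proof -
  have l: "u @ w \<in> P.L" using assms by simp
  show ?thesis unfolding P.cls_mult[OF assms(1,3)] P.cls_mult[OF l assms(2)] append_assoc ..
qed

lemma gg_square:
  assumes us: "wletters n us" and i: "Suc i < n" and v: "v \<in> P.L"
  shows "gg (sword us @ SL i # SL i # v) = gg (sword us @ v) +
    (if \<chi> (wperm us i) = \<chi> (wperm us (Suc i)) then (q - inverse q) * gg (sword us @ SL i # v) else 0)"
proof -
  have i': "Suc i \<in> {1..<n}" using i by simp
  note uL = sword_L[OF us]
  have s: "s_word (Suc i) \<in> P.L" using SL_gens[OF i] by simp
  have ss: "s_word (Suc i) @ s_word (Suc i) \<in> P.L" "[] \<in> P.L" "s_word (Suc i) @ v \<in> P.L" using s v by simp_all
  have es: "eword (Suc i) a @ s_word (Suc i) \<in> P.L" for a using eword_L[OF d1 i'] s by simp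
  have "yh_rel d n (Suc i) \<in> fb_rel_elts" using i' by (simp add: fb_rel_elts_def)
  then have "lin (\<lambda>X. G (P.cls (sword us) \<otimes>\<^bsub>P.G\<^esub> X \<otimes>\<^bsub>P.G\<^esub> P.cls v)) (yh_rel d n (Suc i)) = 0"
    using ann uL v unfolding annihilates_def by blast
  then have "gg (sword us @ s_word (Suc i) @ s_word (Suc i) @ v) -
     ((q - inverse q) * ((1 / of_nat d) * (\<Sum>a\<in>{1..d}. gg (sword us @ eword (Suc i) a @ s_word (Suc i) @ v))) + gg (sword us @ v)) = 0"
    unfolding lin_yh_rel[OF d1 i'] gg_lin[OF uL v ss(1)] gg_lin[OF uL v ss(2)] gg_lin[OF uL v es] append_assoc append_Nil .
  then show ?thesis unfolding gg_E[OF us i ss(3)] by (simp split: if_splits)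
qed

text \<open>The relation is imposed at the first three strands only; conjugation by three successive
  crossings carries it from one place to the next. The coefficients result from multiplying it by
  \<open>q ^ 3\<close> and solving for the longest term.\<close>

lemma gg_cubic:
  assumes us: "wletters n us" and i: "Suc (Suc i) < n" and v: "v \<in> P.L"
    and eq: "\<chi> (wperm us i) = \<chi> (wperm us (Suc i))" "\<chi> (wperm us (Suc i)) = \<chi> (wperm us (Suc (Suc i)))"
  shows "gg (sword us @ SL i # SL (Suc i) # SL i # v) = q ^ 3 * gg (sword us @ v) + - (q ^ 2) * gg (sword us @ SL i # v)
    + - (q ^ 2) * gg (sword us @ SL (Suc i) # v) + q * gg (sword us @ SL i # SL (Suc i) # v) + q * gg (sword us @ SL (Suc i) # SL i # v)"
  using us i v eq
proof (induction i arbitrary: us v)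
  case 0
  then have n: "n > 2" and n0: "Suc 0 < n" and n1: "Suc (Suc 0) < n" by simp_all
  note uL = sword_L[OF \<open>wletters n us\<close>] and v = \<open>v \<in> P.L\<close>
  have e: "eword 1 a \<in> P.L" "eword 2 a \<in> P.L" for a using eword_L[OF d1] n by simp_all
  have s: "s_word 1 \<in> P.L" "s_word 2 \<in> P.L" using n by (simp_all add: fb_gens_def)
  have l: "eword 1 a @ eword 2 b @ w \<in> P.L" if "w \<in> P.L" for a b w using e that by simp
  have sl: "s_word 1 @ s_word 2 \<in> P.L" "s_word 2 @ s_word 1 \<in> P.L" "s_word 1 @ s_word 2 @ s_word 1 \<in> P.L" "[] \<in> P.L"
    using s by simp_all
  define K where "K w = gg (sword us @ w @ v)" for w
  define Y where "Y a b = (\<Sum>(c, w)\<leftarrow>[(1, []), (- inverse q, s_word 1), (- inverse q, s_word 2), (inverse (q ^ 2), s_word 1 @ s_word 2),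
      (inverse (q ^ 2), s_word 2 @ s_word 1), (- inverse (q ^ 3), s_word 1 @ s_word 2 @ s_word 1)]. c * gg (sword us @ eword 1 a @ eword 2 b @ w @ v))" for a b
  have "ftl_elt d n \<in> fb_rel_elts" using n by (simp add: fb_rel_elts_def)
  then have "lin (\<lambda>X. G (P.cls (sword us) \<otimes>\<^bsub>P.G\<^esub> X \<otimes>\<^bsub>P.G\<^esub> P.cls v)) (ftl_elt d n) = 0"
    using ann uL v unfolding annihilates_def by blast
  then have 1: "(1 / of_nat d) * (\<Sum>a\<in>{1..d}. (1 / of_nat d) * (\<Sum>b\<in>{1..d}. Y a b)) = 0"
    unfolding lin_ftl_elt[OF d1 n] Let_def gg_lin[OF uL v l[OF s(1)]] gg_lin[OF uL v l[OF s(2)]]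
      gg_lin[OF uL v l[OF sl(1)]] gg_lin[OF uL v l[OF sl(2)]] gg_lin[OF uL v l[OF sl(3)]] gg_lin[OF uL v l[OF sl(4)]] append_assoc
    unfolding Y_def by (simp add: algebra_simps)
  \<comment> \<open>The three colours are equal, so the framings of the \<open>E\<close>-words
    contribute the scalar 1 and the double average is trivial.\<close>
  have c: "(zeta d ^ \<chi> (wperm us 0)) ^ a * (inverse (zeta d) ^ \<chi> (wperm us 1)) ^ a = 1"
    "(zeta d ^ \<chi> (wperm us 1)) ^ a * (inverse (zeta d) ^ \<chi> (wperm us 2)) ^ a = 1" for a
    using 0 by (simp_all add: numeral_2_eq_2 power_mult_distrib[symmetric])
  have g: "gg (sword us @ eword 1 a @ eword 2 b @ w @ v) = K w" if "w \<in> P.L" for a b w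
  proof -
    have w: "w @ v \<in> P.L" "eword 2 b @ w @ v \<in> P.L" using that v e by simp_all
    show ?thesis using gg_E1[OF \<open>wletters n us\<close> n0 w(2), of a] gg_E1[OF \<open>wletters n us\<close> n1 w(1), of b] c
      by (simp add: K_def numeral_2_eq_2)
  qed
  have Y: "Y a b = K [] - inverse q * K (s_word 1) - inverse q * K (s_word 2) + inverse (q ^ 2) * K (s_word 1 @ s_word 2)
      + inverse (q ^ 2) * K (s_word 2 @ s_word 1) - inverse (q ^ 3) * K (s_word 1 @ s_word 2 @ s_word 1)" for a b
    unfolding Y_def list.map sum_list.Cons sum_list.Nil prod.case g[OF s(1)] g[OF s(2)] g[OF sl(1)] g[OF sl(2)] g[OF sl(3)] g[OF sl(4)]
    by simp
  have "K [] - inverse q * K (s_word 1) - inverse q * K (s_word 2) + inverse (q ^ 2) * K (s_word 1 @ s_word 2)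
      + inverse (q ^ 2) * K (s_word 2 @ s_word 1) - inverse (q ^ 3) * K (s_word 1 @ s_word 2 @ s_word 1) = 0"
    using 1 of_nat_Cq_nonzero[OF d1] unfolding Y by simp
  then have "inverse (q ^ 3) * K (s_word 1 @ s_word 2 @ s_word 1) = K [] - inverse q * K (s_word 1) - inverse q * K (s_word 2)
     + inverse (q ^ 2) * K (s_word 1 @ s_word 2) + inverse (q ^ 2) * K (s_word 2 @ s_word 1)" by simp
  then have "q ^ 3 * (inverse (q ^ 3) * K (s_word 1 @ s_word 2 @ s_word 1)) = q ^ 3 * (K [] - inverse q * K (s_word 1) - inverse q * K (s_word 2)
     + inverse (q ^ 2) * K (s_word 1 @ s_word 2) + inverse (q ^ 2) * K (s_word 2 @ s_word 1))" by (rule arg_cong)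
  moreover have "q ^ 3 * (inverse (q ^ 3) * z) = z" "q ^ 3 * (inverse q * z) = q ^ 2 * z" "q ^ 3 * (inverse (q ^ 2) * z) = q * z" for z
    by (simp_all add: field_simps power2_eq_square power3_eq_cube)
  ultimately have "K (s_word 1 @ s_word 2 @ s_word 1) = q ^ 3 * K [] + - (q ^ 2) * K (s_word 1) + - (q ^ 2) * K (s_word 2)
     + q * K (s_word 1 @ s_word 2) + q * K (s_word 2 @ s_word 1)"
    by (simp only: right_diff_distrib distrib_left) simp
  then show ?case by (simp add: K_def numeral_2_eq_2)
next
  case (Suc i)
  note us = \<open>wletters n us\<close> and v = \<open>v \<in> P.L\<close>
  have i: "Suc (Suc (Suc i)) < n" "Suc (Suc i) < n" "Suc i < n" using Suc.prems by simp_all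
  \<comment> \<open>\<open>C\<close> intertwines: \<open>C s_i = s_{i+1} C\<close> and
    \<open>C s_{i+1} = s_{i+2} C\<close>. Its permutation sends the places
    \<open>i, i+1, i+2\<close> to \<open>i+1, i+2, i+3\<close>, so the colour condition for the
    longer prefix \<open>us'\<close> at \<open>i\<close> is the given one at
    \<open>Suc i\<close>.\<close>
  define C where "C = sword [i, Suc i, Suc (Suc i)]"
  have C: "C \<in> P.L" unfolding C_def by (rule sword_L) (use i in simp)
  define us' where "us' = us @ [i, Suc i, Suc (Suc i)]"
  have us': "wletters n us'" using us i by (simp add: us'_def)
  have w: "wperm us' i = wperm us (Suc i)" "wperm us' (Suc i) = wperm us (Suc (Suc i))" "wperm us' (Suc (Suc i)) = wperm us (Suc (Suc (Suc i)))"
    by (simp_all add: us'_def wperm_append)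
  define v' where "v' = P.winv C @ v"
  have v': "v' \<in> P.L" using P.winv_L[OF C] v by (simp add: v'_def)
  have sL: "[SL k] \<in> P.L" if "Suc k < n" for k using SL_gens[OF that] by simp
  have e0: "P.eqp (C @ [SL i]) (SL (Suc i) # C)"
  proof -
    have "P.eqp ([SL i, SL (Suc i)] @ [SL (Suc (Suc i)), SL i]) ([SL i, SL (Suc i)] @ [SL i, SL (Suc (Suc i))])"
      by (rule P.eqp_append_left[OF pres_eq.sym[OF eqp_far]]) (use i sL in simp_all)
    moreover have "P.eqp ([SL i, SL (Suc i), SL i] @ [SL (Suc (Suc i))]) ([SL (Suc i), SL i, SL (Suc i)] @ [SL (Suc (Suc i))])"
      by (rule P.eqp_append_right[OF eqp_braid]) (use i sL in simp_all)
    ultimately show ?thesis unfolding C_def using pres_eq.trans by fastforce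
  qed
  have e1: "P.eqp (C @ [SL (Suc i)]) (SL (Suc (Suc i)) # C)"
  proof -
    have "P.eqp ([SL i] @ [SL (Suc i), SL (Suc (Suc i)), SL (Suc i)]) ([SL i] @ [SL (Suc (Suc i)), SL (Suc i), SL (Suc (Suc i))])"
      by (rule P.eqp_append_left[OF eqp_braid]) (use i sL in simp_all)
    moreover have "P.eqp ([SL i, SL (Suc (Suc i))] @ [SL (Suc i), SL (Suc (Suc i))]) ([SL (Suc (Suc i)), SL i] @ [SL (Suc i), SL (Suc (Suc i))])"
      by (rule P.eqp_append_right[OF eqp_far]) (use i sL in simp_all)
    ultimately show ?thesis unfolding C_def using pres_eq.trans by fastforce
  qed
  have conj: "gg (sword us' @ sword z @ v') = gg (sword us @ sword (map Suc z) @ v)" if "set z \<subseteq> {i, Suc i}" for z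
  proof -
    have "P.eqp (C @ sword z) (sword (map Suc z) @ C)"
      using that
    proof (induction z)
      case Nil
      then show ?case using pres_eq.refl[OF C] by simp
    next
      case (Cons a z)
      have z: "wletters n z" "wletters n (map Suc z)" "wletters n [Suc a]" using Cons.prems i by (auto simp: wletters_def)
      have "P.eqp (C @ [SL a]) (SL (Suc a) # C)" using Cons.prems e0 e1 by auto
      from P.eqp_append_right[OF this sword_L[OF z(1)]]
      have "P.eqp (C @ sword (a # z)) (SL (Suc a) # C @ sword z)" by simp
      moreover have "P.eqp (sword [Suc a] @ (C @ sword z)) (sword [Suc a] @ (sword (map Suc z) @ C))"
        by (rule P.eqp_append_left[OF _ sword_L[OF z(3)]]) (use Cons in auto)
      ultimately show ?case using pres_eq.trans by fastforce
    qed
    from gg_cong[OF this sword_L[OF us] v']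
    have "gg (sword us' @ sword z @ v') = gg (sword us @ sword (map Suc z) @ C @ P.winv C @ v)"
      by (simp add: us'_def C_def v'_def)
    moreover have "wletters n (map Suc z)" using that i by (auto simp: wletters_def)
    then have l: "sword us @ sword (map Suc z) \<in> P.L" using sword_L us by simp
    have "P.eqp (C @ P.winv C) []"
    proof -
      have "P.winv (P.winv C) = C" by (simp add: P.winv_def C_def)
      then show ?thesis using P.winv_left[OF P.winv_L[OF C]] by simp
    qed
    from gg_cong[OF this l v]
    have "gg (sword us @ sword (map Suc z) @ C @ P.winv C @ v) = gg (sword us @ sword (map Suc z) @ v)" by simp
    ultimately show ?thesis by simp
  qed
  have "gg (sword us' @ SL i # SL (Suc i) # SL i # v') = q ^ 3 * gg (sword us' @ v') + - (q ^ 2) * gg (sword us' @ SL i # v')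
    + - (q ^ 2) * gg (sword us' @ SL (Suc i) # v') + q * gg (sword us' @ SL i # SL (Suc i) # v') + q * gg (sword us' @ SL (Suc i) # SL i # v')"
    by (rule Suc.IH[OF us' i(2) v']) (use Suc.prems in \<open>simp_all add: w\<close>)
  then show ?case
    using conj[of "[]"] conj[of "[i]"] conj[of "[Suc i]"] conj[of "[i, Suc i]"] conj[of "[Suc i, i]"] conj[of "[i, Suc i, i]"] by simp
qed

text \<open>Positive words are settled by \<open>functional_vanishes\<close>. A general word is
  absorbed letter by letter into a growing positive prefix: framings become scalars, and an inverse
  crossing is eliminated by the quadratic relation.\<close>

lemma gg_vanishes:
  assumes van: "\<And>p. p permutes {..<n} \<Longrightarrow> mono_321_free n \<chi> p \<Longrightarrow> gg (sword (can n p)) = 0" and w: "w \<in> P.L"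
  shows "gg w = 0"
proof -
  have S: "gg (sword us) = 0" if "wletters n us" for us
  proof (rule functional_vanishes[where n = n and \<chi> = \<chi> and \<phi> = "\<lambda>us. gg (sword us)"])
    fix u v i assume u: "wletters n u" and v: "wletters n v"
    note uL = sword_L[OF u] and vL = sword_L[OF v]
    show "gg (sword (u @ i # j # v)) = gg (sword (u @ j # i # v))" if "Suc i < j" "Suc j < n" for j
      using gg_cong[OF eqp_far[OF that] uL vL] by simp
    show "gg (sword (u @ i # i # v)) = gg (sword (u @ v)) +
       (if \<chi> (wperm u i) = \<chi> (wperm u (Suc i)) then (q - inverse q) * gg (sword (u @ i # v)) else 0)" if "Suc i < n"
      using gg_square[OF u that vL] by simp
    assume i: "Suc (Suc i) < n"
    show "gg (sword (u @ i # Suc i # i # v)) = gg (sword (u @ Suc i # i # Suc i # v))"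
      using gg_cong[OF eqp_braid[OF i] uL vL] by simp
    show "gg (sword (u @ i # Suc i # i # v)) = q ^ 3 * gg (sword (u @ v)) + - (q ^ 2) * gg (sword (u @ i # v)) + - (q ^ 2) * gg (sword (u @ Suc i # v))
         + q * gg (sword (u @ i # Suc i # v)) + q * gg (sword (u @ Suc i # i # v))"
      if "\<chi> (wperm u i) = \<chi> (wperm u (Suc i))" "\<chi> (wperm u (Suc i)) = \<chi> (wperm u (Suc (Suc i)))"
      using gg_cubic[OF u i vL that] by simp
  qed (use van that in simp_all)
  have "gg (sword us @ w) = 0" if "wletters n us" for us
    using w that
  proof (induction w arbitrary: us rule: list.induct)
    case Nil
    then show ?case using S by simp
  next
    case (Cons l w)
    then have l: "l \<in> fb_gens n \<times> UNIV" and w: "w \<in> P.L" and us: "wletters n us" by auto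
    note IH = Cons.IH[OF w]
    from l show ?case
    proof (cases rule: fb_gens_cases)
      case (1 i e)
      have T: "gg (sword us @ SL i # w) = 0" using IH[of "us @ [i]"] us 1 by simp
      show ?thesis
      proof (cases e)
        case True
        then show ?thesis using T 1 by simp
      next
        case False
        let ?w = "(Sgen (Suc i), False) # w"
        have w': "?w \<in> P.L" using l w 1 False by simp
        have c: "P.eqp [SL i, (Sgen (Suc i), False)] []"
          using pres_eq.cancel[of "Sgen (Suc i)" "fb_gens n" "[]" "[]" "fb_rels d n" True] l 1 by simp
        have s: "[SL i] \<in> P.L" using SL_gens 1 by simp
        have L: "sword (us @ [i]) \<in> P.L" by (rule sword_L) (use us 1 in simp)
        have "gg (sword us @ SL i # SL i # ?w) = gg (sword us @ SL i # w)"
          using gg_cong[OF c L w] by simp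
        moreover have "gg (sword us @ SL i # ?w) = gg (sword us @ w)"
          using gg_cong[OF c sword_L[OF us] w] by simp
        ultimately have "gg (sword us @ ?w) = 0"
          using gg_square[OF us 1(2) w'] T IH[OF us] by (simp split: if_splits)
        then show ?thesis using 1 False by simp
      qed
    next
      case (2 j e)
      then show ?thesis using gg_T[OF us 2(2) w] gg_Ti[OF us 2(2) w] IH[OF us] by (cases e) simp_all
    qed
  qed
  from this[of "[]"] show ?thesis by simp
qed

end

theorem annihilating_functional_vanishes:
  assumes G: "annihilates G"
    and van: "\<And>\<chi> p. \<chi> \<in> colourings n d \<Longrightarrow> p permutes {..<n} \<Longrightarrow> mono_321_free n \<chi> p \<Longrightarrow>
      isotypics \<chi> n G (P.cls (sword (can n p))) = 0"
    and w: "w \<in> P.L"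
  shows "G (P.cls w) = 0"
proof (rule isotypics_vanish[OF _ w])
  fix \<chi> w assume \<chi>: "\<chi> \<in> colourings n d" and w: "w \<in> P.L"
  show "isotypics \<chi> n G (P.cls w) = 0"
    by (rule gg_vanishes[OF \<chi> annihilates_isotypics[OF G order_refl] isotypics_eigen[OF order_refl] van[OF \<chi>] w])
qed

end

section \<open>Specialisation at q = 1\<close>

text \<open>Rational functions regular at \<open>q = 1\<close>, and their values there; \<open>ev\<close> is unspecified on the others.\<close>

definition reg :: "Cq \<Rightarrow> bool" where
  "reg f \<longleftrightarrow> (\<exists>a b. f = Fract a b \<and> poly b 1 \<noteq> 0)"

definition ev :: "Cq \<Rightarrow> complex" where
  "ev f = (THE v. \<exists>a b. f = Fract a b \<and> poly b 1 \<noteq> 0 \<and> v = poly a 1 / poly b 1)"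

lemma ev_Fract:
  assumes "poly b 1 \<noteq> 0"
  shows "ev (Fract a b) = poly a 1 / poly b 1"
  unfolding ev_def
proof (rule the_equality)
  show "\<exists>a' b'. Fract a b = Fract a' b' \<and> poly b' 1 \<noteq> 0 \<and> poly a 1 / poly b 1 = poly a' 1 / poly b' 1"
    using assms by blast
  fix v assume "\<exists>a' b'. Fract a b = Fract a' b' \<and> poly b' 1 \<noteq> 0 \<and> v = poly a' 1 / poly b' 1"
  then obtain a' b' where f: "Fract a b = Fract a' b'" and b': "poly b' 1 \<noteq> 0" and v: "v = poly a' 1 / poly b' 1" by blast
  have "b \<noteq> 0" "b' \<noteq> 0" using assms b' by auto
  then have "a * b' = a' * b" using f eq_fract(1) by blast
  then have "poly a 1 * poly b' 1 = poly a' 1 * poly b 1" by (metis poly_mult)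
  then show "v = poly a 1 / poly b 1" unfolding v using frac_eq_eq[OF b' assms] by simp
qed

lemma reg_Fract: "poly b 1 \<noteq> 0 \<Longrightarrow> reg (Fract a b)"
  unfolding reg_def by blast

lemma regE:
  assumes "reg f"
  obtains a b where "f = Fract a b" "poly b 1 \<noteq> 0" "b \<noteq> 0" "ev f = poly a 1 / poly b 1"
  using assms ev_Fract unfolding reg_def by (metis poly_0)

lemma reg_add: "reg f \<Longrightarrow> reg g \<Longrightarrow> reg (f + g) \<and> ev (f + g) = ev f + ev g"
  by (elim regE) (simp add: reg_Fract ev_Fract add_frac_eq)

lemma reg_mult: "reg f \<Longrightarrow> reg g \<Longrightarrow> reg (f * g) \<and> ev (f * g) = ev f * ev g"
  by (elim regE) (simp add: reg_Fract ev_Fract)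

lemma reg_0 [simp]: "reg 0" "ev 0 = 0"
  by (simp_all add: Zero_fract_def reg_Fract ev_Fract)

lemma reg_1 [simp]: "reg 1" "ev 1 = 1"
  by (simp_all add: One_fract_def reg_Fract ev_Fract)

lemma reg_q [simp]: "reg q" "ev q = 1" "reg (inverse q)" "ev (inverse q) = 1" "reg (q - inverse q)" "ev (q - inverse q) = 0"
proof -
  have "q - inverse q = Fract ([:0, 1:] * [:0, 1:] - 1) [:0, 1:]" by (simp add: q_def eq_fract)
  then show "reg (q - inverse q)" "ev (q - inverse q) = 0" by (simp_all add: reg_Fract ev_Fract)
qed (simp_all add: q_def reg_Fract ev_Fract)

lemma reg_sum: "(\<And>i. i \<in> S \<Longrightarrow> reg (f i)) \<Longrightarrow> reg (\<Sum>i\<in>S. f i) \<and> ev (\<Sum>i\<in>S. f i) = (\<Sum>i\<in>S. ev (f i))"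
  by (induction S rule: infinite_finite_induct) (use reg_add in auto)

lemma reg_prod: "(\<And>i. i \<in> S \<Longrightarrow> reg (f i)) \<Longrightarrow> reg (\<Prod>i\<in>S. f i) \<and> ev (\<Prod>i\<in>S. f i) = (\<Prod>i\<in>S. ev (f i))"
  by (induction S rule: infinite_finite_induct) (use reg_mult in auto)

text \<open>Common factors \<open>X - 1\<close> are cancelled, by induction on the degree of the
  denominator.\<close>

lemma Fract_not_both_zero:
  fixes a b :: "complex poly"
  assumes "b \<noteq> 0"
  shows "\<exists>a' b'. Fract a b = Fract a' b' \<and> b' \<noteq> 0 \<and> (a = 0 \<or> poly a' 1 \<noteq> 0 \<or> poly b' 1 \<noteq> 0)"
  using assms
proof (induction "degree b" arbitrary: a b rule: less_induct)
  case less
  show ?case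
  proof (cases "a = 0 \<or> poly a 1 \<noteq> 0 \<or> poly b 1 \<noteq> 0")
    case True
    then show ?thesis using less.prems by blast
  next
    case False
    then obtain a1 b1 where e: "a = [:- 1, 1:] * a1" "b = [:- 1, 1:] * b1" by (metis poly_eq_0_iff_dvd dvdE)
    then have b1: "b1 \<noteq> 0" using less.prems by auto
    have "degree b = Suc (degree b1)" unfolding e(2) using b1 by (subst degree_mult_eq) auto
    then obtain a' b' where "Fract a1 b1 = Fract a' b'" "b' \<noteq> 0" "a1 = 0 \<or> poly a' 1 \<noteq> 0 \<or> poly b' 1 \<noteq> 0"
      using less.hyps[of b1 a1] b1 by auto
    moreover have "Fract a b = Fract a1 b1" unfolding e by (rule mult_fract_cancel) simp
    ultimately have "Fract a b = Fract a' b' \<and> b' \<noteq> 0 \<and> (a = 0 \<or> poly a' 1 \<noteq> 0 \<or> poly b' 1 \<noteq> 0)"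
      using e(1) by (metis mult_zero_right)
    then show ?thesis by blast
  qed
qed

lemma reg_or_inverse:
  assumes "f \<noteq> 0" "\<not> reg f"
  shows "reg (inverse f) \<and> ev (inverse f) = 0"
proof -
  obtain a b where f: "f = Fract a b" "b \<noteq> 0" "a \<noteq> 0" using Fract_cases_nonzero[of f] assms(1) by metis
  then obtain a' b' where f': "f = Fract a' b'" "poly a' 1 \<noteq> 0 \<or> poly b' 1 \<noteq> 0" using Fract_not_both_zero[of b a] by auto
  have b': "poly b' 1 = 0" using assms(2) f'(1) unfolding reg_def by blast
  then show ?thesis using f' by (simp add: reg_Fract ev_Fract)
qed

text \<open>The regular functions form a valuation ring, so that a nonzero family has a multiple that
  survives the specialisation.\<close>

lemma scale_to_regular:
  assumes "finite S" "\<exists>i\<in>S. F i \<noteq> 0"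
  shows "\<exists>s. s \<noteq> 0 \<and> (\<forall>i\<in>S. reg (s * F i)) \<and> (\<exists>i\<in>S. ev (s * F i) \<noteq> 0)"
  using assms
proof (induction S)
  case (insert i S)
  show ?case
  proof (cases "\<exists>k\<in>S. F k \<noteq> 0")
    case False
    then have "F i \<noteq> 0" "\<And>k. k \<in> S \<Longrightarrow> F k = 0" using insert.prems by auto
    then show ?thesis by (intro exI[of _ "inverse (F i)"]) auto
  next
    case True
    then obtain s where s: "s \<noteq> 0" "\<forall>k\<in>S. reg (s * F k)" "\<exists>k\<in>S. ev (s * F k) \<noteq> 0" using insert.IH by blast
    show ?thesis
    proof (cases "reg (s * F i)")
      case True
      then show ?thesis using s by blast
    next
      case False
      then have nz: "s * F i \<noteq> 0" by auto
      let ?g = "inverse (s * F i)"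
      have g: "reg ?g" "?g \<noteq> 0" using reg_or_inverse[OF nz False] nz by auto
      have "reg (?g * s * F k)" if "k \<in> S" for k using reg_mult[OF g(1)] s(2) that by (simp add: mult.assoc)
      moreover have "?g * s * F i = 1" unfolding mult.assoc using nz by (rule left_inverse)
      ultimately have "?g * s \<noteq> 0 \<and> (\<forall>k\<in>insert i S. reg (?g * s * F k)) \<and> (\<exists>k\<in>insert i S. ev (?g * s * F k) \<noteq> 0)"
        using g(2) s(1) by (simp only: ball_simps bex_simps reg_1 mult_eq_0_iff) simp
      then show ?thesis by blast
    qed
  qed
qed simp

section \<open>Colexicographic comparison of permutations\<close>

lemma base_sum_less: "(\<And>i. i < m \<Longrightarrow> f i \<le> k) \<Longrightarrow> (\<Sum>i<m. f i * Suc k ^ i) < Suc k ^ m"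
proof (induction m)
  case (Suc m)
  have 1: "f m * Suc k ^ m \<le> k * Suc k ^ m" using Suc.prems by simp
  have 2: "(\<Sum>i<m. f i * Suc k ^ i) < Suc k ^ m" using Suc by simp
  show ?case unfolding sum.lessThan_Suc power_Suc mult_Suc by (rule add_less_le_mono[OF 2 1])
qed simp

text \<open>The key reads the values as digits in base \<open>Suc k\<close> with the last place
  leading, so that colexicographic comparison becomes comparison of numbers.\<close>

lemma colex_key_less:
  fixes p p' :: "nat \<Rightarrow> nat"
  assumes "j < m" "p' j < p j" "\<And>i. j < i \<Longrightarrow> i < m \<Longrightarrow> p' i = p i" "\<And>i. i < m \<Longrightarrow> p' i \<le> k"
  shows "(\<Sum>i<m. p' i * Suc k ^ i) < (\<Sum>i<m. p i * Suc k ^ i)"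
proof -
  have split: "(\<Sum>i<m. f i) = (\<Sum>i<j. f i) + f j + (\<Sum>i\<in>{Suc j..<m}. f i)" for f :: "nat \<Rightarrow> nat"
  proof -
    have "{..<m} = {..<j} \<union> ({j} \<union> {Suc j..<m})" using assms(1) by auto
    moreover have "sum f ({..<j} \<union> ({j} \<union> {Suc j..<m})) = sum f {..<j} + sum f ({j} \<union> {Suc j..<m})"
      by (rule sum.union_disjoint) auto
    ultimately show ?thesis by (simp add: add.assoc)
  qed
  have "(\<Sum>i<j. p' i * Suc k ^ i) < Suc k ^ j" by (rule base_sum_less) (use assms in auto)
  then have "(\<Sum>i<j. p' i * Suc k ^ i) + p' j * Suc k ^ j < Suc (p' j) * Suc k ^ j" by simp
  also have "\<dots> \<le> p j * Suc k ^ j" using assms(2) by (intro mult_right_mono) auto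
  finally have "(\<Sum>i<j. p' i * Suc k ^ i) + p' j * Suc k ^ j < (\<Sum>i<j. p i * Suc k ^ i) + p j * Suc k ^ j" by simp
  moreover have "(\<Sum>i\<in>{Suc j..<m}. p' i * Suc k ^ i) = (\<Sum>i\<in>{Suc j..<m}. p i * Suc k ^ i)"
    by (rule sum.cong) (use assms(3) in auto)
  ultimately show ?thesis unfolding split by simp
qed

text \<open>Among the permutations that carry \<open>x\<close> to the same word, the class-increasing one is the
  last in the colexicographic order.\<close>

lemma class_increasing_colex:
  assumes p: "p permutes {..<n}" and p': "p' permutes {..<n}" and inc: "class_increasing n x p"
    and e: "x \<circ> p' = x \<circ> p" and ne: "p' \<noteq> p"
  shows "(\<Sum>i<n. p' i * Suc n ^ i) < (\<Sum>i<n. p i * Suc n ^ i)"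
proof -
  have D: "{i. p' i \<noteq> p i} \<subseteq> {..<n}"
  proof
    fix i assume "i \<in> {i. p' i \<noteq> p i}"
    then show "i \<in> {..<n}" using permutes_not_in[OF p, of i] permutes_not_in[OF p', of i] by (cases "i < n") simp_all
  qed
  have Dne: "{i. p' i \<noteq> p i} \<noteq> {}" using ne by auto
  have Df: "finite {i. p' i \<noteq> p i}" using D finite_subset by blast
  \<comment> \<open>The last place where the two permutations differ. The value \<open>p' j\<close>
    is taken by \<open>p\<close> at an earlier place with the same letter, and \<open>p\<close>
    increases on equal letters.\<close>
  define j where "j = Max {i. p' i \<noteq> p i}"
  have j: "p' j \<noteq> p j" "j < n" using Max_in[OF Df Dne] D unfolding j_def by auto
  have later: "p' i = p i" if "j < i" for i
    using Max_ge[OF Df, of i] that unfolding j_def[symmetric] by (cases "p' i = p i") auto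
  have xe: "x (p' i) = x (p i)" for i using fun_cong[OF e, of i] by simp
  have inj: "p a = p b \<longleftrightarrow> a = b" "p' a = p' b \<longleftrightarrow> a = b" for a b using permutes_inj[OF p] permutes_inj[OF p'] by (simp_all add: inj_eq)
  have lt: "p' i < n" if "i < n" for i using permutes_in_image[OF p', of i] that by simp
  obtain k where k: "p k = p' j" using permutes_surj[OF p] by (metis surjD)
  have kn: "k < n" using k lt[OF j(2)] permutes_in_image[OF p, of k] by simp
  have "k < j"
  proof (rule ccontr)
    assume "\<not> k < j"
    then consider "k = j" | "j < k" by linarith
    then show False
    proof cases
      case 1 then show False using j k by simp
    next
      case 2 then show False using later[OF 2] k inj(2)[of k j] by simp
    qed
  qed
  moreover have "x (p k) = x (p j)" using k xe by simp
  ultimately have "p k < p j" using inc j(2) unfolding class_increasing_def by blast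
  then have "p' j < p j" using k by simp
  then show ?thesis using colex_key_less[OF j(2), of p' p n] later lt less_imp_le by blast
qed

text \<open>At \<open>q = 1\<close> the diagonal coefficient survives only for equal letters, and
  exchanging equal letters does nothing.\<close>

lemma braid_op_ev:
  assumes "\<And>x. reg (v x)"
  shows "reg (braid_op i v x) \<and> ev (braid_op i v x) = ev (v (x \<circ> adj i))"
proof -
  have a: "reg (sa l m) \<and> ev (sa l m) = (if l = m then 1 else 0)" for l m by (simp add: sa_def)
  have b: "reg (sb l m) \<and> ev (sb l m) = (if l = m then 0 else 1)" for l m by (simp add: sb_def)
  have s: "x i = x (Suc i) \<Longrightarrow> x \<circ> adj i = x" by (auto simp: fun_eq_iff Transposition.transpose_def)
  have 1: "reg (sa (x i) (x (Suc i)) * v x) \<and> ev (sa (x i) (x (Suc i)) * v x) = (if x i = x (Suc i) then 1 else 0) * ev (v x)"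
    using reg_mult[of "sa (x i) (x (Suc i))" "v x"] a[of "x i" "x (Suc i)"] assms by simp
  have 2: "reg (sb (x i) (x (Suc i)) * v (x \<circ> adj i)) \<and> ev (sb (x i) (x (Suc i)) * v (x \<circ> adj i)) = (if x i = x (Suc i) then 0 else 1) * ev (v (x \<circ> adj i))"
    using reg_mult[of "sb (x i) (x (Suc i))" "v (x \<circ> adj i)"] b[of "x i" "x (Suc i)"] assms by simp
  show ?thesis unfolding braid_op_def using reg_add[OF conjunct1[OF 1] conjunct1[OF 2]] 1 2 s
    by (cases "x i = x (Suc i)") auto
qed

lemma braid_op_word_ev:
  assumes "\<And>x. reg (v x)"
  shows "reg (foldr braid_op us v x) \<and> ev (foldr braid_op us v x) = ev (v (x \<circ> wperm us))"
proof (induction us arbitrary: x)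
  case Nil
  then show ?case using assms by simp
next
  case (Cons i us)
  then show ?case using braid_op_ev[of "foldr braid_op us v" i x] by (simp add: comp_assoc)
qed

lemma foldr_sword: "foldr (letter_op d) (sword us) v = foldr braid_op us v"
  by (induction us) simp_all

section \<open>The spanning elements and their independence\<close>

definition basis_index :: "nat \<Rightarrow> nat \<Rightarrow> ((nat \<Rightarrow> nat) \<times> (nat \<Rightarrow> nat)) set" where
  "basis_index d n = {(\<chi>, p). \<chi> \<in> colourings n d \<and> p permutes {..<n} \<and> mono_321_free n \<chi> p}"

lemma finite_colourings: "finite (colourings n d)"
proof -
  have "(\<lambda>\<chi> i. 2 * \<chi> i :: nat) ` colourings n d \<subseteq> words n d" by (auto simp: colourings_def words_def)
  moreover have "inj_on (\<lambda>\<chi> i. 2 * \<chi> i :: nat) (colourings n d)" by (auto simp: inj_on_def fun_eq_iff)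
  ultimately show ?thesis using inj_on_finite[OF _ _ finite_words] by blast
qed

lemma finite_basis_index: "finite (basis_index d n)"
proof -
  have "basis_index d n \<subseteq> colourings n d \<times> {p. p permutes {..<n}}" by (auto simp: basis_index_def)
  then show ?thesis using finite_subset finite_colourings finite_permutations[of "{..<n}"] by blast
qed

lemma exc_word_words: "\<chi> \<in> colourings n d \<Longrightarrow> exc_word n \<chi> p \<in> words n d"
  by (auto simp: exc_word_def words_def colourings_def)

lemma words_permute: "x \<in> words n d \<Longrightarrow> p permutes {..<n} \<Longrightarrow> x \<circ> p \<in> words n d"
  using permutes_in_image[of p "{..<n}"] by (force simp: words_def permutes_def)

lemma exc_word_colour: "\<chi> \<in> colourings n d \<Longrightarrow> j < n \<Longrightarrow> exc_word n \<chi> p j div 2 = \<chi> j"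
  by (simp add: exc_word_def)

context
  fixes d n :: nat
  assumes d1: "d \<ge> 1"
begin

abbreviation (input) "NM \<equiv> (2 * d) ^ n"

interpretation P: presentation "fb_gens n" "fb_rels d n"
  by standard (rule fb_rels_lists[OF d1])

lemma monoid_G: "Group.monoid P.G"
  using P.group_G by (rule group.is_monoid)

interpretation A: kalgebra "fb_alg d n"
  by (rule kalgebra_monoid_alg[OF monoid_G])

text \<open>The idempotent of the framings for the colouring \<open>\<chi>\<close> times the
  canonical word of \<open>p\<close>. Its coefficient at \<open>Y\<close> is the projection of the
  functional \<open>X \<mapsto> single X Y\<close>, evaluated at that word.\<close>

definition basis_elt :: "(nat \<Rightarrow> nat) \<times> (nat \<Rightarrow> nat) \<Rightarrow> fb_elt" where
  "basis_elt = (\<lambda>(\<chi>, p) Y. isotypics d n \<chi> n (\<lambda>X. single X Y) (P.cls (sword (can n p))))"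

lemma sword_can_L: "p permutes {..<n} \<Longrightarrow> sword (can n p) \<in> P.L"
  using wperm_can sword_L by blast

lemma finite_support_comb:
  assumes "finite A" "\<And>a. a \<in> A \<Longrightarrow> F a \<in> carrier (fb_alg d n)"
  shows "(\<lambda>Y. \<Sum>a\<in>A. c a * F a Y) \<in> carrier (fb_alg d n) \<and>
    lin H (\<lambda>Y. \<Sum>a\<in>A. c a * F a Y) = (\<Sum>a\<in>A. c a * lin H (F a))"
  using assms
proof (induction A)
  case empty
  then show ?case using A.zero_closed by simp
next
  case (insert a A)
  let ?g = "\<lambda>Y. \<Sum>a\<in>A. c a * F a Y"
  have 1: "?g \<in> carrier (fb_alg d n)" "F a \<in> carrier (fb_alg d n)" using insert by auto
  have e: "(\<lambda>Y. \<Sum>a\<in>insert a A. c a * F a Y) = (c a \<odot>\<^bsub>fb_alg d n\<^esub> F a) \<oplus>\<^bsub>fb_alg d n\<^esub> ?g"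
    using insert.hyps by (simp add: fun_eq_iff)
  show ?case unfolding e lin_alg(2)[OF d1 A.smult_closed[OF 1(2)] 1(1)] lin_alg(3)[OF d1 1(2) 1(2)]
    using A.a_closed[OF A.smult_closed[OF 1(2)] 1(1)] insert by simp
qed

lemma
  assumes "(\<chi>, p) \<in> basis_index d n"
  shows basis_elt_carrier: "basis_elt (\<chi>, p) \<in> carrier (fb_alg d n)"
    and lin_basis_elt: "lin H (basis_elt (\<chi>, p)) = isotypics d n \<chi> n H (P.cls (sword (can n p)))"
proof -
  have X: "P.cls (sword (can n p)) \<in> carrier P.G" using assms sword_can_L[of p] by (auto simp: basis_index_def P.carrier_G)
  have "basis_elt (\<chi>, p) \<in> carrier (fb_alg d n) \<and> lin H (basis_elt (\<chi>, p)) =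
      isotypics d n \<chi> n (\<lambda>X. lin H (single X)) (P.cls (sword (can n p)))"
    unfolding basis_elt_def prod.case
    by (rule isotypics_linear[OF d1 _ _ _ order_refl X]) (simp_all add: finite_support_comb)
  then show "basis_elt (\<chi>, p) \<in> carrier (fb_alg d n)" "lin H (basis_elt (\<chi>, p)) = isotypics d n \<chi> n H (P.cls (sword (can n p)))"
    by simp_all
qed

text \<open>The counterpart of \<open>lin_basis_elt\<close> for a functional known only to be linear
  on all functions, such as a separating functional.\<close>

lemma linear_basis_elt:
  fixes f :: "fb_elt \<Rightarrow> Cq"
  assumes p: "(\<chi>, p) \<in> basis_index d n" and f: "\<And>a b. f (\<lambda>Y. a Y + b Y) = f a + f b" "\<And>c a. f (\<lambda>Y. c * a Y) = c * f a"
  shows "f (basis_elt (\<chi>, p)) = isotypics d n \<chi> n (\<lambda>X. f (single X)) (P.cls (sword (can n p)))"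
proof -
  have X: "P.cls (sword (can n p)) \<in> carrier P.G" using p sword_can_L[of p] by (auto simp: basis_index_def P.carrier_G)
  have f0: "f (\<lambda>Y. 0) = 0" using f(2)[of 0 "\<lambda>Y. 0"] by simp
  have "f (\<lambda>Y. \<Sum>a\<in>A. c a * F a Y) = (\<Sum>a\<in>A. c a * f (F a))" if "finite A" for A :: "nat set" and c F
    using that by (induction A) (simp_all add: f0 f)
  then have "basis_elt (\<chi>, p) \<in> UNIV \<and> f (basis_elt (\<chi>, p)) = isotypics d n \<chi> n (\<lambda>X. f (single X)) (P.cls (sword (can n p)))"
    unfolding basis_elt_def prod.case
    by (intro isotypics_linear[OF d1 _ _ _ order_refl X]) auto
  then show ?thesis by simp
qed

definition entry :: "Cq mat \<Rightarrow> (nat \<Rightarrow> nat) \<Rightarrow> (nat \<Rightarrow> nat) \<Rightarrow> Cq" where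
  "entry M x y = M $$ (word_index d n x, word_index d n y)"

lemma entry_basis:
  assumes p: "(\<chi>, p) \<in> basis_index d n" and xy: "x \<in> words n d" "y \<in> words n d"
  shows "entry (fb_rep d n (basis_elt (\<chi>, p))) x y = (if \<forall>j<n. x j div 2 = \<chi> j then foldr braid_op (can n p) (\<lambda>z. if z = y then 1 else 0) x else 0)"
proof -
  let ?\<delta> = "\<lambda>z. if z = y then 1 else 0"
  have chi: "\<chi> \<in> colourings n d" and L: "sword (can n p) \<in> P.L" using p sword_can_L by (auto simp: basis_index_def)
  have "entry (fb_rep d n (basis_elt (\<chi>, p))) x y = mat_act d n (fb_rep d n (basis_elt (\<chi>, p))) ?\<delta> x"
    unfolding entry_def using mat_act_delta[OF xy(2)] by metis
  also have "\<dots> = isotypics d n \<chi> n (\<lambda>g. mat_act d n (class_rep d n g) ?\<delta> x) (P.cls (sword (can n p)))"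
    unfolding fb_rep_act[OF d1 xy(1)] lin_basis_elt[OF p] ..
  also have "\<dots> = (if \<forall>j<n. x j div 2 = \<chi> j then foldr (letter_op d) (sword (can n p)) ?\<delta> x else 0)"
    by (rule isotypics_act[OF d1 xy(1) chi _ order_refl L]) (rule class_rep_act[OF d1 _ xy(1)])
  finally show ?thesis unfolding foldr_sword .
qed

text \<open>Triangularity at \<open>q = 1\<close>. After scaling, some coefficient survives; within
  its colouring take the surviving permutation \<open>p\<close> of least key and read the entry at
  \<open>x = exc_word n \<chi> p\<close> and \<open>y = x \<circ> p\<close>. Another
  \<open>p'\<close> contributes to this entry only if \<open>x \<circ> p' = y\<close>; then its key
  is smaller than that of \<open>p\<close>, and its coefficient specialises to zero.\<close>

theorem basis_independent:
  assumes z: "\<And>x y. x \<in> words n d \<Longrightarrow> y \<in> words n d \<Longrightarrow> (\<Sum>b\<in>basis_index d n. c b * entry (fb_rep d n (basis_elt b)) x y) = 0"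
    and b: "b \<in> basis_index d n"
  shows "c b = 0"
proof (rule ccontr)
  assume "c b \<noteq> 0"
  then obtain s where s: "s \<noteq> 0" "\<forall>b\<in>basis_index d n. reg (s * c b)" "\<exists>b\<in>basis_index d n. ev (s * c b) \<noteq> 0"
    using scale_to_regular[OF finite_basis_index, of d n c] b by blast
  then obtain \<chi> p0 where p0: "(\<chi>, p0) \<in> basis_index d n" "ev (s * c (\<chi>, p0)) \<noteq> 0" by auto
  define P0 where "P0 = {p. (\<chi>, p) \<in> basis_index d n \<and> ev (s * c (\<chi>, p)) \<noteq> 0}"
  define key where "key p = (\<Sum>i<n. p i * Suc n ^ i)" for p :: "nat \<Rightarrow> nat"
  define p where "p = arg_min key (\<lambda>p. p \<in> P0)"
  have "p0 \<in> P0" using p0 by (simp add: P0_def)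
  then have p: "p \<in> P0" "\<And>p'. p' \<in> P0 \<Longrightarrow> key p \<le> key p'"
    unfolding p_def using arg_min_nat_lemma[of "\<lambda>p. p \<in> P0" p0 key] by auto
  have pb: "(\<chi>, p) \<in> basis_index d n" using p by (simp add: P0_def)
  then have chi: "\<chi> \<in> colourings n d" and pp: "p permutes {..<n}" and free: "mono_321_free n \<chi> p" by (auto simp: basis_index_def)
  define x where "x = exc_word n \<chi> p"
  define y where "y = x \<circ> p"
  have x: "x \<in> words n d" and y: "y \<in> words n d" unfolding x_def y_def using exc_word_words[OF chi] words_permute[OF _ pp] by auto
  have xc: "x j div 2 = \<chi> j" if "j < n" for j using exc_word_colour[OF chi that] by (simp add: x_def)
  let ?v = "\<lambda>z. if z = y then 1 else 0 :: Cq"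
  have t: "reg (s * c (\<chi>', p') * entry (fb_rep d n (basis_elt (\<chi>', p'))) x y) \<and>
      ev (s * c (\<chi>', p') * entry (fb_rep d n (basis_elt (\<chi>', p'))) x y) = (if (\<chi>', p') = (\<chi>, p) then ev (s * c (\<chi>, p)) else 0)"
    if b': "(\<chi>', p') \<in> basis_index d n" for \<chi>' p'
  proof (cases "\<chi>' = \<chi>")
    case False
    have nc: "\<not> (\<forall>j<n. x j div 2 = \<chi>' j)"
    proof
      assume "\<forall>j<n. x j div 2 = \<chi>' j"
      then have "\<chi>' j = \<chi> j" for j using xc chi b' by (cases "j < n") (auto simp: colourings_def basis_index_def)
      then show False using False by blast
    qed
    have e0: "entry (fb_rep d n (basis_elt (\<chi>', p'))) x y = 0" unfolding entry_basis[OF b' x y] by (rule if_not_P[OF nc])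
    show ?thesis unfolding e0 using False by simp
  next
    case True
    have p': "p' permutes {..<n}" "(\<chi>, p') \<in> basis_index d n" using b' True by (auto simp: basis_index_def)
    have ok: "\<forall>j<n. x j div 2 = \<chi>' j" using xc True by simp
    have en: "entry (fb_rep d n (basis_elt (\<chi>', p'))) x y = foldr braid_op (can n p') ?v x"
      unfolding entry_basis[OF b' x y] if_P[OF ok] ..
    have ee: "reg (foldr braid_op (can n p') ?v x) \<and> ev (foldr braid_op (can n p') ?v x) = (if x \<circ> p' = y then 1 else 0)"
      using braid_op_word_ev[of ?v "can n p'" x] wperm_can[OF p'(1)] by simp
    have r: "reg (s * c (\<chi>', p'))" using s(2) b' by blast
    have m: "reg (s * c (\<chi>', p') * foldr braid_op (can n p') ?v x) \<and>
      ev (s * c (\<chi>', p') * foldr braid_op (can n p') ?v x) = ev (s * c (\<chi>', p')) * (if x \<circ> p' = y then 1 else 0)"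
      using reg_mult[OF r conjunct1[OF ee]] ee by simp
    show ?thesis
    proof (cases "p' = p")
      case True
      then show ?thesis unfolding en using m \<open>\<chi>' = \<chi>\<close> by (simp add: y_def)
    next
      case False
      have "ev (s * c (\<chi>', p')) = 0 \<or> x \<circ> p' \<noteq> y"
      proof (rule ccontr)
        assume "\<not> ?thesis"
        then have "p' \<in> P0" "x \<circ> p' = x \<circ> p" using p' True by (auto simp: P0_def y_def)
        then have "key p' < key p" unfolding key_def using exc_word_class_increasing[OF pp free] False
          by (intro class_increasing_colex[OF pp p'(1)]) (simp_all add: x_def)
        then show False using p(2)[OF \<open>p' \<in> P0\<close>] by simp
      qed
      then show ?thesis unfolding en using m False by (elim disjE) simp_all
    qed
  qed
  have "(\<Sum>b\<in>basis_index d n. s * c b * entry (fb_rep d n (basis_elt b)) x y) = s * (\<Sum>b\<in>basis_index d n. c b * entry (fb_rep d n (basis_elt b)) x y)"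
    by (simp add: sum_distrib_left mult.assoc)
  also have "\<dots> = 0" using z[OF x y] by simp
  finally have "0 = ev (\<Sum>b\<in>basis_index d n. s * c b * entry (fb_rep d n (basis_elt b)) x y)" by simp
  also have "\<dots> = (\<Sum>b\<in>basis_index d n. ev (s * c b * entry (fb_rep d n (basis_elt b)) x y))"
  proof (rule conjunct2[OF reg_sum])
    fix b assume "b \<in> basis_index d n"
    then have "(fst b, snd b) \<in> basis_index d n" unfolding prod.collapse .
    from t[OF this] show "reg (s * c b * entry (fb_rep d n (basis_elt b)) x y)" unfolding prod.collapse by (rule conjunct1)
  qed
  also have "\<dots> = (\<Sum>b\<in>basis_index d n. if b = (\<chi>, p) then ev (s * c (\<chi>, p)) else 0)"
  proof (rule sum.cong[OF HOL.refl])
    fix b assume "b \<in> basis_index d n"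
    then have "(fst b, snd b) \<in> basis_index d n" unfolding prod.collapse .
    from t[OF this] show "ev (s * c b * entry (fb_rep d n (basis_elt b)) x y) = (if b = (\<chi>, p) then ev (s * c (\<chi>, p)) else 0)"
      unfolding prod.collapse by (rule conjunct2)
  qed
  also have "\<dots> = ev (s * c (\<chi>, p))" using pb finite_basis_index by simp
  finally show False using p(1) by (simp add: P0_def)
qed

section \<open>Specialisation of the centralizer\<close>

lemma kq_ev: "reg (kq c a) \<and> ev (kq c a) = 1"
  by (simp add: kq_def)

text \<open>A nonzero matrix is scaled so that its entries specialise to a nonzero operator
  satisfying \<open>classical_commutant\<close>. Its weight condition is obtained before
  specialising, by comparing the powers of \<open>q\<close> through which the Cartan generators act;
  in the commutation with \<open>E\<close> the factors \<open>K\<close> become 1.\<close>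

theorem centralizer_determined:
  assumes M: "M \<in> carrier (uq_centralizer d n)"
    and van: "\<And>\<chi> p. (\<chi>, p) \<in> basis_index d n \<Longrightarrow> entry M (exc_word n \<chi> p) (exc_word n \<chi> p \<circ> p) = 0"
    and xy: "x \<in> words n d" "y \<in> words n d"
  shows "entry M x y = 0"
proof (rule ccontr)
  assume "entry M x y \<noteq> 0"
  let ?S = "words n d \<times> words n d"
  have fin: "finite ?S" using finite_words by simp
  have ex: "\<exists>i\<in>?S. entry M (fst i) (snd i) \<noteq> 0"
    by (rule bexI[of _ "(x, y)"]) (use \<open>entry M x y \<noteq> 0\<close> xy in simp_all)
  obtain s where s1: "\<forall>i\<in>?S. reg (s * entry M (fst i) (snd i))" and s2: "\<exists>i\<in>?S. ev (s * entry M (fst i) (snd i)) \<noteq> 0"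
    using scale_to_regular[OF fin ex] by (elim exE conjE)
  have s: "reg (s * entry M x y)" if "x \<in> words n d" "y \<in> words n d" for x y
    using bspec[OF s1, of "(x, y)"] that by simp
  have Mc: "M \<in> carrier_mat NM NM" and comm: "\<And>z. z \<in> uq_gens d \<Longrightarrow> M * uq_tensor d n z = uq_tensor d n z * M"
    using M unfolding carrier_uq_centralizer by auto
  have act: "mat_act d n M (uq_op n c g v) x = uq_op n c g (mat_act d n M v) x" if c: "c < d" and g: "g \<in> gl2_gens" and x: "x \<in> words n d" for c g v x
  proof -
    have z: "(Suc c, g) \<in> uq_gens d" using c g by (auto simp: uq_gens_def)
    have za: "mat_act d n (uq_tensor d n (Suc c, g)) v x = uq_op n c g v x" if "x \<in> words n d" for v x
      using uq_tensor_act[OF c g] that by blast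
    have zc: "uq_tensor d n (Suc c, g) \<in> carrier_mat NM NM" using uq_tensor_act[OF c g] by blast
    have "mat_act d n M (uq_op n c g v) x = mat_act d n M (\<lambda>y. mat_act d n (uq_tensor d n (Suc c, g)) v y) x"
      by (rule mat_act_cong) (simp add: za)
    also have "\<dots> = mat_act d n (uq_tensor d n (Suc c, g) * M) v x"
      unfolding comm[OF z, symmetric] by (rule mat_act_mat_mult[OF Mc zc x, symmetric])
    also have "\<dots> = uq_op n c g (mat_act d n M v) x"
      unfolding mat_act_mat_mult[OF zc Mc x] by (rule za[OF x])
    finally show ?thesis .
  qed
  let ?\<delta> = "\<lambda>y z. if z = y then 1 else 0 :: Cq"
  have md: "mat_act d n M (?\<delta> y) x = entry M x y" if "y \<in> words n d" for x y
    unfolding entry_def by (rule mat_act_delta[OF that])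
  have upd: "x(i := l) \<in> words n d" if "x \<in> words n d" "i < n" "l < 2 * d" for x i l
    using that by (auto simp: words_def)
  interpret classical_commutant n d "\<lambda>x y. ev (s * entry M x y)"
  proof
    fix x y l assume x: "x \<in> words n d" and y: "y \<in> words n d" and "ev (s * entry M x y) \<noteq> 0"
    then have e: "entry M x y \<noteq> 0" by auto
    show "card {i. i < n \<and> x i = l} = card {j. j < n \<and> y j = l}"
    proof (cases "l < 2 * d")
      case False
      then have "{i. i < n \<and> x i = l} = {}" "{i. i < n \<and> y i = l} = {}" using x y by (auto simp: words_def)
      then show ?thesis by (simp only:)
    next
      case True
      \<comment> \<open>The letter \<open>l\<close> is the basis vector \<open>k\<close> of colour
        \<open>c\<close>, with \<open>k\<close> counted from 1, and \<open>GL k\<close> counts its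
        occurrences.\<close>
      define c k where "c = l div 2" and "k = Suc (l mod 2)"
      have c: "c < d" using True by (auto simp: c_def)
      have lk: "Suc a = 2 * c + k \<longleftrightarrow> a = l" for a by (simp add: c_def k_def)
      have "l mod 2 = 0 \<or> l mod 2 = 1" by linarith
      then have g: "GL k \<in> gl2_gens" by (auto simp: gl2_gens_def k_def)
      have LO: "LO c k n x = q ^ card {j. j < n \<and> x j = l}" for x
      proof -
        have "(\<Prod>j<n. if x j = l then q else 1) = (\<Prod>j\<in>{j \<in> {..<n}. x j = l}. q)" by (rule prod.inter_filter[symmetric]) simp
        then show ?thesis unfolding LO_def lk by simp
      qed
      have "mat_act d n M (uq_op n c (GL k) (?\<delta> y)) x = LO c k n y * entry M x y"
      proof -
        have "mat_act d n M (uq_op n c (GL k) (?\<delta> y)) x = (\<Sum>z\<in>words n d. entry M x z * (LO c k n z * ?\<delta> y z))"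
          by (simp add: mat_act_def entry_def)
        also have "\<dots> = (\<Sum>z\<in>words n d. if z = y then LO c k n y * entry M x y else 0)" by (rule sum.cong) auto
        finally show ?thesis using y by (simp add: finite_words)
      qed
      moreover have "uq_op n c (GL k) (mat_act d n M (?\<delta> y)) x = LO c k n x * entry M x y" by (simp add: md[OF y])
      ultimately have "LO c k n y = LO c k n x" using act[OF c g x, of "?\<delta> y"] e by simp
      then show ?thesis unfolding LO q_power_eq_iff by simp
    qed
  next
    fix c x y assume c: "c < d" and x: "x \<in> words n d" and y: "y \<in> words n d"
    have g: "GE \<in> gl2_gens" by (simp add: gl2_gens_def)
    let ?k = "\<lambda>z i. \<Prod>j<i. kq c (z j)"
    have k: "reg (?k z i) \<and> ev (?k z i) = 1" for z :: "nat \<Rightarrow> nat" and i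
      using reg_prod[of "{..<i}" "\<lambda>j. kq c (z j)"] kq_ev by simp
    have R: "uq_op n c GE (mat_act d n M (?\<delta> y)) x = (\<Sum>i\<in>{i. i < n \<and> x i = 2 * c}. ?k x i * entry M (x(i := 2 * c + 1)) y)"
    proof -
      have "uq_op n c GE (mat_act d n M (?\<delta> y)) x = (\<Sum>i\<in>{..<n}. if x i = 2 * c then ?k x i * entry M (x(i := 2 * c + 1)) y else 0)"
        unfolding uq_op.simps EO_def md[OF y] ..
      also have "\<dots> = (\<Sum>i\<in>{i \<in> {..<n}. x i = 2 * c}. ?k x i * entry M (x(i := 2 * c + 1)) y)"
        by (rule sum.inter_filter[symmetric]) simp
      finally show ?thesis by simp
    qed
    \<comment> \<open>The column \<open>y\<close> of \<open>E\<close> is supported at the words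
      \<open>y(i := 2 * c)\<close>, and the eigenvalues of \<open>K\<close> are taken at these
      words.\<close>
    have L: "mat_act d n M (uq_op n c GE (?\<delta> y)) x = (\<Sum>i\<in>{i. i < n \<and> y i = 2 * c + 1}. ?k (y(i := 2 * c)) i * entry M x (y(i := 2 * c)))"
    proof -
      have in1: "(\<Sum>z\<in>words n d. entry M x z * (if z i = 2 * c then ?k z i * ?\<delta> y (z(i := 2 * c + 1)) else 0)) =
          (if y i = 2 * c + 1 then ?k (y(i := 2 * c)) i * entry M x (y(i := 2 * c)) else 0)" if i: "i < n" for i
      proof (cases "y i = 2 * c + 1")
        case False
        have "(z(i := 2 * c + 1)) \<noteq> y" for z using False by auto
        then show ?thesis using False by (simp cong: if_cong)
      next
        case True
        have yw: "y(i := 2 * c) \<in> words n d" using upd[OF y i] c by simp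
        have iff: "z i = 2 * c \<and> z(i := 2 * c + 1) = y \<longleftrightarrow> z = y(i := 2 * c)" for z
        proof
          assume a: "z i = 2 * c \<and> z(i := 2 * c + 1) = y"
          then have "y(i := 2 * c) = z(i := 2 * c)" by auto
          also have "z(i := 2 * c) = z" using a by (auto simp: fun_eq_iff)
          finally show "z = y(i := 2 * c)" by simp
        next
          assume "z = y(i := 2 * c)"
          then show "z i = 2 * c \<and> z(i := 2 * c + 1) = y" using True by (auto simp: fun_eq_iff)
        qed
        have "entry M x z * (if z i = 2 * c then ?k z i * ?\<delta> y (z(i := 2 * c + 1)) else 0) =
            (if z = y(i := 2 * c) then ?k (y(i := 2 * c)) i * entry M x (y(i := 2 * c)) else 0)" for z
        proof (cases "z i = 2 * c \<and> z(i := 2 * c + 1) = y")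
          case True
          then have 1: "z i = 2 * c" and 2: "z(i := 2 * c + 1) = y" and 3: "z = y(i := 2 * c)" using iff by blast+
          show ?thesis unfolding if_P[OF 1] if_P[OF 2] if_P[OF 3] unfolding 3[symmetric] by (simp only: mult_1_left mult_1_right mult.commute)
        next
          case False
          then have 3: "z \<noteq> y(i := 2 * c)" using iff by blast
          show ?thesis
          proof (cases "z i = 2 * c")
            case True
            then have 2: "z(i := 2 * c + 1) \<noteq> y" using False by blast
            show ?thesis unfolding if_not_P[OF 3] if_not_P[OF 2] by simp
          next
            case False
            show ?thesis unfolding if_not_P[OF 3] if_not_P[OF False] by simp
          qed
        qed
        then have "(\<Sum>z\<in>words n d. entry M x z * (if z i = 2 * c then ?k z i * ?\<delta> y (z(i := 2 * c + 1)) else 0)) =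
            (\<Sum>z\<in>words n d. if z = y(i := 2 * c) then ?k (y(i := 2 * c)) i * entry M x (y(i := 2 * c)) else 0)" by (simp only:)
        then show ?thesis using yw True by (simp add: finite_words)
      qed
      have "mat_act d n M (uq_op n c GE (?\<delta> y)) x = (\<Sum>z\<in>words n d. \<Sum>i<n. entry M x z * (if z i = 2 * c then ?k z i * ?\<delta> y (z(i := 2 * c + 1)) else 0))"
        unfolding mat_act_def entry_def uq_op.simps EO_def sum_distrib_left ..
      also have "\<dots> = (\<Sum>i<n. \<Sum>z\<in>words n d. entry M x z * (if z i = 2 * c then ?k z i * ?\<delta> y (z(i := 2 * c + 1)) else 0))"
        by (rule sum.swap)
      also have "\<dots> = (\<Sum>i\<in>{..<n}. if y i = 2 * c + 1 then ?k (y(i := 2 * c)) i * entry M x (y(i := 2 * c)) else 0)"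
        by (rule sum.cong[OF HOL.refl]) (rule in1, simp)
      also have "\<dots> = (\<Sum>i\<in>{i \<in> {..<n}. y i = 2 * c + 1}. ?k (y(i := 2 * c)) i * entry M x (y(i := 2 * c)))"
        by (rule sum.inter_filter[symmetric]) simp
      finally show ?thesis by simp
    qed
    have LR: "s * (\<Sum>i\<in>{i. i < n \<and> x i = 2 * c}. ?k x i * entry M (x(i := 2 * c + 1)) y) =
        s * (\<Sum>i\<in>{i. i < n \<and> y i = 2 * c + 1}. ?k (y(i := 2 * c)) i * entry M x (y(i := 2 * c)))"
      using act[OF c g x, of "?\<delta> y"] unfolding L R by simp
    have scaled: "reg (s * (k1 * e)) \<and> ev (s * (k1 * e)) = ev (s * e)" if "reg k1 \<and> ev k1 = 1" "reg (s * e)" for k1 e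
      using reg_mult[of k1 "s * e"] that by (simp add: mult.left_commute)
    have tx: "reg (s * (?k x i * entry M (x(i := 2 * c + 1)) y)) \<and> ev (s * (?k x i * entry M (x(i := 2 * c + 1)) y)) = ev (s * entry M (x(i := 2 * c + 1)) y)"
      if "i < n" for i by (rule scaled[OF k s[OF upd[OF x that] y]]) (use c in simp)
    have ty: "reg (s * (?k (y(i := 2 * c)) i * entry M x (y(i := 2 * c)))) \<and> ev (s * (?k (y(i := 2 * c)) i * entry M x (y(i := 2 * c)))) = ev (s * entry M x (y(i := 2 * c)))"
      if "i < n" for i by (rule scaled[OF k s[OF x upd[OF y that]]]) (use c in simp)
    have "(\<Sum>i\<in>{i. i < n \<and> x i = 2 * c}. ev (s * entry M (x(i := 2 * c + 1)) y)) =
        (\<Sum>i\<in>{i. i < n \<and> x i = 2 * c}. ev (s * (?k x i * entry M (x(i := 2 * c + 1)) y)))"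
      by (rule sum.cong[OF HOL.refl]) (use tx in auto)
    also have "\<dots> = ev (s * (\<Sum>i\<in>{i. i < n \<and> x i = 2 * c}. ?k x i * entry M (x(i := 2 * c + 1)) y))"
      unfolding sum_distrib_left by (rule conjunct2[OF reg_sum, symmetric]) (use tx in auto)
    also have "\<dots> = (\<Sum>i\<in>{i. i < n \<and> y i = 2 * c + 1}. ev (s * (?k (y(i := 2 * c)) i * entry M x (y(i := 2 * c)))))"
      unfolding LR unfolding sum_distrib_left by (rule conjunct2[OF reg_sum]) (use ty in auto)
    also have "\<dots> = (\<Sum>j\<in>{j. j < n \<and> y j = 2 * c + 1}. ev (s * entry M x (y(j := 2 * c))))"
      by (rule sum.cong[OF HOL.refl]) (use ty in auto)
    finally show "(\<Sum>i\<in>{i. i < n \<and> x i = 2 * c}. ev (s * entry M (x(i := 2 * c + 1)) y)) =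
      (\<Sum>j\<in>{j. j < n \<and> y j = 2 * c + 1}. ev (s * entry M x (y(j := 2 * c))))" .
  qed
  have "ev (s * entry M x y) = 0" if "x \<in> words n d" "y \<in> words n d" for x y
    by (rule determined_by_exc_words[OF _ that]) (simp add: van basis_index_def)
  then show False using s2 by (elim bexE) (simp only: mem_Times_iff)
qed

end

section \<open>The isomorphism\<close>

text \<open>The ambient space consists of all functions, so the functional is linear without side
  conditions. It extends the indicator of \<open>x\<close> from a basis of \<open>U\<close> enlarged
  by \<open>x\<close>.\<close>

lemma separating_functional:
  fixes U :: "('g \<Rightarrow> 'k::field) set"
  assumes zero: "(\<lambda>g. 0) \<in> U"
    and add: "\<And>a b. a \<in> U \<Longrightarrow> b \<in> U \<Longrightarrow> (\<lambda>g. a g + b g) \<in> U"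
    and scale: "\<And>c a. a \<in> U \<Longrightarrow> (\<lambda>g. c * a g) \<in> U"
    and x: "x \<notin> U"
  shows "\<exists>f :: ('g \<Rightarrow> 'k) \<Rightarrow> 'k. (\<forall>a b. f (\<lambda>g. a g + b g) = f a + f b) \<and> (\<forall>c a. f (\<lambda>g. c * a g) = c * f a) \<and>
    (\<forall>a\<in>U. f a = 0) \<and> f x \<noteq> 0"
proof -
  interpret vector_space_pair "\<lambda>(c::'k) (a::'g \<Rightarrow> 'k) g. c * a g" "(*) :: 'k \<Rightarrow> 'k \<Rightarrow> 'k"
    by unfold_locales (simp_all add: fun_eq_iff algebra_simps)
  have U: "vs1.subspace U"
    unfolding vs1.subspace_def zero_fun_def plus_fun_def using zero add scale by blast
  obtain B where B: "B \<subseteq> U" "vs1.independent B" "U \<subseteq> vs1.span B" by (rule vs1.maximal_independent_subset)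
  have xB: "x \<notin> vs1.span B" using vs1.span_minimal[OF B(1) U] x by blast
  then have ind: "vs1.independent (insert x B)" using B(2) by (rule vs1.independent_insertI)
  obtain f where f: "Vector_Spaces.linear (\<lambda>(c::'k) (a::'g \<Rightarrow> 'k) g. c * a g) (*) f"
    and v: "\<forall>y\<in>insert x B. f y = (if y = x then 1 else 0)"
    using linear_independent_extend[OF ind, of "\<lambda>y. if y = x then 1 else 0"] by (elim exE conjE)
  have "f b = 0" if "b \<in> B" for b using v that B(1) x by auto
  then have "f a = 0" if "a \<in> U" for a using linear_eq_0_on_span[OF f, of B a] that B(3) by blast
  moreover have "f (\<lambda>g. a g + b g) = f a + f b" for a b using linear_add[OF f, of a b] by (simp add: plus_fun_def)
  moreover have "f (\<lambda>g. c * a g) = c * f a" for c a by (rule linear_scale[OF f])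
  moreover have "f x \<noteq> 0" using v by simp
  ultimately show ?thesis by blast
qed

text \<open>Plays the part of a dimension count: with unknowns and equations indexed by the same
  finite set, uniqueness implies solvability, through the determinant.\<close>

lemma square_system_solvable:
  fixes N :: "'i \<Rightarrow> 'i \<Rightarrow> 'k::field"
  assumes fin: "finite I"
    and inj: "\<And>c. (\<And>i. i \<in> I \<Longrightarrow> (\<Sum>b\<in>I. N i b * c b) = 0) \<Longrightarrow> \<forall>b\<in>I. c b = 0"
  shows "\<exists>c. \<forall>i\<in>I. (\<Sum>b\<in>I. N i b * c b) = e i"
proof -
  let ?k = "card I"
  obtain h where h: "bij_betw h {0..<?k} I" using ex_bij_betw_nat_finite[OF fin] by blast
  have hI: "h j \<in> I" if "j < ?k" for j using h that by (auto simp: bij_betw_def)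
  have hs: "\<exists>a<?k. i = h a" if "i \<in> I" for i using h that unfolding bij_betw_def by fastforce
  have hinv: "inv_into {0..<?k} h (h j) = j" if "j < ?k" for j using bij_betw_inv_into_left[OF h] that by simp
  define M where "M = mat ?k ?k (\<lambda>(i, j). N (h i) (h j))"
  have M: "M \<in> carrier_mat ?k ?k" by (simp add: M_def)
  have Mv: "(M *\<^sub>v v) $ a = (\<Sum>b\<in>I. N (h a) b * v $ inv_into {0..<?k} h b)" if "a < ?k" "v \<in> carrier_vec ?k" for a v
  proof -
    have "(M *\<^sub>v v) $ a = (\<Sum>j\<in>{0..<?k}. N (h a) (h j) * v $ j)"
      using that by (simp add: M_def scalar_prod_def)
    also have "\<dots> = (\<Sum>j\<in>{0..<?k}. N (h a) (h j) * v $ inv_into {0..<?k} h (h j))"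
      by (rule sum.cong) (simp_all add: hinv)
    also have "\<dots> = (\<Sum>b\<in>I. N (h a) b * v $ inv_into {0..<?k} h b)" by (rule sum.reindex_bij_betw[OF h])
    finally show ?thesis .
  qed
  have "det M \<noteq> 0"
  proof
    assume "det M = 0"
    then obtain v where v: "v \<in> carrier_vec ?k" "v \<noteq> 0\<^sub>v ?k" "M *\<^sub>v v = 0\<^sub>v ?k"
      using det_0_iff_vec_prod_zero_field[OF M] by blast
    have "\<forall>b\<in>I. v $ inv_into {0..<?k} h b = 0"
    proof (rule inj)
      fix i assume "i \<in> I"
      then obtain a where a: "a < ?k" "i = h a" using hs by blast
      show "(\<Sum>b\<in>I. N i b * v $ inv_into {0..<?k} h b) = 0"
        unfolding a(2) Mv[OF a(1) v(1), symmetric] v(3) using a(1) by simp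
    qed
    then have "v $ j = 0" if "j < ?k" for j using hinv[OF that] hI[OF that] by metis
    then have "v = 0\<^sub>v ?k" using v(1) by (intro eq_vecI) auto
    then show False using v(2) by simp
  qed
  from det_non_zero_imp_unit[OF M this, of "()"] obtain B where B: "B \<in> carrier_mat ?k ?k" "M * B = 1\<^sub>m ?k"
    unfolding Units_def ring_mat_def by auto
  define w where "w = vec ?k (\<lambda>j. e (h j))"
  have w: "w \<in> carrier_vec ?k" by (simp add: w_def)
  have Bw: "B *\<^sub>v w \<in> carrier_vec ?k" using B(1) w by simp
  have MBw: "M *\<^sub>v (B *\<^sub>v w) = w" unfolding assoc_mult_mat_vec[OF M B(1) w, symmetric] B(2) using w by simp
  have "(\<Sum>b\<in>I. N i b * (B *\<^sub>v w) $ inv_into {0..<?k} h b) = e i" if i: "i \<in> I" for i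
  proof -
    obtain a where a: "a < ?k" "i = h a" using hs[OF i] by blast
    show ?thesis unfolding a(2) Mv[OF a(1) Bw, symmetric] MBw using a(1) by (simp add: w_def)
  qed
  then show ?thesis by (intro exI[of _ "\<lambda>b. (B *\<^sub>v w) $ inv_into {0..<?k} h b"]) blast
qed

lemma alg_hom_comp: "g \<in> alg_hom A B \<Longrightarrow> h \<in> alg_hom B C \<Longrightarrow> (\<lambda>x. h (g x)) \<in> alg_hom A C"
  by (auto simp: alg_hom_def Ring.ring_hom_def Pi_iff)

section \<open>FTL as a quotient of the group algebra, and the comparison with the
  centralizer\<close>

context
  fixes d n :: nat
  assumes d1: "d \<ge> 1"
begin

interpretation P: presentation "fb_gens n" "fb_rels d n"
  by standard (rule fb_rels_lists[OF d1])

lemma fb_kalgebra: "kalgebra (fb_alg d n)"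
  by (rule kalgebra_monoid_alg[OF monoid_G[OF d1]])

interpretation A: kalgebra "fb_alg d n" by (rule fb_kalgebra)

interpretation QY: algebra_quotient "fb_alg d n" "yh_rels d n"
proof (intro algebra_quotient.intro algebra_quotient_axioms.intro)
  show "yh_rels d n \<subseteq> carrier (fb_alg d n)"
    unfolding yh_rels_eq[OF d1] using yh_rel_carrier[OF d1] by blast
qed (rule fb_kalgebra)

lemma yh_proj_hom: "yh_proj d n \<in> alg_hom (fb_alg d n) (YH d n)"
  using QY.proj_alg_hom unfolding YH_def yh_proj_def[abs_def] .

lemma YH_kalgebra: "kalgebra (YH d n)"
  unfolding YH_def by (rule QY.kalgebra_Q)

interpretation Y: kalgebra "YH d n" by (rule YH_kalgebra)

lemma ftl_rel_eq:
  assumes n: "n > 2"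
  shows "ftl_rel d n = yh_proj d n (ftl_elt d n)"
proof -
  have i: "1 \<in> {1..<n}" "2 \<in> {1..<n}" using n by auto
  note s1 = s_carrier[OF d1 i(1)] and s2 = s_carrier[OF d1 i(2)] and E1 = yh_E_carrier[OF d1 i(1)] and E2 = yh_E_carrier[OF d1 i(2)]
  note s12 = A.m_closed[OF s1 s2] and s21 = A.m_closed[OF s2 s1]
  note s121 = A.m_closed[OF s12 s1] and E12 = A.m_closed[OF E1 E2]
  note c1 = A.minus_closed[OF A.one_closed A.smult_closed[OF s1, of "inverse q"]]
  note c2 = A.minus_closed[OF c1 A.smult_closed[OF s2, of "inverse q"]]
  note c3 = A.a_closed[OF c2 A.smult_closed[OF s12, of "inverse (q ^ 2)"]]
  note c4 = A.a_closed[OF c3 A.smult_closed[OF s21, of "inverse (q ^ 2)"]]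
  note c5 = A.minus_closed[OF c4 A.smult_closed[OF s121, of "inverse (q ^ 3)"]]
  note h = alg_homD[OF yh_proj_hom] and hminus = alg_hom_minus(1)[OF yh_proj_hom A.ring_axioms Y.ring_axioms]
  show ?thesis
    unfolding ftl_rel_def ftl_elt_def[OF d1] Let_def h(4)[OF E12 c5] h(4)[OF E1 E2] hminus[OF c4 A.smult_closed[OF s121]] h(2)[OF s121]
      h(4)[OF s12 s1] h(4)[OF s1 s2] h(4)[OF s2 s1] h(5)[OF c3 A.smult_closed[OF s21]] h(5)[OF c2 A.smult_closed[OF s12]] h(2)[OF s21] h(2)[OF s12]
      hminus[OF c1 A.smult_closed[OF s2]] hminus[OF A.one_closed A.smult_closed[OF s1]] h(2)[OF s1] h(2)[OF s2] h(6) ..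
qed

abbreviation (input) "ftl_gens \<equiv> (if n > 2 then {ftl_rel d n} else {})"

interpretation QF: algebra_quotient "YH d n" ftl_gens
proof (intro algebra_quotient.intro algebra_quotient_axioms.intro)
  show "ftl_gens \<subseteq> carrier (YH d n)"
    using alg_homD(3)[OF yh_proj_hom ftl_elt_carrier[OF d1]] ftl_rel_eq by auto
qed (rule YH_kalgebra)

text \<open>The composite of the two quotient maps. It is onto, so kernel and image can be studied
  in the group algebra.\<close>

definition ftl_proj :: "fb_elt \<Rightarrow> fb_elt set set" where
  "ftl_proj x = QF.I +>\<^bsub>YH d n\<^esub> yh_proj d n x"

lemma ftl_proj_hom: "ftl_proj \<in> alg_hom (fb_alg d n) (FTL d n)"
  using alg_hom_comp[OF yh_proj_hom QF.proj_alg_hom] unfolding FTL_def ftl_proj_def[abs_def] .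

lemma FTL_kalgebra: "kalgebra (FTL d n)"
  unfolding FTL_def by (rule QF.kalgebra_Q)

interpretation F: kalgebra "FTL d n" by (rule FTL_kalgebra)

lemma carrier_YH: "carrier (YH d n) = yh_proj d n ` carrier (fb_alg d n)"
  unfolding YH_def QY.carrier_Q yh_proj_def ..

lemma carrier_FTL: "carrier (FTL d n) = ftl_proj ` carrier (fb_alg d n)"
  unfolding FTL_def QF.carrier_Q carrier_YH ftl_proj_def image_image ..

lemma ftl_proj_rel:
  assumes "r \<in> fb_rel_elts d n"
  shows "ftl_proj r = \<zero>\<^bsub>FTL d n\<^esub>"
proof -
  have "yh_proj d n r \<in> QF.I"
  proof (cases "r \<in> yh_rel d n ` {1..<n}")
    case True
    then have r: "r \<in> yh_rels d n" unfolding yh_rels_eq[OF d1] .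
    then have "r \<in> QY.I" using A.genideal_self[OF QY.gens] by blast
    then have "yh_proj d n r = \<zero>\<^bsub>YH d n\<^esub>"
      using QY.proj_zero_iff[of r] QY.gens r unfolding YH_def yh_proj_def by blast
    then show ?thesis using additive_subgroup.zero_closed[OF QF.id.additive_subgroup_axioms] by simp
  next
    case False
    then have n: "n > 2" and r: "r = ftl_elt d n" using assms by (auto simp: fb_rel_elts_def[OF d1] split: if_splits)
    have "ftl_rel d n \<in> QF.I" using Y.genideal_self[OF QF.gens] n by auto
    then show ?thesis unfolding r ftl_rel_eq[OF n] .
  qed
  moreover have "yh_proj d n r \<in> carrier (YH d n)"
    by (rule alg_homD(3)[OF yh_proj_hom fb_rel_elts_carrier[OF d1 assms]])
  ultimately show ?thesis using QF.proj_zero_iff unfolding FTL_def ftl_proj_def by blast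
qed

lemma fb_rep_factors: "\<exists>\<Phi>\<in>alg_hom (FTL d n) (mat_alg ((2 * d) ^ n)). \<forall>x\<in>carrier (fb_alg d n). \<Phi> (ftl_proj x) = fb_rep d n x"
proof -
  have R: "ring (mat_alg ((2 * d) ^ n))" using kalgebra_mat by (rule kalgebra.axioms(1))
  have "fb_rep d n s = \<zero>\<^bsub>mat_alg ((2 * d) ^ n)\<^esub>" if "s \<in> yh_rels d n" for s
    using that fb_rep_yh_rel[OF d1] by (auto simp: yh_rels_eq[OF d1])
  then obtain h1 where h1: "h1 \<in> alg_hom (YH d n) (mat_alg ((2 * d) ^ n))" "\<forall>x\<in>carrier (fb_alg d n). h1 (yh_proj d n x) = fb_rep d n x"
    using QY.hom_factors[OF fb_rep_hom[OF d1] R] unfolding YH_def yh_proj_def by blast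
  have "h1 s = \<zero>\<^bsub>mat_alg ((2 * d) ^ n)\<^esub>" if "s \<in> ftl_gens" for s
    using that h1(2) ftl_rel_eq fb_rep_ftl_elt[OF d1] ftl_elt_carrier[OF d1] by (auto split: if_splits)
  then obtain h2 where h2: "h2 \<in> alg_hom (FTL d n) (mat_alg ((2 * d) ^ n))" "\<forall>x\<in>carrier (YH d n). h2 (QF.I +>\<^bsub>YH d n\<^esub> x) = h1 x"
    using QF.hom_factors[OF h1(1) R] unfolding FTL_def by blast
  have "h2 (ftl_proj x) = fb_rep d n x" if "x \<in> carrier (fb_alg d n)" for x
    using h1(2) h2(2) that alg_homD(3)[OF yh_proj_hom that] unfolding ftl_proj_def by simp
  then show ?thesis using h2(1) by blast
qed

definition comb :: "((nat \<Rightarrow> nat) \<times> (nat \<Rightarrow> nat) \<Rightarrow> Cq) \<Rightarrow> fb_elt" where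
  "comb c = (\<lambda>Y. \<Sum>b\<in>basis_index d n. c b * basis_elt d n b Y)"

lemma basis_carrier: "b \<in> basis_index d n \<Longrightarrow> basis_elt d n b \<in> carrier (fb_alg d n)"
  using basis_elt_carrier[OF d1, of "fst b" "snd b"] by simp

lemma comb_carrier: "comb c \<in> carrier (fb_alg d n)"
  and lin_comb: "lin H (comb c) = (\<Sum>b\<in>basis_index d n. c b * lin H (basis_elt d n b))"
  using finite_support_comb[where F = "basis_elt d n" and c = c and H = H and A = "basis_index d n" and n = n, OF d1 finite_basis_index] basis_carrier
  unfolding comb_def by blast+

lemma entry_fb_rep: "x \<in> words n d \<Longrightarrow> y \<in> words n d \<Longrightarrow>
  entry d n (fb_rep d n a) x y = lin (\<lambda>g. mat_act d n (class_rep d n g) (\<lambda>z. if z = y then 1 else 0) x) a"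
  using fb_rep_act[OF d1] mat_act_delta[of y n d "fb_rep d n a" x] unfolding entry_def[OF d1] by metis

lemma entry_comb:
  assumes "x \<in> words n d" "y \<in> words n d"
  shows "entry d n (fb_rep d n (comb c)) x y = (\<Sum>b\<in>basis_index d n. c b * entry d n (fb_rep d n (basis_elt d n b)) x y)"
  unfolding entry_fb_rep[OF assms] lin_comb ..

lemma entry_zero: "x \<in> words n d \<Longrightarrow> y \<in> words n d \<Longrightarrow> entry d n (0\<^sub>m ((2 * d) ^ n) ((2 * d) ^ n)) x y = 0"
  unfolding entry_def[OF d1] by (rule index_zero_mat(1)) (rule word_index_less; assumption)+

lemma entry_eqI:
  assumes "M \<in> carrier_mat ((2 * d) ^ n) ((2 * d) ^ n)" "M' \<in> carrier_mat ((2 * d) ^ n) ((2 * d) ^ n)"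
    and "\<And>x y. x \<in> words n d \<Longrightarrow> y \<in> words n d \<Longrightarrow> entry d n M x y = entry d n M' x y"
  shows "M = M'"
proof (rule eq_matI)
  fix i j assume "i < dim_row M'" "j < dim_col M'"
  then have "i < (2 * d) ^ n" "j < (2 * d) ^ n" using assms(2) by auto
  then obtain x y where "x \<in> words n d" "i = word_index d n x" "y \<in> words n d" "j = word_index d n y" using word_index_surj by blast
  then show "M $$ (i, j) = M' $$ (i, j)" using assms(3)[of x y] unfolding entry_def[OF d1] by simp
qed (use assms in auto)

lemma linear_functional_lin:
  fixes f :: "fb_elt \<Rightarrow> Cq"
  assumes f: "\<And>a b. f (\<lambda>Y. a Y + b Y) = f a + f b" "\<And>c a. f (\<lambda>Y. c * a Y) = c * f a"
    and a: "a \<in> carrier (fb_alg d n)"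
  shows "f a = lin (\<lambda>X. f (single X)) a"
proof -
  let ?S = "{X. a X \<noteq> 0}"
  have fin: "finite ?S" using a by (simp add: carrier_monoid_alg)
  have f0: "f (\<lambda>Y. 0) = 0" using f(2)[of 0 "\<lambda>Y. 0"] by simp
  have "f (\<lambda>Y. \<Sum>X\<in>S. a X * single X Y) = (\<Sum>X\<in>S. a X * f (single X))" if "finite S" for S
    using that by (induction S) (simp_all add: f0 f)
  from this[OF fin] have "f (\<lambda>Y. \<Sum>X\<in>?S. a X * single X Y) = lin (\<lambda>X. f (single X)) a" by (simp add: lin_def)
  moreover have "(\<lambda>Y. \<Sum>X\<in>?S. a X * single X Y) = a"
  proof
    fix Y
    have "(\<Sum>X\<in>?S. a X * single X Y) = (\<Sum>X\<in>?S. if Y = X then a X else 0)"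
      by (rule sum.cong) (simp_all add: single_def)
    then show "(\<Sum>X\<in>?S. a X * single X Y) = a Y" using fin by simp
  qed
  ultimately show ?thesis by simp
qed

text \<open>Let \<open>U\<close> be the kernel of \<open>ftl_proj\<close> plus the span of the basis
  elements. A functional separating an element from \<open>U\<close> kills the relations, whose
  ideal lies in the kernel, and the values of its isotypic parts at the canonical words are its
  values at the basis elements, hence zero. So the functional vanishes on the group algebra, a
  contradiction.\<close>

theorem ftl_spanned:
  assumes x: "x \<in> carrier (fb_alg d n)"
  obtains k c where "k \<in> carrier (fb_alg d n)" "ftl_proj k = \<zero>\<^bsub>FTL d n\<^esub>" "x = (\<lambda>Y. k Y + comb c Y)"
proof -
  define K where "K = {k \<in> carrier (fb_alg d n). ftl_proj k = \<zero>\<^bsub>FTL d n\<^esub>}"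
  note ph = alg_homD[OF ftl_proj_hom]
  have K0: "(\<lambda>Y. 0) \<in> K"
    using A.zero_closed alg_hom_minus(2)[OF ftl_proj_hom A.ring_axioms F.ring_axioms A.zero_closed A.zero_closed] by (simp add: K_def)
  have Kadd: "(\<lambda>Y. k Y + k' Y) \<in> K" if "k \<in> K" "k' \<in> K" for k k'
    using that A.a_closed[of k k'] ph(5)[of k k'] by (simp add: K_def)
  have Fs: "c \<odot>\<^bsub>FTL d n\<^esub> \<zero>\<^bsub>FTL d n\<^esub> = \<zero>\<^bsub>FTL d n\<^esub>" for c
    using F.smult_conv_mult[OF F.zero_closed, of c] F.smult_closed[OF F.one_closed] by simp
  have Ksc: "(\<lambda>Y. c * k Y) \<in> K" if "k \<in> K" for c k
    using that A.smult_closed[of k c] ph(2)[of k c] Fs by (simp add: K_def)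
  define U where "U = {\<lambda>Y. k Y + comb c Y | k c. k \<in> K}"
  have UI: "(\<lambda>Y. k Y + comb c Y) \<in> U" if "k \<in> K" for k c
    unfolding U_def using that by (intro CollectI exI[of _ k] exI[of _ c]) simp
  have KU: "k \<in> U" if "k \<in> K" for k
  proof -
    have "(\<lambda>Y. k Y + comb (\<lambda>b. 0) Y) = k" by (simp add: comb_def)
    then show ?thesis using UI[OF that, of "\<lambda>b. 0"] by (simp only:)
  qed
  have U0: "(\<lambda>Y. 0) \<in> U" by (rule KU[OF K0])
  have Uadd: "(\<lambda>Y. a Y + b Y) \<in> U" if ab: "a \<in> U" "b \<in> U" for a b
  proof -
    obtain k c k' c' where e: "a = (\<lambda>Y. k Y + comb c Y)" "k \<in> K" "b = (\<lambda>Y. k' Y + comb c' Y)" "k' \<in> K"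
      using ab unfolding U_def by blast
    have "(\<lambda>Y. a Y + b Y) = (\<lambda>Y. (k Y + k' Y) + comb (\<lambda>b. c b + c' b) Y)"
      unfolding e by (rule ext) (simp add: comb_def sum.distrib distrib_right)
    then show ?thesis using UI[OF Kadd[OF e(2,4)], of "\<lambda>b. c b + c' b"] by (simp only:)
  qed
  have Usc: "(\<lambda>Y. s * a Y) \<in> U" if a: "a \<in> U" for s a
  proof -
    obtain k c where e: "a = (\<lambda>Y. k Y + comb c Y)" "k \<in> K" using a unfolding U_def by blast
    have "(\<lambda>Y. s * a Y) = (\<lambda>Y. s * k Y + comb (\<lambda>b. s * c b) Y)"
      unfolding e by (rule ext) (simp add: comb_def sum_distrib_left distrib_left mult.assoc)
    then show ?thesis using UI[OF Ksc[OF e(2)], of s "\<lambda>b. s * c b"] by (simp only:)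
  qed
  have BU: "basis_elt d n b \<in> U" if b: "b \<in> basis_index d n" for b
  proof -
    have "basis_elt d n b Y = 0 + comb (\<lambda>b'. if b' = b then 1 else 0) Y" for Y
      using b finite_basis_index by (simp add: comb_def if_distrib[of "\<lambda>t. t * _"] cong: if_cong)
    then have "basis_elt d n b = (\<lambda>Y. (\<lambda>Y. 0) Y + comb (\<lambda>b'. if b' = b then 1 else 0) Y)" by (intro ext) simp
    then show ?thesis using UI[OF K0, of "\<lambda>b'. if b' = b then 1 else 0"] by (simp only:)
  qed
  have "x \<in> U"
  proof (rule ccontr)
    assume xU: "x \<notin> U"
    have "\<exists>f :: fb_elt \<Rightarrow> Cq. (\<forall>a b. f (\<lambda>g. a g + b g) = f a + f b) \<and> (\<forall>c a. f (\<lambda>g. c * a g) = c * f a) \<and>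
        (\<forall>a\<in>U. f a = 0) \<and> f x \<noteq> 0"
      by (rule separating_functional[OF U0 _ _ xU]) (rule Uadd Usc; assumption)+
    then obtain f :: "fb_elt \<Rightarrow> Cq" where f': "\<forall>a b. f (\<lambda>g. a g + b g) = f a + f b" "\<forall>c a. f (\<lambda>g. c * a g) = c * f a"
      and fU': "\<forall>a\<in>U. f a = 0" and fx: "f x \<noteq> 0"
      by (elim exE conjE)
    note f = f'(1)[rule_format] f'(2)[rule_format] and fU = fU'[rule_format]
    have fl: "f a = lin (\<lambda>X. f (single X)) a" if "a \<in> carrier (fb_alg d n)" for a
      by (rule linear_functional_lin) (rule f that)+
    define G where "G X = f (single X)" for X
    have "annihilates d n G"
      unfolding annihilates_def[OF d1]
    proof (intro ballI)
      fix u v r assume u: "u \<in> P.L" and v: "v \<in> P.L" and r: "r \<in> fb_rel_elts d n"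
      let ?u = "single (P.cls u) :: fb_elt" and ?v = "single (P.cls v) :: fb_elt"
      note uc = single_cls[OF d1 u] and vc = single_cls[OF d1 v] and rc = fb_rel_elts_carrier[OF d1 r]
      note urc = A.m_closed[OF uc rc]
      note c = A.m_closed[OF urc vc]
      have "ftl_proj (?u \<otimes>\<^bsub>fb_alg d n\<^esub> r \<otimes>\<^bsub>fb_alg d n\<^esub> ?v) = ftl_proj ?u \<otimes>\<^bsub>FTL d n\<^esub> \<zero>\<^bsub>FTL d n\<^esub> \<otimes>\<^bsub>FTL d n\<^esub> ftl_proj ?v"
        unfolding ph(4)[OF urc vc] ph(4)[OF uc rc] ftl_proj_rel[OF r] ..
      also have "\<dots> = \<zero>\<^bsub>FTL d n\<^esub>" using ph(3)[OF uc] ph(3)[OF vc] by simp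
      finally have "f (?u \<otimes>\<^bsub>fb_alg d n\<^esub> r \<otimes>\<^bsub>fb_alg d n\<^esub> ?v) = 0" using c by (intro fU KU) (simp only: K_def mem_Collect_eq)
      then have "lin G (?u \<otimes>\<^bsub>fb_alg d n\<^esub> r \<otimes>\<^bsub>fb_alg d n\<^esub> ?v) = 0"
        using fl[OF c] unfolding G_def[abs_def] by (simp only:)
      then show "lin (\<lambda>X. G (P.cls u \<otimes>\<^bsub>P.G\<^esub> X \<otimes>\<^bsub>P.G\<^esub> P.cls v)) r = 0"
        unfolding lin_alg(4)[OF d1 urc vc] lin_alg(4)[OF d1 uc rc] lin_single .
    qed
    then have "G (P.cls w) = 0" if "w \<in> P.L" for w
    proof (rule annihilating_functional_vanishes[OF d1 _ _ that])
      fix \<chi> p assume "\<chi> \<in> colourings n d" "p permutes {..<n}" "mono_321_free n \<chi> p"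
      then have b: "(\<chi>, p) \<in> basis_index d n" by (simp add: basis_index_def)
      show "isotypics d n \<chi> n G (P.cls (sword (can n p))) = 0"
      proof -
        have "f (basis_elt d n (\<chi>, p)) = isotypics d n \<chi> n (\<lambda>X. f (single X)) (P.cls (sword (can n p)))"
          by (rule linear_basis_elt[OF d1 b]) (rule f)+
        then show ?thesis using fU[OF BU[OF b]] unfolding G_def[abs_def] by simp
      qed
    qed
    then have "G X = 0" if "X \<in> carrier P.G" for X using that by (auto simp: P.carrier_G)
    then have "lin G x = lin (\<lambda>X. 0) x" using x by (intro lin_cong) (auto simp: carrier_monoid_alg)
    then have "f x = 0" unfolding fl[OF x] G_def[abs_def] by (simp add: lin_def)
    then show False using fx by simp
  qed
  then obtain k c where "x = (\<lambda>Y. k Y + comb c Y)" "k \<in> K" unfolding U_def by blast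
  then show ?thesis using that[of k c] unfolding K_def by simp
qed

text \<open>Elements of the kernel of \<open>ftl_proj\<close> act by zero, so only a combination of
  basis elements remains, and its coefficients vanish by independence.\<close>

lemma fb_rep_kernel:
  assumes x: "x \<in> carrier (fb_alg d n)" and z: "fb_rep d n x = 0\<^sub>m ((2 * d) ^ n) ((2 * d) ^ n)"
  shows "ftl_proj x = \<zero>\<^bsub>FTL d n\<^esub>"
proof -
  obtain k c where k: "k \<in> carrier (fb_alg d n)" "ftl_proj k = \<zero>\<^bsub>FTL d n\<^esub>" and xe: "x = (\<lambda>Y. k Y + comb c Y)"
    by (rule ftl_spanned[OF x])
  obtain \<Phi> where \<Phi>: "\<Phi> \<in> alg_hom (FTL d n) (mat_alg ((2 * d) ^ n))" "\<forall>x\<in>carrier (fb_alg d n). \<Phi> (ftl_proj x) = fb_rep d n x"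
    using fb_rep_factors by blast
  have R: "ring (mat_alg ((2 * d) ^ n))" using kalgebra_mat by (rule kalgebra.axioms(1))
  have "fb_rep d n k = 0\<^sub>m ((2 * d) ^ n) ((2 * d) ^ n)"
    using \<Phi>(2) k alg_hom_minus(2)[OF \<Phi>(1) F.ring_axioms R F.zero_closed F.zero_closed] by auto
  moreover have "fb_rep d n x = fb_rep d n k + fb_rep d n (comb c)"
    using alg_homD(5)[OF fb_rep_hom[OF d1] k(1) comb_carrier[of c]] unfolding xe by simp
  ultimately have cz: "fb_rep d n (comb c) = 0\<^sub>m ((2 * d) ^ n) ((2 * d) ^ n)"
    using z left_add_zero_mat[OF fb_rep_carrier[OF d1, of n "comb c"]] by simp
  have "c b = 0" if "b \<in> basis_index d n" for b
  proof (rule basis_independent[OF d1 _ that])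
    fix x y assume xy: "x \<in> words n d" "y \<in> words n d"
    show "(\<Sum>b\<in>basis_index d n. c b * entry d n (fb_rep d n (basis_elt d n b)) x y) = 0"
      unfolding entry_comb[OF xy, symmetric] cz by (rule entry_zero[OF xy])
  qed
  then have "x = k" unfolding xe comb_def by simp
  then show ?thesis using k by simp
qed

lemma centralizer_diff:
  assumes "M \<in> carrier (uq_centralizer d n)" "M' \<in> carrier (uq_centralizer d n)"
  shows "M - M' \<in> carrier (uq_centralizer d n)"
proof -
  have "(M - M') * uq_tensor d n z = uq_tensor d n z * (M - M')" if z: "z \<in> uq_gens d" for z
    using assms minus_mult_distrib_mat[of M "(2 * d) ^ n" "(2 * d) ^ n" M' "uq_tensor d n z" "(2 * d) ^ n"]
      mult_minus_distrib_mat[of "uq_tensor d n z" "(2 * d) ^ n" "(2 * d) ^ n" M "(2 * d) ^ n" M'] uq_tensor_carrier[OF z] z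
    by (simp add: carrier_uq_centralizer)
  then show ?thesis using assms by (simp add: carrier_uq_centralizer minus_carrier_mat)
qed

text \<open>An operator of the centralizer is determined by its entries at the excedance pairs, one
  for each element of \<open>basis_index d n\<close>. On combinations of basis elements these
  entries form a square system, injective by independence; a combination with the same entries as
  \<open>M\<close> therefore exists, and it must represent \<open>M\<close>.\<close>

lemma fb_rep_surj:
  assumes M: "M \<in> carrier (uq_centralizer d n)"
  shows "\<exists>x\<in>carrier (fb_alg d n). fb_rep d n x = M"
proof -
  define e where "e M b = entry d n M (exc_word n (fst b) (snd b)) (exc_word n (fst b) (snd b) \<circ> snd b)"
    for M and b :: "(nat \<Rightarrow> nat) \<times> (nat \<Rightarrow> nat)"
  have det: "M = 0\<^sub>m ((2 * d) ^ n) ((2 * d) ^ n)" if M: "M \<in> carrier (uq_centralizer d n)" and z: "\<And>b. b \<in> basis_index d n \<Longrightarrow> e M b = 0" for M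
  proof (rule entry_eqI)
    show "M \<in> carrier_mat ((2 * d) ^ n) ((2 * d) ^ n)" using M by (simp add: carrier_uq_centralizer)
    fix x y assume xy: "x \<in> words n d" "y \<in> words n d"
    have "entry d n M x y = 0"
      by (rule centralizer_determined[OF d1 M _ xy]) (use z in \<open>force simp: e_def\<close>)
    then show "entry d n M x y = entry d n (0\<^sub>m ((2 * d) ^ n) ((2 * d) ^ n)) x y"
      unfolding entry_zero[OF xy] .
  qed simp
  have w: "exc_word n (fst b) (snd b) \<in> words n d" "exc_word n (fst b) (snd b) \<circ> snd b \<in> words n d" if "b \<in> basis_index d n" for b
    using that exc_word_words words_permute by (auto simp: basis_index_def)
  have ec: "e (fb_rep d n (comb c)) b = (\<Sum>b'\<in>basis_index d n. e (fb_rep d n (basis_elt d n b')) b * c b')" if "b \<in> basis_index d n" for b c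
    unfolding e_def entry_comb[OF w[OF that]] by (simp only: mult.commute)
  have "\<exists>c. \<forall>b\<in>basis_index d n. (\<Sum>b'\<in>basis_index d n. e (fb_rep d n (basis_elt d n b')) b * c b') = e M b"
  proof (rule square_system_solvable[OF finite_basis_index])
    fix c assume "\<And>b. b \<in> basis_index d n \<Longrightarrow> (\<Sum>b'\<in>basis_index d n. e (fb_rep d n (basis_elt d n b')) b * c b') = 0"
    then have cz: "fb_rep d n (comb c) = 0\<^sub>m ((2 * d) ^ n) ((2 * d) ^ n)"
      by (intro det fb_rep_centralizer[OF d1] comb_carrier) (simp add: ec)
    show "\<forall>b\<in>basis_index d n. c b = 0"
    proof
      fix b assume b: "b \<in> basis_index d n"
      show "c b = 0"
      proof (rule basis_independent[OF d1 _ b])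
        fix x y assume xy: "x \<in> words n d" "y \<in> words n d"
        show "(\<Sum>b\<in>basis_index d n. c b * entry d n (fb_rep d n (basis_elt d n b)) x y) = 0"
          unfolding entry_comb[OF xy, symmetric] cz by (rule entry_zero[OF xy])
      qed
    qed
  qed
  then obtain c where c0: "\<forall>b\<in>basis_index d n. (\<Sum>b'\<in>basis_index d n. e (fb_rep d n (basis_elt d n b')) b * c b') = e M b" ..
  have c: "e (fb_rep d n (comb c)) b = e M b" if "b \<in> basis_index d n" for b
    using bspec[OF c0 that] unfolding ec[OF that] .
  have hc: "fb_rep d n (comb c) \<in> carrier (uq_centralizer d n)" by (rule fb_rep_centralizer[OF d1 comb_carrier])
  have Mc: "M \<in> carrier_mat ((2 * d) ^ n) ((2 * d) ^ n)" using M by (simp add: carrier_uq_centralizer)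
  have z: "fb_rep d n (comb c) - M = 0\<^sub>m ((2 * d) ^ n) ((2 * d) ^ n)"
  proof (rule det[OF centralizer_diff[OF hc M]])
    fix b assume b: "b \<in> basis_index d n"
    have lt: "word_index d n (exc_word n (fst b) (snd b)) < (2 * d) ^ n" "word_index d n (exc_word n (fst b) (snd b) \<circ> snd b) < (2 * d) ^ n"
      using w[OF b] word_index_less by auto
    have "e (fb_rep d n (comb c) - M) b = e (fb_rep d n (comb c)) b - e M b"
      unfolding e_def entry_def[OF d1] using lt Mc by simp
    then show "e (fb_rep d n (comb c) - M) b = 0" using c[OF b] by simp
  qed
  have "fb_rep d n (comb c) = M"
  proof (rule eq_matI)
    fix i j assume ij: "i < dim_row M" "j < dim_col M"
    then have "(fb_rep d n (comb c) - M) $$ (i, j) = fb_rep d n (comb c) $$ (i, j) - M $$ (i, j)" by simp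
    then show "fb_rep d n (comb c) $$ (i, j) = M $$ (i, j)" unfolding z using ij Mc by simp
  qed (use Mc fb_rep_carrier[OF d1, of n "comb c"] in auto)
  then show ?thesis using comb_carrier by blast
qed

lemma FTL_iso: "FTL d n \<cong>\<^bold>a uq_centralizer d n"
proof -
  obtain \<Phi> where \<Phi>: "\<Phi> \<in> alg_hom (FTL d n) (mat_alg ((2 * d) ^ n))" "\<And>x. x \<in> carrier (fb_alg d n) \<Longrightarrow> \<Phi> (ftl_proj x) = fb_rep d n x"
    using fb_rep_factors by blast
  note h = alg_homD[OF \<Phi>(1)]
  have R: "ring (mat_alg ((2 * d) ^ n))" using kalgebra_mat by (rule kalgebra.axioms(1))
  have C: "mult (uq_centralizer d n) = mult (mat_alg ((2 * d) ^ n))" "add (uq_centralizer d n) = add (mat_alg ((2 * d) ^ n))"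
    "one (uq_centralizer d n) = one (mat_alg ((2 * d) ^ n))" "smult (uq_centralizer d n) = smult (mat_alg ((2 * d) ^ n))"
    by (simp_all add: uq_centralizer_def)
  have im: "\<Phi> ` carrier (FTL d n) = carrier (uq_centralizer d n)"
  proof (intro Set.set_eqI iffI)
    fix M assume "M \<in> \<Phi> ` carrier (FTL d n)"
    then obtain x where "x \<in> carrier (fb_alg d n)" "M = \<Phi> (ftl_proj x)" unfolding carrier_FTL by blast
    then show "M \<in> carrier (uq_centralizer d n)" using \<Phi>(2) fb_rep_centralizer[OF d1] by simp
  next
    fix M assume "M \<in> carrier (uq_centralizer d n)"
    then obtain x where x: "x \<in> carrier (fb_alg d n)" "fb_rep d n x = M" using fb_rep_surj by blast
    have e: "M = \<Phi> (ftl_proj x)" using \<Phi>(2)[OF x(1)] x(2) by simp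
    have "ftl_proj x \<in> carrier (FTL d n)" unfolding carrier_FTL using x(1) by (rule imageI)
    then show "M \<in> \<Phi> ` carrier (FTL d n)" using e by (rule rev_image_eqI)
  qed
  have "inj_on \<Phi> (carrier (FTL d n))"
  proof (rule inj_onI)
    fix X X' assume X: "X \<in> carrier (FTL d n)" and X': "X' \<in> carrier (FTL d n)" and e: "\<Phi> X = \<Phi> X'"
    have "X \<ominus>\<^bsub>FTL d n\<^esub> X' \<in> carrier (FTL d n)" using X X' by (rule F.minus_closed)
    then obtain x where x: "x \<in> carrier (fb_alg d n)" "X \<ominus>\<^bsub>FTL d n\<^esub> X' = ftl_proj x" unfolding carrier_FTL by blast
    have c: "\<Phi> X' \<in> carrier_mat ((2 * d) ^ n) ((2 * d) ^ n)" using h(3)[OF X'] by simp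
    have "fb_rep d n x = \<Phi> X - \<Phi> X'"
      using \<Phi>(2)[OF x(1)] alg_hom_minus(1)[OF \<Phi>(1) F.ring_axioms R X X'] mat_alg_minus[OF _ c] c unfolding x(2)[symmetric] e by simp
    then have "fb_rep d n x = 0\<^sub>m ((2 * d) ^ n) ((2 * d) ^ n)" unfolding e using c by simp
    then have "X \<ominus>\<^bsub>FTL d n\<^esub> X' = \<zero>\<^bsub>FTL d n\<^esub>" using fb_rep_kernel[OF x(1)] x(2) by simp
    moreover have "X = (X \<ominus>\<^bsub>FTL d n\<^esub> X') \<oplus>\<^bsub>FTL d n\<^esub> X'"
      using X X' by (simp add: F.minus_eq F.a_assoc F.l_neg)
    ultimately show "X = X'" using X' by simp
  qed
  then have bij: "bij_betw \<Phi> (carrier (FTL d n)) (carrier (uq_centralizer d n))" using im by (simp add: bij_betw_def)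
  have "\<Phi> \<in> Ring.ring_hom (FTL d n) (uq_centralizer d n)"
  proof (rule ring_hom_memI)
    show "\<Phi> \<one>\<^bsub>FTL d n\<^esub> = \<one>\<^bsub>uq_centralizer d n\<^esub>" unfolding C by (rule h(6))
    fix x y assume x: "x \<in> carrier (FTL d n)"
    then show "\<Phi> x \<in> carrier (uq_centralizer d n)" unfolding im[symmetric] by (rule imageI)
    assume y: "y \<in> carrier (FTL d n)"
    show "\<Phi> (x \<otimes>\<^bsub>FTL d n\<^esub> y) = \<Phi> x \<otimes>\<^bsub>uq_centralizer d n\<^esub> \<Phi> y"
      "\<Phi> (x \<oplus>\<^bsub>FTL d n\<^esub> y) = \<Phi> x \<oplus>\<^bsub>uq_centralizer d n\<^esub> \<Phi> y"
      unfolding C by (rule h(4)[OF x y], rule h(5)[OF x y])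
  qed
  then have "\<Phi> \<in> algebra_iso (FTL d n) (uq_centralizer d n)"
    using bij h(2) unfolding algebra_iso_def ring_iso_def C by blast
  then show ?thesis unfolding is_algebra_iso_def by blast
qed

end

theorem theorem5p5:
  fixes d n :: nat
  assumes "d \<ge> 1" and "n \<ge> 1"
  shows "FTL d n \<cong>\<^bold>a uq_centralizer d n"
  using assms(1) by (rule FTL_iso)

end
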